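(* Let $n\ge 3$ and let $M$ be a set of $n$ points in the plane in general position. Then $M$ has at least $W_n$ partial triangulations. Moreover, $M$ has exactly $W_n$ partial triangulations if and only if $M$ is quasi-convex.
   Context: For $n\ge 2$, $W_n=c_{n-2}$, where $c_k=\frac{1}{k+1}\binom{2k}{k}$ is the $k$-th Catalan number (so $W_2=1$, and $W_n$ is the number of triangulations of a convex $n$-gon for $n\ge3$). For a finite point set $M$ in the plane, let $M'$ denote the set of vertices of the convex hull $\mathrm{conv}(M)$. A partial triangulation of $M$ is a triangulation of the polygon $\mathrm{conv}(M)$ whose vertex set $V$ satisfies $M'\subseteq V\subseteq M$. A point $P\in M$ is an interior point of $M$ if it is not a vertex of $\mathrm{conv}(M)$. An interior point $P$ of $M$ is close to a side $QR$ of $\mathrm{conv}(M)$ if every triangle $P'QR$ with $P'\in M$ contains $P$. The set $M$ is quasi-convex if every interior point of $M$ is close to some side of $\mathrm{conv}(M)$. *)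

theory Defs
  imports "HOL-Analysis.Analysis"
begin

type_synonym point = "real ^ 2"

(* The division is exact, see catalan_eq below. *)
definition catalan :: "nat \<Rightarrow> nat" where
  "catalan k = ((2 * k) choose k) div (k + 1)"

definition W :: "nat \<Rightarrow> nat" where
  "W n = catalan (n - 2)"

definition general_position :: "point set \<Rightarrow> bool" where
  "general_position M \<longleftrightarrow>
     (\<forall>a\<in>M. \<forall>b\<in>M. \<forall>c\<in>M. a \<noteq> b \<and> b \<noteq> c \<and> a \<noteq> c \<longrightarrow> \<not> collinear {a, b, c})"

definition hull_vertices :: "point set \<Rightarrow> point set" where
  "hull_vertices M = {x. x extreme_point_of (convex hull M)}"

(* A triangulation is represented by the set of its (closed, nondegenerate) triangles; the library
   predicate triangulation says that they are finitely many and meet face to face. *)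
definition triangulation_of :: "point set set \<Rightarrow> point set \<Rightarrow> bool" where
  "triangulation_of \<T> S \<longleftrightarrow> triangulation \<T> \<and> (\<forall>T\<in>\<T>. 2 simplex T) \<and> \<Union>\<T> = S"

definition vertex_set :: "point set set \<Rightarrow> point set" where
  "vertex_set \<T> = {v. \<exists>T\<in>\<T>. v extreme_point_of T}"

definition partial_triangulations :: "point set \<Rightarrow> point set set set" where
  "partial_triangulations M =
     {\<T>. triangulation_of \<T> (convex hull M) \<and>
          hull_vertices M \<subseteq> vertex_set \<T> \<and> vertex_set \<T> \<subseteq> M}"

definition interior_point :: "point set \<Rightarrow> point \<Rightarrow> bool" where
  "interior_point M P \<longleftrightarrow> P \<in> M \<and> P \<notin> hull_vertices M"

definition is_side :: "point set \<Rightarrow> point \<Rightarrow> point \<Rightarrow> bool" where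
  "is_side M Q R \<longleftrightarrow> closed_segment Q R edge_of (convex hull M)"

(* P' ranges over M - {Q, R} because P'QR is a triangle only for such P'. *)
definition close_to_side :: "point set \<Rightarrow> point \<Rightarrow> point \<Rightarrow> point \<Rightarrow> bool" where
  "close_to_side M P Q R \<longleftrightarrow> (\<forall>P'\<in>M - {Q, R}. P \<in> convex hull {P', Q, R})"

definition quasi_convex :: "point set \<Rightarrow> bool" where
  "quasi_convex M \<longleftrightarrow>
     (\<forall>P. interior_point M P \<longrightarrow> (\<exists>Q R. is_side M Q R \<and> close_to_side M P Q R))"

lemma catalan_eq: "real (catalan k) = 1 / (real k + 1) * real ((2 * k) choose k)"
proof -
  have "(k + 1) * ((2 * k) choose (k + 1)) = k * ((2 * k) choose k)"
    using binomial_absorption[of k "2 * k"] binomial_absorb_comp[of "2 * k" k] by auto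
  then have "(k + 1) dvd k * ((2 * k) choose k)"
    by (metis dvd_triv_left)
  then have "(k + 1) dvd ((2 * k) choose k)"
    by (metis coprime_Suc_left_nat coprime_dvd_mult_right_iff Suc_eq_plus1)
  then show ?thesis
    unfolding catalan_def by (simp add: real_of_nat_div add.commute)
qed

(* Hence card (partial_triangulations M) is the actual number of partial triangulations. *)
lemma finite_partial_triangulations:
  assumes "finite M"
  shows "finite (partial_triangulations M)"
proof (rule finite_subset)
  show "partial_triangulations M \<subseteq> Pow ((\<lambda>C. convex hull C) ` Pow M)"
  proof (intro subsetI PowI)
    fix \<T> T assume "\<T> \<in> partial_triangulations M" "T \<in> \<T>"
    then have T: "2 simplex T" and V: "{v. v extreme_point_of T} \<subseteq> M"
      by (auto simp: partial_triangulations_def triangulation_of_def vertex_set_def)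
    from T obtain C where C: "\<not> affine_dependent C" "T = convex hull C"
      by (auto simp: simplex_def)
    then have "{v. v extreme_point_of T} = C"
      by (simp add: extreme_point_of_convex_hull_affine_independent)
    with V C show "T \<in> (\<lambda>C. convex hull C) ` Pow M" by blast
  qed
  show "finite (Pow ((\<lambda>C. convex hull C) ` Pow M))" using assms by simp
qed

end

theory Submission
  imports Defs
begin

text \<open>
  Lower bound, by induction on the number of points. Let \<open>R\<close> be a hull vertex and move it to infinity by a projective
  transformation. The triangles at \<open>R\<close> of a triangulation then lie below a monotone path \<open>S\<close> through some of the other
  points. The points strictly below \<open>S\<close> together with the peaks of \<open>S\<close> form the cut set of \<open>S\<close>, and \<open>S\<close> is determined by
  it, so that every set of inner points is the cut set of exactly one path. The peaks of \<open>S\<close> divide the remaining points into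
  blocks that lie above \<open>S\<close>; arbitrary triangulations of the blocks, together with the triangles at \<open>R\<close>, extend to a
  triangulation of the whole set. The number of choices is at least the sum, over all sets of inner points, of the products
  of the Catalan numbers of the gaps, and by the Catalan recursion this sum is \<open>W n\<close>.

  If \<open>z\<close> is an interior point that is close to no side, then for the path with cut set \<open>{z}\<close> either one of these
  inequalities is strict or some triangulation does not arise from blocks.

  Conversely, a quasi-convex set has a boundary order in which all triples are positively oriented except that a dent lies on
  the wrong side of its two neighbours. As for a convex polygon, the triangle on a fixed side splits a triangulation into
  triangulations of two intervals of this order, which yields the Catalan recursion as an upper bound.
\<close>

section \<open>Catalan numbers\<close>

text \<open>The lower bound only needs an injection. The choices can be read off the finished
  triangulation, \<open>S\<close> from its triangles at \<open>R\<close> and each block from the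
  triangles inside it, so the region above the blocks may be filled in any way. A path is determined
  by its inner vertices, so there are as many paths as sets of inner points, and uniqueness of the
  path with a given cut set already gives its existence. The gaps of the cut set are finer than the
  blocks, because cut points strictly below \<open>S\<close> do not separate blocks; the inequality
  \<open>c_i c_j \<le> c_(i+j)\<close> absorbs this, strictly for \<open>i, j > 0\<close>, which is
  where one of the strict inequalities in the equality case comes from.

  The upper bound uses a linear order on a cyclic boundary. A dent of the side that joins the two
  ends of the order is not the middle of three consecutive points. It is put last, and the
  triangulations that omit it supply the term that is missing from the recursion for the
  others.\<close>

lemma catalan_0 [simp]: "catalan 0 = 1"
  by (simp add: catalan_def)

text \<open>The ratio of consecutive Catalan numbers without division:
  \<open>(k + 1) * catalan k\<close> is a central binomial coefficient, and these are related by
  absorption. The later facts on \<open>catalan\<close> rest on this recursion.\<close>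

lemma catalan_Suc: "(n + 2) * catalan (Suc n) = (4 * n + 2) * catalan n"
proof -
  have *: "(k + 1) * catalan k = (2 * k) choose k" for k
  proof -
    have "real ((k + 1) * catalan k) = (real k + 1) * (1 / (real k + 1) * real ((2 * k) choose k))"
      by (simp only: of_nat_mult of_nat_add of_nat_1 catalan_eq)
    also have "\<dots> = ((real k + 1) * (1 / (real k + 1))) * real ((2 * k) choose k)"
      by (simp only: mult.assoc)
    also have "(real k + 1) * (1 / (real k + 1)) = 1"
      by simp
    finally have "real ((k + 1) * catalan k) = real ((2 * k) choose k)" by simp
    then show ?thesis
      by (simp only: of_nat_eq_iff)
  qed
  have a: "Suc n * ((2 * Suc n) choose Suc n) = (2 * Suc n) * ((2 * n + 1) choose n)"
    using binomial_absorption[of n "2 * Suc n"] by simp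
  have "(2 * n + 1) choose n = (2 * n + 1) choose Suc n"
    using binomial_symmetric[of n "2 * n + 1"] by simp
  moreover have "Suc n * ((2 * n + 1) choose Suc n) = (2 * n + 1) * ((2 * n) choose n)"
    using binomial_absorption[of n "2 * n + 1"] by simp
  ultimately have "Suc n * (Suc n * ((2 * Suc n) choose Suc n)) = (2 * Suc n) * ((2 * n + 1) * ((2 * n) choose n))"
    using a by (metis mult.left_commute)
  then have "Suc n * (Suc n * ((Suc n + 1) * catalan (Suc n))) = (2 * Suc n) * ((2 * n + 1) * ((n + 1) * catalan n))"
    by (simp only: *)
  then have "(Suc n * Suc n) * ((n + 2) * catalan (Suc n)) = (Suc n * Suc n) * ((4 * n + 2) * catalan n)"
    by (simp add: algebra_simps)
  then show ?thesis
    unfolding mult_cancel1 by simp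
qed

lemma catalan_Suc_0 [simp]: "catalan (Suc 0) = 1"
  using catalan_Suc[of 0] by simp

lemma catalan_pos: "0 < catalan n"
proof (induction n)
  case (Suc n)
  then show ?case
    using catalan_Suc[of n] by (metis add_gr_0 mult_pos_pos nat_0_less_mult_iff zero_less_numeral)
qed simp

text \<open>Let \<open>S n\<close> be the convolution. Reversing the index shows that weighting the
  terms by \<open>i\<close> multiplies the sum by \<open>n / 2\<close>. Evaluating the weighted sum
  for \<open>Suc n\<close> a second time through the ratio recursion relates
  \<open>S (Suc n)\<close> linearly to \<open>S n\<close>, and the induction hypothesis
  finishes.\<close>

lemma catalan_convolution: "(\<Sum>i\<le>n. catalan i * catalan (n - i)) = catalan (Suc n)"
proof (induction n)
  case 0
  show ?case by simp
next
  case (Suc n)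
  define C where "C i = real (catalan i)" for i
  define S where "S n = (\<Sum>i\<le>n. C i * C (n - i))" for n
  have rec: "(real i + 2) * C (Suc i) = (4 * real i + 2) * C i" for i
    using arg_cong[OF catalan_Suc[of i], of real] by (simp add: C_def algebra_simps)
  have refl: "(\<Sum>i\<le>n. real i * (C i * C (n - i))) = real n / 2 * S n" for n
  proof -
    have "(\<Sum>i\<le>n. real i * (C i * C (n - i))) = (\<Sum>i\<le>n. real (n - i) * (C i * C (n - i)))"
      by (rule sum.reindex_bij_witness[of _ "\<lambda>i. n - i" "\<lambda>i. n - i"]) auto
    then have "2 * (\<Sum>i\<le>n. real i * (C i * C (n - i))) = (\<Sum>i\<le>n. (real i + real (n - i)) * (C i * C (n - i)))"
      by (simp only: sum.distrib distrib_right mult_2)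
    also have "\<dots> = (\<Sum>i\<le>n. real n * (C i * C (n - i)))"
      by (rule sum.cong) (auto simp: of_nat_diff)
    also have "\<dots> = real n * S n"
      by (simp only: S_def sum_distrib_left)
    finally show ?thesis by simp
  qed
  have "(\<Sum>i\<le>n. (real i + 2) * C (Suc i) * C (n - i)) = (\<Sum>i\<le>n. (4 * real i + 2) * C i * C (n - i))"
    by (simp add: rec)
  also have "\<dots> = 4 * (\<Sum>i\<le>n. real i * (C i * C (n - i))) + 2 * S n"
    by (simp add: S_def sum.distrib sum_distrib_left algebra_simps)
  also have "\<dots> = (2 * real n + 2) * S n"
    unfolding refl by (simp add: algebra_simps)
  finally have 1: "(\<Sum>i\<le>n. (real i + 2) * C (Suc i) * C (n - i)) = (2 * real n + 2) * S n" .
  have "(\<Sum>i\<le>Suc n. (real i + 1) * C i * C (Suc n - i)) = C (Suc n) + (\<Sum>i\<le>n. (real i + 2) * C (Suc i) * C (n - i))"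
    by (subst sum.atMost_Suc_shift) (simp add: C_def algebra_simps)
  moreover have "(\<Sum>i\<le>Suc n. (real i + 1) * C i * C (Suc n - i)) = (\<Sum>i\<le>Suc n. real i * (C i * C (Suc n - i))) + S (Suc n)"
    by (simp add: S_def sum.distrib algebra_simps)
  ultimately have "real (Suc n) / 2 * S (Suc n) + S (Suc n) = C (Suc n) + (2 * real n + 2) * S n"
    using refl[of "Suc n"] 1 by simp
  moreover have "S n = C (Suc n)"
    using arg_cong[OF Suc, of real] by (simp add: S_def C_def)
  ultimately have "(real n + 3) * S (Suc n) = (4 * real n + 6) * C (Suc n)"
    by (simp add: field_simps)
  also have "\<dots> = (real n + 3) * C (Suc (Suc n))"
    using rec[of "Suc n"] by (simp add: algebra_simps)
  finally have "S (Suc n) = C (Suc (Suc n))" by simp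
  then have "real (\<Sum>i\<le>Suc n. catalan i * catalan (Suc n - i)) = real (catalan (Suc (Suc n)))"
    by (simp add: S_def C_def)
  then show ?case by (simp only: of_nat_eq_iff)
qed

text \<open>Log-convexity: the ratio \<open>(4 * k + 2) / (k + 2)\<close> of consecutive Catalan
  numbers increases with \<open>k\<close>.\<close>

lemma catalan_mult_Suc_le:
  assumes "j \<le> i"
  shows "catalan (Suc j) * catalan i \<le> catalan j * catalan (Suc i)"
proof -
  have "(i + 2) * (j + 2) * (catalan (Suc j) * catalan i) = (i + 2) * ((j + 2) * catalan (Suc j)) * catalan i"
    by (simp only: mult.assoc)
  also have "\<dots> = ((i + 2) * (4 * j + 2)) * (catalan j * catalan i)"
    unfolding catalan_Suc by (simp only: mult.assoc)
  also have "\<dots> \<le> ((j + 2) * (4 * i + 2)) * (catalan j * catalan i)"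
    using assms by (intro mult_right_mono) (auto simp: algebra_simps)
  also have "\<dots> = (j + 2) * catalan j * ((4 * i + 2) * catalan i)"
    by (simp only: ac_simps)
  also have "\<dots> = (j + 2) * catalan j * ((i + 2) * catalan (Suc i))"
    unfolding catalan_Suc ..
  also have "\<dots> = (i + 2) * (j + 2) * (catalan j * catalan (Suc i))"
    by (simp only: ac_simps)
  finally have "(i + 2) * (j + 2) * (catalan (Suc j) * catalan i) \<le> (i + 2) * (j + 2) * (catalan j * catalan (Suc i))" .
  then show ?thesis unfolding mult_le_cancel1 by simp
qed

text \<open>Log-convexity allows one unit at a time to be moved from the smaller index to the larger
  one, until the smaller index is 0.\<close>

lemma catalan_mult_le: "catalan i * catalan j \<le> catalan (i + j)"
proof (induction j arbitrary: i)
  case (Suc j)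
  have *: "catalan k * catalan l \<le> catalan (k + l)" if "k \<le> l" for k l
    using that
  proof (induction k arbitrary: l)
    case (Suc k)
    have "catalan (Suc k) * catalan l \<le> catalan k * catalan (Suc l)"
      using Suc.prems by (intro catalan_mult_Suc_le) simp
    also have "\<dots> \<le> catalan (k + Suc l)"
      using Suc.prems by (intro Suc.IH) simp
    finally show ?case by simp
  qed simp
  show ?case
    using *[of i "Suc j"] *[of "Suc j" i] by (cases "i \<le> Suc j") (simp_all add: ac_simps)
qed simp

lemma catalan_less_Suc:
  assumes "0 < i"
  shows "catalan i < catalan (Suc i)"
proof -
  have "(i + 2) * catalan i < (4 * i + 2) * catalan i"
    using assms catalan_pos[of i] by simp
  then have "(i + 2) * catalan i < (i + 2) * catalan (Suc i)"
    by (simp only: catalan_Suc)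
  then show ?thesis by (simp only: mult_less_cancel1)
qed

text \<open>The same transport of units. The last move, from \<open>catalan 1 * catalan l\<close> to
  \<open>catalan (l + 1)\<close>, gains strictly because \<open>l > 0\<close>.\<close>

lemma catalan_mult_less:
  assumes "0 < i" "0 < j"
  shows "catalan i * catalan j < catalan (i + j)"
proof -
  have *: "catalan k * catalan l < catalan (k + l)" if "k \<le> l" "0 < k" for k l
    using that
  proof (induction k arbitrary: l)
    case (Suc k)
    show ?case
    proof (cases "k = 0")
      case True
      then show ?thesis
        using catalan_less_Suc[of l] Suc.prems by simp
    next
      case False
      have "catalan (Suc k) * catalan l \<le> catalan k * catalan (Suc l)"
        using Suc.prems by (intro catalan_mult_Suc_le) simp
      also have "\<dots> < catalan (k + Suc l)"
        using Suc.prems False by (intro Suc.IH) simp_all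
      finally show ?thesis by simp
    qed
  qed simp
  show ?thesis
    using *[of i j] *[of j i] assms by (cases "i \<le> j") (simp_all add: ac_simps)
qed

section \<open>Chains and monotone paths\<close>

text \<open>The point \<open>c\<close> need not lie in \<open>A\<close>: the function is also
  applied to points that a path passes without visiting. The value is meaningful if \<open>x\<close>
  is injective on \<open>A\<close> and some point of \<open>A\<close> lies to the right of
  \<open>c\<close>.\<close>

definition nxt :: "('a \<Rightarrow> real) \<Rightarrow> 'a set \<Rightarrow> 'a \<Rightarrow> 'a" where
  "nxt x A c = (THE b. b \<in> A \<and> x c < x b \<and> (\<forall>s\<in>A. x c < x s \<longrightarrow> x b \<le> x s))"

definition prv :: "('a \<Rightarrow> real) \<Rightarrow> 'a set \<Rightarrow> 'a \<Rightarrow> 'a" where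
  "prv x A c = (THE b. b \<in> A \<and> x b < x c \<and> (\<forall>s\<in>A. x s < x c \<longrightarrow> x s \<le> x b))"

definition adjacent :: "('a \<Rightarrow> real) \<Rightarrow> 'a set \<Rightarrow> 'a \<Rightarrow> 'a \<Rightarrow> bool" where
  "adjacent x A a b \<longleftrightarrow> a \<in> A \<and> b \<in> A \<and> x a < x b \<and> (\<forall>s\<in>A. x s \<le> x a \<or> x b \<le> x s)"

lemma nxt_eqI:
  assumes "inj_on x A" "b \<in> A" "x c < x b" "\<And>s. s \<in> A \<Longrightarrow> x c < x s \<Longrightarrow> x b \<le> x s"
  shows "nxt x A c = b"
  unfolding nxt_def
proof (rule the_equality)
  show "b \<in> A \<and> x c < x b \<and> (\<forall>s\<in>A. x c < x s \<longrightarrow> x b \<le> x s)"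
    using assms by blast
next
  fix b' assume "b' \<in> A \<and> x c < x b' \<and> (\<forall>s\<in>A. x c < x s \<longrightarrow> x b' \<le> x s)"
  then have "x b' = x b" using assms by (meson order_antisym)
  then show "b' = b" using assms \<open>b' \<in> A \<and> _\<close> by (auto simp: inj_on_def)
qed

lemma prv_eqI:
  assumes "inj_on x A" "b \<in> A" "x b < x c" "\<And>s. s \<in> A \<Longrightarrow> x s < x c \<Longrightarrow> x s \<le> x b"
  shows "prv x A c = b"
  unfolding prv_def
proof (rule the_equality)
  show "b \<in> A \<and> x b < x c \<and> (\<forall>s\<in>A. x s < x c \<longrightarrow> x s \<le> x b)"
    using assms by blast
next
  fix b' assume "b' \<in> A \<and> x b' < x c \<and> (\<forall>s\<in>A. x s < x c \<longrightarrow> x s \<le> x b')"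
  then have "x b' = x b" using assms by (meson order_antisym)
  then show "b' = b" using assms \<open>b' \<in> A \<and> _\<close> by (auto simp: inj_on_def)
qed

lemma nxt_props:
  assumes "inj_on x A" "finite A" "a \<in> A" "x c < x a"
  shows "nxt x A c \<in> A" "x c < x (nxt x A c)" "\<And>s. s \<in> A \<Longrightarrow> x c < x s \<Longrightarrow> x (nxt x A c) \<le> x s"
proof -
  let ?B = "{s \<in> A. x c < x s}"
  have "finite (x ` ?B)" "x ` ?B \<noteq> {}" using assms by auto
  then obtain b where b: "b \<in> ?B" "x b = Min (x ` ?B)"
    by (metis (no_types, lifting) Min_in imageE)
  have m: "x b \<le> x s" if "s \<in> A" "x c < x s" for s
    using that b \<open>finite (x ` ?B)\<close> by (simp add: Min_le)
  have "nxt x A c = b"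
    using b m by (intro nxt_eqI[OF assms(1)]) auto
  then show "nxt x A c \<in> A" "x c < x (nxt x A c)" "\<And>s. s \<in> A \<Longrightarrow> x c < x s \<Longrightarrow> x (nxt x A c) \<le> x s"
    using b m by auto
qed

lemma prv_props:
  assumes "inj_on x A" "finite A" "a \<in> A" "x a < x c"
  shows "prv x A c \<in> A" "x (prv x A c) < x c" "\<And>s. s \<in> A \<Longrightarrow> x s < x c \<Longrightarrow> x s \<le> x (prv x A c)"
proof -
  let ?B = "{s \<in> A. x s < x c}"
  have "finite (x ` ?B)" "x ` ?B \<noteq> {}" using assms by auto
  then obtain b where b: "b \<in> ?B" "x b = Max (x ` ?B)"
    by (metis (no_types, lifting) Max_in imageE)
  have m: "x s \<le> x b" if "s \<in> A" "x s < x c" for s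
    using that b \<open>finite (x ` ?B)\<close> by (simp add: Max_ge)
  have "prv x A c = b"
    using b m by (intro prv_eqI[OF assms(1)]) auto
  then show "prv x A c \<in> A" "x (prv x A c) < x c" "\<And>s. s \<in> A \<Longrightarrow> x s < x c \<Longrightarrow> x s \<le> x (prv x A c)"
    using b m by auto
qed

text \<open>Counting the smaller elements maps \<open>A\<close> bijectively onto the numbers below
  \<open>card A\<close>.\<close>

lemma sum_by_rank:
  fixes x :: "'a \<Rightarrow> real" and h :: "nat \<Rightarrow> nat"
  assumes "finite A" "inj_on x A"
  shows "(\<Sum>a\<in>A. h (card {b \<in> A. x b < x a})) = (\<Sum>i<card A. h i)"
proof -
  let ?r = "\<lambda>a. card {b \<in> A. x b < x a}"
  have less: "?r a < ?r b" if "a \<in> A" "b \<in> A" "x a < x b" for a b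
    by (rule psubset_card_mono) (use that assms in auto)
  have inj: "inj_on ?r A"
  proof (rule inj_onI)
    fix a b assume "a \<in> A" "b \<in> A" "?r a = ?r b"
    then have "x a = x b" using less[of a b] less[of b a] by linarith
    then show "a = b" using assms \<open>a \<in> A\<close> \<open>b \<in> A\<close> by (auto simp: inj_on_def)
  qed
  have "?r ` A \<subseteq> {..<card A}"
  proof clarsimp
    fix a assume "a \<in> A"
    then show "?r a < card A" by (intro psubset_card_mono) (use assms in auto)
  qed
  then have "{..<card A} = ?r ` A"
    using inj by (intro card_subset_eq[symmetric]) (auto simp: card_image)
  then show ?thesis
    using inj by (simp add: sum.reindex)
qed

text \<open>The sets \<open>B\<close> are grouped by the first point \<open>b\<close> after
  \<open>p\<close>, with \<open>b = q\<close> for \<open>B = {}\<close>. The gap before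
  \<open>b\<close> contributes one factor, the points from \<open>b\<close> on give the same sum for
  a smaller set, and the Catalan recursion adds up the products. In terms of Dyck paths of
  semilength \<open>card X - 1\<close>, the gaps are the interiors of the arches between consecutive
  returns.\<close>

lemma catalan_compositions:
  fixes x :: "'a \<Rightarrow> real"
  assumes "finite X" "inj_on x X" "p \<in> X" "q \<in> X" "x p < x q" "\<And>s. s \<in> X \<Longrightarrow> x p \<le> x s \<and> x s \<le> x q"
  shows "(\<Sum>B\<in>Pow (X - {p, q}). \<Prod>b\<in>insert p B. catalan (card {s \<in> X. x b < x s \<and> x s < x (nxt x (insert q B) b)})) = catalan (card X - 1)"
  using assms
proof (induction "card X" arbitrary: X p rule: less_induct)
  case less
  note fin = less.prems(1) and inj = less.prems(2)
  define w where "w Y B b = catalan (card {s \<in> Y. x b < x s \<and> x s < x (nxt x (insert q B) b)})" for Y B b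
  have inj': "inj_on x Y" if "Y \<subseteq> X" for Y using inj that by (rule inj_on_subset)
  have neq: "x r \<noteq> x s" if "r \<in> X" "s \<in> X" "r \<noteq> s" for r s
    using inj_onD[OF inj _ that(1,2)] that(3) by blast
  have gt: "x p < x s" if "s \<in> X - {p}" for s
    using less.prems(6)[of s] neq[of p s] that less.prems(3) by auto
  have lt: "x s < x q" if "s \<in> X - {q}" for s
    using less.prems(6)[of s] neq[of q s] that less.prems(4) by auto
  define Xo where "Xo b = {s \<in> X. x b \<le> x s}" for b
  define P where "P b = {B. B \<subseteq> X - {p, q} \<and> nxt x (insert q B) p = b}" for b
  have nx: "nxt x (insert q B) p \<in> insert q B" "x p < x (nxt x (insert q B) p)"
     "\<And>s. s \<in> insert q B \<Longrightarrow> x p < x s \<Longrightarrow> x (nxt x (insert q B) p) \<le> x s" if "B \<subseteq> X - {p, q}" for B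
  proof -
    have "insert q B \<subseteq> X" using that less.prems(4) by auto
    then have "inj_on x (insert q B)" "finite (insert q B)"
      using inj' finite_subset[OF _ fin] by blast+
    from nxt_props[OF this insertI1 less.prems(5)]
    show "nxt x (insert q B) p \<in> insert q B" "x p < x (nxt x (insert q B) p)"
      "\<And>s. s \<in> insert q B \<Longrightarrow> x p < x s \<Longrightarrow> x (nxt x (insert q B) p) \<le> x s" by blast+
  qed
  have sumP: "(\<Sum>B\<in>P b. \<Prod>c\<in>insert p B. w X B c) = catalan (card {s \<in> X - {p}. x s < x b}) * catalan (card {s \<in> X - {p}. x b < x s})"
    if b: "b \<in> X - {p}" for b
  proof (cases "b = q")
    case True
    have "B = {}" if "B \<in> P q" for B
    proof (rule ccontr)
      assume "B \<noteq> {}"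
      then obtain s where s: "s \<in> B" by blast
      then have "s \<in> X - {p}" "s \<noteq> q" using that by (auto simp: P_def)
      then have "x s < x q" using lt[of s] by auto
      moreover have "x q \<le> x s" using nx(3)[of B s] that s gt[OF \<open>s \<in> X - {p}\<close>] by (auto simp: P_def)
      ultimately show False by simp
    qed
    moreover have "{} \<in> P q"
      using less.prems by (auto simp: P_def intro!: nxt_eqI)
    ultimately have "P q = {{}}" by blast
    moreover have e: "{s \<in> X - {p}. x q < x s} = {}" using lt by force
    moreover have "{s \<in> X. x p < x s \<and> x s < x q} = {s \<in> X - {p}. x s < x q}"
      using gt by auto
    moreover have "nxt x {q} p = q" using less.prems by (intro nxt_eqI) auto
    ultimately show ?thesis unfolding True e by (simp add: w_def)
  next
    case False
    have xb: "x p < x b" "x b < x q"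
      using gt[OF b] lt[of b] b False by auto
    have Xo: "finite (Xo b)" "inj_on x (Xo b)" "b \<in> Xo b" "q \<in> Xo b" "\<And>s. s \<in> Xo b \<Longrightarrow> x b \<le> x s \<and> x s \<le> x q"
      using less.prems b xb fin by (auto simp: Xo_def inj_on_def)
    have "p \<notin> Xo b" "Xo b \<subseteq> X" using xb by (auto simp: Xo_def)
    then have "card (Xo b) < card X"
      using less.prems(3) by (intro psubset_card_mono[OF fin]) auto
    note IH = less.hyps[OF this Xo(1-4) xb(2) Xo(5)]
    \<comment> \<open>Removing the first point \<open>b\<close> leaves an arbitrary set of points
      strictly between \<open>b\<close> and \<open>q\<close>.\<close>
    have "bij_betw (insert b) (Pow (Xo b - {b, q})) (P b)"
      unfolding bij_betw_def
    proof
      show "inj_on (insert b) (Pow (Xo b - {b, q}))"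
        by (auto simp: inj_on_def)
      show "insert b ` Pow (Xo b - {b, q}) = P b"
      proof (intro equalityI subsetI)
        fix B assume "B \<in> insert b ` Pow (Xo b - {b, q})"
        then obtain C where C: "B = insert b C" "C \<subseteq> Xo b - {b, q}" by blast
        have "inj_on x (insert q B)"
          using C b less.prems(4) by (intro inj') (auto simp: Xo_def)
        then have "nxt x (insert q B) p = b"
          by (rule nxt_eqI) (use C xb in \<open>auto simp: Xo_def\<close>)
        moreover have "B \<subseteq> X - {p, q}"
        proof
          fix s assume "s \<in> B"
          then consider "s = b" | "s \<in> Xo b" "s \<noteq> q" using C by auto
          then show "s \<in> X - {p, q}" using b False xb by cases (auto simp: Xo_def)
        qed
        ultimately show "B \<in> P b" by (simp add: P_def)
      next
        fix B assume B: "B \<in> P b"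
        then have "b \<in> insert q B" using nx(1)[of B] by (auto simp: P_def)
        then have "b \<in> B" using False by simp
        moreover have "x b \<le> x s" if "s \<in> B" for s
          using nx(3)[of B s] B that gt[of s] by (auto simp: P_def)
        ultimately have "B = insert b (B - {b})" "B - {b} \<subseteq> Xo b - {b, q}"
          using B by (auto simp: P_def Xo_def)
        then show "B \<in> insert b ` Pow (Xo b - {b, q})" by blast
      qed
    qed
    then have "(\<Sum>B\<in>P b. \<Prod>c\<in>insert p B. w X B c) = (\<Sum>C\<in>Pow (Xo b - {b, q}). \<Prod>c\<in>insert p (insert b C). w X (insert b C) c)"
      by (subst sum.reindex_bij_betw[of "insert b" "Pow (Xo b - {b, q})" "P b" "\<lambda>B. \<Prod>c\<in>insert p B. w X B c", symmetric]) simp_all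
    also have "\<dots> = (\<Sum>C\<in>Pow (Xo b - {b, q}). catalan (card {s \<in> X - {p}. x s < x b}) * (\<Prod>c\<in>insert b C. w (Xo b) C c))"
    proof (rule sum.cong[OF refl])
      fix C assume "C \<in> Pow (Xo b - {b, q})"
      then have C: "C \<subseteq> Xo b - {b, q}" by simp
      then have CX: "C \<subseteq> X" "finite C" using fin by (auto simp: Xo_def intro: finite_subset)
      have "p \<notin> insert b C" using C xb b by (auto simp: Xo_def)
      moreover have "inj_on x (insert q (insert b C))"
        using C b less.prems(4) by (intro inj') (auto simp: Xo_def)
      then have "nxt x (insert q (insert b C)) p = b"
        by (rule nxt_eqI) (use C xb in \<open>auto simp: Xo_def\<close>)
      then have "w X (insert b C) p = catalan (card {s \<in> X - {p}. x s < x b})"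
        unfolding w_def using gt by (intro arg_cong[of _ _ "\<lambda>A. catalan (card A)"]) auto
      moreover have "w X (insert b C) c = w (Xo b) C c" if c: "c \<in> insert b C" for c
      proof -
        have cb: "x b \<le> x c" "x c < x q"
          using c C xb lt[of c] by (auto simp: Xo_def)
        have "nxt x (insert q (insert b C)) c = nxt x (insert q C) c"
        proof -
          have "insert q C \<subseteq> X" using CX less.prems(4) by auto
          then have "inj_on x (insert q C)" "finite (insert q C)"
            using inj' finite_subset[OF _ fin] by blast+
          note * = nxt_props[OF this insertI1 cb(2)]
          show ?thesis
          proof (rule nxt_eqI)
            show "inj_on x (insert q (insert b C))"
              using CX b less.prems(4) by (intro inj') auto
            show "nxt x (insert q C) c \<in> insert q (insert b C)" using *(1) by auto
            show "x c < x (nxt x (insert q C) c)" by (rule *(2))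
            show "x (nxt x (insert q C) c) \<le> x s" if "s \<in> insert q (insert b C)" "x c < x s" for s
              using that *(3)[of s] cb by auto
          qed
        qed
        then show ?thesis
          unfolding w_def using cb by (intro arg_cong[of _ _ "\<lambda>A. catalan (card A)"]) (auto simp: Xo_def)
      qed
      ultimately show "(\<Prod>c\<in>insert p (insert b C). w X (insert b C) c) = catalan (card {s \<in> X - {p}. x s < x b}) * (\<Prod>c\<in>insert b C. w (Xo b) C c)"
        using CX by (subst prod.insert) auto
    qed
    also have "\<dots> = catalan (card {s \<in> X - {p}. x s < x b}) * catalan (card (Xo b) - 1)"
      using IH by (simp add: w_def sum_distrib_left[symmetric])
    also have "card (Xo b) - 1 = card {s \<in> X - {p}. x b < x s}"
    proof -
      have "Xo b = insert b {s \<in> X - {p}. x b < x s}"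
      proof (intro equalityI subsetI)
        fix s assume "s \<in> Xo b"
        then show "s \<in> insert b {s \<in> X - {p}. x b < x s}"
          using neq[of b s] b xb by (auto simp: Xo_def)
      qed (use b in \<open>auto simp: Xo_def\<close>)
      then show ?thesis using fin by simp
    qed
    finally show ?thesis .
  qed
  have "Pow (X - {p, q}) = (\<Union>b\<in>X - {p}. P b)"
  proof (intro equalityI subsetI)
    fix B assume "B \<in> Pow (X - {p, q})"
    then show "B \<in> (\<Union>b\<in>X - {p}. P b)"
      using nx(1,2)[of B] less.prems by (auto simp: P_def)
  qed (auto simp: P_def)
  moreover have "finite (P b)" for b
    using fin by (auto simp: P_def intro!: finite_subset[of _ "Pow X"])
  ultimately have "(\<Sum>B\<in>Pow (X - {p, q}). \<Prod>b\<in>insert p B. w X B b) = (\<Sum>b\<in>X - {p}. \<Sum>B\<in>P b. \<Prod>c\<in>insert p B. w X B c)"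
    using fin by (simp only:) (rule sum.UNION_disjoint, auto simp: P_def)
  also have "\<dots> = (\<Sum>b\<in>X - {p}. catalan (card {s \<in> X - {p}. x s < x b}) * catalan (card {s \<in> X - {p}. x b < x s}))"
    by (rule sum.cong[OF refl sumP])
  also have "\<dots> = (\<Sum>b\<in>X - {p}. catalan (card {s \<in> X - {p}. x s < x b}) * catalan (card (X - {p}) - 1 - card {s \<in> X - {p}. x s < x b}))"
  proof (rule sum.cong[OF refl])
    fix b assume b: "b \<in> X - {p}"
    define lo hi where lh: "lo = {s \<in> X - {p}. x s < x b}" "hi = {s \<in> X - {p}. x b < x s}"
    have "X - {p} = insert b (lo \<union> hi)" "lo \<inter> hi = {}" "b \<notin> lo \<union> hi" "finite lo" "finite hi"
      using b neq[of b] fin by (auto simp: neq_iff lh)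
    then have "card (X - {p}) = Suc (card lo + card hi)"
      by (simp add: card_Un_disjoint)
    then show "catalan (card {s \<in> X - {p}. x s < x b}) * catalan (card {s \<in> X - {p}. x b < x s}) =
       catalan (card {s \<in> X - {p}. x s < x b}) * catalan (card (X - {p}) - 1 - card {s \<in> X - {p}. x s < x b})"
      by (simp add: lh)
  qed
  also have "\<dots> = (\<Sum>i<card (X - {p}). catalan i * catalan (card (X - {p}) - 1 - i))"
    by (rule sum_by_rank) (use fin inj in \<open>auto simp: inj_on_def\<close>)
  also have "\<dots> = catalan (card X - 1)"
  proof -
    have "q \<in> X - {p}" using less.prems(4,5) by auto
    then have "0 < card (X - {p})" using fin card_gt_0_iff[of "X - {p}"] by auto
    then obtain k where k: "card (X - {p}) = Suc k" using gr0_implies_Suc by blast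
    moreover have "card X - 1 = card (X - {p})" using less.prems fin by (simp add: card_Diff_singleton)
    ultimately show ?thesis by (simp only: k lessThan_Suc_atMost diff_Suc_1 catalan_convolution)
  qed
  finally show ?case by (simp add: w_def)
qed

section \<open>Chords, convex chains and upper hulls\<close>

definition lin :: "('a \<Rightarrow> real) \<Rightarrow> ('a \<Rightarrow> real) \<Rightarrow> 'a \<Rightarrow> 'a \<Rightarrow> real \<Rightarrow> real" where
  "lin x y a b t = y a + (y b - y a) * (t - x a) / (x b - x a)"

lemma lin_left [simp]: "lin x y a b (x a) = y a"
  by (simp add: lin_def)

lemma lin_right [simp]: "x a \<noteq> x b \<Longrightarrow> lin x y a b (x b) = y b"
  by (simp add: lin_def)

lemma lin_commute: "x a \<noteq> x b \<Longrightarrow> lin x y a b t = lin x y b a t"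
  by (simp add: lin_def field_simps)

lemma lin_reflect: "lin (\<lambda>s. - x s) y a b (- t) = lin x y a b t"
proof -
  have "(- t - - x a) / (- x b - - x a) = (t - x a) / (x b - x a)"
  proof -
    have "- t - - x a = - (t - x a)" "- x b - - x a = - (x b - x a)" by simp_all
    then show ?thesis by (simp only: minus_divide_divide)
  qed
  then show ?thesis by (simp add: lin_def flip: times_divide_eq_right)
qed

lemma lin_uminus: "lin x (\<lambda>s. - y s) a b t = - lin x y a b t"
  by (simp add: lin_def algebra_simps diff_divide_distrib)

lemma lin_diff: "lin x (\<lambda>s. u s - v s) a b t = lin x u a b t - lin x v a b t"
  by (simp add: lin_def algebra_simps diff_divide_distrib add_divide_distrib)

text \<open>An affine function is reproduced by interpolation at any two nodes. Together with
  \<open>lin_diff\<close> this allows a fixed line to be subtracted from all heights, so that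
  comparing a chord with a line becomes comparing it with 0.\<close>

lemma lin_lin:
  assumes "x c \<noteq> x d"
  shows "lin x (\<lambda>s. lin x y a b (x s)) c d t = lin x y a b t"
proof -
  define m k where "m = (y b - y a) / (x b - x a)" and "k = y a - m * x a"
  have *: "lin x y a b t = m * t + k" for t
  proof -
    have "(y b - y a) * (t - x a) / (x b - x a) = m * (t - x a)" by (simp add: m_def)
    then show ?thesis by (simp add: lin_def k_def algebra_simps)
  qed
  have "((m * x d + k) - (m * x c + k)) * (t - x c) / (x d - x c) = m * (t - x c)"
  proof -
    have "((m * x d + k) - (m * x c + k)) * (t - x c) = m * (t - x c) * (x d - x c)"
      by (simp add: algebra_simps)
    moreover have "x d - x c \<noteq> 0" using assms by simp
    ultimately show ?thesis by (simp only: nonzero_mult_div_cancel_right not_False_eq_True)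
  qed
  then show ?thesis
    unfolding * lin_def[of x "\<lambda>s. m * x s + k"] by (simp add: algebra_simps)
qed

lemma lin_mono:
  assumes "x a < x b" "x a \<le> t" "t \<le> x b" "u a \<le> v a" "u b \<le> v b"
  shows "lin x u a b t \<le> lin x v a b t"
proof -
  have eq: "lin x u a b t = (u a * (x b - t) + u b * (t - x a)) / (x b - x a)" for u
    using assms(1) by (simp add: lin_def field_simps)
  show ?thesis
    unfolding eq using assms
    by (intro divide_right_mono add_mono mult_right_mono) auto
qed

lemma lin_const [simp]: "lin x (\<lambda>_. c) a b t = c"
  by (simp add: lin_def)

lemma lin_le:
  assumes "x a < x b" "x a \<le> t" "t \<le> x b" "u a \<le> c" "u b \<le> c"
  shows "lin x u a b t \<le> c"
  using lin_mono[of x a b t u "\<lambda>_. c"] assms by simp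

lemma lin_gt:
  assumes "x a < x b" "x a < t" "t < x b" "c \<le> u a" "c \<le> u b" "c < u a \<or> c < u b"
  shows "c < lin x u a b t"
proof -
  have eq: "lin x u a b t = (u a * (x b - t) + u b * (t - x a)) / (x b - x a)"
    using assms(1) by (simp add: lin_def field_simps)
  have "c * (x b - t) \<le> u a * (x b - t)" "c * (t - x a) \<le> u b * (t - x a)"
    using assms by (auto intro: mult_right_mono)
  moreover have "c * (x b - t) < u a * (x b - t) \<or> c * (t - x a) < u b * (t - x a)"
    using assms by auto
  ultimately have "c * (x b - x a) < u a * (x b - t) + u b * (t - x a)"
    by (auto simp: algebra_simps)
  then show ?thesis
    unfolding eq using assms(1) by (simp add: pos_less_divide_eq)
qed

text \<open>The polygonal line has slope \<open>k\<close> before \<open>s\<close> and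
  \<open>l\<close> after it, and \<open>conv\<close> says \<open>k < l\<close>. The chord from
  \<open>hv\<close> to \<open>hw\<close> exceeds \<open>ys\<close> by
  \<open>(s - v) * (w - s) * (l - k) / (w - v)\<close>.\<close>

lemma chord_above_convex_kink:
  fixes xa ya xb yb s ys v w :: real
  assumes "xa \<le> v" "v < s" "s < w" "w \<le> xb"
    and conv: "ys < ya + (yb - ya) * (s - xa) / (xb - xa)"
    and hv: "hv = ya + (ys - ya) * (v - xa) / (s - xa)"
    and hw: "hw = ys + (yb - ys) * (w - s) / (xb - s)"
  shows "ys < hv + (hw - hv) * (s - v) / (w - v)"
proof -
  define k l where "k = (ys - ya) / (s - xa)" and "l = (yb - ys) / (xb - s)"
  have ya: "ya = ys - k * (s - xa)" and yb: "yb = ys + l * (xb - s)"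
    using assms by (simp_all add: k_def l_def)
  have "(ys - ya) * (xb - xa) < (yb - ya) * (s - xa)"
    using conv assms by (simp add: field_simps)
  then have "0 < (s - xa) * (xb - s) * (l - k)"
    unfolding ya yb by (simp add: algebra_simps)
  moreover have "0 < (s - xa) * (xb - s)" using assms by simp
  ultimately have "0 < l - k" by (rule zero_less_mult_pos)
  then have kl: "k < l" by simp
  have hv': "hv = ys - k * (s - v)"
  proof -
    have "(ys - ya) * (v - xa) / (s - xa) = k * (v - xa)" by (simp add: k_def)
    then show ?thesis unfolding hv by (simp add: ya algebra_simps)
  qed
  have hw': "hw = ys + l * (w - s)"
    unfolding hw by (simp add: l_def)
  have "hv + (hw - hv) * (s - v) / (w - v) - ys = (s - v) * (w - s) * (l - k) / (w - v)"
    unfolding hv' hw' using assms by (simp add: field_simps)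
  also have "\<dots> > 0" using assms kl by simp
  finally show ?thesis by simp
qed

lemma lin_above_convex_kink:
  assumes "x a \<le> x v" "x v < x s" "x s < x w" "x w \<le> x b" "y s < lin x y a b (x s)"
    and "h v = lin x y a s (x v)" "h w = lin x y s b (x w)"
  shows "y s < lin x h v w (x s)"
  using chord_above_convex_kink[of "x a" "x v" "x s" "x w" "x b" "y s" "y a" "y b" "h v" "h w"] assms
  by (simp add: lin_def)

lemma finite_argmax:
  fixes f :: "'a \<Rightarrow> real"
  assumes "finite A" "A \<noteq> {}"
  obtains a where "a \<in> A" "\<And>b. b \<in> A \<Longrightarrow> f b \<le> f a"
proof -
  have "Max (f ` A) \<in> f ` A" using assms by simp
  then obtain a where "a \<in> A" "f a = Max (f ` A)" by auto
  then show ?thesis using assms that[of a] by simp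
qed

lemma adjacentD:
  assumes "adjacent x S a b"
  shows "a \<in> S" "b \<in> S" "x a < x b" "\<And>s. s \<in> S \<Longrightarrow> x s \<le> x a \<or> x b \<le> x s"
  using assms by (auto simp: adjacent_def)

lemma adjacent_reflect: "adjacent (\<lambda>s. - x s) S a b \<longleftrightarrow> adjacent x S b a"
  by (auto simp: adjacent_def)

lemma adjacent_nxt:
  assumes "inj_on x S" "finite S" "s \<in> S" "a \<in> S" "x s < x a"
  shows "adjacent x S s (nxt x S s)"
  using nxt_props[OF assms(1,2,4,5)] assms(3) by (force simp: adjacent_def)

lemma adjacent_prv:
  assumes "inj_on x S" "finite S" "s \<in> S" "a \<in> S" "x a < x s"
  shows "adjacent x S (prv x S s) s"
  using prv_props[OF assms(1,2,4,5)] assms(3) by (force simp: adjacent_def)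

lemma nxt_adjacent:
  assumes "inj_on x S" "adjacent x S a b" "x a \<le> x s" "x s < x b"
  shows "nxt x S s = b"
  using adjacentD[OF assms(2)] assms by (intro nxt_eqI) force+

lemma prv_adjacent:
  assumes "inj_on x S" "adjacent x S a b" "x a < x s" "x s \<le> x b"
  shows "prv x S s = a"
  using adjacentD[OF assms(2)] assms by (intro prv_eqI) force+

lemma convex_chain_right:
  assumes S: "finite S" "inj_on x S" and ab: "adjacent x S a b" and ca: "x c \<le> x a"
    and conv: "\<And>s t u. adjacent x S s t \<Longrightarrow> adjacent x S t u \<Longrightarrow> x c \<le> x s \<Longrightarrow> x u \<le> x d \<Longrightarrow> y t < lin x y s u (x t)"
    and s: "s \<in> S" "x b < x s" "x s \<le> x d"
  shows "lin x y a b (x s) < y s"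
proof (rule ccontr)
  assume neg: "\<not> lin x y a b (x s) < y s"
  define \<delta> where "\<delta> t = y t - lin x y a b (x t)" for t
  note abD = adjacentD[OF ab]
  let ?Q = "{t \<in> S. x b \<le> x t \<and> x t < x s}"
  have "finite ?Q" "?Q \<noteq> {}" using S abD s by auto
  then obtain t where t: "t \<in> ?Q" and max: "\<And>r. r \<in> ?Q \<Longrightarrow> \<delta> r \<le> \<delta> t"
    using finite_argmax[of ?Q \<delta>] by blast
  have d0: "\<delta> a = 0" "\<delta> b = 0" "\<delta> s \<le> 0" using abD neg by (auto simp: \<delta>_def)
  have tpos: "0 \<le> \<delta> t" using max[of b] abD s d0 by auto
  define u v where "u = nxt x S t" and "v = prv x S t"
  have tu: "adjacent x S t u" unfolding u_def
    using t s S by (intro adjacent_nxt[of x S t s]) auto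
  have vt: "adjacent x S v t" unfolding v_def
    using t abD S by (intro adjacent_prv[of x S t a]) auto
  have "x u \<le> x s" using adjacentD(4)[OF tu s(1)] t by auto
  have "x a \<le> x v" using adjacentD(4)[OF vt abD(1)] t abD(3) by auto
  have "y t < lin x y v u (x t)"
    using conv[OF vt tu] \<open>x u \<le> x s\<close> \<open>x a \<le> x v\<close> ca s(3) by simp
  moreover have "\<delta> u \<le> \<delta> t"
  proof (cases "x u = x s")
    case True
    then have "u = s" using S(2) s(1) adjacentD(2)[OF tu] by (auto simp: inj_on_def)
    then show ?thesis using d0 tpos by simp
  next
    case False
    then show ?thesis using max[of u] adjacentD[OF tu] t \<open>x u \<le> x s\<close> by auto
  qed
  moreover have "\<delta> v \<le> \<delta> t"
  proof (cases "x b \<le> x v")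
    case True
    then show ?thesis using max[of v] adjacentD[OF vt] t by auto
  next
    case False
    then have "x v = x a" using abD(4)[OF adjacentD(1)[OF vt]] \<open>x a \<le> x v\<close> by auto
    then have "v = a" using S(2) abD(1) adjacentD(1)[OF vt] by (auto simp: inj_on_def)
    then show ?thesis using d0 tpos by simp
  qed
  moreover have vu: "x v < x t" "x t < x u" using adjacentD(3)[OF vt] adjacentD(3)[OF tu] by auto
  ultimately have "lin x \<delta> v u (x t) \<le> \<delta> t"
    by (intro lin_le) auto
  moreover have "lin x \<delta> v u (x t) = lin x y v u (x t) - lin x y a b (x t)"
    using vu unfolding \<delta>_def by (simp add: lin_diff lin_lin)
  ultimately show False
    using \<open>y t < lin x y v u (x t)\<close> by (simp add: \<delta>_def)
qed

lemma convex_chain: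
  assumes S: "finite S" "inj_on x S" and ab: "adjacent x S a b" and cd: "x c \<le> x a" "x b \<le> x d"
    and conv: "\<And>s t u. adjacent x S s t \<Longrightarrow> adjacent x S t u \<Longrightarrow> x c \<le> x s \<Longrightarrow> x u \<le> x d \<Longrightarrow> y t < lin x y s u (x t)"
    and s: "s \<in> S" "x c \<le> x s" "x s \<le> x d" "s \<noteq> a" "s \<noteq> b"
  shows "lin x y a b (x s) < y s"
proof (cases "x b < x s")
  case True
  then show ?thesis using convex_chain_right[OF S ab cd(1) conv] s by blast
next
  case False
  have "x s \<noteq> x a" "x s \<noteq> x b"
    using S(2) s adjacentD[OF ab] by (auto simp: inj_on_def)
  then have "x s < x a" using adjacentD(3,4)[OF ab] s(1) False by force
  \<comment> \<open>Points to the left of \<open>a\<close> are handled by reflecting the horizontal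
    axis.\<close>
  have "lin (\<lambda>s. - x s) y b a (- x s) < y s"
  proof (rule convex_chain_right[of S "\<lambda>s. - x s" b a d c])
    fix s t u assume "adjacent (\<lambda>s. - x s) S s t" "adjacent (\<lambda>s. - x s) S t u" "- x d \<le> - x s" "- x u \<le> - x c"
    then show "y t < lin (\<lambda>s. - x s) y s u (- x t)"
      using conv[of u t s] adjacentD(3)[of x S u t] adjacentD(3)[of x S t s]
      by (simp add: adjacent_reflect lin_reflect lin_commute[of x s u])
  qed (use S ab cd s \<open>x s < x a\<close> in \<open>auto simp: adjacent_reflect inj_on_def\<close>)
  then show ?thesis
    using adjacentD(3)[OF ab] by (simp add: lin_reflect lin_commute[of x b a])
qed

text \<open>\<open>U\<close> consists of the points above every chord that spans them; the two ends
  are spanned by none. If a point lay above the line through neighbours \<open>a\<close>,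
  \<open>b\<close> of \<open>U\<close>, the point \<open>m\<close> highest above that line would
  belong to \<open>U\<close>, hence lie to the left of \<open>a\<close> or to the right of
  \<open>b\<close>, and the chord from \<open>m\<close> to the far endpoint would pass above the
  near one.\<close>

lemma upper_hull_exists:
  assumes B: "finite B" "inj_on x B"
    and gp: "\<And>a b c. a \<in> B \<Longrightarrow> b \<in> B \<Longrightarrow> c \<in> B \<Longrightarrow> a \<noteq> b \<Longrightarrow> b \<noteq> c \<Longrightarrow> a \<noteq> c \<Longrightarrow> y c \<noteq> lin x y a b (x c)"
    and cd: "c \<in> B" "d \<in> B" "\<And>s. s \<in> B \<Longrightarrow> x c \<le> x s \<and> x s \<le> x d"
  obtains U where "U \<subseteq> B" "c \<in> U" "d \<in> U"
    "\<And>a b s. adjacent x U a b \<Longrightarrow> s \<in> B - {a, b} \<Longrightarrow> y s < lin x y a b (x s)"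
proof
  define U where "U = {s \<in> B. \<forall>a\<in>B. \<forall>b\<in>B. x a < x s \<and> x s < x b \<longrightarrow> lin x y a b (x s) < y s}"
  show "U \<subseteq> B" by (auto simp: U_def)
  show "c \<in> U" "d \<in> U" using cd by (force simp: U_def)+
  fix a b s assume ab: "adjacent x U a b" and s: "s \<in> B - {a, b}"
  define \<delta> where "\<delta> t = y t - lin x y a b (x t)" for t
  note abD = adjacentD[OF ab]
  have abB: "a \<in> B" "b \<in> B" "a \<noteq> b" using abD by (auto simp: U_def)
  have d0: "\<delta> a = 0" "\<delta> b = 0" using abD by (auto simp: \<delta>_def)
  show "y s < lin x y a b (x s)"
  proof (rule ccontr)
    assume "\<not> y s < lin x y a b (x s)"
    then have "0 < \<delta> s" using gp[of a b s] abB s by (auto simp: \<delta>_def)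
    obtain m where m: "m \<in> B" and max: "\<And>r. r \<in> B \<Longrightarrow> \<delta> r \<le> \<delta> m"
      using finite_argmax[OF B(1), of \<delta>] s by blast
    have mpos: "0 < \<delta> m" using max[of s] s \<open>0 < \<delta> s\<close> by auto
    then have mab: "m \<noteq> a" "m \<noteq> b" using d0 by auto
    have "lin x y a' b' (x m) < y m" if "a' \<in> B" "b' \<in> B" "x a' < x m" "x m < x b'" for a' b'
    proof -
      have "lin x \<delta> a' b' (x m) \<le> \<delta> m" using that max by (intro lin_le) auto
      moreover have "lin x \<delta> a' b' (x m) = lin x y a' b' (x m) - lin x y a b (x m)"
        using that unfolding \<delta>_def by (simp add: lin_diff lin_lin)
      ultimately have "lin x y a' b' (x m) \<le> y m" by (simp add: \<delta>_def)
      then show ?thesis using gp[of a' b' m] that m by force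
    qed
    then have mU: "m \<in> U" using m by (auto simp: U_def)
    have xm: "x m \<noteq> x a" "x m \<noteq> x b"
      using mab B(2) m abB by (auto simp: inj_on_def)
    consider "x m < x a" | "x b < x m" using abD(4)[OF mU] xm by force
    then show False
    proof cases
      case 1
      then have "lin x y m b (x a) < y a" using abD m abB by (auto simp: U_def)
      moreover have "0 < lin x \<delta> m b (x a)"
        using 1 abD(3) mpos d0 by (intro lin_gt) auto
      moreover have "lin x \<delta> m b (x a) = lin x y m b (x a) - lin x y a b (x a)"
        using 1 abD(3) unfolding \<delta>_def by (simp add: lin_diff lin_lin)
      ultimately show False by simp
    next
      case 2
      then have "lin x y a m (x b) < y b" using abD m abB by (auto simp: U_def)
      moreover have "0 < lin x \<delta> a m (x b)"
        using 2 abD(3) mpos d0 by (intro lin_gt) auto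
      moreover have "lin x \<delta> a m (x b) = lin x y a m (x b) - lin x y a b (x b)"
        using 2 abD(3) unfolding \<delta>_def by (simp add: lin_diff lin_lin)
      ultimately show False using abD(3) by simp
    qed
  qed
qed

section \<open>Monotone paths between the two extreme points, and their cut sets\<close>

locale planar_chain =
  fixes x y :: "'a \<Rightarrow> real" and X :: "'a set" and p q :: 'a
  assumes fin: "finite X" and inj: "inj_on x X" and pX: "p \<in> X" and qX: "q \<in> X" and pq: "x p < x q"
    and bounds: "\<And>s. s \<in> X \<Longrightarrow> x p \<le> x s \<and> x s \<le> x q"
    and gp: "\<And>a b c. a \<in> X \<Longrightarrow> b \<in> X \<Longrightarrow> c \<in> X \<Longrightarrow> a \<noteq> b \<Longrightarrow> b \<noteq> c \<Longrightarrow> a \<noteq> c \<Longrightarrow> y c \<noteq> lin x y a b (x c)"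
begin

definition paths :: "'a set set" where "paths = {S. S \<subseteq> X \<and> p \<in> S \<and> q \<in> S}"

text \<open>A path is the shortest monotone path that runs weakly above its cut points and weakly below the other points.\<close>

definition cut :: "'a set \<Rightarrow> 'a set" where "cut S = {s \<in> X - {p, q}. (s \<notin> S \<and> y s < lin x y (prv x S s) (nxt x S s) (x s)) \<or>
                                   (s \<in> S \<and> lin x y (prv x S s) (nxt x S s) (x s) < y s)}"

text \<open>The height of the polygonal path \<open>S\<close> at the abscissa of \<open>s\<close>,
  whether or not \<open>s\<close> is one of its vertices.\<close>

definition hgt :: "'a set \<Rightarrow> 'a \<Rightarrow> real" where "hgt S s = (if s \<in> S then y s else lin x y (prv x S s) (nxt x S s) (x s))"

lemma x_eq_iff: "a \<in> X \<Longrightarrow> b \<in> X \<Longrightarrow> x a = x b \<longleftrightarrow> a = b"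
  using inj by (auto simp: inj_on_def)

lemma pathD:
  assumes "S \<in> paths"
  shows "S \<subseteq> X" "p \<in> S" "q \<in> S" "finite S" "inj_on x S"
  using assms fin inj by (auto simp: paths_def intro: finite_subset inj_on_subset)

lemma inner_between: "s \<in> X - {p, q} \<Longrightarrow> x p < x s \<and> x s < x q"
  using bounds[of s] x_eq_iff[of p s] x_eq_iff[of s q] pX qX by force

lemma path_neighbours:
  assumes "S \<in> paths" "s \<in> X - {p, q}"
  shows "prv x S s \<in> S" "nxt x S s \<in> S" "x (prv x S s) < x s" "x s < x (nxt x S s)"
    "\<And>t. t \<in> S \<Longrightarrow> x t < x s \<Longrightarrow> x t \<le> x (prv x S s)"
    "\<And>t. t \<in> S \<Longrightarrow> x s < x t \<Longrightarrow> x (nxt x S s) \<le> x t"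
proof -
  note S = pathD[OF assms(1)] and b = inner_between[OF assms(2)]
  show "prv x S s \<in> S" "x (prv x S s) < x s" "\<And>t. t \<in> S \<Longrightarrow> x t < x s \<Longrightarrow> x t \<le> x (prv x S s)"
    using prv_props[OF S(5,4,2), of s] b by auto
  show "nxt x S s \<in> S" "x s < x (nxt x S s)" "\<And>t. t \<in> S \<Longrightarrow> x s < x t \<Longrightarrow> x (nxt x S s) \<le> x t"
    using nxt_props[OF S(5,4,3), of s] b by auto
qed

lemma path_adjacent:
  assumes "S \<in> paths" "s \<in> X - {p, q}"
  shows "s \<in> S \<Longrightarrow> adjacent x S (prv x S s) s" "s \<in> S \<Longrightarrow> adjacent x S s (nxt x S s)"
    "s \<notin> S \<Longrightarrow> adjacent x S (prv x S s) (nxt x S s)"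
proof -
  note n = path_neighbours[OF assms] and S = pathD[OF assms(1)]
  show "s \<in> S \<Longrightarrow> adjacent x S (prv x S s) s"
    using n(1,3,5) unfolding adjacent_def by (auto simp: not_le[symmetric])
  show "s \<in> S \<Longrightarrow> adjacent x S s (nxt x S s)"
    using n(2,4,6) unfolding adjacent_def by (auto simp: not_le[symmetric])
  show "adjacent x S (prv x S s) (nxt x S s)" if "s \<notin> S"
  proof -
    have "x t < x s \<or> x s < x t" if "t \<in> S" for t
    proof -
      have "t \<in> X" "s \<in> X" "t \<noteq> s" using that S(1) assms(2) \<open>s \<notin> S\<close> by auto
      then have "x t \<noteq> x s" using x_eq_iff[of t s] by simp
      then show ?thesis by linarith
    qed
    then have "x t \<le> x (prv x S s) \<or> x (nxt x S s) \<le> x t" if "t \<in> S" for t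
      using n(5,6)[OF that] that by blast
    then show ?thesis using n(1-4) unfolding adjacent_def by simp
  qed
qed

lemma neighbour_gp:
  assumes "S \<in> paths" "s \<in> X - {p, q}"
  shows "y s \<noteq> lin x y (prv x S s) (nxt x S s) (x s)"
  using path_neighbours(1-4)[OF assms] pathD(1)[OF assms(1)] assms(2) by (intro gp) auto

lemma hgt_on_edge:
  assumes S: "S \<in> paths" and ab: "adjacent x S a b" and s: "s \<in> X" "x a \<le> x s" "x s \<le> x b"
  shows "hgt S s = lin x y a b (x s)"
proof (cases "s \<in> S")
  case True
  then have "x s = x a \<or> x s = x b" using adjacentD(4)[OF ab True] s by auto
  moreover have "a \<in> X" "b \<in> X" using adjacentD[OF ab] pathD(1)[OF S] by auto
  ultimately have "s = a \<or> s = b" using x_eq_iff s(1) by auto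
  then show ?thesis using True adjacentD(3)[OF ab] by (auto simp: hgt_def)
next
  case False
  then have "x s \<noteq> x a" "x s \<noteq> x b"
    using x_eq_iff[of s a] x_eq_iff[of s b] s(1) adjacentD[OF ab] pathD(1)[OF S] by auto
  then have "prv x S s = a" "nxt x S s = b"
    using prv_adjacent[OF pathD(5)[OF S] ab, of s] nxt_adjacent[OF pathD(5)[OF S] ab, of s] s by auto
  then show ?thesis using False by (simp add: hgt_def)
qed

text \<open>At a point \<open>s\<close> where \<open>hgt S - hgt S'\<close> is maximal and positive, the path \<open>S\<close> does not bend down and
  \<open>S'\<close> does not bend up, since \<open>s\<close> is a cut point of both paths or of none. As one of them bends, this is impossible.\<close>

lemma hgt_le_of_cut_eq:
  assumes S: "S \<in> paths" and S': "S' \<in> paths" and eq: "cut S = cut S'" and t: "t \<in> S \<union> S'"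
  shows "hgt S t \<le> hgt S' t"
proof (rule ccontr)
  assume neg: "\<not> hgt S t \<le> hgt S' t"
  define d where "d s = hgt S s - hgt S' s" for s
  let ?T = "S \<union> S'"
  have T: "?T \<in> paths" using pathD(1-3)[OF S] pathD(1)[OF S'] by (auto simp: paths_def)
  obtain s where s: "s \<in> ?T" and max: "\<And>r. r \<in> ?T \<Longrightarrow> d r \<le> d s"
    using finite_argmax[OF pathD(4)[OF T], of d] t by blast
  have pos: "0 < d s" using max[OF t] neg by (simp add: d_def)
  have "s \<noteq> p" "s \<noteq> q" using pos pathD(2,3)[OF S] pathD(2,3)[OF S'] by (auto simp: d_def hgt_def)
  then have sX: "s \<in> X - {p, q}" using s pathD(1)[OF T] by auto
  define v u where "v = prv x ?T s" and "u = nxt x ?T s"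
  note n = path_neighbours[OF T sX, folded v_def u_def]
  have vuX: "v \<in> X" "u \<in> X" using n pathD(1)[OF T] by auto
  \<comment> \<open>\<open>v\<close> and \<open>u\<close> are the neighbours of \<open>s\<close>
    among the vertices of both paths. A path that skips \<open>s\<close> is straight from
    \<open>v\<close> to \<open>u\<close>; one that visits \<open>s\<close> is straight from
    \<open>v\<close> to \<open>s\<close> and from \<open>s\<close> to \<open>u\<close>, as
    \<open>kink\<close> records.\<close>
  have line: "hgt A s = lin x (hgt A) v u (x s)" if A: "A \<in> paths" "A \<subseteq> ?T" "s \<notin> A" for A
  proof -
    let ?a = "prv x A s" and ?b = "nxt x A s"
    note m = path_neighbours[OF A(1) sX]
    have ab: "adjacent x A ?a ?b" using path_adjacent(3)[OF A(1) sX A(3)] .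
    have "x ?a \<le> x v" using n(5)[of ?a] m A by auto
    moreover have "x u \<le> x ?b" using n(6)[of ?b] m A by auto
    ultimately have "hgt A v = lin x y ?a ?b (x v)" "hgt A u = lin x y ?a ?b (x u)" "hgt A s = lin x y ?a ?b (x s)"
      using hgt_on_edge[OF A(1) ab] vuX sX n(3,4) m(3,4) by auto
    moreover have "lin x (\<lambda>r. lin x y ?a ?b (x r)) v u (x s) = lin x y ?a ?b (x s)"
      using n(3,4) by (intro lin_lin) auto
    ultimately show ?thesis by (simp add: lin_def)
  qed
  have kink: "x (prv x A s) \<le> x v \<and> x u \<le> x (nxt x A s) \<and> hgt A v = lin x y (prv x A s) s (x v) \<and> hgt A u = lin x y s (nxt x A s) (x u)"
    if A: "A \<in> paths" "A \<subseteq> ?T" "s \<in> A" for A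
  proof -
    note m = path_neighbours[OF A(1) sX]
    have "x (prv x A s) \<le> x v" using n(5)[of "prv x A s"] m A by auto
    moreover have "x u \<le> x (nxt x A s)" using n(6)[of "nxt x A s"] m A by auto
    ultimately show ?thesis
      using hgt_on_edge[OF A(1) path_adjacent(1)[OF A(1) sX A(3)], of v]
        hgt_on_edge[OF A(1) path_adjacent(2)[OF A(1) sX A(3)], of u] vuX n(3,4) by auto
  qed
  have up: "hgt S s < lin x (hgt S) v u (x s)" if "s \<in> S"
  proof -
    have "s \<notin> S'" using that pos by (auto simp: d_def hgt_def)
    then have "s \<notin> cut S'" using pos that by (auto simp: d_def hgt_def cut_def)
    then have "y s < lin x y (prv x S s) (nxt x S s) (x s)"
      using that sX neighbour_gp[OF S sX] unfolding eq[symmetric] by (auto simp: cut_def)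
    then have "y s < lin x (hgt S) v u (x s)"
      using kink[OF S _ that] n(3,4) by (intro lin_above_convex_kink[of x "prv x S s" v s u "nxt x S s"]) auto
    then show ?thesis using that by (simp add: hgt_def[of S s])
  qed
  have down: "lin x (hgt S') v u (x s) < hgt S' s" if "s \<in> S'"
  proof -
    have "s \<notin> S" using that pos by (auto simp: d_def hgt_def)
    then have "s \<in> cut S" using pos that sX by (auto simp: d_def hgt_def cut_def)
    then have "lin x y (prv x S' s) (nxt x S' s) (x s) < y s"
      using that unfolding eq by (auto simp: cut_def)
    then have "- y s < lin x (\<lambda>r. - hgt S' r) v u (x s)"
      using kink[OF S' _ that] n(3,4)
      by (intro lin_above_convex_kink[of x "prv x S' s" v s u "nxt x S' s" "\<lambda>r. - y r"]) (auto simp: lin_uminus)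
    then have "lin x (hgt S') v u (x s) < y s" by (simp add: lin_uminus)
    then show ?thesis using that by (simp add: hgt_def[of S' s])
  qed
  \<comment> \<open>At least one of the paths has \<open>s\<close> as a vertex and bends there
    strictly, by general position, so the maximum of \<open>d\<close> would lie strictly below a
    chord between smaller or equal values.\<close>
  have "d s < lin x d v u (x s)"
    using s line[OF S] line[OF S'] up down unfolding d_def lin_diff by (cases "s \<in> S"; cases "s \<in> S'") auto
  moreover have "lin x d v u (x s) \<le> d s"
    using n max by (intro lin_le) auto
  ultimately show False by simp
qed

text \<open>Equal heights at all vertices force equal vertex sets: a vertex of one path that the
  other skips would lie on the line through two other points, against \<open>gp\<close>.\<close>

lemma inj_on_cut: "inj_on cut paths"
proof (rule inj_onI)
  fix S S' assume S: "S \<in> paths" and S': "S' \<in> paths" and eq: "cut S = cut S'"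
  have *: "hgt S t = hgt S' t" if "t \<in> S \<union> S'" for t
    using hgt_le_of_cut_eq[OF S S' eq] hgt_le_of_cut_eq[OF S' S eq[symmetric]] that by (force intro: order_antisym)
  have sub: "A \<subseteq> B" if A: "A \<in> paths" "B \<in> paths" "\<And>t. t \<in> A \<Longrightarrow> hgt A t = hgt B t" for A B
  proof
    fix t assume t: "t \<in> A"
    show "t \<in> B"
    proof (rule ccontr)
      assume "t \<notin> B"
      then have "t \<in> X - {p, q}" using t pathD[OF A(1)] pathD[OF A(2)] by auto
      from neighbour_gp[OF A(2) this] show False
        using A(3)[OF t] t \<open>t \<notin> B\<close> by (simp add: hgt_def)
    qed
  qed
  have "S \<subseteq> S'" by (rule sub[OF S S']) (use * in auto)
  moreover have "S' \<subseteq> S" by (rule sub[OF S' S]) (use * in auto)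
  ultimately show "S = S'" by auto
qed

text \<open>A path consists of \<open>p\<close>, \<open>q\<close> and an arbitrary set of inner
  points, so there are as many paths as sets of inner points, and an injective map between finite
  sets of equal size is onto. No path with a prescribed cut set is constructed.\<close>

lemma bij_betw_cut: "bij_betw cut paths (Pow (X - {p, q}))"
proof -
  have "bij_betw (\<lambda>A. insert p (insert q A)) (Pow (X - {p, q})) paths"
    unfolding bij_betw_def
  proof
    show "inj_on (\<lambda>A. insert p (insert q A)) (Pow (X - {p, q}))"
      by (auto simp: inj_on_def)
    show "(\<lambda>A. insert p (insert q A)) ` Pow (X - {p, q}) = paths"
    proof (intro equalityI subsetI)
      fix S assume "S \<in> (\<lambda>A. insert p (insert q A)) ` Pow (X - {p, q})"
      then obtain A where "A \<subseteq> X - {p, q}" "S = insert p (insert q A)" by blast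
      then show "S \<in> paths" using pX qX by (simp add: paths_def subset_iff)
    next
      fix S assume "S \<in> paths"
      then have "S = insert p (insert q (S - {p, q}))" "S - {p, q} \<in> Pow (X - {p, q})"
        using pathD(1-3)[OF \<open>S \<in> paths\<close>] by blast+
      then show "S \<in> (\<lambda>A. insert p (insert q A)) ` Pow (X - {p, q})" by (rule image_eqI)
    qed
  qed
  then have "card paths = card (Pow (X - {p, q}))" by (simp add: bij_betw_same_card)
  moreover have "cut ` paths \<subseteq> Pow (X - {p, q})" by (auto simp: cut_def)
  moreover have "finite (Pow (X - {p, q}))" using fin by simp
  ultimately have "cut ` paths = Pow (X - {p, q})"
    using card_image[OF inj_on_cut] card_subset_eq[of "Pow (X - {p, q})" "cut ` paths"] by simp
  then show ?thesis using inj_on_cut by (simp add: bij_betw_def)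
qed

section \<open>Blocks between consecutive peaks\<close>

definition corners :: "'a set \<Rightarrow> 'a set" where "corners S = insert p (S \<inter> cut S)"
definition stop :: "'a set \<Rightarrow> 'a \<Rightarrow> 'a" where "stop S c = nxt x (insert q (corners S)) c"
text \<open>Between consecutive corners the path bends only upwards, so it is the lower hull of the
  block. The block contains the path vertices there and the points above the path, but not the cut
  points strictly below it.\<close>

definition block :: "'a set \<Rightarrow> 'a \<Rightarrow> 'a set" where "block S c = {s \<in> X. s = c \<or> s = stop S c \<or> (x c < x s \<and> x s < x (stop S c) \<and> s \<notin> cut S)}"

lemma corners_subset: "S \<in> paths \<Longrightarrow> corners S \<subseteq> S" "q \<notin> corners S"
  using pathD(2) pq by (auto simp: corners_def cut_def)

lemma corner_less: "S \<in> paths \<Longrightarrow> c \<in> corners S \<Longrightarrow> x c < x q"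
  using inner_between pq by (auto simp: corners_def cut_def)

lemma stop_props:
  assumes S: "S \<in> paths" and c: "c \<in> corners S"
  shows "stop S c \<in> insert q (corners S)" "x c < x (stop S c)"
    "\<And>s. s \<in> insert q (corners S) \<Longrightarrow> x c < x s \<Longrightarrow> x (stop S c) \<le> x s"
    "stop S c \<in> S" "c \<in> S"
proof -
  have "insert q (corners S) \<subseteq> S" using corners_subset(1)[OF S] pathD(3)[OF S] by auto
  then have *: "inj_on x (insert q (corners S))" "finite (insert q (corners S))"
    by (rule inj_on_subset[OF pathD(5)[OF S]], rule finite_subset[OF _ pathD(4)[OF S]])
  note r = nxt_props[OF * insertI1 corner_less[OF assms], folded stop_def]
  show "stop S c \<in> insert q (corners S)" "x c < x (stop S c)"
    "\<And>s. s \<in> insert q (corners S) \<Longrightarrow> x c < x s \<Longrightarrow> x (stop S c) \<le> x s" using r by auto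
  show "stop S c \<in> S" "c \<in> S" using r(1) c \<open>insert q (corners S) \<subseteq> S\<close> by auto
qed

text \<open>No vertex strictly between \<open>c\<close> and \<open>stop S c\<close> is a peak, so
  this part of \<open>S\<close> is a convex chain and lies above the line of each of its edges. A
  block point off the path is above the edge over its abscissa, hence above the line as
  well.\<close>

lemma block_above:
  assumes S: "S \<in> paths" and c: "c \<in> corners S" and ab: "adjacent x S a b" "x c \<le> x a" "x b \<le> x (stop S c)"
    and s: "s \<in> block S c" "s \<noteq> a" "s \<noteq> b"
  shows "lin x y a b (x s) < y s"
proof -
  note st = stop_props[OF S c] and P = pathD[OF S]
  \<comment> \<open>An inner vertex of this stretch is no corner, hence no cut point, so the path
    bends upwards there.\<close>
  have conv: "y t < lin x y s u (x t)"
    if "adjacent x S s t" "adjacent x S t u" "x c \<le> x s" "x u \<le> x (stop S c)" for s t u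
  proof -
    note st' = adjacentD[OF that(1)] and tu = adjacentD[OF that(2)]
    have "x c < x t" "x t < x (stop S c)" using st'(3) tu(3) that by auto
    then have tc: "t \<notin> insert q (corners S)" using st(3)[of t] by auto
    then have tX: "t \<in> X - {p, q}" using tu(1) P(1) by (auto simp: corners_def)
    have "prv x S t = s" "nxt x S t = u"
      using prv_adjacent[OF P(5) that(1), of t] nxt_adjacent[OF P(5) that(2), of t] st'(3) tu(3) by auto
    moreover have "t \<notin> cut S" using tc tu(1) by (auto simp: corners_def)
    ultimately show ?thesis using neighbour_gp[OF S tX] tu(1) tX by (auto simp: cut_def)
  qed
  have onS: "lin x y a b (x r) < y r" if "r \<in> S" "x c \<le> x r" "x r \<le> x (stop S c)" "r \<noteq> a" "r \<noteq> b" for r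
    by (rule convex_chain[OF P(4,5) ab(1) ab(2,3) conv]) (use that in auto)
  have onS': "lin x y a b (x r) \<le> y r" if "r \<in> S" "x c \<le> x r" "x r \<le> x (stop S c)" for r
    using onS[OF that] adjacentD(3)[OF ab(1)] by (cases "r = a"; cases "r = b") auto
  show ?thesis
  proof (cases "s \<in> S")
    case True
    then show ?thesis using onS[of s] s st(2) by (auto simp: block_def)
  next
    case False
    then have sc: "x c < x s" "x s < x (stop S c)" "s \<notin> cut S" "s \<in> X"
      using s st(4,5) by (auto simp: block_def)
    have "s \<noteq> p" "s \<noteq> q" using False P by auto
    then have sX: "s \<in> X - {p, q}" using sc by auto
    note n = path_neighbours[OF S sX]
    let ?v = "prv x S s" and ?u = "nxt x S s"
    have vu: "x c \<le> x ?v" "x ?u \<le> x (stop S c)" using n(5)[OF st(5)] n(6)[OF st(4)] sc by auto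
    have "lin x y a b (x ?v) \<le> y ?v" "lin x y a b (x ?u) \<le> y ?u"
      using onS'[of ?v] onS'[of ?u] n vu sc by auto
    then have "lin x (\<lambda>r. lin x y a b (x r)) ?v ?u (x s) \<le> lin x y ?v ?u (x s)"
      using n by (intro lin_mono) auto
    moreover have "lin x (\<lambda>r. lin x y a b (x r)) ?v ?u (x s) = lin x y a b (x s)"
      using n by (intro lin_lin) auto
    moreover have "lin x y ?v ?u (x s) < y s"
      using neighbour_gp[OF S sX] sc(3) False sX by (auto simp: cut_def)
    ultimately show ?thesis by simp
  qed
qed

lemma prod_catalan_le:
  assumes "finite I"
  shows "(\<Prod>i\<in>I. catalan (f i)) \<le> catalan (\<Sum>i\<in>I. f i)"
  using assms
proof (induction I)
  case (insert i I)
  have "catalan (f i) * (\<Prod>i\<in>I. catalan (f i)) \<le> catalan (f i) * catalan (\<Sum>i\<in>I. f i)"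
    using insert by simp
  also have "\<dots> \<le> catalan (f i + (\<Sum>i\<in>I. f i))" by (rule catalan_mult_le)
  finally show ?case using insert by simp
qed simp

text \<open>The left side has a factor for each gap of the full cut set, the right side one for each
  block. Cut points strictly below \<open>S\<close> separate gaps but not blocks: the inside of the
  block at \<open>c\<close> is the union of the gaps \<open>g r\<close> with \<open>r\<close> in
  \<open>D c\<close>, and \<open>prod_catalan_le\<close> merges their factors.\<close>

lemma block_product:
  assumes S: "S \<in> paths"
  shows "(\<Prod>c\<in>insert p (cut S). catalan (card {s \<in> X. x c < x s \<and> x s < x (nxt x (insert q (cut S)) c)}))
     \<le> (\<Prod>c\<in>corners S. catalan (card (block S c) - 2))"
proof -
  define g where "g c = {s \<in> X. x c < x s \<and> x s < x (nxt x (insert q (cut S)) c)}" for c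
  define D where "D c = {r \<in> insert p (cut S). x c \<le> x r \<and> x r < x (stop S c)}" for c
  note P = pathD[OF S]
  have cutX: "cut S \<subseteq> X - {p, q}" by (auto simp: cut_def)
  have K: "insert p (cut S) \<subseteq> X" "insert q (cut S) \<subseteq> X" using cutX pX qX by auto
  have finK: "finite (insert p (cut S))" "finite (insert q (cut S))"
    using K[THEN finite_subset, OF fin] .
  have injK: "inj_on x (insert p (cut S))" "inj_on x (insert q (cut S))"
    using K[THEN inj_on_subset[OF inj]] .
  have cless: "x c < x q" if "c \<in> insert p (cut S)" for c
    using that cutX inner_between pq by auto
  have nx: "nxt x (insert q (cut S)) c \<in> insert q (cut S)" "x c < x (nxt x (insert q (cut S)) c)"
    "\<And>s. s \<in> insert q (cut S) \<Longrightarrow> x c < x s \<Longrightarrow> x (nxt x (insert q (cut S)) c) \<le> x s"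
    if "c \<in> insert p (cut S)" for c
    using nxt_props[OF injK(2) finK(2) insertI1 cless[OF that]] by auto
  have sub: "corners S \<subseteq> insert p (cut S)" by (auto simp: corners_def)
  have finD: "finite (D c)" for c using finK(1) unfolding D_def by (rule finite_subset[rotated]) auto
  have finC: "finite (corners S)" using sub finK(1) by (rule finite_subset)
  have inner: "block S c - {c, stop S c} = (\<Union>r\<in>D c. g r)" if c: "c \<in> corners S" for c
  proof (intro equalityI subsetI)
    note st = stop_props[OF S c]
    fix s assume "s \<in> block S c - {c, stop S c}"
    then have s: "s \<in> X" "x c < x s" "x s < x (stop S c)" "s \<notin> cut S" by (auto simp: block_def)
    have cK: "c \<in> insert p (cut S)" using c sub by auto
    let ?r = "prv x (insert p (cut S)) s"
    note r = prv_props[OF injK(1) finK(1) cK s(2)]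
    have "x s < x (nxt x (insert q (cut S)) ?r)"
    proof (rule ccontr)
      assume neg: "\<not> x s < x (nxt x (insert q (cut S)) ?r)"
      let ?u = "nxt x (insert q (cut S)) ?r"
      have "x (stop S c) \<le> x q" using st(4) P(1) bounds by auto
      then have "?u \<noteq> q" using neg s(3) by auto
      then have "?u \<in> cut S" using nx(1)[OF r(1)] by auto
      moreover have "x ?u \<noteq> x s" using x_eq_iff[of ?u s] s(1,4) \<open>?u \<in> cut S\<close> cutX by auto
      ultimately have "x ?u \<le> x ?r" using r(3)[of ?u] neg by auto
      then show False using nx(2)[OF r(1)] by simp
    qed
    moreover have "?r \<in> D c" using r(1) r(3)[OF cK s(2)] r(2) s(3) by (auto simp: D_def)
    ultimately show "s \<in> (\<Union>r\<in>D c. g r)" using r(2) s(1) by (auto simp: g_def)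
  next
    note st = stop_props[OF S c]
    fix s assume "s \<in> (\<Union>r\<in>D c. g r)"
    then obtain r where r: "r \<in> insert p (cut S)" "x c \<le> x r" "x r < x (stop S c)"
      and s: "s \<in> X" "x r < x s" "x s < x (nxt x (insert q (cut S)) r)" by (auto simp: D_def g_def)
    have "s \<notin> cut S" using nx(3)[OF r(1), of s] s by auto
    moreover have "stop S c \<noteq> p" using st(2,5) P(1) bounds by force
    then have "stop S c \<in> insert q (cut S)" using st(1) by (auto simp: corners_def)
    then have "x s < x (stop S c)" using nx(3)[OF r(1)] r(3) s(3) by force
    ultimately show "s \<in> block S c - {c, stop S c}" using r s by (auto simp: block_def)
  qed
  have disj_g: "g r \<inter> g r' = {}" if "r \<in> insert p (cut S)" "r' \<in> insert p (cut S)" "x r < x r'" for r r'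
  proof -
    have "r' \<noteq> p" using that(1,3) bounds[of r] K(1) by auto
    then have "x (nxt x (insert q (cut S)) r) \<le> x r'" using nx(3)[OF that(1), of r'] that by auto
    then show ?thesis by (auto simp: g_def)
  qed
  have disj_g': "g r \<inter> g r' = {}" if "r \<in> insert p (cut S)" "r' \<in> insert p (cut S)" "r \<noteq> r'" for r r'
  proof -
    have "x r \<noteq> x r'" using that injK(1) by (auto simp: inj_on_def)
    then show ?thesis using disj_g[of r r'] disj_g[of r' r] that by (cases "x r < x r'") auto
  qed
  have card: "card (block S c) - 2 = (\<Sum>r\<in>D c. card (g r))" if c: "c \<in> corners S" for c
  proof -
    note st = stop_props[OF S c]
    have "finite (block S c)" "{c, stop S c} \<subseteq> block S c"
      using fin st(4,5) P(1) by (auto simp: block_def)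
    then have "card (block S c - {c, stop S c}) = card (block S c) - card {c, stop S c}"
      by (intro card_Diff_subset) auto
    moreover have "c \<noteq> stop S c" using st(2) by force
    then have "card {c, stop S c} = 2" by simp
    moreover have "card (\<Union>r\<in>D c. g r) = (\<Sum>r\<in>D c. card (g r))"
      by (rule card_UN_disjoint) (use finD disj_g' fin in \<open>auto simp: D_def g_def\<close>)
    ultimately show ?thesis using inner[OF c] by simp
  qed
  have un: "insert p (cut S) = (\<Union>c\<in>corners S. D c)"
  proof (intro equalityI subsetI)
    fix r assume r: "r \<in> insert p (cut S)"
    show "r \<in> (\<Union>c\<in>corners S. D c)"
    proof (cases "r \<in> corners S")
      case True
      then show ?thesis using stop_props(2)[OF S True] r by (auto simp: D_def)
    next
      case False
      then have "r \<noteq> p" by (auto simp: corners_def)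
      then have xr: "x p < x r" using r cutX inner_between by auto
      let ?c = "prv x (corners S) r"
      have "inj_on x (corners S)" using injK(1) sub by (rule inj_on_subset)
      moreover have pc: "p \<in> corners S" by (simp add: corners_def)
      ultimately have c: "?c \<in> corners S" "x ?c < x r" "\<And>s. s \<in> corners S \<Longrightarrow> x s < x r \<Longrightarrow> x s \<le> x ?c"
        using prv_props[OF _ finC pc xr] by auto
      note st = stop_props[OF S c(1)]
      have "x r < x (stop S ?c)"
      proof (rule ccontr)
        assume neg: "\<not> x r < x (stop S ?c)"
        then have "stop S ?c \<noteq> q" using cless[OF r] by auto
        then have sc: "stop S ?c \<in> corners S" using st(1) by auto
        then have "stop S ?c \<noteq> r" using False by auto
        moreover have "stop S ?c \<in> X" "r \<in> X" using subsetD[OF K(1)] sc sub r by blast+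
        ultimately have "x (stop S ?c) \<noteq> x r" using x_eq_iff by blast
        then have "x (stop S ?c) \<le> x ?c" using c(3)[OF sc] neg by simp
        then show False using st(2) by simp
      qed
      then have "r \<in> D ?c" using c(2) r by (simp add: D_def)
      then show ?thesis using c(1) by blast
    qed
  qed (auto simp: D_def)
  have disjD: "D c \<inter> D c' = {}" if "c \<in> corners S" "c' \<in> corners S" "c \<noteq> c'" for c c'
  proof -
    have "c \<in> X" "c' \<in> X" using that sub K(1) by blast+
    then have "x c \<noteq> x c'" using that(3) x_eq_iff by blast
    then have "x (stop S c) \<le> x c' \<or> x (stop S c') \<le> x c"
      using stop_props(3)[OF S that(1), of c'] stop_props(3)[OF S that(2), of c] that by (auto simp: neq_iff)
    then show ?thesis by (auto simp: D_def)
  qed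
  have "(\<Prod>r\<in>insert p (cut S). catalan (card (g r))) = (\<Prod>c\<in>corners S. \<Prod>r\<in>D c. catalan (card (g r)))"
    unfolding un by (rule prod.UNION_disjoint) (use finC finD disjD in auto)
  also have "\<dots> \<le> (\<Prod>c\<in>corners S. catalan (card (block S c) - 2))"
  proof (rule prod_mono)
    fix c assume "c \<in> corners S"
    then show "0 \<le> (\<Prod>r\<in>D c. catalan (card (g r))) \<and> (\<Prod>r\<in>D c. catalan (card (g r))) \<le> catalan (card (block S c) - 2)"
      using prod_catalan_le[OF finD, of "\<lambda>r. card (g r)" c] card by simp
  qed
  finally show ?thesis by (simp add: g_def)
qed

lemma catalan_le_sum_blocks:
  "catalan (card X - 1) \<le> (\<Sum>S\<in>paths. \<Prod>c\<in>corners S. catalan (card (block S c) - 2))"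
proof -
  have "catalan (card X - 1) = (\<Sum>B\<in>Pow (X - {p, q}). \<Prod>b\<in>insert p B. catalan (card {s \<in> X. x b < x s \<and> x s < x (nxt x (insert q B) b)}))"
    by (rule catalan_compositions[symmetric]) (use fin inj pX qX pq bounds in auto)
  also have "\<dots> = (\<Sum>S\<in>paths. \<Prod>b\<in>insert p (cut S). catalan (card {s \<in> X. x b < x s \<and> x s < x (nxt x (insert q (cut S)) b)}))"
    by (rule sum.reindex_bij_betw[OF bij_betw_cut, symmetric])
  also have "\<dots> \<le> (\<Sum>S\<in>paths. \<Prod>c\<in>corners S. catalan (card (block S c) - 2))"
    by (rule sum_mono) (rule block_product)
  finally show ?thesis .
qed

end

section \<open>Families of triangles\<close>

text \<open>Triangulations encoded by the vertex sets of their triangles. For affinely independent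
  triples, meeting face to face amounts to \<open>convex hull V \<inter> convex hull W = convex hull
  (V \<inter> W)\<close>; in general position all triples are independent.\<close>

definition trifams :: "point set \<Rightarrow> point set set set" where
  "trifams M = {\<V>. (\<forall>V\<in>\<V>. V \<subseteq> M \<and> card V = 3)
     \<and> (\<forall>V\<in>\<V>. \<forall>W\<in>\<V>. convex hull V \<inter> convex hull W = convex hull (V \<inter> W))
     \<and> (\<Union>V\<in>\<V>. convex hull V) = convex hull M}"

lemma trifamsD:
  assumes "\<V> \<in> trifams M"
  shows "\<And>V. V \<in> \<V> \<Longrightarrow> V \<subseteq> M" "\<And>V. V \<in> \<V> \<Longrightarrow> card V = 3"
    "\<And>V W. V \<in> \<V> \<Longrightarrow> W \<in> \<V> \<Longrightarrow> convex hull V \<inter> convex hull W = convex hull (V \<inter> W)"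
    "(\<Union>V\<in>\<V>. convex hull V) = convex hull M"
  using assms by (auto simp: trifams_def)

lemma finite_trifams: "finite M \<Longrightarrow> finite (trifams M)"
  by (rule finite_subset[of _ "Pow (Pow M)"]) (auto simp: trifams_def)

lemma general_position_subset: "general_position M \<Longrightarrow> N \<subseteq> M \<Longrightarrow> general_position N"
  unfolding general_position_def by blast

lemma triple_independent:
  assumes "general_position M" "V \<subseteq> M" "card V = 3"
  shows "\<not> affine_dependent V"
proof -
  obtain a b c where V: "V = {a, b, c}" "a \<noteq> b" "b \<noteq> c" "a \<noteq> c"
    using assms(3) by (auto simp: card_3_iff)
  then have "\<not> collinear {a, b, c}" using assms(1,2) by (simp add: general_position_def)
  then show ?thesis using V by (simp add: collinear_3_eq_affine_dependent)
qed

lemma convex_hull_Int_faces: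
  fixes V :: "point set"
  assumes "\<not> affine_dependent V" "A \<subseteq> V" "B \<subseteq> V"
  shows "convex hull A \<inter> convex hull B = convex hull (A \<inter> B)"
proof -
  have "\<not> affine_dependent (A \<union> B)" using assms affine_dependent_subset by blast
  then show ?thesis by (simp add: convex_hull_Int)
qed

lemma simplex_vertices_unique:
  fixes V W :: "point set"
  assumes "\<not> affine_dependent V" "\<not> affine_dependent W" "convex hull V = convex hull W"
  shows "V = W"
  using extreme_point_of_convex_hull_affine_independent[OF assms(1)]
    extreme_point_of_convex_hull_affine_independent[OF assms(2)] assms(3) by auto

text \<open>The vertex set of a triangle is recovered as its set of extreme points. A hull vertex of
  \<open>M\<close> lies in some triangle and is extreme there as well, hence one of its vertices.
  Conversely, a common face of two triangles is spanned by vertices of either one, and these are the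
  same points.\<close>

lemma bij_betw_trifams:
  assumes gp: "general_position M" and fin: "finite M"
  shows "bij_betw (image (\<lambda>V. convex hull V)) (trifams M) (partial_triangulations M)"
  unfolding bij_betw_def
proof
  have ind: "\<not> affine_dependent V" if "\<V> \<in> trifams M" "V \<in> \<V>" for V \<V>
    using triple_independent[OF gp] trifamsD(1,2)[OF that(1)] that(2) by blast
  show "inj_on (image (\<lambda>V. convex hull V)) (trifams M)"
  proof (rule inj_onI)
    fix \<V> \<W> assume VW: "\<V> \<in> trifams M" "\<W> \<in> trifams M" "(\<lambda>V. convex hull V) ` \<V> = (\<lambda>V. convex hull V) ` \<W>"
    have "\<A> \<subseteq> \<B>" if AB: "\<A> \<in> trifams M" "\<B> \<in> trifams M" "(\<lambda>V. convex hull V) ` \<A> = (\<lambda>V. convex hull V) ` \<B>" for \<A> \<B>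
    proof
      fix V assume V: "V \<in> \<A>"
      then have "convex hull V \<in> (\<lambda>V. convex hull V) ` \<B>" unfolding AB(3)[symmetric] by (rule imageI)
      then obtain W where W: "W \<in> \<B>" "convex hull V = convex hull W" by auto
      then have "V = W" using simplex_vertices_unique[OF ind[OF AB(1) V] ind[OF AB(2)]] by blast
      then show "V \<in> \<B>" using W by simp
    qed
    from this[OF VW] this[OF VW(2,1) VW(3)[symmetric]] show "\<V> = \<W>" by (rule equalityI)
  qed
  show "image (\<lambda>V. convex hull V) ` trifams M = partial_triangulations M"
  proof (intro equalityI subsetI)
    fix \<T> assume "\<T> \<in> image (\<lambda>V. convex hull V) ` trifams M"
    then obtain \<V> where V: "\<V> \<in> trifams M" "\<T> = (\<lambda>V. convex hull V) ` \<V>" by auto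
    note D = trifamsD[OF V(1)]
    have "finite \<V>" using D(1) fin by (intro finite_subset[of \<V> "Pow M"]) auto
    moreover have s: "2 simplex convex hull V" if "V \<in> \<V>" for V
      unfolding simplex_def using ind[OF V(1) that] D(2)[OF that] by (intro exI[of _ V]) simp
    moreover have "convex hull A \<inter> convex hull B face_of convex hull A" if "A \<in> \<V>" "B \<in> \<V>" for A B
      using D(3)[OF that] face_of_convex_hull_affine_independent[OF ind[OF V(1) that(1)]] by blast
    ultimately have "triangulation_of \<T> (convex hull M)"
      using D(4) unfolding triangulation_of_def triangulation_def V(2) by auto
    moreover have "hull_vertices M \<subseteq> vertex_set \<T>"
    proof
      fix v assume "v \<in> hull_vertices M"
      then have v: "v extreme_point_of convex hull M" by (simp add: hull_vertices_def)
      then have "v \<in> convex hull M" by (simp add: extreme_point_of_def)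
      then obtain W where W: "W \<in> \<V>" "v \<in> convex hull W" using D(4) by blast
      then have "convex hull W \<subseteq> convex hull M" using D(1) by (simp add: hull_mono)
      then have "v extreme_point_of convex hull W" using v W(2) by (auto simp: extreme_point_of_def)
      then show "v \<in> vertex_set \<T>" using W(1) V(2) by (auto simp: vertex_set_def)
    qed
    moreover have "vertex_set \<T> \<subseteq> M"
      using D(1) V(2) by (auto simp: vertex_set_def dest!: extreme_point_of_convex_hull)
    ultimately show "\<T> \<in> partial_triangulations M" by (simp add: partial_triangulations_def)
  next
    fix \<T> assume "\<T> \<in> partial_triangulations M"
    then have T: "triangulation \<T>" "\<And>T. T \<in> \<T> \<Longrightarrow> 2 simplex T" "\<Union>\<T> = convex hull M" "vertex_set \<T> \<subseteq> M"
      by (auto simp: partial_triangulations_def triangulation_of_def)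
    define \<V> where "\<V> = {V. \<not> affine_dependent V \<and> card V = 3 \<and> convex hull V \<in> \<T>}"
    have VM: "V \<subseteq> M" if "V \<in> \<V>" for V
    proof
      fix v assume "v \<in> V"
      then have "v extreme_point_of convex hull V" "convex hull V \<in> \<T>"
        using that extreme_point_of_convex_hull_affine_independent by (auto simp: \<V>_def)
      then show "v \<in> M" using T(4) by (auto simp: vertex_set_def)
    qed
    have img: "(\<lambda>V. convex hull V) ` \<V> = \<T>"
    proof (intro equalityI subsetI)
      fix S assume "S \<in> \<T>"
      then obtain C where "\<not> affine_dependent C" "int (card C) = 2 + 1" "S = convex hull C"
        using T(2)[of S] by (auto simp: simplex_def)
      then show "S \<in> (\<lambda>V. convex hull V) ` \<V>" using \<open>S \<in> \<T>\<close> by (auto simp: \<V>_def)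
    qed (auto simp: \<V>_def)
    have compat: "convex hull A \<inter> convex hull B = convex hull (A \<inter> B)" if AB: "A \<in> \<V>" "B \<in> \<V>" for A B
    proof -
      have i: "\<not> affine_dependent A" "\<not> affine_dependent B" using AB by (auto simp: \<V>_def)
      have "convex hull A \<inter> convex hull B face_of convex hull A" "convex hull B \<inter> convex hull A face_of convex hull B"
        using T(1) AB by (auto simp: triangulation_def \<V>_def)
      then obtain c c' where c: "c \<subseteq> A" "convex hull A \<inter> convex hull B = convex hull c"
        "c' \<subseteq> B" "convex hull B \<inter> convex hull A = convex hull c'"
        using i by (auto simp: face_of_convex_hull_affine_independent)
      have "c = c'"
        by (rule simplex_vertices_unique) (use c i affine_dependent_subset in blast)+
      then have "c \<subseteq> A \<inter> B" using c by auto
      then have "convex hull c \<subseteq> convex hull (A \<inter> B)" by (rule hull_mono)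
      moreover have "convex hull (A \<inter> B) \<subseteq> convex hull A \<inter> convex hull B" by (simp add: hull_mono)
      ultimately show ?thesis using c(2) by auto
    qed
    have "(\<Union>V\<in>\<V>. convex hull V) = convex hull M" using img T(3) by simp
    then have "\<V> \<in> trifams M" using VM compat by (auto simp: trifams_def \<V>_def)
    then show "\<T> \<in> image (\<lambda>V. convex hull V) ` trifams M" using img by blast
  qed
qed

section \<open>Sides of the hull, unions of compatible families, and triangles recognised by an
  inner point\<close>

lemma convex_hull_supporting:
  fixes V :: "point set"
  assumes "finite V" "\<And>v. v \<in> V \<Longrightarrow> c \<le> w \<bullet> v" "q \<in> convex hull V" "w \<bullet> q = c"
  shows "q \<in> convex hull {v \<in> V. w \<bullet> v = c}"
proof -
  obtain u where u: "\<And>v. v \<in> V \<Longrightarrow> 0 \<le> u v" "sum u V = 1" "(\<Sum>v\<in>V. u v *\<^sub>R v) = q"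
    using assms(3) unfolding convex_hull_finite[OF assms(1)] by auto
  have "(\<Sum>v\<in>V. u v * (w \<bullet> v - c)) = w \<bullet> q - c"
    unfolding u(3)[symmetric] by (simp add: inner_sum_right right_diff_distrib sum_subtractf u(2) flip: sum_distrib_right)
  then have "(\<Sum>v\<in>V. u v * (w \<bullet> v - c)) = 0" using assms(4) by simp
  then have "\<forall>v\<in>V. u v * (w \<bullet> v - c) = 0"
    using assms(1,2) u(1) by (subst (asm) sum_nonneg_eq_0_iff) auto
  then have z: "u v = 0" if "v \<in> V - {v \<in> V. w \<bullet> v = c}" for v using that by auto
  let ?V = "{v \<in> V. w \<bullet> v = c}"
  have "sum u ?V = 1" using u(2) z sum.mono_neutral_left[OF assms(1), of ?V u] by auto
  moreover have "(\<Sum>v\<in>?V. u v *\<^sub>R v) = q"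
    using u(3) z sum.mono_neutral_left[OF assms(1), of ?V "\<lambda>v. u v *\<^sub>R v"] by auto
  moreover have "finite ?V" using assms(1) by simp
  ultimately show ?thesis unfolding convex_hull_finite[OF \<open>finite ?V\<close>] using u(1) by auto
qed

text \<open>Some triangle contains the midpoint of \<open>a\<close> and \<open>b\<close>. The line
  through \<open>a\<close> and \<open>b\<close> supports the hull and meets \<open>B\<close> only in
  these two points, so the triangle must have both as vertices.\<close>

lemma side_in_triangle:
  assumes T: "\<T> \<in> trifams B" and ab: "a \<in> B" "b \<in> B" "a \<noteq> b"
    and w: "w \<bullet> a = c" "w \<bullet> b = c" "\<And>s. s \<in> B - {a, b} \<Longrightarrow> c < w \<bullet> s"
  shows "\<exists>V\<in>\<T>. {a, b} \<subseteq> V"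
proof -
  note D = trifamsD[OF T]
  let ?m = "midpoint a b"
  have "?m \<in> convex hull {a, b}"
    by (simp add: midpoints_in_convex_hull hull_inc)
  then have "?m \<in> convex hull B" using hull_mono[of "{a, b}" B convex] ab by auto
  then obtain V where V: "V \<in> \<T>" "?m \<in> convex hull V" using D(4) by blast
  have VB: "V \<subseteq> B" "finite V" using D(1)[OF V(1)] D(2)[OF V(1)] card.infinite by fastforce+
  have ge: "c \<le> w \<bullet> v" if "v \<in> V" for v using w VB that by (cases "v = a"; cases "v = b") force+
  have "w \<bullet> ?m = c" using w by (simp add: midpoint_def inner_add_right)
  from convex_hull_supporting[OF VB(2) ge V(2) this]
  have m: "?m \<in> convex hull {v \<in> V. w \<bullet> v = c}" .
  have sub: "{v \<in> V. w \<bullet> v = c} \<subseteq> {a, b}" using w(3) VB(1) by force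
  have "a \<in> V"
  proof (rule ccontr)
    assume "a \<notin> V"
    then have "{v \<in> V. w \<bullet> v = c} \<subseteq> {b}" using sub by auto
    then have "?m \<in> convex hull {b}" using m hull_mono by blast
    then show False using ab(3) by (simp add: midpoint_eq_endpoint)
  qed
  moreover have "b \<in> V"
  proof (rule ccontr)
    assume "b \<notin> V"
    then have "{v \<in> V. w \<bullet> v = c} \<subseteq> {a}" using sub by auto
    then have "?m \<in> convex hull {a}" using m hull_mono by blast
    then show False using ab(3) by (simp add: midpoint_eq_endpoint)
  qed
  ultimately show ?thesis using V(1) by blast
qed

definition compat :: "point set set \<Rightarrow> bool" where
  "compat \<V> \<longleftrightarrow> (\<forall>V\<in>\<V>. \<forall>W\<in>\<V>. convex hull V \<inter> convex hull W = convex hull (V \<inter> W))"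

text \<open>\<open>E\<close> is the set of common edges. A point of both regions lies on some edge
  \<open>e\<close>, which is a face of a triangle in either family. Compatibility within each family
  puts it into the hull of \<open>e \<inter> V\<close> and into that of \<open>e \<inter> W\<close>,
  and faces of one simplex meet in the face spanned by their common vertices.\<close>

lemma compat_Un:
  assumes V: "compat \<V>" "\<And>V. V \<in> \<V> \<Longrightarrow> \<not> affine_dependent V"
    and W: "compat \<W>" "\<And>W. W \<in> \<W> \<Longrightarrow> \<not> affine_dependent W"
    and int: "(\<Union>V\<in>\<V>. convex hull V) \<inter> (\<Union>W\<in>\<W>. convex hull W) \<subseteq> (\<Union>e\<in>E. convex hull e)"
    and E: "\<And>e. e \<in> E \<Longrightarrow> \<exists>V\<in>\<V>. e \<subseteq> V" "\<And>e. e \<in> E \<Longrightarrow> \<exists>W\<in>\<W>. e \<subseteq> W"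
  shows "compat (\<V> \<union> \<W>)"
proof -
  have *: "convex hull V \<inter> convex hull W = convex hull (V \<inter> W)" if "V \<in> \<V>" "W \<in> \<W>" for V W
  proof (intro equalityI subsetI)
    fix q assume q: "q \<in> convex hull V \<inter> convex hull W"
    then obtain e where e: "e \<in> E" "q \<in> convex hull e" using int \<open>V \<in> \<V>\<close> \<open>W \<in> \<W>\<close> by blast
    have in_face: "q \<in> convex hull (e \<inter> A)"
      if A: "compat \<A>" "\<And>A. A \<in> \<A> \<Longrightarrow> \<not> affine_dependent A" "\<exists>A\<in>\<A>. e \<subseteq> A" "A \<in> \<A>" "q \<in> convex hull A" for \<A> A
    proof -
      obtain A' where A': "A' \<in> \<A>" "e \<subseteq> A'" using A(3) by blast
      then have "q \<in> convex hull A'" using e(2) hull_mono by blast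
      then have "q \<in> convex hull (A' \<inter> A)"
        using A(1,4,5) A'(1) unfolding compat_def by blast
      then have "q \<in> convex hull (e \<inter> (A' \<inter> A))"
        using convex_hull_Int_faces[OF A(2)[OF A'(1)] A'(2), of "A' \<inter> A"] e(2) by blast
      then show ?thesis using hull_mono[of "e \<inter> (A' \<inter> A)" "e \<inter> A"] by blast
    qed
    have "q \<in> convex hull (e \<inter> V)" "q \<in> convex hull (e \<inter> W)"
      using in_face[OF V E(1)[OF e(1)] \<open>V \<in> \<V>\<close>] in_face[OF W E(2)[OF e(1)] \<open>W \<in> \<W>\<close>] q by auto
    then have "q \<in> convex hull ((e \<inter> V) \<inter> (e \<inter> W))"
      using convex_hull_Int_faces[OF V(2)[OF \<open>V \<in> \<V>\<close>], of "e \<inter> V" "V"]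
        E(1)[OF e(1)] V(2) convex_hull_Int_faces[of _ "e \<inter> V" "e \<inter> W"] by blast
    then show "q \<in> convex hull (V \<inter> W)" using hull_mono[of "(e \<inter> V) \<inter> (e \<inter> W)" "V \<inter> W"] by blast
  next
    fix q assume "q \<in> convex hull (V \<inter> W)"
    then show "q \<in> convex hull V \<inter> convex hull W"
      using hull_mono[of "V \<inter> W" V convex] hull_mono[of "V \<inter> W" W convex] by blast
  qed
  moreover have "convex hull W \<inter> convex hull V = convex hull (W \<inter> V)" if "V \<in> \<V>" "W \<in> \<W>" for V W
    using *[OF that] by (simp only: Int_commute)
  ultimately show ?thesis using V(1) W(1) unfolding compat_def ball_Un by blast
qed

definition centroid :: "point set \<Rightarrow> point" where "centroid V = (\<Sum>v\<in>V. (1 / real (card V)) *\<^sub>R v)"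

lemma centroid_in_hull:
  assumes "finite V" "V \<noteq> {}"
  shows "centroid V \<in> convex hull V"
  unfolding centroid_def convex_hull_finite[OF assms(1)] using assms
  by (auto intro!: exI[of _ "\<lambda>_. 1 / real (card V)"])

text \<open>Barycentric coordinates are unique, so a point with all coordinates positive lies in no
  proper face.\<close>

lemma in_hull_subset_pos:
  fixes V :: "point set"
  assumes V: "\<not> affine_dependent V" "A \<subseteq> V" "q \<in> convex hull A"
    and u: "\<And>v. v \<in> V \<Longrightarrow> 0 < u v" "sum u V = 1" "q = (\<Sum>v\<in>V. u v *\<^sub>R v)"
  shows "A = V"
proof (rule ccontr)
  assume "A \<noteq> V"
  then obtain v where v: "v \<in> V" "v \<notin> A" using V(2) by blast
  have fin: "finite V" "finite A" using aff_independent_finite[OF V(1)] V(2) finite_subset by auto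
  obtain t where t: "\<And>v. v \<in> A \<Longrightarrow> 0 \<le> t v" "sum t A = 1" "(\<Sum>v\<in>A. t v *\<^sub>R v) = q"
    using V(3) unfolding convex_hull_finite[OF fin(2)] by auto
  define t' where "t' v = (if v \<in> A then t v else 0)" for v
  have t': "sum t' V = 1" "(\<Sum>v\<in>V. t' v *\<^sub>R v) = q"
  proof -
    have "sum t' V = sum t' A" by (rule sum.mono_neutral_right[OF fin(1) V(2)]) (auto simp: t'_def)
    then show "sum t' V = 1" using t(2) by (simp add: t'_def)
    have "(\<Sum>v\<in>V. t' v *\<^sub>R v) = (\<Sum>v\<in>A. t' v *\<^sub>R v)"
      by (rule sum.mono_neutral_right[OF fin(1) V(2)]) (auto simp: t'_def)
    then show "(\<Sum>v\<in>V. t' v *\<^sub>R v) = q" using t(3) by (simp add: t'_def)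
  qed
  have "sum (\<lambda>v. u v - t' v) V = 0" "(\<Sum>v\<in>V. (u v - t' v) *\<^sub>R v) = 0"
    using t' u(2,3) by (simp_all add: sum_subtractf scaleR_diff_left)
  moreover have "u v - t' v \<noteq> 0" using u(1)[OF v(1)] v(2) by (simp add: t'_def)
  ultimately have "affine_dependent V"
    unfolding affine_dependent_explicit_finite[OF fin(1)] using v(1) by (intro exI[of _ "\<lambda>v. u v - t' v"]) blast
  then show False using V(1) by contradiction
qed

lemma compat_eqI:
  fixes V W :: "point set"
  assumes c: "compat \<V>" "V \<in> \<V>" "W \<in> \<V>" "\<not> affine_dependent V" "card V = card W" "finite W"
    and q: "q \<in> convex hull W" and u: "\<And>v. v \<in> V \<Longrightarrow> 0 < u v" "sum u V = 1" "q = (\<Sum>v\<in>V. u v *\<^sub>R v)"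
  shows "V = W"
proof -
  have fin: "finite V" using c(4) aff_independent_finite by blast
  have "q \<in> convex hull V"
    unfolding convex_hull_finite[OF fin] using u by (auto intro!: exI[of _ u] less_imp_le)
  then have "q \<in> convex hull (V \<inter> W)" using c(1-3) q unfolding compat_def by blast
  then have "V \<inter> W = V" using in_hull_subset_pos[OF c(4) _ _ u] by blast
  then show ?thesis using c(5,6) card_subset_eq by blast
qed

text \<open>The centroid of \<open>V\<close> lies in no proper face of \<open>V\<close>, so a
  compatible triangle that contains it equals \<open>V\<close>. This identifies the triangles inside
  a region that is already triangulated.\<close>

lemma covered_triangle_mem:
  assumes c: "compat \<V>" "V \<in> \<V>" "\<W> \<subseteq> \<V>" "\<And>V. V \<in> \<V> \<Longrightarrow> card V = 3" "\<not> affine_dependent V"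
    and sub: "convex hull V \<subseteq> (\<Union>W\<in>\<W>. convex hull W)"
  shows "V \<in> \<W>"
proof -
  have card: "card V = 3" using c by blast
  then have fin: "finite V" "V \<noteq> {}" using card.infinite by fastforce+
  obtain W where W: "W \<in> \<W>" "centroid V \<in> convex hull W" using centroid_in_hull[OF fin] sub by blast
  have "card W = 3" using W c by blast
  moreover then have "finite W" using card.infinite by fastforce
  moreover have "sum (\<lambda>v. 1 / real (card V)) V = 1" using card by simp
  ultimately have "V = W"
    using c W card by (intro compat_eqI[OF c(1,2) _ c(5) _ _ W(2), of "\<lambda>_. 1 / real (card V)"]) (auto simp: centroid_def)
  then show ?thesis using W by simp
qed

section \<open>Triangulations seen from a hull vertex\<close>

lemma hull_ge:
  fixes w :: "'a::euclidean_space"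
  assumes "q \<in> convex hull A" "\<And>s. s \<in> A \<Longrightarrow> c \<le> w \<bullet> s"
  shows "c \<le> w \<bullet> q"
  using hull_minimal[of A "{q. c \<le> w \<bullet> q}" convex] assms convex_halfspace_ge[of c w] by blast

lemma hull_gt:
  fixes w :: "'a::euclidean_space"
  assumes "q \<in> convex hull A" "\<And>s. s \<in> A \<Longrightarrow> c < w \<bullet> s"
  shows "c < w \<bullet> q"
  using hull_minimal[of A "{q. c < w \<bullet> q}" convex] assms convex_halfspace_gt[of c w] by blast

text \<open>The coordinates \<open>hx\<close> and \<open>hy\<close> are those of a projective transformation that moves the hull vertex \<open>R\<close> to the
  point at infinity of the negative vertical direction: a triangle with vertices \<open>R\<close>, \<open>a\<close>, \<open>b\<close>
  becomes the half-strip below the segment \<open>ab\<close>.\<close>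

locale star =
  fixes R u v :: point and M :: "point set" and p1 p2 :: point
  assumes finM: "finite M" and gpM: "general_position M" and RM: "R \<in> M"
    and det: "u $ 1 * v $ 2 - u $ 2 * v $ 1 \<noteq> 0"
    and pos: "\<And>s. s \<in> M - {R} \<Longrightarrow> 0 < u \<bullet> (s - R)"
    and p1: "p1 \<in> M - {R}" and p2: "p2 \<in> M - {R}" and card3: "3 \<le> card M"
    and ends: "\<And>s. s \<in> M - {R} \<Longrightarrow> (v \<bullet> (p1 - R)) / (u \<bullet> (p1 - R)) \<le> (v \<bullet> (s - R)) / (u \<bullet> (s - R))"
       "\<And>s. s \<in> M - {R} \<Longrightarrow> (v \<bullet> (s - R)) / (u \<bullet> (s - R)) \<le> (v \<bullet> (p2 - R)) / (u \<bullet> (p2 - R))"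
begin

definition ff :: "point \<Rightarrow> real" where "ff q = u \<bullet> (q - R)"
definition gg :: "point \<Rightarrow> real" where "gg q = v \<bullet> (q - R)"
definition hx :: "point \<Rightarrow> real" where "hx q = gg q / ff q"
definition hy :: "point \<Rightarrow> real" where "hy q = - 1 / ff q"
definition X :: "point set" where "X = M - {R}"

abbreviation "hlin \<equiv> lin hx hy"

lemma ff_pos: "s \<in> X \<Longrightarrow> 0 < ff s"
  using pos by (simp add: ff_def X_def)

lemma ff_R [simp]: "ff R = 0" and gg_R [simp]: "gg R = 0"
  by (simp_all add: ff_def gg_def)

lemma coords_ext:
  assumes "ff q = ff r" "gg q = gg r"
  shows "q = r"
proof -
  define d1 d2 where d: "d1 = q $ 1 - r $ 1" "d2 = q $ 2 - r $ 2"
  have e: "u $ 1 * d1 + u $ 2 * d2 = 0" "v $ 1 * d1 + v $ 2 * d2 = 0"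
    using assms by (simp_all add: ff_def gg_def inner_vec_def sum_2 d algebra_simps)
  have *: "(u $ 1 * v $ 2 - u $ 2 * v $ 1) * d1 = v $ 2 * (u $ 1 * d1 + u $ 2 * d2) - u $ 2 * (v $ 1 * d1 + v $ 2 * d2)"
    "(u $ 1 * v $ 2 - u $ 2 * v $ 1) * d2 = u $ 1 * (v $ 1 * d1 + v $ 2 * d2) - v $ 1 * (u $ 1 * d1 + u $ 2 * d2)"
    by (simp_all add: algebra_simps)
  have "d1 = 0" "d2 = 0" using *[unfolded e] det by simp_all
  then show ?thesis by (simp add: vec_eq_iff forall_2 d)
qed

lemma coords_surj: "\<exists>q. ff q = \<alpha> \<and> gg q = \<beta>"
proof -
  define D where "D = u $ 1 * v $ 2 - u $ 2 * v $ 1"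
  define d where "d = (vector [(\<alpha> * v $ 2 - \<beta> * u $ 2) / D, (\<beta> * u $ 1 - \<alpha> * v $ 1) / D] :: point)"
  have d12: "d $ 1 = (\<alpha> * v $ 2 - \<beta> * u $ 2) / D" "d $ 2 = (\<beta> * u $ 1 - \<alpha> * v $ 1) / D"
    by (simp_all add: d_def)
  have "D \<noteq> 0" using det by (simp add: D_def)
  have "u \<bullet> d = (u $ 1 * (\<alpha> * v $ 2 - \<beta> * u $ 2) + u $ 2 * (\<beta> * u $ 1 - \<alpha> * v $ 1)) / D"
    by (simp add: inner_vec_def sum_2 d12 add_divide_distrib)
  also have "u $ 1 * (\<alpha> * v $ 2 - \<beta> * u $ 2) + u $ 2 * (\<beta> * u $ 1 - \<alpha> * v $ 1) = \<alpha> * D"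
    by (simp add: D_def algebra_simps)
  finally have 1: "u \<bullet> d = \<alpha>" using \<open>D \<noteq> 0\<close> by simp
  have "v \<bullet> d = (v $ 1 * (\<alpha> * v $ 2 - \<beta> * u $ 2) + v $ 2 * (\<beta> * u $ 1 - \<alpha> * v $ 1)) / D"
    by (simp add: inner_vec_def sum_2 d12 add_divide_distrib)
  also have "v $ 1 * (\<alpha> * v $ 2 - \<beta> * u $ 2) + v $ 2 * (\<beta> * u $ 1 - \<alpha> * v $ 1) = \<beta> * D"
    by (simp add: D_def algebra_simps)
  finally have "v \<bullet> d = \<beta>" using \<open>D \<noteq> 0\<close> by simp
  then show ?thesis using 1 by (intro exI[of _ "R + d"]) (simp add: ff_def gg_def)
qed

lemma ff_comb: "s + t = 1 \<Longrightarrow> ff (s *\<^sub>R a + t *\<^sub>R b) = s * ff a + t * ff b"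
  and gg_comb: "s + t = 1 \<Longrightarrow> gg (s *\<^sub>R a + t *\<^sub>R b) = s * gg a + t * gg b"
proof -
  assume "s + t = 1"
  then have "s *\<^sub>R a + t *\<^sub>R b - R = s *\<^sub>R (a - R) + t *\<^sub>R (b - R)"
    by (simp add: algebra_simps flip: scaleR_add_left)
  then show "ff (s *\<^sub>R a + t *\<^sub>R b) = s * ff a + t * ff b" "gg (s *\<^sub>R a + t *\<^sub>R b) = s * gg a + t * gg b"
    by (simp_all add: ff_def gg_def inner_add_right)
qed

lemma ff_comb3: "r + s + t = 1 \<Longrightarrow> ff (r *\<^sub>R c + s *\<^sub>R a + t *\<^sub>R b) = r * ff c + s * ff a + t * ff b"
  and gg_comb3: "r + s + t = 1 \<Longrightarrow> gg (r *\<^sub>R c + s *\<^sub>R a + t *\<^sub>R b) = r * gg c + s * gg a + t * gg b"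
proof -
  assume "r + s + t = 1"
  then have "R = (r + s + t) *\<^sub>R R" by simp
  then have "r *\<^sub>R c + s *\<^sub>R a + t *\<^sub>R b - R = r *\<^sub>R (c - R) + s *\<^sub>R (a - R) + t *\<^sub>R (b - R)"
    by (simp add: algebra_simps)
  then show "ff (r *\<^sub>R c + s *\<^sub>R a + t *\<^sub>R b) = r * ff c + s * ff a + t * ff b"
    "gg (r *\<^sub>R c + s *\<^sub>R a + t *\<^sub>R b) = r * gg c + s * gg a + t * gg b"
    by (simp_all add: ff_def gg_def inner_add_right)
qed

lemma gg_eq: "0 < ff q \<Longrightarrow> gg q = hx q * ff q"
  by (simp add: hx_def)

lemma hxy_ext:
  assumes "0 < ff q" "0 < ff r" "hx q = hx r" "hy q = hy r"
  shows "q = r"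
proof (rule coords_ext)
  show "ff q = ff r" using assms by (simp add: hy_def)
  then show "gg q = gg r" using assms by (simp add: gg_eq)
qed

text \<open>The affine coordinates of \<open>q\<close> with respect to \<open>R\<close>,
  \<open>a\<close>, \<open>b\<close>. The weight \<open>1 - s - t\<close> of \<open>R\<close>
  vanishes exactly if \<open>q\<close> lies on the transformed line \<open>a b\<close>, and it is
  nonnegative exactly if \<open>q\<close> lies on or below that line.\<close>

lemma star_comb:
  assumes "0 < ff a" "0 < ff b" "hx a \<noteq> hx b" "0 < ff q"
  obtains s t where "s = (hx b - hx q) / (hx b - hx a) * (ff q / ff a)" "t = (hx q - hx a) / (hx b - hx a) * (ff q / ff b)"
    "s + t = ff q * - hlin a b (hx q)" "q = (1 - s - t) *\<^sub>R R + s *\<^sub>R a + t *\<^sub>R b"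
proof -
  define \<beta> where "\<beta> = (hx q - hx a) / (hx b - hx a)"
  have \<beta>': "(hx b - hx q) / (hx b - hx a) = 1 - \<beta>" using assms(3) by (simp add: \<beta>_def field_simps)
  have hq: "hx q = hx a + \<beta> * (hx b - hx a)" using assms(3) by (simp add: \<beta>_def)
  define s t where "s = (1 - \<beta>) * (ff q / ff a)" and "t = \<beta> * (ff q / ff b)"
  have "hlin a b (hx q) = hy a + \<beta> * (hy b - hy a)" by (simp add: lin_def \<beta>_def)
  then have "- hlin a b (hx q) = (1 - \<beta>) / ff a + \<beta> / ff b"
    by (simp add: hy_def algebra_simps diff_divide_distrib)
  then have sum: "s + t = ff q * - hlin a b (hx q)"
    by (simp add: s_def t_def distrib_left mult.commute)
  let ?q = "(1 - s - t) *\<^sub>R R + s *\<^sub>R a + t *\<^sub>R b"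
  have sf: "s * ff a = (1 - \<beta>) * ff q" "t * ff b = \<beta> * ff q" using assms by (simp_all add: s_def t_def)
  have sg: "s * gg a = hx a * ((1 - \<beta>) * ff q)" "t * gg b = hx b * (\<beta> * ff q)"
    unfolding gg_eq[OF assms(1)] gg_eq[OF assms(2)] sf[symmetric] by simp_all
  have "ff ?q = s * ff a + t * ff b" "gg ?q = s * gg a + t * gg b"
    using ff_comb3[of "1 - s - t" s t R a b] gg_comb3[of "1 - s - t" s t R a b] by simp_all
  then have "ff ?q = ff q" "gg ?q = gg q"
    unfolding sf sg gg_eq[OF assms(4)] hq by (simp_all add: algebra_simps)
  then have "q = ?q" by (intro coords_ext) simp_all
  moreover have "s = (hx b - hx q) / (hx b - hx a) * (ff q / ff a)" "t = (hx q - hx a) / (hx b - hx a) * (ff q / ff b)"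
    unfolding \<beta>' s_def t_def by (simp_all only: \<beta>_def)
  ultimately show ?thesis using that sum by blast
qed

text \<open>Projective transformations map lines to lines: multiplying by \<open>ff q > 0\<close>
  clears the denominators and turns the vertical distance to the line \<open>a b\<close> into an
  affine function of \<open>q\<close>. Its value \<open>- 1\<close> at \<open>R\<close> says that
  \<open>R\<close> lies below every such line.\<close>

lemma above_affine:
  assumes "hx a \<noteq> hx b"
  obtains w c where "\<And>q. 0 < ff q \<Longrightarrow> ff q * (hy q - hlin a b (hx q)) = w \<bullet> q - c" "w \<bullet> R - c = - 1"
proof -
  define m k where "m = (hy b - hy a) / (hx b - hx a)" and "k = hy a - m * hx a"
  have *: "hlin a b t = m * t + k" for t
    by (simp add: lin_def m_def k_def algebra_simps add_divide_distrib diff_divide_distrib)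
  define w where "w = - (m *\<^sub>R v + k *\<^sub>R u)"
  have "ff q * (hy q - hlin a b (hx q)) = w \<bullet> q - (1 + w \<bullet> R)" if "0 < ff q" for q
  proof -
    have "ff q * (hy q - hlin a b (hx q)) = - 1 - m * gg q - k * ff q"
      using that by (simp add: * hy_def hx_def algebra_simps)
    moreover have "- m * gg q - k * ff q = w \<bullet> (q - R)"
      by (simp add: w_def gg_def ff_def inner_add_left inner_diff_right algebra_simps)
    ultimately show ?thesis by (simp add: inner_diff_right)
  qed
  then show ?thesis using that[of w "1 + w \<bullet> R"] by simp
qed

lemma hull_ff_pos: "q \<in> convex hull A \<Longrightarrow> (\<And>s. s \<in> A \<Longrightarrow> 0 < ff s) \<Longrightarrow> 0 < ff q"
  using hull_gt[of q A "u \<bullet> R" u] by (simp add: ff_def inner_diff_right)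

lemma hull_above:
  assumes "q \<in> convex hull A" "\<And>s. s \<in> A \<Longrightarrow> 0 < ff s" "hx a \<noteq> hx b" "\<And>s. s \<in> A \<Longrightarrow> hlin a b (hx s) \<le> hy s"
  shows "hlin a b (hx q) \<le> hy q"
proof -
  obtain w c where w: "\<And>q. 0 < ff q \<Longrightarrow> ff q * (hy q - hlin a b (hx q)) = w \<bullet> q - c" using above_affine[OF assms(3)] by blast
  have "c \<le> w \<bullet> s" if "s \<in> A" for s
    using w[OF assms(2)[OF that]] assms(4)[OF that] mult_nonneg_nonneg[of "ff s" "hy s - hlin a b (hx s)"] assms(2)[OF that] by simp
  then have "c \<le> w \<bullet> q" using hull_ge[OF assms(1)] by blast
  then have "0 \<le> ff q * (hy q - hlin a b (hx q))" using w[OF hull_ff_pos[OF assms(1,2)]] by simp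
  then show ?thesis using hull_ff_pos[OF assms(1,2)] by (simp add: zero_le_mult_iff)
qed

lemma hull_below:
  assumes "q \<in> convex hull A" "\<And>s. s \<in> A \<Longrightarrow> s = R \<or> 0 < ff s \<and> hy s \<le> hlin a b (hx s)" "hx a \<noteq> hx b" "0 < ff q"
  shows "hy q \<le> hlin a b (hx q)"
proof -
  obtain w c where w: "\<And>q. 0 < ff q \<Longrightarrow> ff q * (hy q - hlin a b (hx q)) = w \<bullet> q - c" and wR: "w \<bullet> R - c = - 1"
    using above_affine[OF assms(3)] by blast
  have "- c \<le> (- w) \<bullet> s" if "s \<in> A" for s
  proof (cases "s = R")
    case False
    then have "0 < ff s" "hy s - hlin a b (hx s) \<le> 0" using assms(2)[OF that] by auto
    then have "w \<bullet> s - c \<le> 0" using w[of s] mult_nonneg_nonpos[of "ff s" "hy s - hlin a b (hx s)"] by simp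
    then show ?thesis by simp
  qed (use wR in simp)
  then have "- c \<le> (- w) \<bullet> q" using hull_ge[OF assms(1)] by blast
  then have "ff q * (hy q - hlin a b (hx q)) \<le> 0" using w[OF assms(4)] by simp
  then show ?thesis using assms(4) by (simp add: mult_le_0_iff)
qed

lemma hull_hx:
  assumes "q \<in> convex hull A" "0 < ff q"
  shows "(\<And>s. s \<in> A \<Longrightarrow> s = R \<or> 0 < ff s \<and> \<tau> \<le> hx s) \<Longrightarrow> \<tau> \<le> hx q"
    and "(\<And>s. s \<in> A \<Longrightarrow> s = R \<or> 0 < ff s \<and> hx s \<le> \<tau>) \<Longrightarrow> hx q \<le> \<tau>"
proof -
  have w: "(v - \<tau> *\<^sub>R u) \<bullet> q - (v - \<tau> *\<^sub>R u) \<bullet> R = gg q - \<tau> * ff q" for q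
    by (simp add: ff_def gg_def inner_diff_left inner_diff_right algebra_simps)
  {
    assume A: "\<And>s. s \<in> A \<Longrightarrow> s = R \<or> 0 < ff s \<and> \<tau> \<le> hx s"
    have "(v - \<tau> *\<^sub>R u) \<bullet> R \<le> (v - \<tau> *\<^sub>R u) \<bullet> s" if "s \<in> A" for s
    proof (cases "s = R")
      case False
      then have "\<tau> * ff s \<le> gg s" using A[OF that] by (auto simp: gg_eq intro!: mult_right_mono)
      then show ?thesis using w[of s] by linarith
    qed simp
    then have "(v - \<tau> *\<^sub>R u) \<bullet> R \<le> (v - \<tau> *\<^sub>R u) \<bullet> q" using hull_ge[OF assms(1)] by blast
    then have "\<tau> * ff q \<le> gg q" using w[of q] by linarith
    then show "\<tau> \<le> hx q" using assms(2) by (simp add: hx_def pos_le_divide_eq)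
  }
  {
    assume A: "\<And>s. s \<in> A \<Longrightarrow> s = R \<or> 0 < ff s \<and> hx s \<le> \<tau>"
    have "- ((v - \<tau> *\<^sub>R u) \<bullet> R) \<le> (- (v - \<tau> *\<^sub>R u)) \<bullet> s" if "s \<in> A" for s
    proof (cases "s = R")
      case False
      then have "gg s \<le> \<tau> * ff s" using A[OF that] by (auto simp: gg_eq intro!: mult_right_mono)
      then show ?thesis using w[of s] unfolding inner_minus_left by linarith
    qed (simp only: inner_minus_left)
    then have "- ((v - \<tau> *\<^sub>R u) \<bullet> R) \<le> (- (v - \<tau> *\<^sub>R u)) \<bullet> q" using hull_ge[OF assms(1)] by blast
    then have "gg q \<le> \<tau> * ff q" using w[of q] unfolding inner_minus_left by linarith
    then show "hx q \<le> \<tau>" using assms(2) by (simp add: hx_def pos_divide_le_eq)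
  }
qed

lemma mem_segment:
  assumes "0 < ff a" "0 < ff b" "hx a < hx b" "0 < ff q" "hx a \<le> hx q" "hx q \<le> hx b" "hy q = hlin a b (hx q)"
  shows "q \<in> convex hull {a, b}"
proof -
  obtain s t where st: "s = (hx b - hx q) / (hx b - hx a) * (ff q / ff a)" "t = (hx q - hx a) / (hx b - hx a) * (ff q / ff b)"
    "s + t = ff q * - hlin a b (hx q)" "q = (1 - s - t) *\<^sub>R R + s *\<^sub>R a + t *\<^sub>R b"
    by (rule star_comb[OF assms(1,2) less_imp_neq[OF assms(3)] assms(4)], rule that)
  have "0 \<le> s" "0 \<le> t" unfolding st(1,2) using assms by simp_all
  moreover have s1: "s + t = 1" using st(3) assms(4) assms(7)[symmetric] by (simp add: hy_def)
  moreover have "q = s *\<^sub>R a + t *\<^sub>R b"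
  proof -
    have "1 - s - t = 0" using s1 by simp
    then show ?thesis using st(4) by simp
  qed
  ultimately show ?thesis unfolding convex_hull_2 by blast
qed

lemma mem_wedge:
  assumes "0 < ff a" "0 < ff b" "hx a < hx b"
  shows "q \<in> convex hull {R, a, b} \<longleftrightarrow> q = R \<or> 0 < ff q \<and> hx a \<le> hx q \<and> hx q \<le> hx b \<and> hy q \<le> hlin a b (hx q)"
proof
  assume q: "q \<in> convex hull {R, a, b}"
  then obtain r s t where st: "0 \<le> r" "0 \<le> s" "0 \<le> t" "r + s + t = 1" "q = r *\<^sub>R R + s *\<^sub>R a + t *\<^sub>R b"
    unfolding convex_hull_3 by auto
  show "q = R \<or> 0 < ff q \<and> hx a \<le> hx q \<and> hx q \<le> hx b \<and> hy q \<le> hlin a b (hx q)"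
  proof (cases "s = 0 \<and> t = 0")
    case True
    then show ?thesis using st by simp
  next
    case False
    have "ff q = s * ff a + t * ff b" using st(4,5) ff_comb3[of r s t R a b] by simp
    moreover have "0 \<le> s * ff a" "0 \<le> t * ff b" "0 < s * ff a \<or> 0 < t * ff b"
      using st assms False by (auto simp: zero_less_mult_iff less_le)
    ultimately have "0 < ff q" by linarith
    moreover have "hx a \<le> hx q" by (rule hull_hx(1)[OF q \<open>0 < ff q\<close>]) (use assms in auto)
    moreover have "hx q \<le> hx b" by (rule hull_hx(2)[OF q \<open>0 < ff q\<close>]) (use assms in auto)
    moreover have "hy q \<le> hlin a b (hx q)" by (rule hull_below[OF q _ _ \<open>0 < ff q\<close>]) (use assms in auto)
    ultimately show ?thesis by simp
  qed
next
  assume "q = R \<or> 0 < ff q \<and> hx a \<le> hx q \<and> hx q \<le> hx b \<and> hy q \<le> hlin a b (hx q)"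
  then consider "q = R" | "0 < ff q" "hx a \<le> hx q" "hx q \<le> hx b" "hy q \<le> hlin a b (hx q)" by blast
  then show "q \<in> convex hull {R, a, b}"
  proof cases
    case 1
    then show ?thesis by (simp add: hull_inc)
  next
    case 2
    obtain s t where st: "s = (hx b - hx q) / (hx b - hx a) * (ff q / ff a)" "t = (hx q - hx a) / (hx b - hx a) * (ff q / ff b)"
      "s + t = ff q * - hlin a b (hx q)" "q = (1 - s - t) *\<^sub>R R + s *\<^sub>R a + t *\<^sub>R b"
      by (rule star_comb[OF assms(1,2) less_imp_neq[OF assms(3)] 2(1)], rule that)
    have "0 \<le> s" "0 \<le> t" unfolding st(1,2) using assms 2 by simp_all
    moreover have "s + t \<le> 1"
    proof -
      have "ff q * - hlin a b (hx q) \<le> ff q * - hy q" using 2 by (intro mult_left_mono) auto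
      also have "ff q * - hy q = 1" using 2 by (simp add: hy_def)
      finally show ?thesis using st(3) by simp
    qed
    moreover have "(1 - s - t) + s + t = 1" by simp
    ultimately show ?thesis unfolding convex_hull_3 using st(4) by (intro CollectI exI[of _ "1 - s - t"] exI[of _ s] exI[of _ t]) simp
  qed
qed

lemma mem_ray:
  assumes "0 < ff b" "0 < ff q" "hx q = hx b" "hy q \<le> hy b"
  shows "q \<in> convex hull {R, b}"
proof -
  define t where "t = ff q / ff b"
  have "ff q \<le> ff b" using assms by (simp add: hy_def field_simps)
  then have "0 \<le> t" "t \<le> 1" using assms by (auto simp: t_def)
  moreover have "q = (1 - t) *\<^sub>R R + t *\<^sub>R b"
    using assms by (intro coords_ext) (simp_all add: ff_comb gg_comb gg_eq[of b] gg_eq[of q] t_def)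
  moreover have "(1 - t) + t = 1" by simp
  ultimately show ?thesis unfolding convex_hull_2 by (intro CollectI exI[of _ "1 - t"] exI[of _ t]) simp
qed

lemma mem_vertical:
  assumes "0 < ff l" "0 < ff w" "0 < ff q" "hx l = hx q" "hx w = hx q" "hy l \<le> hy q" "hy q \<le> hy w"
  shows "q \<in> convex hull {l, w}"
proof (cases "ff l = ff w")
  case True
  then have "hy l = hy q" using assms by (simp add: hy_def)
  then have "q = l" using assms by (intro hxy_ext) auto
  then show ?thesis by (simp add: hull_inc)
next
  case False
  have "ff l \<le> ff q" "ff q \<le> ff w" using assms by (simp_all add: hy_def field_simps)
  then have lt: "ff l < ff w" using False by simp
  define t where "t = (ff q - ff l) / (ff w - ff l)"
  have t01: "0 \<le> t" "t \<le> 1" using lt \<open>ff l \<le> ff q\<close> \<open>ff q \<le> ff w\<close> by (auto simp: t_def)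
  have "ff q = (1 - t) * ff l + t * ff w"
  proof -
    have "t * (ff w - ff l) = ff q - ff l" using lt by (simp add: t_def)
    then show ?thesis by (simp add: algebra_simps)
  qed
  then have fq: "ff q = ff ((1 - t) *\<^sub>R l + t *\<^sub>R w)" by (simp add: ff_comb)
  have "gg ((1 - t) *\<^sub>R l + t *\<^sub>R w) = (1 - t) * (hx q * ff l) + t * (hx q * ff w)"
    using gg_comb[of "1 - t" t l w] gg_eq[OF assms(1)] gg_eq[OF assms(2)] assms(4,5) by simp
  also have "\<dots> = hx q * ((1 - t) * ff l + t * ff w)" by (simp add: algebra_simps)
  also have "\<dots> = hx q * ff q" using \<open>ff q = (1 - t) * ff l + t * ff w\<close> by simp
  also have "\<dots> = gg q" using gg_eq[OF assms(3)] by simp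
  finally have "q = (1 - t) *\<^sub>R l + t *\<^sub>R w" using fq by (intro coords_ext) simp_all
  moreover have "(1 - t) + t = 1" by simp
  ultimately show ?thesis using t01 unfolding convex_hull_2 by (intro CollectI exI[of _ "1 - t"] exI[of _ t]) simp
qed

lemma hy_neg: "0 < ff q \<Longrightarrow> hy q < 0"
  by (simp add: hy_def)

lemma point_on_segment:
  assumes "0 < ff a" "0 < ff b" "hx a < hx b" "hx a \<le> \<tau>" "\<tau> \<le> hx b"
  obtains l where "l \<in> convex hull {a, b}" "0 < ff l" "hx l = \<tau>" "hy l = hlin a b \<tau>"
proof -
  \<comment> \<open>A point of height \<open>h\<close> has \<open>ff = - 1 / h\<close>, so only
    negative heights belong to points with positive \<open>ff\<close>.\<close>
  have neg: "hlin a b \<tau> < 0"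
  proof -
    have "hlin a b \<tau> \<le> max (hy a) (hy b)" using assms by (intro lin_le) auto
    then show ?thesis using hy_neg[OF assms(1)] hy_neg[OF assms(2)] by simp
  qed
  obtain l where l: "ff l = - 1 / hlin a b \<tau>" "gg l = \<tau> * (- 1 / hlin a b \<tau>)" using coords_surj by blast
  have fl: "0 < ff l" using neg l by (simp add: divide_pos_neg)
  have "hx l = \<tau>" "hy l = hlin a b \<tau>" using neg by (simp_all add: hx_def hy_def l)
  then show ?thesis using that[of l] fl mem_segment[of a b l] assms by simp
qed

text \<open>Points with equal \<open>hx\<close> lie on one ray from \<open>R\<close>, which general
  position excludes.\<close>

lemma hx_inj: "inj_on hx X"
proof (rule inj_onI, rule ccontr)
  fix a b assume ab: "a \<in> X" "b \<in> X" "hx a = hx b" "a \<noteq> b"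
  note fp = ff_pos[OF ab(1)] ff_pos[OF ab(2)]
  define t where "t = ff b / ff a"
  have "b = (1 - t) *\<^sub>R R + t *\<^sub>R a"
    using fp ab(3) by (intro coords_ext) (simp_all add: ff_comb gg_comb gg_eq[of a] gg_eq[of b] t_def)
  then have "b = (1 - t) *\<^sub>R R + (1 - (1 - t)) *\<^sub>R a" by simp
  then have "collinear {R, b, a}" unfolding collinear_3_expand by blast
  then show False using gpM RM ab by (auto simp: general_position_def X_def)
qed

lemma hx_neq: "a \<in> X \<Longrightarrow> b \<in> X \<Longrightarrow> a \<noteq> b \<Longrightarrow> hx a \<noteq> hx b"
  using hx_inj by (auto simp: inj_on_def)

lemma star_gp:
  assumes "a \<in> X" "b \<in> X" "c \<in> X" "a \<noteq> b" "b \<noteq> c" "a \<noteq> c"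
  shows "hy c \<noteq> hlin a b (hx c)"
proof
  assume h: "hy c = hlin a b (hx c)"
  note fp = ff_pos[OF assms(1)] ff_pos[OF assms(2)] ff_pos[OF assms(3)]
  obtain s t where st: "s + t = ff c * - hlin a b (hx c)" "c = (1 - s - t) *\<^sub>R R + s *\<^sub>R a + t *\<^sub>R b"
    by (rule star_comb[OF fp(1,2) hx_neq[OF assms(1,2,4)] fp(3)], rule that)
  have s1: "s + t = 1" using st(1) fp(3) h[symmetric] by (simp add: hy_def)
  then have "1 - s - t = 0" "t = 1 - s" by simp_all
  then have "c = s *\<^sub>R a + (1 - s) *\<^sub>R b" using st(2) by simp
  then have "collinear {a, c, b}" unfolding collinear_3_expand by blast
  then show False using gpM assms by (auto simp: general_position_def X_def)
qed

sublocale planar_chain hx hy X p1 p2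
proof
  show "finite X" using finM by (simp add: X_def)
  show "p1 \<in> X" "p2 \<in> X" using p1 p2 by (auto simp: X_def)
  show b: "hx p1 \<le> hx s \<and> hx s \<le> hx p2" if "s \<in> X" for s
    using ends[of s] that by (simp add: hx_def gg_def ff_def X_def)
  show "inj_on hx X" by (rule hx_inj)
  have "hx p1 \<noteq> hx p2"
  proof
    assume eq: "hx p1 = hx p2"
    have "s = p1" if "s \<in> X" for s
      using b[OF that] eq hx_neq[OF that \<open>p1 \<in> X\<close>] by linarith
    then have "X \<subseteq> {p1}" by blast
    then have "card X \<le> 1" using card_mono[of "{p1}" X] by simp
    moreover have "card X = card M - 1" using finM RM by (simp add: X_def)
    ultimately show False using card3 by linarith
  qed
  then show "hx p1 < hx p2" using b[OF \<open>p2 \<in> X\<close>] by simp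
  show "\<And>a b c. a \<in> X \<Longrightarrow> b \<in> X \<Longrightarrow> c \<in> X \<Longrightarrow> a \<noteq> b \<Longrightarrow> b \<noteq> c \<Longrightarrow> a \<noteq> c \<Longrightarrow> hy c \<noteq> hlin a b (hx c)"
    by (rule star_gp)
qed

lemma X_M: "X \<subseteq> M" "R \<notin> X" "M = insert R X"
  using RM by (auto simp: X_def)

lemma trifams_side:
  assumes T: "\<T> \<in> trifams B" and BX: "B \<subseteq> X" and ab: "a \<in> B" "b \<in> B" "hx a < hx b"
    and side: "(\<forall>s\<in>B - {a, b}. hlin a b (hx s) < hy s) \<or> (\<forall>s\<in>B - {a, b}. hy s < hlin a b (hx s))"
  shows "\<exists>V\<in>\<T>. {a, b} \<subseteq> V"
proof -
  obtain w c where w: "\<And>q. 0 < ff q \<Longrightarrow> ff q * (hy q - hlin a b (hx q)) = w \<bullet> q - c"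
    using above_affine[OF less_imp_neq[OF ab(3)]] by blast
  have ne: "a \<noteq> b" using ab(3) by auto
  have fp: "0 < ff s" if "s \<in> B" for s using ff_pos BX that by auto
  have w0: "w \<bullet> a = c" "w \<bullet> b = c" using w[OF fp[OF ab(1)]] w[OF fp[OF ab(2)]] ab(3) by simp_all
  from side show ?thesis
  proof
    assume s: "\<forall>s\<in>B - {a, b}. hlin a b (hx s) < hy s"
    have "c < w \<bullet> s" if "s \<in> B - {a, b}" for s
      using w[OF fp, of s] bspec[OF s that] fp[of s] that mult_pos_pos[of "ff s" "hy s - hlin a b (hx s)"] by simp
    then show ?thesis by (rule side_in_triangle[OF T ab(1,2) ne w0])
  next
    assume s: "\<forall>s\<in>B - {a, b}. hy s < hlin a b (hx s)"
    have "- c < (- w) \<bullet> s" if "s \<in> B - {a, b}" for s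
      using w[OF fp, of s] bspec[OF s that] fp[of s] that mult_pos_neg[of "ff s" "hy s - hlin a b (hx s)"] by simp
    moreover have "(- w) \<bullet> a = - c" "(- w) \<bullet> b = - c" using w0 by simp_all
    ultimately show ?thesis using side_in_triangle[OF T ab(1,2) ne] by blast
  qed
qed

end

text \<open>\<open>K\<close> is twice the signed area of the triangle \<open>a\<close>,
  \<open>t\<close>, \<open>b\<close>. The vertical distance of each point from the line through the
  other two is, up to sign, \<open>K\<close> divided by a positive length, so all three distances
  describe the same turn.\<close>

lemma lin_kink:
  fixes x y :: "'a \<Rightarrow> real"
  assumes "x a < x t" "x t < x b"
  defines "K \<equiv> (y b - y a) * (x t - x a) - (y t - y a) * (x b - x a)"
  shows "lin x y a b (x t) - y t = K / (x b - x a)" "y b - lin x y a t (x b) = K / (x t - x a)"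
    "y a - lin x y t b (x a) = K / (x b - x t)"
proof -
  have d: "x b - x a \<noteq> 0" "x t - x a \<noteq> 0" "x b - x t \<noteq> 0" using assms by auto
  have "lin x y a b (x t) - y t = ((y b - y a) * (x t - x a)) / (x b - x a) - (y t - y a)" by (simp add: lin_def)
  also have "\<dots> = K / (x b - x a)" unfolding K_def diff_divide_distrib using d by simp
  finally show "lin x y a b (x t) - y t = K / (x b - x a)" .
  have "y b - lin x y a t (x b) = (y b - y a) - (y t - y a) * (x b - x a) / (x t - x a)" by (simp add: lin_def)
  also have "\<dots> = K / (x t - x a)" unfolding K_def diff_divide_distrib using d by simp
  finally show "y b - lin x y a t (x b) = K / (x t - x a)" .
  have "y a - lin x y t b (x a) = (y b - y t) * (x t - x a) / (x b - x t) - (y t - y a)"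
    by (simp add: lin_def diff_divide_distrib algebra_simps)
  also have "\<dots> = ((y b - y t) * (x t - x a) - (y t - y a) * (x b - x t)) / (x b - x t)"
    unfolding diff_divide_distrib using d by simp
  also have "(y b - y t) * (x t - x a) - (y t - y a) * (x b - x t) = K" by (simp add: K_def algebra_simps)
  finally show "y a - lin x y t b (x a) = K / (x b - x t)" .
qed

lemma lin_kink_iff:
  fixes x y :: "'a \<Rightarrow> real"
  assumes "x a < x t" "x t < x b"
  shows "lin x y a t (x b) < y b \<longleftrightarrow> y t < lin x y a b (x t)" "lin x y t b (x a) < y a \<longleftrightarrow> y t < lin x y a b (x t)"
    "y b < lin x y a t (x b) \<longleftrightarrow> lin x y a b (x t) < y t" "y a < lin x y t b (x a) \<longleftrightarrow> lin x y a b (x t) < y t"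
proof -
  define K where "K = (y b - y a) * (x t - x a) - (y t - y a) * (x b - x a)"
  note k = lin_kink[of x a t b y, OF assms, folded K_def]
  have d: "0 < x b - x a" "0 < x t - x a" "0 < x b - x t" using assms by auto
  have "y t < lin x y a b (x t) \<longleftrightarrow> 0 < lin x y a b (x t) - y t" by simp
  also have "\<dots> \<longleftrightarrow> 0 < K" unfolding k using d(1) by (simp add: zero_less_divide_iff)
  finally have 1: "y t < lin x y a b (x t) \<longleftrightarrow> 0 < K" .
  have "lin x y a b (x t) < y t \<longleftrightarrow> lin x y a b (x t) - y t < 0" by simp
  also have "\<dots> \<longleftrightarrow> K < 0" unfolding k using d(1) by (simp add: divide_less_0_iff)
  finally have 2: "lin x y a b (x t) < y t \<longleftrightarrow> K < 0" .
  have "lin x y a t (x b) < y b \<longleftrightarrow> 0 < y b - lin x y a t (x b)" by simp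
  also have "\<dots> \<longleftrightarrow> 0 < K" unfolding k using d(2) by (simp add: zero_less_divide_iff)
  finally show "lin x y a t (x b) < y b \<longleftrightarrow> y t < lin x y a b (x t)" using 1 by simp
  have "lin x y t b (x a) < y a \<longleftrightarrow> 0 < y a - lin x y t b (x a)" by simp
  also have "\<dots> \<longleftrightarrow> 0 < K" unfolding k using d(3) by (simp add: zero_less_divide_iff)
  finally show "lin x y t b (x a) < y a \<longleftrightarrow> y t < lin x y a b (x t)" using 1 by simp
  have "y b < lin x y a t (x b) \<longleftrightarrow> y b - lin x y a t (x b) < 0" by simp
  also have "\<dots> \<longleftrightarrow> K < 0" unfolding k using d(2) by (simp add: divide_less_0_iff)
  finally show "y b < lin x y a t (x b) \<longleftrightarrow> lin x y a b (x t) < y t" using 2 by simp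
  have "y a < lin x y t b (x a) \<longleftrightarrow> y a - lin x y t b (x a) < 0" by simp
  also have "\<dots> \<longleftrightarrow> K < 0" unfolding k using d(3) by (simp add: divide_less_0_iff)
  finally show "y a < lin x y t b (x a) \<longleftrightarrow> lin x y a b (x t) < y t" using 2 by simp
qed

lemma adjacent_interval:
  assumes S: "finite S" "inj_on x S" "c \<in> S" "d \<in> S" "x c < x d" and \<tau>: "x c \<le> \<tau>" "\<tau> \<le> x d"
  obtains a b where "adjacent x S a b" "x c \<le> x a" "x b \<le> x d" "x a \<le> \<tau>" "\<tau> \<le> x b"
proof (cases "\<tau> = x d")
  case True
  note n = prv_props[OF S(2,1,3,5)]
  show ?thesis
  proof (rule that[of "prv x S d" d])
    show "adjacent x S (prv x S d) d" by (rule adjacent_prv[OF S(2,1,4,3,5)])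
    show "x c \<le> x (prv x S d)" by (rule n(3)[OF S(3,5)])
    show "x (prv x S d) \<le> \<tau>" "\<tau> \<le> x d" using n(2) True by simp_all
  qed simp
next
  case False
  obtain a where a: "a \<in> {s \<in> S. x s \<le> \<tau>}" and max: "\<And>s. s \<in> {s \<in> S. x s \<le> \<tau>} \<Longrightarrow> x s \<le> x a"
  proof (rule finite_argmax[of "{s \<in> S. x s \<le> \<tau>}" x])
    show "finite {s \<in> S. x s \<le> \<tau>}" using S(1) by simp
    show "{s \<in> S. x s \<le> \<tau>} \<noteq> {}" using S(3) \<tau>(1) by blast
  qed (rule that)
  have aS: "a \<in> S" "x a \<le> \<tau>" "x a < x d" using a False \<tau> by auto
  note n = nxt_props[OF S(2,1,4) aS(3)]
  have "\<tau> \<le> x (nxt x S a)" using max[of "nxt x S a"] n(1,2) by force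
  moreover have "x c \<le> x a" using max[of c] S(3) \<tau>(1) by auto
  ultimately show ?thesis
    by (intro that[OF adjacent_nxt[OF S(2,1) aS(1) S(4) aS(3)] _ n(3)[OF S(4) aS(3)] aS(2)])
qed

text \<open>The height of a path is well defined: two different edges over the same abscissa share a
  vertex there.\<close>

lemma adjacent_lin_eq:
  assumes inj: "inj_on x S" and ab: "adjacent x S a b" and ab': "adjacent x S a' b'"
    and \<tau>: "x a \<le> \<tau>" "\<tau> \<le> x b" "x a' \<le> \<tau>" "\<tau> \<le> x b'"
  shows "lin x y a b \<tau> = lin x y a' b' \<tau>"
proof -
  have *: "lin x y a b \<tau> = lin x y a' b' \<tau>"
    if "adjacent x S a b" "adjacent x S a' b'" "x a \<le> \<tau>" "\<tau> \<le> x b" "x a' \<le> \<tau>" "\<tau> \<le> x b'" "x a < x a'" for a b a' b'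
  proof -
    note A = adjacentD[OF that(1)] and A' = adjacentD[OF that(2)]
    have "x b \<le> x a'" using A(4)[OF A'(1)] that(7) by auto
    then have e: "\<tau> = x b" "\<tau> = x a'" using that by auto
    then have "x b = x a'" by simp
    then have "b = a'" using inj_onD[OF inj _ A(2) A'(1)] by blast
    then show ?thesis using e(1) A(3) by simp
  qed
  note A = adjacentD[OF ab] and A' = adjacentD[OF ab']
  consider "x a < x a'" | "x a' < x a" | "x a = x a'" by linarith
  then show ?thesis
  proof cases
    case 3
    then have a: "a = a'" using inj_onD[OF inj _ A(1) A'(1)] by blast
    have "x b \<le> x b'" "x b' \<le> x b" using A(4)[OF A'(2)] A'(4)[OF A(2)] A(3) A'(3) a by auto
    then have "x b = x b'" by simp
    then have "b = b'" using inj_onD[OF inj _ A(2) A'(2)] by blast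
    then show ?thesis using a by simp
  qed (use *[OF ab ab' \<tau>] *[OF ab' ab \<tau>(3,4,1,2)] in simp_all)
qed

section \<open>Triangulations of the region below a path\<close>

context star
begin

definition fan :: "point set \<Rightarrow> point set set" where
  "fan S = {{R, a, b} |a b. adjacent hx S a b}"

definition wedges :: "point set \<Rightarrow> point set" where
  "wedges S = (\<Union>V\<in>fan S. convex hull V)"

lemma path_edge:
  assumes "S \<in> paths" "adjacent hx S a b"
  shows "a \<in> X" "b \<in> X" "0 < ff a" "0 < ff b" "hx a < hx b" "a \<in> S" "b \<in> S"
  using adjacentD[OF assms(2)] pathD(1)[OF assms(1)] ff_pos by auto

lemma path_edge_at:
  assumes "S \<in> paths" "hx p1 \<le> \<tau>" "\<tau> \<le> hx p2"
  obtains a b where "adjacent hx S a b" "hx a \<le> \<tau>" "\<tau> \<le> hx b"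
  using adjacent_interval[OF pathD(4,5,2,3)[OF assms(1)] pq assms(2,3)] by blast

lemma mem_wedges:
  assumes S: "S \<in> paths"
  shows "q \<in> wedges S \<longleftrightarrow> q = R \<or> 0 < ff q \<and> (\<exists>a b. adjacent hx S a b \<and> hx a \<le> hx q \<and> hx q \<le> hx b \<and> hy q \<le> hlin a b (hx q))"
proof -
  have "q \<in> wedges S \<longleftrightarrow> (\<exists>a b. adjacent hx S a b \<and> q \<in> convex hull {R, a, b})"
    unfolding wedges_def fan_def by blast
  also have "\<dots> \<longleftrightarrow> (\<exists>a b. adjacent hx S a b \<and> (q = R \<or> 0 < ff q \<and> hx a \<le> hx q \<and> hx q \<le> hx b \<and> hy q \<le> hlin a b (hx q)))"
    using mem_wedge path_edge[OF S] by (intro ex_cong1 conj_cong refl) blast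
  moreover have "\<exists>a b. adjacent hx S a b" using path_edge_at[OF S order_refl] pq by (meson less_imp_le)
  ultimately show ?thesis by blast
qed

text \<open>A triangulation under construction that fills exactly the region below the path
  \<open>S\<close>. The last clause makes every path edge part of some triangle, as
  \<open>compat_Un\<close> demands when further triangles are put on top.\<close>

definition state :: "point set set \<Rightarrow> point set \<Rightarrow> bool" where
  "state \<V> S \<longleftrightarrow> S \<in> paths \<and> (\<forall>V\<in>\<V>. V \<subseteq> M \<and> card V = 3) \<and> compat \<V> \<and> (\<Union>V\<in>\<V>. convex hull V) = wedges S
     \<and> (\<forall>a b. adjacent hx S a b \<longrightarrow> (\<exists>V\<in>\<V>. {a, b} \<subseteq> V))"

lemma stateD:
  assumes "state \<V> S"
  shows "S \<in> paths" "\<And>V. V \<in> \<V> \<Longrightarrow> V \<subseteq> M \<and> card V = 3" "compat \<V>" "(\<Union>V\<in>\<V>. convex hull V) = wedges S"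
    "\<And>a b. adjacent hx S a b \<Longrightarrow> \<exists>V\<in>\<V>. {a, b} \<subseteq> V"
proof -
  note s = assms[unfolded state_def]
  show "S \<in> paths" "compat \<V>" "(\<Union>V\<in>\<V>. convex hull V) = wedges S" using s by simp_all
  show "\<And>V. V \<in> \<V> \<Longrightarrow> V \<subseteq> M \<and> card V = 3" using s by simp
  show "\<And>a b. adjacent hx S a b \<Longrightarrow> \<exists>V\<in>\<V>. {a, b} \<subseteq> V" using s by simp
qed

lemma state_fan:
  assumes S: "S \<in> paths"
  shows "state (fan S) S"
proof -
  have "V \<subseteq> M \<and> card V = 3" if V': "V \<in> fan S" for V
  proof -
    obtain a b where V: "V = {R, a, b}" "adjacent hx S a b" using V' unfolding fan_def by blast
    have "a \<noteq> b" "R \<noteq> a" "R \<noteq> b" using path_edge[OF S V(2)] X_M(2) by auto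
    then show ?thesis using V(1) path_edge[OF S V(2)] X_M by auto
  qed
  moreover have "compat (fan S)"
  proof -
    \<comment> \<open>Wedges over different edges meet beyond \<open>R\<close> only below a common
      endpoint, that is, in the segment from \<open>R\<close> to that endpoint.\<close>
    have *: "convex hull {R, a, b} \<inter> convex hull {R, a', b'} \<subseteq> convex hull ({R, a, b} \<inter> {R, a', b'})"
      if e: "adjacent hx S a b" "adjacent hx S a' b'" "hx b \<le> hx a'" for a b a' b'
    proof
      note E = path_edge[OF S e(1)] and E' = path_edge[OF S e(2)]
      fix q assume q: "q \<in> convex hull {R, a, b} \<inter> convex hull {R, a', b'}"
      show "q \<in> convex hull ({R, a, b} \<inter> {R, a', b'})"
      proof (cases "q = R")
        case True
        then show ?thesis by (simp add: hull_inc)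
      next
        case False
        then have w: "0 < ff q" "hx q \<le> hx b" "hy q \<le> hlin a b (hx q)" "hx a' \<le> hx q"
          using q unfolding mem_wedge[OF E(3-5)] mem_wedge[OF E'(3-5)] Int_iff by blast+
        then have eq: "hx b = hx a'" "hx q = hx b" using e(3) by auto
        then have "b = a'" using hx_neq[OF E(2) E'(1)] by blast
        have "hy q \<le> hy b" using w(3) E(5) unfolding eq(2) by simp
        then have "q \<in> convex hull {R, b}" using w(1) eq(2) E(4) by (intro mem_ray)
        moreover have "{R, b} \<subseteq> {R, a, b} \<inter> {R, a', b'}" using \<open>b = a'\<close> by blast
        ultimately show ?thesis using hull_mono by blast
      qed
    qed
    have "convex hull V \<inter> convex hull V' \<subseteq> convex hull (V \<inter> V')" if "V \<in> fan S" "V' \<in> fan S" for V V'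
    proof -
      obtain a b a' b' where V: "V = {R, a, b}" "V' = {R, a', b'}" and e: "adjacent hx S a b" "adjacent hx S a' b'"
        using \<open>V \<in> fan S\<close> \<open>V' \<in> fan S\<close> unfolding fan_def by blast
      note A = adjacentD[OF e(1)] and A' = adjacentD[OF e(2)]
      consider "hx b \<le> hx a'" | "hx b' \<le> hx a" | "hx a = hx a'"
        using A(4)[OF A'(1)] A'(4)[OF A(1)] by linarith
      then show ?thesis
      proof cases
        case 1 show ?thesis unfolding V by (rule *[OF e 1])
      next
        case 2 then show ?thesis unfolding V using *[OF e(2,1) 2] by (simp only: Int_commute)
      next
        case 3
        have "hx b \<le> hx b'" "hx b' \<le> hx b" using A(4)[OF A'(2)] A'(4)[OF A(2)] A(3) A'(3) 3 by auto
        then have "b = b'" "a = a'" using 3 hx_neq[of b b'] hx_neq[of a a'] path_edge(1,2)[OF S e(1)] path_edge(1,2)[OF S e(2)] by force+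
        then show ?thesis unfolding V by simp
      qed
    qed
    moreover have "convex hull (V \<inter> V') \<subseteq> convex hull V \<inter> convex hull V'" for V V' :: "point set"
      by (simp add: hull_mono)
    ultimately show ?thesis unfolding compat_def by blast
  qed
  moreover have "\<exists>V\<in>fan S. {a, b} \<subseteq> V" if "adjacent hx S a b" for a b
    using that by (intro bexI[of _ "{R, a, b}"]) (auto simp: fan_def)
  ultimately show ?thesis using S unfolding state_def wedges_def by blast
qed

lemma mem_between:
  assumes "B \<subseteq> X" "a \<in> B" "b \<in> B" "a' \<in> B" "b' \<in> B" "hx a < hx b" "hx a' < hx b'" "0 < ff q"
    "hx a \<le> hx q" "hx q \<le> hx b" "hx a' \<le> hx q" "hx q \<le> hx b'" "hlin a b (hx q) \<le> hy q" "hy q \<le> hlin a' b' (hx q)"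
  shows "q \<in> convex hull B"
proof -
  have fp: "0 < ff a" "0 < ff b" "0 < ff a'" "0 < ff b'" using assms(1-5) ff_pos by blast+
  obtain l where l: "l \<in> convex hull {a, b}" "0 < ff l" "hx l = hx q" "hy l = hlin a b (hx q)"
    using point_on_segment[OF fp(1,2) assms(6,9,10)] by blast
  obtain w where w: "w \<in> convex hull {a', b'}" "0 < ff w" "hx w = hx q" "hy w = hlin a' b' (hx q)"
    using point_on_segment[OF fp(3,4) assms(7,11,12)] by blast
  have "q \<in> convex hull {l, w}" by (rule mem_vertical) (use l w assms(8,13,14) in simp_all)
  moreover have "l \<in> convex hull B" "w \<in> convex hull B"
    using l(1) w(1) hull_mono[of "{a, b}" B convex] hull_mono[of "{a', b'}" B convex] assms(2-5) by blast+
  then have "convex hull {l, w} \<subseteq> convex hull B" by (intro hull_minimal) (auto simp: convex_convex_hull)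
  ultimately show ?thesis by blast
qed

text \<open>The block \<open>B\<close> lies above the path \<open>S\<close> between \<open>c\<close> and \<open>d\<close>; adding a triangulation of it replaces this
  part of the path, the lower hull of \<open>B\<close>, by the upper hull \<open>U\<close>.\<close>

lemma block_step:
  assumes st: "state \<V> S" and BX: "B \<subseteq> X" and T: "\<T> \<in> trifams B"
    and cd: "c \<in> S" "d \<in> S" "hx c < hx d"
    and bnd: "\<And>s. s \<in> B \<Longrightarrow> hx c \<le> hx s \<and> hx s \<le> hx d"
    and LH: "\<And>a b s. adjacent hx S a b \<Longrightarrow> hx c \<le> hx a \<Longrightarrow> hx b \<le> hx d \<Longrightarrow> s \<in> B - {a, b} \<Longrightarrow> hlin a b (hx s) < hy s"
    and SB: "\<And>s. s \<in> S \<Longrightarrow> hx c \<le> hx s \<Longrightarrow> hx s \<le> hx d \<Longrightarrow> s \<in> B"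
    and U: "U \<subseteq> B" "c \<in> U" "d \<in> U"
    and UH: "\<And>a b s. adjacent hx U a b \<Longrightarrow> s \<in> B - {a, b} \<Longrightarrow> hy s < hlin a b (hx s)"
  shows "state (\<V> \<union> \<T>) ({s \<in> S. hx s \<le> hx c \<or> hx d \<le> hx s} \<union> U)" (is "state _ ?S'")
proof -
  have S: "S \<in> paths" and V3: "\<And>V. V \<in> \<V> \<Longrightarrow> V \<subseteq> M \<and> card V = 3" and comp: "compat \<V>"
    and un: "(\<Union>V\<in>\<V>. convex hull V) = wedges S" and adjV: "\<And>a b. adjacent hx S a b \<Longrightarrow> \<exists>V\<in>\<V>. {a, b} \<subseteq> V"
    using stateD[OF st] by simp_all
  note P = pathD[OF S]
  have UX: "U \<subseteq> X" using U(1) BX by blast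
  have finU: "finite U" by (rule finite_subset[OF UX fin])
  have injU: "inj_on hx U" by (rule inj_on_subset[OF inj UX])
  have fB: "0 < ff s" if "s \<in> B" for s using ff_pos BX that by blast
  have S': "?S' \<in> paths"
  proof -
    have "hx p1 \<le> hx c" "hx d \<le> hx p2" using bounds cd P(1) by blast+
    then show ?thesis using P(1-3) UX by (auto simp: paths_def)
  qed
  have eqX: "s = t" if "s \<in> X" "t \<in> X" "hx s = hx t" for s t using hx_neq[of s t] that by blast
  \<comment> \<open>The edges of the new path are those of \<open>U\<close> and the old edges
    outside the range from \<open>c\<close> to \<open>d\<close>.\<close>
  have adjS': "adjacent hx ?S' a b \<longleftrightarrow> adjacent hx U a b \<or> adjacent hx S a b \<and> (hx b \<le> hx c \<or> hx d \<le> hx a)" (is "?l \<longleftrightarrow> ?r") for a b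
  proof
    assume ?l
    note A = adjacentD[OF this]
    have abX: "a \<in> X" "b \<in> X" using A(1,2) P(1) UX by blast+
    have cX: "c \<in> X" "d \<in> X" using cd P(1) by blast+
    have c': "hx c \<le> hx a \<or> hx b \<le> hx c" and d': "hx d \<le> hx a \<or> hx b \<le> hx d" using A(4) U(2,3) by blast+
    have inS: "s \<in> S" if "s \<in> ?S'" "hx s \<le> hx c \<or> hx d \<le> hx s" for s
    proof (cases "s \<in> U")
      case True
      then have "hx c \<le> hx s \<and> hx s \<le> hx d" using bnd U(1) by blast
      then have "hx s = hx c \<or> hx s = hx d" using that(2) by linarith
      then have "s = c \<or> s = d" using eqX[of s c] eqX[of s d] True UX cX by blast
      then show ?thesis using cd by blast
    qed (use that in blast)
    have inU: "s \<in> U" if "s \<in> ?S'" "hx c \<le> hx s" "hx s \<le> hx d" for s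
    proof (cases "s \<in> U")
      case False
      then have "s \<in> S" "hx s = hx c \<or> hx s = hx d" using that by auto
      then have "s = c \<or> s = d" using eqX[of s c] eqX[of s d] P(1) cX by blast
      then show ?thesis using U by blast
    qed
    show ?r
    proof (cases "hx b \<le> hx c \<or> hx d \<le> hx a")
      case True
      then have "a \<in> S" "b \<in> S" using inS[OF A(1)] inS[OF A(2)] A(3) by linarith+
      moreover have "hx s \<le> hx a \<or> hx b \<le> hx s" if "s \<in> S" for s
      proof (cases "hx s \<le> hx c \<or> hx d \<le> hx s")
        case True
        then show ?thesis using A(4)[of s] that by blast
      next
        case False
        then show ?thesis using \<open>hx b \<le> hx c \<or> hx d \<le> hx a\<close> by linarith
      qed
      ultimately show ?thesis using True A(3) unfolding adjacent_def by blast
    next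
      case False
      then have ab: "hx c \<le> hx a" "hx b \<le> hx d" using c' d' by blast+
      then have "a \<in> U" "b \<in> U" using inU[OF A(1)] inU[OF A(2)] A(3) by linarith+
      moreover have "hx s \<le> hx a \<or> hx b \<le> hx s" if "s \<in> U" for s using A(4) that by blast
      ultimately show ?thesis using A(3) unfolding adjacent_def by blast
    qed
  next
    assume ?r
    then show ?l
    proof
      assume U1: "adjacent hx U a b"
      note A = adjacentD[OF U1]
      have ab: "hx c \<le> hx a" "hx b \<le> hx d" using bnd U(1) A(1,2) by blast+
      have "hx s \<le> hx a \<or> hx b \<le> hx s" if "s \<in> ?S'" for s
      proof (cases "s \<in> U")
        case False
        then have "hx s \<le> hx c \<or> hx d \<le> hx s" using that by blast
        then show ?thesis using ab by linarith
      qed (rule A(4))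
      then show ?l using A(1-3) unfolding adjacent_def by blast
    next
      assume S1: "adjacent hx S a b \<and> (hx b \<le> hx c \<or> hx d \<le> hx a)"
      then have A: "a \<in> S" "b \<in> S" "hx a < hx b" "\<And>s. s \<in> S \<Longrightarrow> hx s \<le> hx a \<or> hx b \<le> hx s" and o: "hx b \<le> hx c \<or> hx d \<le> hx a"
        using adjacentD[of hx S a b] by blast+
      have "a \<in> ?S'" "b \<in> ?S'" using A(1-3) o by auto
      moreover have "hx s \<le> hx a \<or> hx b \<le> hx s" if "s \<in> ?S'" for s
      proof (cases "s \<in> U")
        case True
        then have "hx c \<le> hx s \<and> hx s \<le> hx d" using bnd U(1) by blast
        then show ?thesis using o by linarith
      next
        case False
        then show ?thesis using A(4)[of s] that by blast
      qed
      ultimately show ?l using A(3) unfolding adjacent_def by blast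
    qed
  qed
  have low: "hlin a b (hx q) \<le> hy q" if "adjacent hx S a b" "hx c \<le> hx a" "hx b \<le> hx d" "q \<in> convex hull B" for a b q
  proof (rule hull_above[OF that(4) fB])
    have lt: "hx a < hx b" using adjacentD(3)[OF that(1)] .
    then show "hx a \<noteq> hx b" by simp
    show "hlin a b (hx s) \<le> hy s" if "s \<in> B" for s
      using LH[OF \<open>adjacent hx S a b\<close> \<open>hx c \<le> hx a\<close> \<open>hx b \<le> hx d\<close>, of s] lt that by (cases "s = a"; cases "s = b") auto
  qed
  have fq: "0 < ff q" if "q \<in> convex hull B" for q using hull_ff_pos[OF that fB] .
  have up: "hy q \<le> hlin a b (hx q)" if "adjacent hx U a b" "q \<in> convex hull B" for a b q
  proof (rule hull_below[OF that(2) _ _ fq[OF that(2)]])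
    have lt: "hx a < hx b" using adjacentD(3)[OF that(1)] .
    then show "hx a \<noteq> hx b" by simp
    show "s = R \<or> 0 < ff s \<and> hy s \<le> hlin a b (hx s)" if "s \<in> B" for s
      using UH[OF \<open>adjacent hx U a b\<close>, of s] fB[OF that] lt that by (cases "s = a"; cases "s = b") auto
  qed
  have hxq: "hx c \<le> hx q" "hx q \<le> hx d" if "q \<in> convex hull B" for q
    using hull_hx[OF that fq[OF that]] bnd fB by blast+
  have Uat: "\<exists>a b. adjacent hx U a b \<and> hx a \<le> \<tau> \<and> \<tau> \<le> hx b" if "hx c \<le> \<tau>" "\<tau> \<le> hx d" for \<tau>
    using adjacent_interval[OF finU injU U(2,3) cd(3) that] by blast
  have Sat: "\<exists>a b. adjacent hx S a b \<and> hx c \<le> hx a \<and> hx b \<le> hx d \<and> hx a \<le> \<tau> \<and> \<tau> \<le> hx b" if "hx c \<le> \<tau>" "\<tau> \<le> hx d" for \<tau>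
    using adjacent_interval[OF P(4,5) cd that] by blast
  have SB': "a \<in> B" "b \<in> B" "hx a < hx b" if "adjacent hx S a b" "hx c \<le> hx a" "hx b \<le> hx d" for a b
    using SB adjacentD(1-3)[OF that(1)] that(2,3) by force+
  have union: "wedges S \<union> convex hull B = wedges ?S'"
  proof (intro equalityI subsetI)
    fix q assume q: "q \<in> wedges S \<union> convex hull B"
    show "q \<in> wedges ?S'"
    proof (cases "q \<in> convex hull B")
      case True
      obtain a b where ab: "adjacent hx U a b" "hx a \<le> hx q" "hx q \<le> hx b" using Uat[OF hxq[OF True]] by blast
      then have "adjacent hx ?S' a b" using adjS' by blast
      then show ?thesis unfolding mem_wedges[OF S'] using ab fq[OF True] up[OF ab(1) True] by blast
    next
      case False
      then have "q \<in> wedges S" using q by blast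
      then consider "q = R" | a b where "0 < ff q" "adjacent hx S a b" "hx a \<le> hx q" "hx q \<le> hx b" "hy q \<le> hlin a b (hx q)"
        unfolding mem_wedges[OF S] by blast
      then show ?thesis
      proof cases
        case 1
        then show ?thesis unfolding mem_wedges[OF S'] by blast
      next
        case 2
        show ?thesis
        proof (cases "hx b \<le> hx c \<or> hx d \<le> hx a")
          case True
          then have "adjacent hx ?S' a b" using adjS' 2(2) by blast
          then show ?thesis unfolding mem_wedges[OF S'] using 2 by blast
        next
          case False
          then have ab: "hx c \<le> hx a" "hx b \<le> hx d" using adjacentD(4)[OF 2(2)] cd by blast+
          then obtain a' b' where U1: "adjacent hx U a' b'" "hx a' \<le> hx q" "hx q \<le> hx b'" using Uat[of "hx q"] 2 by force
          have "hlin a b (hx q) \<le> hlin a' b' (hx q)"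
          proof -
            note e = path_edge[OF S 2(2)]
            obtain l where l: "l \<in> convex hull {a, b}" "hx l = hx q" "hy l = hlin a b (hx q)"
              using point_on_segment[OF e(3-5) 2(3,4)] by blast
            have "l \<in> convex hull B" using l(1) hull_mono[of "{a, b}" B convex] SB'[OF 2(2) ab] by blast
            from up[OF U1(1) this] show ?thesis using l by simp
          qed
          then have "hy q \<le> hlin a' b' (hx q)" using 2(5) by simp
          moreover have "adjacent hx ?S' a' b'" using adjS' U1(1) by blast
          ultimately show ?thesis unfolding mem_wedges[OF S'] using U1 2(1) by blast
        qed
      qed
    qed
  next
    fix q assume "q \<in> wedges ?S'"
    then consider "q = R" | a b where "0 < ff q" "adjacent hx ?S' a b" "hx a \<le> hx q" "hx q \<le> hx b" "hy q \<le> hlin a b (hx q)"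
      unfolding mem_wedges[OF S'] by blast
    then show "q \<in> wedges S \<union> convex hull B"
    proof cases
      case 1
      then show ?thesis using mem_wedges[OF S] by blast
    next
      case 2
      consider "adjacent hx U a b" | "adjacent hx S a b" using 2(2) unfolding adjS' by blast
      then show ?thesis
      proof cases
        case 1
        note A = adjacentD[OF 1]
        have "hx c \<le> hx q" "hx q \<le> hx d" using bnd[of a] bnd[of b] U(1) A(1,2) 2(3,4) by force+
        then obtain a' b' where L: "adjacent hx S a' b'" "hx c \<le> hx a'" "hx b' \<le> hx d" "hx a' \<le> hx q" "hx q \<le> hx b'"
          using Sat by blast
        show ?thesis
        proof (cases "hy q \<le> hlin a' b' (hx q)")
          case True
          then show ?thesis using L 2(1) mem_wedges[OF S] by blast
        next
          case False
          have "a \<in> B" "b \<in> B" using A(1,2) U(1) by blast+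
          then have "q \<in> convex hull B"
            using SB'[OF L(1-3)] A(3) L(4,5) 2 False by (intro mem_between[OF BX, of a' b' a b]) auto
          then show ?thesis by blast
        qed
      next
        case 2
        then show ?thesis using \<open>0 < ff q\<close> \<open>hx a \<le> hx q\<close> \<open>hx q \<le> hx b\<close> \<open>hy q \<le> hlin a b (hx q)\<close> mem_wedges[OF S] by blast
      qed
    qed
  qed
  note TD = trifamsD[OF T]
  \<comment> \<open>The replaced path edges: old and new triangles can meet only along them.\<close>
  define E where "E = {{a, b} |a b. adjacent hx S a b \<and> hx c \<le> hx a \<and> hx b \<le> hx d}"
  have comp': "compat (\<V> \<union> \<T>)"
  proof (rule compat_Un[where E = E])
    show "compat \<V>" by (rule comp)
    show "compat \<T>" unfolding compat_def using TD(3) by blast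
    show "\<not> affine_dependent V" if "V \<in> \<V>" for V using triple_independent[OF gpM] V3[OF that] by blast
    show "\<not> affine_dependent V" if "V \<in> \<T>" for V
      using triple_independent[OF gpM, of V] TD(1,2)[OF that] BX X_M(1) by blast
    show "\<exists>V\<in>\<V>. e \<subseteq> V" if "e \<in> E" for e using that adjV unfolding E_def by blast
    show "\<exists>V\<in>\<T>. e \<subseteq> V" if "e \<in> E" for e
    proof -
      obtain a b where e: "e = {a, b}" "adjacent hx S a b" "hx c \<le> hx a" "hx b \<le> hx d" using \<open>e \<in> E\<close> unfolding E_def by blast
      have "\<forall>s\<in>B - {a, b}. hlin a b (hx s) < hy s" using LH[OF e(2-4)] by blast
      then show ?thesis unfolding e(1) using trifams_side[OF T BX SB'[OF e(2-4)]] by blast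
    qed
    show "(\<Union>V\<in>\<V>. convex hull V) \<inter> (\<Union>V\<in>\<T>. convex hull V) \<subseteq> (\<Union>e\<in>E. convex hull e)"
    proof
      fix q assume "q \<in> (\<Union>V\<in>\<V>. convex hull V) \<inter> (\<Union>V\<in>\<T>. convex hull V)"
      then have q: "q \<in> wedges S" "q \<in> convex hull B" using un TD(4) by auto
      have "q \<noteq> R" using fq[OF q(2)] by auto
      then obtain a b where ab: "adjacent hx S a b" "hx a \<le> hx q" "hx q \<le> hx b" "hy q \<le> hlin a b (hx q)"
        using q(1) unfolding mem_wedges[OF S] by blast
      obtain a' b' where L: "adjacent hx S a' b'" "hx c \<le> hx a'" "hx b' \<le> hx d" "hx a' \<le> hx q" "hx q \<le> hx b'"
        using Sat hxq[OF q(2)] by blast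
      have "hlin a b (hx q) = hlin a' b' (hx q)" by (rule adjacent_lin_eq[OF P(5) ab(1) L(1) ab(2,3) L(4,5)])
      then have "hy q = hlin a' b' (hx q)" using ab(4) low[OF L(1-3) q(2)] by simp
      then have "q \<in> convex hull {a', b'}" using mem_segment[OF path_edge(3-5)[OF S L(1)] fq[OF q(2)] L(4,5)] by blast
      then show "q \<in> (\<Union>e\<in>E. convex hull e)" using L(1-3) unfolding E_def by blast
    qed
  qed
  have "\<exists>V\<in>\<V> \<union> \<T>. {a, b} \<subseteq> V" if "adjacent hx ?S' a b" for a b
  proof -
    consider "adjacent hx U a b" | "adjacent hx S a b" using \<open>adjacent hx ?S' a b\<close> unfolding adjS' by blast
    then show ?thesis
    proof cases
      case 1
      have "a \<in> B" "b \<in> B" "hx a < hx b" using adjacentD(1-3)[OF 1] U(1) by blast+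
      from trifams_side[OF T BX this disjI2] have "\<exists>V\<in>\<T>. {a, b} \<subseteq> V" using UH[OF 1] by simp
      then show ?thesis by blast
    next
      case 2
      then show ?thesis using adjV by blast
    qed
  qed
  moreover have "V \<subseteq> M \<and> card V = 3" if "V \<in> \<V> \<union> \<T>" for V using that V3 TD(1,2) BX X_M(1) by blast
  moreover have "(\<Union>V\<in>\<V> \<union> \<T>. convex hull V) = wedges ?S'" using union un TD(4) by auto
  ultimately show ?thesis unfolding state_def using S' comp' by blast
qed

end

lemma singleton_trifam: "card B = 3 \<Longrightarrow> {B} \<in> trifams B"
  by (auto simp: trifams_def)

section \<open>Completing a triangulation of the region below a path\<close>

context star
begin

lemma wedges_subset_hull:
  assumes "S \<in> paths"
  shows "wedges S \<subseteq> convex hull M"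
  unfolding wedges_def using stateD(2)[OF state_fan[OF assms]] hull_mono[of _ M convex] by blast

lemma path_subset_wedges:
  assumes S: "S \<in> paths" and s: "s \<in> S"
  shows "s \<in> wedges S"
proof -
  have sX: "s \<in> X" using s pathD(1)[OF S] by blast
  obtain a b where ab: "adjacent hx S a b" "hx a \<le> hx s" "hx s \<le> hx b"
    using path_edge_at[OF S] bounds[OF sX] by blast
  have "hgt S s = hlin a b (hx s)" by (rule hgt_on_edge[OF S ab(1) sX ab(2,3)])
  then have "hy s = hlin a b (hx s)" using s by (simp add: hgt_def)
  then show ?thesis unfolding mem_wedges[OF S] using ab ff_pos[OF sX] by force
qed

text \<open>Where the path bends upwards at \<open>t\<close>, the triangle \<open>a t b\<close>
  fills the notch and \<open>t\<close> leaves the path. This is \<open>block_step\<close> for a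
  block of three points with upper hull \<open>{a, b}\<close>.\<close>

lemma drop_corner:
  assumes st: "state \<V> S" and e: "adjacent hx S a t" "adjacent hx S t b" and k: "hy t < hlin a b (hx t)"
  shows "state (insert {a, t, b} \<V>) (S - {t})"
proof -
  note S = stateD(1)[OF st]
  note A = adjacentD[OF e(1)] and B = adjacentD[OF e(2)]
  note X = path_edge[OF S e(1)] path_edge[OF S e(2)]
  have lt: "hx a < hx t" "hx t < hx b" using A(3) B(3) by auto
  have ne: "a \<noteq> t" "t \<noteq> b" "a \<noteq> b" using lt by auto
  have between: "s \<in> {a, t, b}" if "s \<in> S" "hx a \<le> hx s" "hx s \<le> hx b" for s
  proof -
    have "s \<in> X" using that(1) pathD(1)[OF S] by blast
    moreover have "hx s = hx a \<or> hx s = hx t \<or> hx s = hx b" using A(4)[OF that(1)] B(4)[OF that(1)] that(2,3) by linarith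
    ultimately show ?thesis using hx_neq[of s a] hx_neq[of s t] hx_neq[of s b] X by blast
  qed
  have edge: "a' = a \<and> b' = t \<or> a' = t \<and> b' = b" if "adjacent hx S a' b'" "hx a \<le> hx a'" "hx b' \<le> hx b" for a' b'
  proof -
    note C = adjacentD[OF that(1)]
    have "a' \<in> {a, t, b}" "b' \<in> {a, t, b}" using between C(1-3) that(2,3) by force+
    then show ?thesis using C(3) C(4)[of t] A(2) lt by auto
  qed
  have "state (\<V> \<union> {{a, t, b}}) ({s \<in> S. hx s \<le> hx a \<or> hx b \<le> hx s} \<union> {a, b})"
  proof (rule block_step[OF st])
    show "{a, t, b} \<subseteq> X" using X by blast
    show "{{a, t, b}} \<in> trifams {a, t, b}" using ne by (intro singleton_trifam) simp
    show "a \<in> S" "b \<in> S" "hx a < hx b" using A(1) B(2) lt by auto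
    show "hx a \<le> hx s \<and> hx s \<le> hx b" if "s \<in> {a, t, b}" for s using that lt by auto
    show "hlin a' b' (hx s) < hy s" if "adjacent hx S a' b'" "hx a \<le> hx a'" "hx b' \<le> hx b" "s \<in> {a, t, b} - {a', b'}" for a' b' s
    proof -
      have "hlin a t (hx b) < hy b" "hlin t b (hx a) < hy a" using lin_kink_iff(1,2)[of hx a t b hy, OF lt] k by auto
      then show ?thesis using edge[OF that(1-3)] that(4) ne by blast
    qed
    show "s \<in> {a, t, b}" if "s \<in> S" "hx a \<le> hx s" "hx s \<le> hx b" for s by (rule between[OF that])
    show "{a, b} \<subseteq> {a, t, b}" "a \<in> {a, b}" "b \<in> {a, b}" by auto
    show "hy s < hlin a' b' (hx s)" if "adjacent hx {a, b} a' b'" "s \<in> {a, t, b} - {a', b'}" for a' b' s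
    proof -
      have "a' = a" "b' = b" using adjacentD(1-3)[OF that(1)] lt by auto
      then show ?thesis using that(2) k by blast
    qed
  qed
  moreover have "{s \<in> S. hx s \<le> hx a \<or> hx b \<le> hx s} \<union> {a, b} = S - {t}"
  proof (intro equalityI subsetI)
    fix s assume "s \<in> S - {t}"
    then show "s \<in> {s \<in> S. hx s \<le> hx a \<or> hx b \<le> hx s} \<union> {a, b}" using between[of s] by force
  qed (use A(1) B(2) lt ne in auto)
  ultimately show ?thesis by simp
qed

text \<open>The triangle \<open>a t b\<close> is put on the edge \<open>a b\<close> and
  \<open>t\<close> joins the path: a block of three points whose upper hull contains all of
  them.\<close>

lemma add_apex:
  assumes st: "state \<V> S" and e: "adjacent hx S a b" and t: "t \<in> X" "hx a < hx t" "hx t < hx b" "hlin a b (hx t) < hy t"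
  shows "state (insert {a, t, b} \<V>) (insert t S)"
proof -
  note S = stateD(1)[OF st]
  note A = adjacentD[OF e]
  note X = path_edge[OF S e]
  note lt = t(2,3)
  have ne: "a \<noteq> t" "t \<noteq> b" "a \<noteq> b" using lt by auto
  have between: "s \<in> {a, b}" if "s \<in> S" "hx a \<le> hx s" "hx s \<le> hx b" for s
  proof -
    have "s \<in> X" using that(1) pathD(1)[OF S] by blast
    moreover have "hx s = hx a \<or> hx s = hx b" using A(4)[OF that(1)] that(2,3) by linarith
    ultimately show ?thesis using hx_neq[of s a] hx_neq[of s b] X by blast
  qed
  have edge: "a' = a \<and> b' = b" if "adjacent hx S a' b'" "hx a \<le> hx a'" "hx b' \<le> hx b" for a' b'
  proof -
    note C = adjacentD[OF that(1)]
    have "a' \<in> {a, b}" "b' \<in> {a, b}" using between C(1-3) that(2,3) by force+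
    then show ?thesis using C(3) A(3) by auto
  qed
  have "state (\<V> \<union> {{a, t, b}}) ({s \<in> S. hx s \<le> hx a \<or> hx b \<le> hx s} \<union> {a, t, b})"
  proof (rule block_step[OF st])
    show "{a, t, b} \<subseteq> X" using X t(1) by blast
    show "{{a, t, b}} \<in> trifams {a, t, b}" using ne by (intro singleton_trifam) simp
    show "a \<in> S" "b \<in> S" "hx a < hx b" using A(1-3) by auto
    show "hx a \<le> hx s \<and> hx s \<le> hx b" if "s \<in> {a, t, b}" for s using that lt by auto
    show "hlin a' b' (hx s) < hy s" if "adjacent hx S a' b'" "hx a \<le> hx a'" "hx b' \<le> hx b" "s \<in> {a, t, b} - {a', b'}" for a' b' s
      using edge[OF that(1-3)] that(4) t(4) by blast
    show "s \<in> {a, t, b}" if "s \<in> S" "hx a \<le> hx s" "hx s \<le> hx b" for s using between[OF that] by blast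
    show "{a, t, b} \<subseteq> {a, t, b}" "a \<in> {a, t, b}" "b \<in> {a, t, b}" by auto
    show "hy s < hlin a' b' (hx s)" if "adjacent hx {a, t, b} a' b'" "s \<in> {a, t, b} - {a', b'}" for a' b' s
    proof -
      have "a' = a \<and> b' = t \<or> a' = t \<and> b' = b" using adjacentD(1-3)[OF that(1)] adjacentD(4)[OF that(1), of t] lt by auto
      moreover have "hy b < hlin a t (hx b)" "hy a < hlin t b (hx a)" using lin_kink_iff(3,4)[of hx a t b hy, OF lt] t(4) by auto
      ultimately show ?thesis using that(2) ne by blast
    qed
  qed
  moreover have "{s \<in> S. hx s \<le> hx a \<or> hx b \<le> hx s} \<union> {a, t, b} = insert t S"
  proof (intro equalityI subsetI)
    fix s assume "s \<in> insert t S"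
    then show "s \<in> {s \<in> S. hx s \<le> hx a \<or> hx b \<le> hx s} \<union> {a, t, b}" using between[of s] by force
  qed (use A(1,2) in auto)
  ultimately show ?thesis by simp
qed

lemma hull_M_pos:
  assumes "q \<in> convex hull M" "q \<noteq> R"
  shows "0 < ff q"
proof -
  have "X \<noteq> {}" using pX by blast
  have "q \<in> convex hull (insert R X)" by (subst X_M(3)[symmetric]) (rule assms(1))
  then obtain s t r where st: "0 \<le> s" "0 \<le> t" "s + t = 1" "r \<in> convex hull X" "q = s *\<^sub>R R + t *\<^sub>R r"
    unfolding convex_hull_insert[OF \<open>X \<noteq> {}\<close>] by blast
  have "ff q = t * ff r" unfolding st(5) ff_comb[OF st(3)] by simp
  moreover have "0 < ff r" by (rule hull_ff_pos[OF st(4) ff_pos])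
  moreover have "t \<noteq> 0" using st(3,5) assms(2) by auto
  ultimately show ?thesis using st(2) by simp
qed

text \<open>Without upward bends the path is concave, so by \<open>convex_chain\<close> for
  \<open>- hy\<close> it lies below the line of each of its edges. If no point is above the path
  either, it is the upper hull of \<open>X\<close>.\<close>

lemma wedges_eq_hull:
  assumes S: "S \<in> paths" and X: "X \<subseteq> wedges S"
    and nc: "\<And>a t b. adjacent hx S a t \<Longrightarrow> adjacent hx S t b \<Longrightarrow> \<not> hy t < hlin a b (hx t)"
  shows "wedges S = convex hull M"
proof (intro equalityI wedges_subset_hull[OF S] subsetI)
  fix q assume q: "q \<in> convex hull M"
  note P = pathD[OF S]
  show "q \<in> wedges S"
  proof (cases "q = R")
    case True
    then show ?thesis unfolding mem_wedges[OF S] by blast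
  next
    case False
    note fq = hull_M_pos[OF q False]
    have "hx p1 \<le> hx q" by (rule hull_hx(1)[OF q fq]) (use X_M(3) ff_pos bounds in blast)
    moreover have "hx q \<le> hx p2" by (rule hull_hx(2)[OF q fq]) (use X_M(3) ff_pos bounds in blast)
    ultimately obtain a b where ab: "adjacent hx S a b" "hx a \<le> hx q" "hx q \<le> hx b" using path_edge_at[OF S] by blast
    note ab' = path_edge[OF S ab(1)]
    have conc: "- hy t < lin hx (\<lambda>s. - hy s) s w (hx t)" if "adjacent hx S s t" "adjacent hx S t w" for s t w
    proof -
      note e = path_edge[OF S that(1)] path_edge[OF S that(2)]
      have "s \<noteq> w" "w \<noteq> t" "s \<noteq> t" using e(5,12) by auto
      then have "hy t \<noteq> hlin s w (hx t)" using gp[of s w t] e by blast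
      then show ?thesis using nc[OF that] by (simp add: lin_uminus)
    qed
    have onS: "hy r \<le> hlin a b (hx r)" if r: "r \<in> S" for r
    proof (cases "r = a \<or> r = b")
      case True
      then show ?thesis using ab'(5) by auto
    next
      case False
      have "lin hx (\<lambda>s. - hy s) a b (hx r) < - hy r"
      proof (rule convex_chain[where c = p1 and d = p2, OF P(4,5) ab(1)])
        show "hx p1 \<le> hx a" "hx b \<le> hx p2" using bounds ab'(1,2) by blast+
        show "hx p1 \<le> hx r" "hx r \<le> hx p2" using bounds P(1) r by blast+
      qed (use conc False r in blast)+
      then show ?thesis by (simp add: lin_uminus)
    qed
    have "hy s \<le> hlin a b (hx s)" if s: "s \<in> X" for s
    proof -
      have "s \<noteq> R" using s X_M(2) by blast
      then obtain a' b' where e: "adjacent hx S a' b'" "hx a' \<le> hx s" "hx s \<le> hx b'" "hy s \<le> hlin a' b' (hx s)"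
        using subsetD[OF X s] unfolding mem_wedges[OF S] by blast
      note e' = path_edge[OF S e(1)]
      have "hlin a' b' (hx s) \<le> lin hx (\<lambda>r. hlin a b (hx r)) a' b' (hx s)"
        using e'(5) e(2,3) onS[OF e'(6)] onS[OF e'(7)] by (intro lin_mono) auto
      also have "\<dots> = hlin a b (hx s)" using e'(5) by (intro lin_lin) auto
      finally show ?thesis using e(4) by simp
    qed
    then have "\<And>s. s \<in> M \<Longrightarrow> s = R \<or> 0 < ff s \<and> hy s \<le> hlin a b (hx s)" using X_M(3) ff_pos by blast
    from hull_below[OF q this less_imp_neq[OF ab'(5)] fq] show ?thesis
      unfolding mem_wedges[OF S] using ab fq by blast
  qed
qed

text \<open>As long as the hull is not filled, there is a notch to fill or a point above the path to
  which a triangle can be erected. Filling a notch shortens the path; a new apex lengthens it by one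
  but lowers the number of points above it, whence the weight 2 in the measure. Neither kind of
  triangle uses \<open>R\<close>.\<close>

lemma state_extend:
  assumes "state \<V> S"
  shows "\<exists>\<T>\<in>trifams M. \<V> \<subseteq> \<T> \<and> (\<forall>V\<in>\<T> - \<V>. R \<notin> V)"
  using assms
proof (induction "card S + 2 * card {s \<in> X. s \<notin> wedges S}" arbitrary: \<V> S rule: less_induct)
  case less
  note st = less.prems
  note S = stateD(1)[OF st]
  have grow: "wedges S \<subseteq> wedges S'" if "state (insert V \<V>) S'" for V S'
    unfolding stateD(4)[OF that, symmetric] stateD(4)[OF st, symmetric] by blast
  have finO: "finite {s \<in> X. s \<notin> wedges S'}" for S' using fin by simp
  have RX: "R \<notin> V" if "V \<subseteq> X" for V using that X_M(2) by blast
  have step: ?case if st': "state (insert V \<V>) S'" "V \<subseteq> X"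
    and less': "card S' + 2 * card {s \<in> X. s \<notin> wedges S'} < card S + 2 * card {s \<in> X. s \<notin> wedges S}" for V S'
  proof -
    obtain \<T> where "\<T> \<in> trifams M" "insert V \<V> \<subseteq> \<T>" "\<forall>W\<in>\<T> - insert V \<V>. R \<notin> W"
      using less.hyps[OF less' st'(1)] by blast
    then show ?thesis using RX[OF st'(2)] by blast
  qed
  show ?case
  proof (cases "\<exists>a t b. adjacent hx S a t \<and> adjacent hx S t b \<and> hy t < hlin a b (hx t)")
    case True
    then obtain a t b where e: "adjacent hx S a t" "adjacent hx S t b" "hy t < hlin a b (hx t)" by blast
    have st': "state (insert {a, t, b} \<V>) (S - {t})" by (rule drop_corner[OF st e])
    have "card (S - {t}) < card S" using pathD(4)[OF S] path_edge(7)[OF S e(1)] by (intro card_Diff1_less)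
    moreover have "card {s \<in> X. s \<notin> wedges (S - {t})} \<le> card {s \<in> X. s \<notin> wedges S}"
      by (rule card_mono[OF finO]) (use grow[OF st'] in blast)
    ultimately show ?thesis using step[OF st'] path_edge[OF S e(1)] path_edge[OF S e(2)] by simp
  next
    case nc: False
    show ?thesis
    proof (cases "X \<subseteq> wedges S")
      case False
      then obtain t where t: "t \<in> X" "t \<notin> wedges S" by blast
      obtain a b where ab: "adjacent hx S a b" "hx a \<le> hx t" "hx t \<le> hx b" using path_edge_at[OF S] bounds[OF t(1)] by blast
      note ab' = path_edge[OF S ab(1)]
      have tS: "t \<notin> S" using path_subset_wedges[OF S] t(2) by blast
      then have "hx t \<noteq> hx a" "hx t \<noteq> hx b" using hx_neq[OF t(1)] ab' by blast+
      then have lt: "hx a < hx t" "hx t < hx b" using ab by auto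
      have "hlin a b (hx t) < hy t" using t(2) ab ff_pos[OF t(1)] unfolding mem_wedges[OF S] by force
      then have st': "state (insert {a, t, b} \<V>) (insert t S)" by (intro add_apex[OF st ab(1) t(1) lt])
      have "t \<in> wedges (insert t S)" by (rule path_subset_wedges[OF stateD(1)[OF st']]) simp
      then have "{s \<in> X. s \<notin> wedges (insert t S)} \<subset> {s \<in> X. s \<notin> wedges S}" using grow[OF st'] t by blast
      then have "card {s \<in> X. s \<notin> wedges (insert t S)} < card {s \<in> X. s \<notin> wedges S}" by (rule psubset_card_mono[OF finO])
      moreover have "card (insert t S) = Suc (card S)" using tS pathD(4)[OF S] by simp
      ultimately show ?thesis using step[OF st'] ab' t(1) by simp
    next
      case True
      have "wedges S = convex hull M" by (rule wedges_eq_hull[OF S True]) (use nc in blast)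
      then have "\<V> \<in> trifams M" using stateD[OF st] unfolding trifams_def compat_def by simp
      then show ?thesis by blast
    qed
  qed
qed

text \<open>A block of two points is a segment. Its single, empty triangulation corresponds to
  \<open>catalan 0 = 1\<close>.\<close>

definition block_trifams :: "point set \<Rightarrow> point set set set" where
  "block_trifams B = (if card B \<le> 2 then {{}} else trifams B)"

lemma block_props:
  assumes S: "S \<in> paths" and c: "c \<in> corners S"
  shows "block S c \<subseteq> X" "finite (block S c)" "c \<in> block S c" "stop S c \<in> block S c"
    "\<And>s. s \<in> block S c \<Longrightarrow> hx c \<le> hx s \<and> hx s \<le> hx (stop S c)"
    "\<And>s. s \<in> S \<Longrightarrow> hx c \<le> hx s \<Longrightarrow> hx s \<le> hx (stop S c) \<Longrightarrow> s \<in> block S c"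
proof -
  note t = stop_props[OF S c] and P = pathD[OF S]
  have X: "c \<in> X" "stop S c \<in> X" using t(4,5) P(1) by blast+
  show sub: "block S c \<subseteq> X" by (auto simp: block_def)
  show "finite (block S c)" by (rule finite_subset[OF sub fin])
  show "c \<in> block S c" "stop S c \<in> block S c" using X by (auto simp: block_def)
  show "\<And>s. s \<in> block S c \<Longrightarrow> hx c \<le> hx s \<and> hx s \<le> hx (stop S c)" using t(2) by (auto simp: block_def)
  fix s assume s: "s \<in> S" "hx c \<le> hx s" "hx s \<le> hx (stop S c)"
  have sX: "s \<in> X" using s(1) P(1) by blast
  show "s \<in> block S c"
  proof (cases "s = c \<or> s = stop S c")
    case False
    then have lt: "hx c < hx s" "hx s < hx (stop S c)" using hx_neq[OF sX X(1)] hx_neq[OF sX X(2)] s(2,3) by force+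
    have "s \<notin> corners S" using t(3)[of s] lt by auto
    then have "s \<notin> cut S" using s(1) by (auto simp: corners_def)
    then show ?thesis using lt sX by (simp add: block_def)
  qed (use X in \<open>auto simp: block_def\<close>)
qed

text \<open>Induction on the set \<open>D\<close> of corners whose blocks are glued already. The
  invariant is that over the other blocks the path is still \<open>S\<close>, so that
  \<open>block_above\<close> applies to the next one; it persists because the ranges of two blocks
  share at most an end.\<close>

lemma glue_blocks:
  assumes S: "S \<in> paths" and D: "D \<subseteq> corners S" and T: "\<forall>c\<in>corners S. T c \<in> block_trifams (block S c)"
  shows "\<exists>S'. state (fan S \<union> (\<Union>c\<in>D. T c)) S' \<and>
    (\<forall>c\<in>corners S - D. \<forall>s. hx c \<le> hx s \<and> hx s \<le> hx (stop S c) \<longrightarrow> (s \<in> S' \<longleftrightarrow> s \<in> S))"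
proof -
  have "corners S \<subseteq> S" by (rule corners_subset(1)[OF S])
  then have "finite D" using D pathD(4)[OF S] by (meson finite_subset)
  then show ?thesis using D
  proof (induction D)
    case empty
    then show ?case using state_fan[OF S] by (intro exI[of _ S]) simp
  next
    case (insert c D)
    then obtain S' where S': "state (fan S \<union> (\<Union>c\<in>D. T c)) S'"
      and agree: "\<And>c s. c \<in> corners S - D \<Longrightarrow> hx c \<le> hx s \<Longrightarrow> hx s \<le> hx (stop S c) \<Longrightarrow> s \<in> S' \<longleftrightarrow> s \<in> S" by blast
    have c: "c \<in> corners S" "c \<in> corners S - D" using insert by blast+
    note b = block_props[OF S c(1)] and t = stop_props[OF S c(1)]
    show ?case
    proof (cases "card (block S c) \<le> 2")
      case True
      then have "T c = {}" using bspec[OF T c(1)] by (simp add: block_trifams_def)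
      then show ?thesis using S' agree by (intro exI[of _ S']) auto
    next
      case False
      let ?B = "block S c" and ?d = "stop S c"
      have TB: "T c \<in> trifams ?B" using bspec[OF T c(1)] False by (simp add: block_trifams_def)
      obtain U where U: "U \<subseteq> ?B" "c \<in> U" "?d \<in> U"
        "\<And>a b s. adjacent hx U a b \<Longrightarrow> s \<in> ?B - {a, b} \<Longrightarrow> hy s < hlin a b (hx s)"
      proof (rule upper_hull_exists[of ?B hx hy c ?d])
        show "inj_on hx ?B" by (rule inj_on_subset[OF inj b(1)])
        show "\<And>a b c. a \<in> ?B \<Longrightarrow> b \<in> ?B \<Longrightarrow> c \<in> ?B \<Longrightarrow> a \<noteq> b \<Longrightarrow> b \<noteq> c \<Longrightarrow> a \<noteq> c \<Longrightarrow> hy c \<noteq> hlin a b (hx c)"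
          using gp b(1) by blast
      qed (use b in blast)+
      let ?S'' = "{s \<in> S'. hx s \<le> hx c \<or> hx ?d \<le> hx s} \<union> U"
      have "state ((fan S \<union> (\<Union>c\<in>D. T c)) \<union> T c) ?S''"
      proof (rule block_step[OF S' b(1) TB])
        show "c \<in> S'" "?d \<in> S'" using agree[OF c(2), of c] agree[OF c(2), of ?d] t by auto
        show "hx c < hx ?d" by (rule t(2))
        show "s \<in> ?B" if "s \<in> S'" "hx c \<le> hx s" "hx s \<le> hx ?d" for s
          using agree[OF c(2) that(2,3)] that b(6) by blast
        show "hlin a' b' (hx s) < hy s"
          if e: "adjacent hx S' a' b'" "hx c \<le> hx a'" "hx b' \<le> hx ?d" "s \<in> ?B - {a', b'}" for a' b' s
        proof -
          note A = adjacentD[OF e(1)]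
          have "hx r \<le> hx a' \<or> hx b' \<le> hx r" if "r \<in> S" for r
          proof (cases "hx c \<le> hx r \<and> hx r \<le> hx ?d")
            case True
            then show ?thesis using agree[OF c(2), of r] that A(4) by blast
          next
            case False
            then show ?thesis using e(2,3) by linarith
          qed
          moreover have "a' \<in> S" "b' \<in> S" using agree[OF c(2), of a'] agree[OF c(2), of b'] A(1-3) e(2,3) by auto
          ultimately have "adjacent hx S a' b'" using A(3) unfolding adjacent_def by blast
          then show ?thesis using block_above[OF S c(1) _ e(2,3)] e(4) by blast
        qed
        show "U \<subseteq> ?B" "c \<in> U" "?d \<in> U" by (fact U)+
        show "\<And>s. s \<in> ?B \<Longrightarrow> hx c \<le> hx s \<and> hx s \<le> hx ?d" by (rule b(5))
        show "\<And>a b s. adjacent hx U a b \<Longrightarrow> s \<in> ?B - {a, b} \<Longrightarrow> hy s < hlin a b (hx s)" by (rule U(4))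
      qed
      moreover have "(fan S \<union> (\<Union>c\<in>D. T c)) \<union> T c = fan S \<union> (\<Union>c\<in>insert c D. T c)" by blast
      moreover have "s \<in> ?S'' \<longleftrightarrow> s \<in> S"
        if c': "c' \<in> corners S - insert c D" and s: "hx c' \<le> hx s" "hx s \<le> hx (stop S c')" for c' s
      proof -
        have c'S: "c' \<in> corners S" "c' \<in> corners S - D" "c' \<noteq> c" using c' by blast+
        have "c' \<in> X" "c \<in> X" using c'S c(1) \<open>corners S \<subseteq> S\<close> pathD(1)[OF S] by blast+
        then have "hx c' \<noteq> hx c" using hx_neq c'S(3) by blast
        then have "hx ?d \<le> hx c' \<or> hx (stop S c') \<le> hx c"
          using t(3)[of c'] stop_props(3)[OF S c'S(1), of c] c'S(1) c(1) by (cases "hx c < hx c'") auto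
        then have out: "hx s \<le> hx c \<or> hx ?d \<le> hx s" using s by linarith
        have ag: "s \<in> S' \<longleftrightarrow> s \<in> S" by (rule agree[OF c'S(2) s])
        have "s \<in> S'" if "s \<in> U"
        proof -
          have sB: "s \<in> ?B" using U(1) \<open>s \<in> U\<close> by blast
          have "hx s = hx c \<or> hx s = hx ?d" using out b(5)[OF sB] by linarith
          then have "s = c \<or> s = ?d" using hx_neq[of s c] hx_neq[of s ?d] sB b(1,3,4) by blast
          then show ?thesis using ag t by blast
        qed
        then show ?thesis using out ag by blast
      qed
      ultimately show ?thesis by (intro exI[of _ ?S'']) auto
    qed
  qed
qed

text \<open>The choices remain visible in the result. The triangles added by
  \<open>state_extend\<close> avoid \<open>R\<close>, so those at \<open>R\<close> are the fan; and
  a triangle inside a block, being covered by \<open>T c\<close>, belongs to \<open>T c\<close> by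
  \<open>covered_triangle_mem\<close>.\<close>

lemma glue:
  assumes S: "S \<in> paths" and T: "\<And>c. c \<in> corners S \<Longrightarrow> T c \<in> block_trifams (block S c)"
  shows "\<exists>\<T>\<in>trifams M. {V \<in> \<T>. R \<in> V} = fan S \<and> (\<forall>c\<in>corners S. {V \<in> \<T>. V \<subseteq> block S c} = T c)"
proof -
  have T': "\<forall>c\<in>corners S. T c \<in> block_trifams (block S c)" using T by simp
  obtain S' where "state (fan S \<union> (\<Union>c\<in>corners S. T c)) S'" 
    using glue_blocks[of S "corners S" T, OF S order_refl T'] by (elim exE conjE) (rule that)
  from state_extend[OF this] obtain \<T> where tr: "\<T> \<in> trifams M" and sub: "fan S \<union> (\<Union>c\<in>corners S. T c) \<subseteq> \<T>"
    and noR0: "\<forall>V\<in>\<T> - (fan S \<union> (\<Union>c\<in>corners S. T c)). R \<notin> V" by (elim bexE conjE) (rule that)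
  have noR: "R \<notin> V" if "V \<in> \<T>" "V \<notin> fan S" "\<And>c. c \<in> corners S \<Longrightarrow> V \<notin> T c" for V
    using bspec[OF noR0, of V] that by simp
  note D = trifamsD[OF tr]
  have TB: "V \<subseteq> block S c" if "c \<in> corners S" "V \<in> T c" for V c
    using T[OF that(1)] that(2) by (auto simp: block_trifams_def trifams_def split: if_splits)
  have "{V \<in> \<T>. R \<in> V} = fan S"
  proof (intro equalityI subsetI)
    fix V assume V: "V \<in> {V \<in> \<T>. R \<in> V}"
    have "V \<notin> T c" if "c \<in> corners S" for c using TB[OF that, of V] V block_props(1)[OF S that] X_M(2) by blast
    then show "V \<in> fan S" using noR[of V] V by blast
  next
    fix V assume "V \<in> fan S"
    moreover then have "R \<in> V" unfolding fan_def by blast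
    ultimately show "V \<in> {V \<in> \<T>. R \<in> V}" using sub by blast
  qed
  moreover have "{V \<in> \<T>. V \<subseteq> block S c} = T c" if c: "c \<in> corners S" for c
  proof (intro equalityI subsetI)
    fix V assume V: "V \<in> {V \<in> \<T>. V \<subseteq> block S c}"
    have "3 \<le> card (block S c)" using card_mono[OF block_props(2)[OF S c], of V] V D(2)[of V] by auto
    then have Tc: "T c \<in> trifams (block S c)" using T[OF c] by (simp add: block_trifams_def split: if_splits)
    show "V \<in> T c"
    proof (rule covered_triangle_mem)
      show "compat \<T>" unfolding compat_def using D(3) by blast
      show "V \<in> \<T>" "T c \<subseteq> \<T>" using V sub c by blast+
      show "\<And>V. V \<in> \<T> \<Longrightarrow> card V = 3" by (rule D(2))
      show "\<not> affine_dependent V" using triple_independent[OF gpM D(1,2)] V by blast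
      show "convex hull V \<subseteq> (\<Union>W\<in>T c. convex hull W)" unfolding trifamsD(4)[OF Tc] using V by (simp add: hull_mono)
    qed
  qed (use sub c TB in blast)
  ultimately show ?thesis using tr by blast
qed

definition glued :: "point set set set" where
  "glued = {\<T> \<in> trifams M. \<exists>S\<in>paths. {V \<in> \<T>. R \<in> V} = fan S \<and>
     (\<forall>c\<in>corners S. {V \<in> \<T>. V \<subseteq> block S c} \<in> block_trifams (block S c))}"

lemma fan_inj:
  assumes "S \<in> paths" "S' \<in> paths" "fan S = fan S'"
  shows "S = S'"
proof -
  have *: "\<Union>(fan S) - {R} = S" if S: "S \<in> paths" for S
  proof (intro equalityI subsetI)
    fix s assume "s \<in> \<Union>(fan S) - {R}"
    then show "s \<in> S" using path_edge(6,7)[OF S] unfolding fan_def by blast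
  next
    fix s assume s: "s \<in> S"
    then have sX: "s \<in> X" using pathD(1)[OF S] by blast
    obtain a b where ab: "adjacent hx S a b" "hx a \<le> hx s" "hx s \<le> hx b" using path_edge_at[OF S] bounds[OF sX] by blast
    then have "hx s = hx a \<or> hx s = hx b" using adjacentD(4)[OF ab(1) s] by linarith
    then have "s = a \<or> s = b" using hx_neq[OF sX] path_edge[OF S ab(1)] by blast
    then have "s \<in> {R, a, b}" by blast
    moreover have "{R, a, b} \<in> fan S" using ab(1) unfolding fan_def by blast
    ultimately show "s \<in> \<Union>(fan S) - {R}" using sX X_M(2) by blast
  qed
  have "S = \<Union>(fan S') - {R}" unfolding assms(3)[symmetric] by (rule *[OF assms(1), symmetric])
  also have "\<dots> = S'" by (rule *[OF assms(2)])
  finally show ?thesis .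
qed

lemma finite_paths: "finite paths"
proof (rule finite_subset)
  show "paths \<subseteq> Pow X" using pathD(1) by blast
  show "finite (Pow X)" by (simp only: finite_Pow_iff fin)
qed

lemma finite_corners: "S \<in> paths \<Longrightarrow> finite (corners S)"
  by (rule finite_subset[OF corners_subset(1) pathD(4)])

text \<open>A path together with a choice for each of its blocks is recovered from the glued
  triangulation, the path through \<open>fan_inj\<close>. So these pairs inject into
  \<open>glued\<close>.\<close>

lemma card_glued_ge:
  "(\<Sum>S\<in>paths. \<Prod>c\<in>corners S. card (block_trifams (block S c))) \<le> card glued"
proof -
  define \<Sigma> where "\<Sigma> = Sigma paths (\<lambda>S. PiE (corners S) (\<lambda>c. block_trifams (block S c)))"
  define good where "good = (\<lambda>(S, T) \<T>. \<T> \<in> trifams M \<and> {V \<in> \<T>. R \<in> V} = fan S \<and> (\<forall>c\<in>corners S. {V \<in> \<T>. V \<subseteq> block S c} = T c))"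
  define g where "g p = (SOME \<T>. good p \<T>)" for p
  have g: "good p (g p)" if "p \<in> \<Sigma>" for p
  proof -
    obtain S T where p: "p = (S, T)" "S \<in> paths" "T \<in> PiE (corners S) (\<lambda>c. block_trifams (block S c))"
      using \<open>p \<in> \<Sigma>\<close> unfolding \<Sigma>_def by blast
    have "\<exists>\<T>. good p \<T>" using glue[OF p(2), of T] PiE_mem[OF p(3)] unfolding good_def p(1) by auto
    then show ?thesis unfolding g_def by (rule someI_ex)
  qed
  have "inj_on g \<Sigma>"
  proof (rule inj_onI)
    fix p p' assume pp: "p \<in> \<Sigma>" "p' \<in> \<Sigma>" "g p = g p'"
    obtain S T S' T' where p: "p = (S, T)" "p' = (S', T')" by (meson surj_pair)
    have gd: "good (S, T) (g p)" "good (S', T') (g p)" using g[OF pp(1)] g[OF pp(2)] pp(3) p by auto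
    have m: "S \<in> paths" "S' \<in> paths" "T \<in> PiE (corners S) (\<lambda>c. block_trifams (block S c))" "T' \<in> PiE (corners S') (\<lambda>c. block_trifams (block S' c))"
      using pp(1,2) unfolding p \<Sigma>_def by auto
    have "fan S = fan S'" using gd unfolding good_def by auto
    then have SS: "S = S'" by (rule fan_inj[OF m(1,2)])
    have "T = T'"
    proof (rule PiE_ext[OF m(3) m(4)[folded SS]])
      fix c assume "c \<in> corners S"
      then have "T c = {V \<in> g p. V \<subseteq> block S c}" "T' c = {V \<in> g p. V \<subseteq> block S c}" using gd SS unfolding good_def by auto
      then show "T c = T' c" by simp
    qed
    then show "p = p'" using p SS by simp
  qed
  moreover have "g ` \<Sigma> \<subseteq> glued"
  proof
    fix \<T> assume "\<T> \<in> g ` \<Sigma>"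
    then obtain S T where p: "(S, T) \<in> \<Sigma>" "\<T> = g (S, T)" by (metis imageE surj_pair)
    then have m: "S \<in> paths" "T \<in> PiE (corners S) (\<lambda>c. block_trifams (block S c))" unfolding \<Sigma>_def by auto
    have gd: "\<T> \<in> trifams M" "{V \<in> \<T>. R \<in> V} = fan S" "\<forall>c\<in>corners S. {V \<in> \<T>. V \<subseteq> block S c} = T c"
      using g[OF p(1)] unfolding good_def p(2) by simp_all
    have "{V \<in> \<T>. V \<subseteq> block S c} \<in> block_trifams (block S c)" if "c \<in> corners S" for c
      using bspec[OF gd(3) that] PiE_mem[OF m(2) that] by simp
    then show "\<T> \<in> glued" unfolding glued_def using gd(1,2) m(1) by blast
  qed
  moreover have "finite glued" by (rule finite_subset[OF _ finite_trifams[OF finM]]) (auto simp: glued_def)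
  ultimately have "card \<Sigma> \<le> card glued" by (intro card_inj_on_le)
  moreover have "card \<Sigma> = (\<Sum>S\<in>paths. card (PiE (corners S) (\<lambda>c. block_trifams (block S c))))"
    unfolding \<Sigma>_def
  proof (rule card_SigmaI[OF finite_paths], rule ballI)
    fix S assume S: "S \<in> paths"
    have "finite (block_trifams (block S c))" if "c \<in> corners S" for c
      using finite_trifams[OF block_props(2)[OF S that]] by (simp add: block_trifams_def)
    then show "finite (PiE (corners S) (\<lambda>c. block_trifams (block S c)))" by (intro finite_PiE finite_corners[OF S])
  qed
  moreover have "\<dots> = (\<Sum>S\<in>paths. \<Prod>c\<in>corners S. card (block_trifams (block S c)))"
    by (rule sum.cong[OF refl]) (rule card_PiE[OF finite_corners])
  ultimately show ?thesis by simp
qed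

lemma card_X: "card X = card M - 1"
  using finM RM by (simp add: X_def)

lemma catalan_le_block_trifams:
  assumes IH: "\<And>B. B \<subset> M \<Longrightarrow> 3 \<le> card B \<Longrightarrow> catalan (card B - 2) \<le> card (trifams B)"
    and S: "S \<in> paths" and c: "c \<in> corners S"
  shows "catalan (card (block S c) - 2) \<le> card (block_trifams (block S c))"
proof (cases "card (block S c) \<le> 2")
  case True
  then show ?thesis by (simp add: block_trifams_def catalan_0)
next
  case False
  have "block S c \<subset> M" using block_props(1)[OF S c] X_M by blast
  then show ?thesis using False IH[of "block S c"] by (simp add: block_trifams_def)
qed

text \<open>The bound counts glued triangulations only. In the equality case this leaves no room for
  any other triangulation.\<close>

lemma catalan_le_glued:
  assumes IH: "\<And>B. B \<subset> M \<Longrightarrow> 3 \<le> card B \<Longrightarrow> catalan (card B - 2) \<le> card (trifams B)"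
  shows "catalan (card M - 2) \<le> card glued"
proof -
  have "catalan (card M - 2) = catalan (card X - 1)" by (simp add: card_X numeral_2_eq_2)
  also have "\<dots> \<le> (\<Sum>S\<in>paths. \<Prod>c\<in>corners S. catalan (card (block S c) - 2))" by (rule catalan_le_sum_blocks)
  also have "\<dots> \<le> (\<Sum>S\<in>paths. \<Prod>c\<in>corners S. card (block_trifams (block S c)))"
    by (intro sum_mono prod_mono conjI catalan_le_block_trifams[OF IH]) auto
  also have "\<dots> \<le> card glued" by (rule card_glued_ge)
  finally show ?thesis .
qed

lemma glued_subset: "glued \<subseteq> trifams M"
  by (auto simp: glued_def)

end

lemma star_exists:
  assumes fin: "finite M" and gp: "general_position M" and card: "3 \<le> card M" and R: "R extreme_point_of convex hull M"
  obtains u v p1 p2 where "star R u v M p1 p2"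
proof -
  have RM: "R \<in> M" using R by (rule extreme_point_of_convex_hull)
  let ?X = "M - {R}"
  have "card ?X = card M - 1" using fin RM by simp
  then have "card ?X \<noteq> 0" using card by linarith
  then have ne: "?X \<noteq> {}" using card.empty by metis
  \<comment> \<open>Removing an extreme point keeps the hull convex, so \<open>R\<close> can be
    strictly separated from the other points.\<close>
  have "convex (convex hull M - {R})" using R extreme_point_of_stillconvex[of "convex hull M"] by (simp add: convex_convex_hull)
  moreover have "?X \<subseteq> convex hull M - {R}" using hull_subset[of M convex] by blast
  ultimately have "convex hull ?X \<subseteq> convex hull M - {R}" by (intro hull_minimal)
  then have "R \<notin> convex hull ?X" by blast
  moreover have "closed (convex hull ?X)" using fin by (simp add: compact_imp_closed finite_imp_compact_convex_hull)
  ultimately obtain u b where ub: "u \<bullet> R < b" "\<forall>s\<in>convex hull ?X. b < u \<bullet> s"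
    using separating_hyperplane_closed_point[OF convex_convex_hull] by blast
  have pos: "0 < u \<bullet> (s - R)" if "s \<in> ?X" for s
    using bspec[OF ub(2), of s] ub(1) hull_inc[OF that, of convex] by (simp add: inner_diff_right)
  \<comment> \<open>\<open>u\<close> turned by a right angle, which makes the determinant equal to
    \<open>u \<bullet> u\<close>.\<close>
  define v where "v = (vector [- u $ 2, u $ 1] :: point)"
  have "u \<noteq> 0" using ne pos by force
  then have "u \<bullet> u \<noteq> 0" by simp
  then have det: "u $ 1 * v $ 2 - u $ 2 * v $ 1 \<noteq> 0" by (simp add: v_def inner_vec_def sum_2)
  define r where "r s = (v \<bullet> (s - R)) / (u \<bullet> (s - R))" for s
  obtain p2 where p2: "p2 \<in> ?X" "\<And>s. s \<in> ?X \<Longrightarrow> r s \<le> r p2" using finite_argmax[of ?X r] fin ne by blast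
  obtain p1 where p1: "p1 \<in> ?X" "\<And>s. s \<in> ?X \<Longrightarrow> - r s \<le> - r p1" using finite_argmax[of ?X "\<lambda>s. - r s"] fin ne by blast
  have "star R u v M p1 p2"
  proof
    show "\<And>s. s \<in> ?X \<Longrightarrow> (v \<bullet> (p1 - R)) / (u \<bullet> (p1 - R)) \<le> (v \<bullet> (s - R)) / (u \<bullet> (s - R))" using p1(2) unfolding r_def by simp
    show "\<And>s. s \<in> ?X \<Longrightarrow> (v \<bullet> (s - R)) / (u \<bullet> (s - R)) \<le> (v \<bullet> (p2 - R)) / (u \<bullet> (p2 - R))" using p2(2) unfolding r_def by simp
  qed (use fin gp RM det pos p1(1) p2(1) card in blast)+
  then show ?thesis by (rule that)
qed

lemma hull_vertex_exists:
  fixes M :: "point set"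
  assumes "finite M" "M \<noteq> {}"
  obtains R where "R extreme_point_of convex hull M"
proof -
  have "convex hull M = convex hull {x. x extreme_point_of convex hull M}"
    by (rule Krein_Milman_polytope[OF assms(1)])
  then have "{x. x extreme_point_of convex hull M} \<noteq> {}" using assms(2) by force
  then show ?thesis using that by blast
qed

theorem catalan_le_card_trifams:
  assumes "finite M" "general_position M" "3 \<le> card M"
  shows "catalan (card M - 2) \<le> card (trifams M)"
  using assms
proof (induction "card M" arbitrary: M rule: less_induct)
  case less
  have "M \<noteq> {}" using less.prems(3) by auto
  then obtain R where R: "R extreme_point_of convex hull M" using hull_vertex_exists[OF less.prems(1)] by blast
  obtain u v p1 p2 where "star R u v M p1 p2" using star_exists[OF less.prems R] .
  then interpret star R u v M p1 p2 .
  have "catalan (card M - 2) \<le> card glued"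
  proof (rule catalan_le_glued)
    fix B assume B: "B \<subset> M" "3 \<le> card B"
    show "catalan (card B - 2) \<le> card (trifams B)"
    proof (rule less.hyps[OF psubset_card_mono[OF less.prems(1) B(1)] _ _ B(2)])
      show "finite B" using B(1) less.prems(1) finite_subset by blast
      show "general_position B" using B(1) less.prems(2) general_position_subset by blast
    qed
  qed
  also have "\<dots> \<le> card (trifams M)" by (rule card_mono[OF finite_trifams[OF less.prems(1)] glued_subset])
  finally show ?case .
qed

section \<open>Sets with the least number of triangulations\<close>

lemma is_sideI:
  assumes fin: "finite M" and ab: "a \<in> M" "b \<in> M" "a \<noteq> b"
    and w: "w \<bullet> a = c" "w \<bullet> b = c" "\<And>s. s \<in> M - {a, b} \<Longrightarrow> c < w \<bullet> s"
  shows "is_side M a b"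
proof -
  have ge: "c \<le> w \<bullet> s" if "s \<in> M" for s using w that by (cases "s = a"; cases "s = b") force+
  have "convex hull M \<inter> {q. w \<bullet> q = c} face_of convex hull M"
    by (rule face_of_Int_supporting_hyperplane_ge[OF convex_convex_hull]) (rule hull_ge[OF _ ge])
  moreover have "convex hull M \<inter> {q. w \<bullet> q = c} = convex hull {a, b}"
  proof (intro equalityI subsetI)
    fix q assume q: "q \<in> convex hull M \<inter> {q. w \<bullet> q = c}"
    have "q \<in> convex hull {v \<in> M. w \<bullet> v = c}" using convex_hull_supporting[OF fin ge] q by blast
    moreover have "{v \<in> M. w \<bullet> v = c} \<subseteq> {a, b}" using w(3) by force
    ultimately show "q \<in> convex hull {a, b}" using hull_mono by blast
  next
    fix q assume q: "q \<in> convex hull {a, b}"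
    then have "q \<in> convex hull M" using hull_mono[of "{a, b}" M convex] ab by blast
    moreover have "w \<bullet> q = c"
    proof -
      obtain s t where "s + t = 1" "q = s *\<^sub>R a + t *\<^sub>R b" using q unfolding convex_hull_2 by blast
      then have "w \<bullet> q = s * c + t * c" using w by (simp add: inner_add_right)
      also have "\<dots> = (s + t) * c" by (simp add: distrib_right)
      finally show ?thesis using \<open>s + t = 1\<close> by simp
    qed
    ultimately show "q \<in> convex hull M \<inter> {q. w \<bullet> q = c}" by blast
  qed
  moreover have "aff_dim (convex hull {a, b}) = 1" using ab(3) by (simp add: aff_dim_convex_hull aff_dim_2)
  ultimately show ?thesis unfolding is_side_def edge_of_def by (simp add: segment_convex_hull)
qed

section \<open>Paths with a single cut point, and triangulations that are not glued\<close>

context star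
begin

text \<open>Negating \<open>v\<close> changes the sign of \<open>hx\<close> and leaves
  \<open>hy\<close> alone, so statements about the left of a point transfer to the right.\<close>

lemma mirror: "star R u (- v) M p2 p1"
proof
  show "\<And>s. s \<in> M - {R} \<Longrightarrow> (- v \<bullet> (p2 - R)) / (u \<bullet> (p2 - R)) \<le> (- v \<bullet> (s - R)) / (u \<bullet> (s - R))"
    "\<And>s. s \<in> M - {R} \<Longrightarrow> (- v \<bullet> (s - R)) / (u \<bullet> (s - R)) \<le> (- v \<bullet> (p1 - R)) / (u \<bullet> (p1 - R))"
    using ends by simp_all
  show "u $ 1 * (- v) $ 2 - u $ 2 * (- v) $ 1 \<noteq> 0" using det by simp
qed (fact finM gpM RM pos p1 p2 card3)+

lemma mirror_hx: "star.hx R u (- v) = (\<lambda>q. - hx q)"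
  by (rule ext) (simp add: star.hx_def[OF mirror] star.gg_def[OF mirror] star.ff_def[OF mirror] hx_def gg_def ff_def)

lemma mirror_paths: "planar_chain.paths X p2 p1 = paths"
proof -
  interpret m: star R u "- v" M p2 p1 by (rule mirror)
  show ?thesis unfolding m.paths_def paths_def by blast
qed

lemma mirror_state: "star.state R u (- v) M p2 p1 = state"
proof -
  interpret m: star R u "- v" M p2 p1 by (rule mirror)
  have "m.fan S = fan S" for S
    unfolding m.fan_def fan_def mirror_hx adjacent_reflect by (auto simp: insert_commute)
  then have "m.wedges = wedges" unfolding m.wedges_def[abs_def] wedges_def[abs_def] by simp
  moreover have "(\<forall>a b. adjacent hx S b a \<longrightarrow> (\<exists>V\<in>\<V>. {a, b} \<subseteq> V)) \<longleftrightarrow> (\<forall>a b. adjacent hx S a b \<longrightarrow> (\<exists>V\<in>\<V>. {a, b} \<subseteq> V))" for S \<V>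
    unfolding insert_subset by blast
  ultimately have "m.state \<V> S \<longleftrightarrow> state \<V> S" for \<V> S
    unfolding m.state_def state_def mirror_hx adjacent_reflect mirror_paths by (simp only:)
  then show ?thesis by (intro ext) 
qed

lemma trifams_nonempty:
  assumes "B \<subseteq> M" "3 \<le> card B"
  shows "trifams B \<noteq> {}"
proof -
  have "catalan (card B - 2) \<le> card (trifams B)"
    by (rule catalan_le_card_trifams[OF finite_subset[OF assms(1) finM] general_position_subset[OF gpM assms(1)] assms(2)])
  then show ?thesis using catalan_pos[of "card B - 2"] by force
qed

text \<open>To the left of \<open>z\<close>, the path is the lower hull of all points of
  \<open>X\<close> there, \<open>z\<close> included.\<close>

definition descends_left :: "point set \<Rightarrow> point \<Rightarrow> bool" where
  "descends_left S z \<longleftrightarrow> (\<forall>a b s. adjacent hx S a b \<longrightarrow> hx b \<le> hx z \<longrightarrow> s \<in> X \<longrightarrow> hx s \<le> hx z \<longrightarrow> s \<notin> {a, b} \<longrightarrow> hlin a b (hx s) < hy s)"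

text \<open>If \<open>k\<close> is not on the path, it is attached as an apex. The path points from
  \<open>k\<close> to \<open>z\<close> then form a convex chain below the chord \<open>k z\<close>,
  and a triangulation of them makes this chord an edge of the new path. From \<open>z\<close> on to
  the right, the path does not change.\<close>

lemma reach_left:
  assumes st: "state \<V> S" and z: "z \<in> S" and k: "k \<in> X" "hx k < hx z" and low: "descends_left S z"
  shows "\<exists>\<V>' S'. state \<V>' S' \<and> \<V> \<subseteq> \<V>' \<and> (\<forall>V\<in>\<V>' - \<V>. R \<notin> V) \<and> adjacent hx S' k z \<and> (\<forall>s. hx z \<le> hx s \<longrightarrow> (s \<in> S' \<longleftrightarrow> s \<in> S))"
proof -
  have lowD: "hlin a b (hx s) < hy s" if "adjacent hx S a b" "hx b \<le> hx z" "s \<in> X" "hx s \<le> hx z" "s \<noteq> a" "s \<noteq> b" for a b s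
    using low that unfolding descends_left_def by simp
  note S = stateD(1)[OF st]
  have zX: "z \<in> X" using z pathD(1)[OF S] by blast
  obtain \<V>1 S1 where S1: "state \<V>1 S1" "\<V> \<subseteq> \<V>1" "\<forall>V\<in>\<V>1 - \<V>. R \<notin> V" "S1 = insert k S"
  proof (cases "k \<in> S")
    case True
    then have "insert k S = S" by blast
    then show ?thesis using that[of \<V> S] st by simp
  next
    case False
    obtain a b where ab: "adjacent hx S a b" "hx a \<le> hx k" "hx k \<le> hx b" using path_edge_at[OF S] bounds[OF k(1)] by blast
    note ab' = path_edge[OF S ab(1)]
    have ne: "k \<noteq> a" "k \<noteq> b" using False ab' by blast+
    then have lt: "hx a < hx k" "hx k < hx b" using ab hx_neq[OF k(1) ab'(1)] hx_neq[OF k(1) ab'(2)] by force+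
    have "hx b \<le> hx z" using adjacentD(4)[OF ab(1) z] lt(1) k(2) by linarith
    from lowD[OF ab(1) this k(1) less_imp_le[OF k(2)] ne]
    have "state (insert {a, k, b} \<V>) (insert k S)" by (rule add_apex[OF st ab(1) k(1) lt])
    moreover have "R \<notin> {a, k, b}" using ab' k(1) X_M(2) by blast
    ultimately show ?thesis using that[of "insert {a, k, b} \<V>" "insert k S"] by blast
  qed
  note P1 = stateD(1)[OF S1(1)]
  note F1 = pathD[OF P1]
  have kz: "k \<in> S1" "z \<in> S1" using S1(4) z by blast+
  have ag: "s \<in> S1 \<longleftrightarrow> s \<in> S" if "hx z \<le> hx s" for s using that k(2) S1(4) by auto
  show ?thesis
  proof (cases "adjacent hx S1 k z")
    case True
    then show ?thesis using S1(1-3) ag by blast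
  next
    case False
    define B where "B = {s \<in> S1. hx k \<le> hx s \<and> hx s \<le> hx z}"
    have BX: "B \<subseteq> X" using F1(1) by (auto simp: B_def)
    have kzB: "k \<in> B" "z \<in> B" "k \<noteq> z" using kz k(2) by (auto simp: B_def)
    obtain m where m: "m \<in> S1" "hx k < hx m" "hx m < hx z"
      using False kz k(2) unfolding adjacent_def by (meson not_le)
    have finB: "finite B" by (rule finite_subset[OF BX fin])
    have "{k, m, z} \<subseteq> B" using kzB m by (auto simp: B_def)
    then have "card {k, m, z} \<le> card B" by (rule card_mono[OF finB])
    moreover have "k \<noteq> m" "m \<noteq> z" using m by auto
    then have "card {k, m, z} = 3" using kzB(3) by simp
    ultimately have "3 \<le> card B" by simp
    then obtain \<T> where T: "\<T> \<in> trifams B" using trifams_nonempty[of B] BX X_M(1) by blast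
    \<comment> \<open>The edge \<open>t w\<close> belongs to \<open>S\<close> itself, so
      \<open>descends_left\<close> puts \<open>s\<close> above its line, even for
      \<open>s = k\<close>.\<close>
    have conv: "hy t < hlin s w (hx t)"
      if "adjacent hx S1 s t" "adjacent hx S1 t w" "hx k \<le> hx s" "hx w \<le> hx z" for s t w
    proof -
      note A = adjacentD[OF that(1)] and A' = adjacentD[OF that(2)]
      have "t \<noteq> k" "w \<noteq> k" using A(3) A'(3) that(3) by auto
      then have tw: "t \<in> S" "w \<in> S" using A'(1,2) S1(4) by blast+
      have "adjacent hx S t w" using tw A'(3,4) S1(4) unfolding adjacent_def by blast
      moreover have "s \<in> X" using A(1) F1(1) by blast
      moreover have "hx s \<le> hx z" "s \<noteq> t" "s \<noteq> w" using A(3) A'(3) that(4) by auto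
      ultimately have "hlin t w (hx s) < hy s" using lowD that(4) by blast
      then show ?thesis using lin_kink_iff(2)[of hx s t w hy, OF A(3) A'(3)] by blast
    qed
    have LH: "hlin a b (hx s) < hy s"
      if "adjacent hx S1 a b" "hx k \<le> hx a" "hx b \<le> hx z" "s \<in> B - {a, b}" for a b s
    proof (rule convex_chain[where c = k and d = z, OF F1(4,5) that(1-3) conv])
      show "s \<in> S1" "hx k \<le> hx s" "hx s \<le> hx z" "s \<noteq> a" "s \<noteq> b" using that(4) by (auto simp: B_def)
    qed
    have UH: "hy s < hlin k z (hx s)" if s: "s \<in> B" "s \<noteq> k" "s \<noteq> z" for s
    proof -
      have sX: "s \<in> X" using s(1) BX by blast
      have lt: "hx k < hx s" "hx s < hx z" using s hx_neq[OF sX k(1)] hx_neq[OF sX zX] by (force simp: B_def)+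
      have sS: "s \<in> S1" using s(1) by (simp add: B_def)
      define w where "w = nxt hx S1 s"
      have sw: "adjacent hx S1 s w" unfolding w_def by (rule adjacent_nxt[OF F1(5,4) sS kz(2) lt(2)])
      note A = adjacentD[OF sw]
      have wz: "hx w \<le> hx z" using A(4)[OF kz(2)] lt(2) by linarith
      have "k \<noteq> w" using A(3) lt(1) by auto
      then have k1: "hlin s w (hx k) < hy k" using LH[OF sw _ wz, of k] lt(1) kzB s(2) by auto
      have z1: "hlin s w (hx z) \<le> hy z"
      proof (cases "z = w")
        case True
        then show ?thesis using A(3) by simp
      next
        case False
        then show ?thesis using LH[OF sw _ wz, of z] lt(1) kzB s(3) by auto
      qed
      have "0 < lin hx (\<lambda>r. hy r - hlin s w (hx r)) k z (hx s)"
        using k1 z1 lt by (intro lin_gt) auto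
      also have "\<dots> = hlin k z (hx s) - hlin s w (hx s)" unfolding lin_diff using k(2) lin_lin[of hx k z hy s w] by simp
      finally show ?thesis by simp
    qed
    have "state (\<V>1 \<union> \<T>) ({s \<in> S1. hx s \<le> hx k \<or> hx z \<le> hx s} \<union> {k, z})"
    proof (rule block_step[OF S1(1) BX T kz k(2)])
      show "\<And>s. s \<in> B \<Longrightarrow> hx k \<le> hx s \<and> hx s \<le> hx z" by (simp add: B_def)
      show "\<And>a b s. adjacent hx S1 a b \<Longrightarrow> hx k \<le> hx a \<Longrightarrow> hx b \<le> hx z \<Longrightarrow> s \<in> B - {a, b} \<Longrightarrow> hlin a b (hx s) < hy s" by (rule LH)
      show "\<And>s. s \<in> S1 \<Longrightarrow> hx k \<le> hx s \<Longrightarrow> hx s \<le> hx z \<Longrightarrow> s \<in> B" by (simp add: B_def)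
      show "{k, z} \<subseteq> B" "k \<in> {k, z}" "z \<in> {k, z}" using kzB by auto
      show "hy s < hlin a b (hx s)" if "adjacent hx {k, z} a b" "s \<in> B - {a, b}" for a b s
      proof -
        have "a = k" "b = z" using adjacentD(1-3)[OF that(1)] k(2) by auto
        then show ?thesis using UH that(2) by blast
      qed
    qed
    moreover have "adjacent hx ({s \<in> S1. hx s \<le> hx k \<or> hx z \<le> hx s} \<union> {k, z}) k z"
      using k(2) unfolding adjacent_def by auto
    moreover have "R \<notin> V" if "V \<in> \<T>" for V using trifamsD(1)[OF T that] BX X_M(2) by blast
    moreover have "s \<in> {s \<in> S1. hx s \<le> hx k \<or> hx z \<le> hx s} \<union> {k, z} \<longleftrightarrow> s \<in> S" if "hx z \<le> hx s" for s
      using ag[OF that] that k(2) z by auto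
    ultimately show ?thesis using S1(2,3)
      by (intro exI[of _ "\<V>1 \<union> \<T>"] exI[of _ "{s \<in> S1. hx s \<le> hx k \<or> hx z \<le> hx s} \<union> {k, z}"]) blast
  qed
qed

definition descends_right :: "point set \<Rightarrow> point \<Rightarrow> bool" where
  "descends_right S z \<longleftrightarrow> (\<forall>a b s. adjacent hx S a b \<longrightarrow> hx z \<le> hx a \<longrightarrow> s \<in> X \<longrightarrow> hx z \<le> hx s \<longrightarrow> s \<notin> {a, b} \<longrightarrow> hlin a b (hx s) < hy s)"

lemma reach_right:
  assumes st: "state \<V> S" and z: "z \<in> S" and k: "k \<in> X" "hx z < hx k" and low: "descends_right S z"
  shows "\<exists>\<V>' S'. state \<V>' S' \<and> \<V> \<subseteq> \<V>' \<and> (\<forall>V\<in>\<V>' - \<V>. R \<notin> V) \<and> adjacent hx S' z k \<and> (\<forall>s. hx s \<le> hx z \<longrightarrow> (s \<in> S' \<longleftrightarrow> s \<in> S))"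
proof -
  interpret m: star R u "- v" M p2 p1 by (rule mirror)
  have "m.descends_left S z"
    unfolding m.descends_left_def mirror_hx adjacent_reflect
  proof (intro allI impI)
    fix a b s assume h: "adjacent hx S b a" "- hx b \<le> - hx z" "s \<in> X" "- hx s \<le> - hx z" "s \<notin> {a, b}"
    have "hx z \<le> hx b" "hx z \<le> hx s" "s \<notin> {b, a}" using h by auto
    then have "hlin b a (hx s) < hy s" using low h(1,3) unfolding descends_right_def by blast
    moreover have "hx a \<noteq> hx b" using adjacentD(3)[OF h(1)] by simp
    ultimately show "lin (\<lambda>q. - hx q) hy a b (- hx s) < hy s" unfolding lin_reflect using lin_commute[of hx a b hy] by simp
  qed
  moreover have "m.state \<V> S" using st unfolding mirror_state .
  ultimately have "\<exists>\<V>' S'. m.state \<V>' S' \<and> \<V> \<subseteq> \<V>' \<and> (\<forall>V\<in>\<V>' - \<V>. R \<notin> V) \<and> adjacent m.hx S' k z \<and> (\<forall>s. m.hx z \<le> m.hx s \<longrightarrow> (s \<in> S' \<longleftrightarrow> s \<in> S))"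
    using k z by (intro m.reach_left) (simp_all add: mirror_hx)
  then show ?thesis unfolding mirror_state mirror_hx adjacent_reflect by simp
qed

lemma cut_single:
  assumes S: "S \<in> paths" and cut: "cut S = {z}" and z: "z \<in> X - {p1, p2}"
  shows "z \<notin> S \<Longrightarrow> corners S = {p1} \<and> stop S p1 = p2 \<and> block S p1 = X - {z}"
    and "z \<in> S \<Longrightarrow> corners S = {p1, z} \<and> stop S p1 = z \<and> stop S z = p2 \<and> block S p1 = {s \<in> X. hx s \<le> hx z} \<and> block S z = {s \<in> X. hx z \<le> hx s}"
proof -
  have zz: "hx p1 < hx z" "hx z < hx p2" using inner_between[OF z] by auto
  have sX: "hx p1 \<le> hx s" "hx s \<le> hx p2" if "s \<in> X" for s using bounds[OF that] by auto
  have iX: "inj_on hx A" if "A \<subseteq> X" for A by (rule inj_on_subset[OF inj that])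
  have eq: "s = t" if "s \<in> X" "t \<in> X" "\<not> hx s < hx t" "\<not> hx t < hx s" for s t using hx_neq[of s t] that by force
  {
    assume "z \<notin> S"
    then have c: "corners S = {p1}" using cut by (auto simp: corners_def)
    have st: "stop S p1 = p2" unfolding stop_def c
      by (rule nxt_eqI[OF iX]) (use pX qX pq in auto)
    have "block S p1 = X - {z}"
    proof (intro equalityI subsetI)
      fix s assume "s \<in> X - {z}"
      then show "s \<in> block S p1" using eq[of s p1] eq[of s p2] sX[of s] pX qX unfolding block_def st cut by force
    qed (use zz pX qX in \<open>auto simp: block_def st cut\<close>)
    then show "corners S = {p1} \<and> stop S p1 = p2 \<and> block S p1 = X - {z}" using c st by simp
  }
  {
    assume "z \<in> S"
    then have c: "corners S = {p1, z}" using cut by (auto simp: corners_def)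
    have sub: "insert p2 {p1, z} \<subseteq> X" using pX qX z by blast
    have st1: "stop S p1 = z" unfolding stop_def c by (rule nxt_eqI[OF iX[OF sub]]) (use zz in auto)
    have st2: "stop S z = p2" unfolding stop_def c by (rule nxt_eqI[OF iX[OF sub]]) (use zz in auto)
    have "block S p1 = {s \<in> X. hx s \<le> hx z}"
    proof (intro equalityI subsetI)
      fix s assume "s \<in> {s \<in> X. hx s \<le> hx z}"
      then show "s \<in> block S p1" using eq[of s p1] eq[of s z] sX[of s] pX z unfolding block_def st1 cut by force
    qed (use zz pX z in \<open>auto simp: block_def st1\<close>)
    moreover have "block S z = {s \<in> X. hx z \<le> hx s}"
    proof (intro equalityI subsetI)
      fix s assume "s \<in> {s \<in> X. hx z \<le> hx s}"
      then show "s \<in> block S z" using eq[of s p2] eq[of s z] sX[of s] qX z unfolding block_def st2 cut by force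
    qed (use zz qX z in \<open>auto simp: block_def st2\<close>)
    ultimately show "corners S = {p1, z} \<and> stop S p1 = z \<and> stop S z = p2 \<and> block S p1 = {s \<in> X. hx s \<le> hx z} \<and> block S z = {s \<in> X. hx z \<le> hx s}"
      using c st1 st2 by simp
  }
qed

lemma cut_single_exists:
  assumes "z \<in> X - {p1, p2}"
  obtains S where "S \<in> paths" "cut S = {z}"
proof -
  have "{z} \<in> cut ` paths" using bij_betw_imp_surj_on[OF bij_betw_cut] assms by blast
  then show ?thesis using that by auto
qed

text \<open>If the path passes above \<open>z\<close>, all other points form one block, whereas the
  cut set \<open>{z}\<close> has two gaps. Both are nonempty because of \<open>l\<close> and
  \<open>r\<close>, so \<open>catalan_mult_less\<close> makes one summand strictly larger.\<close>

lemma catalan_less_sum_blocks: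
  assumes z: "z \<in> X - {p1, p2}" and S: "S \<in> paths" "cut S = {z}" "z \<notin> S"
    and l: "l \<in> X" "hx p1 < hx l" "hx l < hx z" and r: "r \<in> X" "hx z < hx r" "hx r < hx p2"
  shows "catalan (card X - 1) < (\<Sum>S\<in>paths. \<Prod>c\<in>corners S. catalan (card (block S c) - 2))"
proof -
  define gap where "gap A b = {s \<in> X. hx b < hx s \<and> hx s < hx (nxt hx (insert p2 A) b)}" for A b
  have zz: "hx p1 < hx z" "hx z < hx p2" using inner_between[OF z] by auto
  note c = cut_single(1)[OF S(1,2) z S(3)]
  have "catalan (card X - 1) = (\<Sum>B\<in>Pow (X - {p1, p2}). \<Prod>b\<in>insert p1 B. catalan (card (gap B b)))"
    unfolding gap_def by (rule catalan_compositions[OF fin inj pX qX pq bounds, symmetric])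
  also have "\<dots> = (\<Sum>S\<in>paths. \<Prod>b\<in>insert p1 (cut S). catalan (card (gap (cut S) b)))"
    by (rule sum.reindex_bij_betw[OF bij_betw_cut, symmetric])
  also have "\<dots> < (\<Sum>S\<in>paths. \<Prod>c\<in>corners S. catalan (card (block S c) - 2))"
  proof (rule sum_strict_mono_ex1[OF finite_paths], rule ballI)
    show "(\<Prod>b\<in>insert p1 (cut S). catalan (card (gap (cut S) b))) \<le> (\<Prod>c\<in>corners S. catalan (card (block S c) - 2))"
      if "S \<in> paths" for S unfolding gap_def by (rule block_product[OF that])
    have sub: "insert p2 {z} \<subseteq> X" using qX z by blast
    have n: "nxt hx (insert p2 {z}) p1 = z" "nxt hx (insert p2 {z}) z = p2"
      by (rule nxt_eqI[OF inj_on_subset[OF inj sub]]; use zz in auto)+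
    define I J where "I = {s \<in> X. hx p1 < hx s \<and> hx s < hx z}" and "J = {s \<in> X. hx z < hx s \<and> hx s < hx p2}"
    have g: "gap {z} p1 = I" "gap {z} z = J" unfolding gap_def n I_def J_def by simp_all
    have fIJ: "finite I" "finite J" using fin by (simp_all add: I_def J_def)
    have "l \<in> I" "r \<in> J" using l r by (simp_all add: I_def J_def)
    then have pos: "0 < card I" "0 < card J" using fIJ by (auto simp: card_gt_0_iff)
    have "X - {z} = {p1, p2} \<union> (I \<union> J)"
    proof (intro equalityI subsetI)
      fix s assume s: "s \<in> X - {z}"
      show "s \<in> {p1, p2} \<union> (I \<union> J)"
      proof (cases "s = p1 \<or> s = p2")
        case False
        then have "hx p1 < hx s" "hx s < hx p2" using inner_between[of s] s by auto
        moreover have "hx s \<noteq> hx z" using hx_neq[of s z] s z by blast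
        ultimately show ?thesis using s by (auto simp: I_def J_def neq_iff)
      qed blast
    qed (use zz pX qX in \<open>auto simp: I_def J_def\<close>)
    moreover have "card ({p1, p2} \<union> (I \<union> J)) = 2 + (card I + card J)"
    proof -
      have "card ({p1, p2} \<union> (I \<union> J)) = card {p1, p2} + card (I \<union> J)"
        by (rule card_Un_disjoint) (use fIJ pq zz in \<open>auto simp: I_def J_def\<close>)
      moreover have "card (I \<union> J) = card I + card J"
        by (rule card_Un_disjoint) (use fIJ in \<open>auto simp: I_def J_def\<close>)
      moreover have "p1 \<noteq> p2" using pq by auto
      then have "card {p1, p2} = 2" by simp
      ultimately show ?thesis by simp
    qed
    ultimately have "card (block S p1) - 2 = card I + card J" using c by simp
    then have "(\<Prod>c\<in>corners S. catalan (card (block S c) - 2)) = catalan (card I + card J)" using c by simp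
    moreover have "(\<Prod>b\<in>insert p1 (cut S). catalan (card (gap (cut S) b))) = catalan (card I) * catalan (card J)"
    proof -
      have "p1 \<noteq> z" using z by blast
      then show ?thesis unfolding S(2) using g by simp
    qed
    ultimately have "(\<Prod>b\<in>insert p1 (cut S). catalan (card (gap (cut S) b))) < (\<Prod>c\<in>corners S. catalan (card (block S c) - 2))"
      using catalan_mult_less[OF pos] by simp
    then show "\<exists>S\<in>paths. (\<Prod>b\<in>insert p1 (cut S). catalan (card (gap (cut S) b))) < (\<Prod>c\<in>corners S. catalan (card (block S c) - 2))"
      using S(1) by blast
  qed
  finally show ?thesis .
qed

text \<open>The path with the single cut point \<open>z\<close> has \<open>z\<close> as a peak. The constructed triangulation contains its fan and
  the triangle \<open>{k, z, a'}\<close>, which overlaps the block to the left of \<open>z\<close> although it does not belong to it.\<close>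

lemma not_glued_exists:
  assumes z: "z \<in> X - {p1, p2}" and l: "l \<in> X" "r \<in> X" "hx l < hx z" "hx z < hx r" "hlin l r (hx z) < hy z"
    and a: "a \<in> X" "hx a < hx z" "hlin k z (hx a) < hy a" and k: "k \<in> X" "hx k < hx z" "k \<noteq> a"
    and a': "a' \<in> X" "hx z < hx a'" "hy z < hlin k a' (hx z)"
  shows "\<exists>\<T>\<in>trifams M. \<T> \<notin> glued"
proof -
  obtain S where S: "S \<in> paths" "cut S = {z}" using cut_single_exists[OF z] .
  note P = pathD[OF S(1)]
  have zX: "z \<in> X" using z by blast
  \<comment> \<open>Otherwise all points except \<open>z\<close> lie on or above the line of the
    path edge over \<open>z\<close>. Then so does the chord \<open>l r\<close> at \<open>z\<close>,
    although it passes below \<open>z\<close> and \<open>z\<close> is below that edge.\<close>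
  have zS: "z \<in> S"
  proof (rule ccontr)
    assume "z \<notin> S"
    note c = cut_single(1)[OF S z this]
    let ?b = "prv hx S z" and ?d = "nxt hx S z"
    note n = path_neighbours[OF S(1) z]
    have e: "adjacent hx S ?b ?d" by (rule path_adjacent(3)[OF S(1) z \<open>z \<notin> S\<close>])
    have lo: "hy z < hlin ?b ?d (hx z)" using S(2) \<open>z \<notin> S\<close> unfolding cut_def by blast
    have ab: "hlin ?b ?d (hx s) \<le> hy s" if "s \<in> X" "s \<noteq> z" for s
    proof (cases "s = ?b \<or> s = ?d")
      case True
      then show ?thesis using n(3,4) by auto
    next
      case False
      have "hlin ?b ?d (hx s) < hy s"
      proof (rule block_above[OF S(1) _ e, of p1])
        show "p1 \<in> corners S" using c by simp
        show "hx p1 \<le> hx ?b" using bounds n(1) P(1) by blast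
        have "hx ?d \<le> hx p2" using bounds n(2) P(1) by blast
        then show "hx ?d \<le> hx (stop S p1)" using c by simp
        show "s \<in> block S p1" using c that by simp
        show "s \<noteq> ?b" "s \<noteq> ?d" using False by blast+
      qed
      then show ?thesis by simp
    qed
    have "lin hx (\<lambda>s. hlin ?b ?d (hx s)) l r (hx z) \<le> hlin l r (hx z)"
      using l ab[of l] ab[of r] by (intro lin_mono) auto
    moreover have "lin hx (\<lambda>s. hlin ?b ?d (hx s)) l r (hx z) = hlin ?b ?d (hx z)" using l by (intro lin_lin) auto
    ultimately show False using lo l(5) by simp
  qed
  note c = cut_single(2)[OF S z zS]
  have dl: "descends_left S z"
    unfolding descends_left_def
  proof (intro allI impI)
    fix b d s assume h: "adjacent hx S b d" "hx d \<le> hx z" "s \<in> X" "hx s \<le> hx z" "s \<notin> {b, d}"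
    have "hx p1 \<le> hx b" using bounds path_edge(1)[OF S(1) h(1)] by blast
    then show "hlin b d (hx s) < hy s" using block_above[OF S(1) _ h(1), of p1 s] c h by simp
  qed
  have dr: "descends_right S z"
    unfolding descends_right_def
  proof (intro allI impI)
    fix b d s assume h: "adjacent hx S b d" "hx z \<le> hx b" "s \<in> X" "hx z \<le> hx s" "s \<notin> {b, d}"
    have "hx d \<le> hx p2" using bounds path_edge(2)[OF S(1) h(1)] by blast
    then show "hlin b d (hx s) < hy s" using block_above[OF S(1) _ h(1), of z s] c h by simp
  qed
  \<comment> \<open>The points \<open>k\<close> and \<open>a'\<close> are made the neighbours of
    \<open>z\<close> on the path. As \<open>z\<close> lies below the chord \<open>k a'\<close>, the
    triangle \<open>k z a'\<close> then fills a notch.\<close>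
  obtain \<V>1 S1 where s1: "state \<V>1 S1" "fan S \<subseteq> \<V>1" "\<forall>V\<in>\<V>1 - fan S. R \<notin> V" "adjacent hx S1 k z"
    and ag1': "\<forall>s. hx z \<le> hx s \<longrightarrow> (s \<in> S1 \<longleftrightarrow> s \<in> S)"
    using reach_left[OF state_fan[OF S(1)] zS k(1,2) dl] by (elim exE conjE) (rule that)
  have ag1: "s \<in> S1 \<longleftrightarrow> s \<in> S" if "hx z \<le> hx s" for s using ag1' that by simp
  have "descends_right S1 z"
    unfolding descends_right_def
  proof (intro allI impI)
    fix b d s assume h: "adjacent hx S1 b d" "hx z \<le> hx b" "s \<in> X" "hx z \<le> hx s" "s \<notin> {b, d}"
    note A = adjacentD[OF h(1)]
    have "b \<in> S" "d \<in> S" using ag1[of b] ag1[of d] A(1-3) h(2) by auto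
    moreover have "hx t \<le> hx b \<or> hx d \<le> hx t" if "t \<in> S" for t
      using A(4)[of t] ag1[of t] that h(2) by (cases "hx z \<le> hx t") auto
    ultimately have "adjacent hx S b d" using A(3) unfolding adjacent_def by blast
    then show "hlin b d (hx s) < hy s" using dr h(2-5) unfolding descends_right_def by blast
  qed
  from reach_right[OF s1(1) adjacentD(2)[OF s1(4)] a'(1,2) this]
  obtain \<V>2 S2 where s2: "state \<V>2 S2" "\<V>1 \<subseteq> \<V>2" "\<forall>V\<in>\<V>2 - \<V>1. R \<notin> V" "adjacent hx S2 z a'"
    and ag2': "\<forall>s. hx s \<le> hx z \<longrightarrow> (s \<in> S2 \<longleftrightarrow> s \<in> S1)" by (elim exE conjE) (rule that)
  have ag2: "s \<in> S2 \<longleftrightarrow> s \<in> S1" if "hx s \<le> hx z" for s using ag2' that by simp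
  have "adjacent hx S2 k z"
  proof -
    note A = adjacentD[OF s1(4)]
    have "k \<in> S2" "z \<in> S2" using ag2[of k] ag2[of z] A(1,2) k(2) by auto
    moreover have "hx t \<le> hx k \<or> hx z \<le> hx t" if "t \<in> S2" for t
      using A(4)[of t] ag2[of t] that by (cases "hx t \<le> hx z") auto
    ultimately show ?thesis using A(3) unfolding adjacent_def by blast
  qed
  from drop_corner[OF s2(1) this s2(4) a'(3)]
  have "state (insert {k, z, a'} \<V>2) (S2 - {z})" .
  from state_extend[OF this] obtain \<T> where T: "\<T> \<in> trifams M" "insert {k, z, a'} \<V>2 \<subseteq> \<T>" "\<forall>V\<in>\<T> - insert {k, z, a'} \<V>2. R \<notin> V"
    by (elim bexE conjE) (rule that)
  have RV: "R \<notin> {k, z, a'}" using k(1) zX a'(1) X_M(2) by blast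
  have fanT: "{V \<in> \<T>. R \<in> V} = fan S"
  proof (intro equalityI subsetI)
    fix V assume "V \<in> {V \<in> \<T>. R \<in> V}"
    then show "V \<in> fan S" using T(3) RV s2(3) s1(3) by blast
  next
    fix V assume V: "V \<in> fan S"
    then have "R \<in> V" unfolding fan_def by blast
    then show "V \<in> {V \<in> \<T>. R \<in> V}" using V T(2) s2(2) s1(2) by blast
  qed
  have "\<T> \<notin> glued"
  proof
    assume "\<T> \<in> glued"
    then obtain S0 where S0: "S0 \<in> paths" "{V \<in> \<T>. R \<in> V} = fan S0"
      "\<forall>c\<in>corners S0. {V \<in> \<T>. V \<subseteq> block S0 c} \<in> block_trifams (block S0 c)" unfolding glued_def by blast
    have "fan S0 = fan S" using fanT S0(2) by simp
    then have "S0 = S" by (rule fan_inj[OF S0(1) S(1)])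
    define L where "L = {s \<in> X. hx s \<le> hx z}"
    have p1c: "p1 \<in> corners S" by (simp add: corners_def)
    have "{V \<in> \<T>. V \<subseteq> L} \<in> block_trifams L" using bspec[OF S0(3)[unfolded \<open>S0 = S\<close>] p1c] c unfolding L_def by simp
    moreover have "\<not> card L \<le> 2"
    proof -
      have "finite L" using fin by (simp add: L_def)
      moreover have "{a, k, z} \<subseteq> L" using a k zX by (simp add: L_def)
      ultimately have "card {a, k, z} \<le> card L" by (rule card_mono)
      moreover have "a \<noteq> z" "k \<noteq> z" using a(2) k(2) by auto
      then have "card {a, k, z} = 3" using k(3) by simp
      ultimately show ?thesis by simp
    qed
    ultimately have LT: "{V \<in> \<T>. V \<subseteq> L} \<in> trifams L" by (simp add: block_trifams_def)
    have LX: "L \<subseteq> X" by (auto simp: L_def)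
    \<comment> \<open>A point \<open>q\<close> over \<open>\<tau>\<close>, above the chord
      \<open>k z\<close> but below \<open>a z\<close> and \<open>k a'\<close>, lies in the hull of
      the left block \<open>L\<close> and in the triangle \<open>k z a'\<close>. A triangle inside
      \<open>L\<close> shares at most the edge \<open>k z\<close> with the latter, so the triangles
      inside \<open>L\<close> do not cover its hull.\<close>
    obtain \<tau> where \<tau>: "max (hx a) (hx k) < \<tau>" "\<tau> < hx z" using dense[of "max (hx a) (hx k)" "hx z"] a(2) k(2) by auto
    have fp: "0 < ff a" "0 < ff k" "0 < ff z" "0 < ff a'" using ff_pos a(1) k(1) zX a'(1) by blast+
    have h1: "hlin k z \<tau> < hlin a z \<tau>"
    proof -
      have "0 < lin hx (\<lambda>s. hy s - hlin k z (hx s)) a z \<tau>"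
        by (rule lin_gt) (use \<tau> a(3) a(2) k(2) in auto)
      also have "\<dots> = hlin a z \<tau> - hlin k z \<tau>" unfolding lin_diff using a(2) lin_lin[of hx a z hy k z] by simp
      finally show ?thesis by simp
    qed
    have h2: "hlin k z \<tau> < hlin k a' \<tau>"
    proof -
      have "hlin k z (hx a') < hy a'" using lin_kink_iff(1)[of hx k z a' hy, OF k(2) a'(2)] a'(3) by blast
      then have "0 < lin hx (\<lambda>s. hy s - hlin k z (hx s)) k a' \<tau>"
        by (intro lin_gt) (use \<tau> a'(2) k(2) in auto)
      also have "\<dots> = hlin k a' \<tau> - hlin k z \<tau>" unfolding lin_diff using a'(2) k(2) lin_lin[of hx k a' hy k z] by simp
      finally show ?thesis by simp
    qed
    obtain h where h: "hlin k z \<tau> < h" "h < min (hlin a z \<tau>) (hlin k a' \<tau>)" using dense[of "hlin k z \<tau>" "min (hlin a z \<tau>) (hlin k a' \<tau>)"] h1 h2 by auto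
    have "hlin a z \<tau> \<le> max (hy a) (hy z)" by (rule lin_le) (use \<tau> a(2) in auto)
    then have hneg: "h < 0" using h(2) hy_neg[OF fp(1)] hy_neg[OF fp(3)] by auto
    obtain q where q: "ff q = - 1 / h" "gg q = \<tau> * (- 1 / h)" using coords_surj by blast
    have fq: "0 < ff q" using hneg q(1) by (simp add: divide_pos_neg)
    have hq: "hx q = \<tau>" "hy q = h" using hneg by (simp_all add: hx_def hy_def q)
    have "q \<in> convex hull L"
      by (rule mem_between[OF LX, of k z a z]) (use a k zX \<tau> h fq hq in \<open>auto simp: L_def\<close>)
    then obtain V where V: "V \<in> \<T>" "V \<subseteq> L" "q \<in> convex hull V" using trifamsD(4)[OF LT] by blast
    have "q \<in> convex hull {k, z, a'}"
      by (rule mem_between[of "{k, z, a'}" k z k a']) (use a' k zX \<tau> h fq hq in auto)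
    then have "q \<in> convex hull ({k, z, a'} \<inter> V)" using trifamsD(3)[OF T(1), of "{k, z, a'}" V] T(2) V by blast
    moreover have "{k, z, a'} \<inter> V \<subseteq> {k, z}" using V(2) a'(2) by (auto simp: L_def)
    ultimately have "q \<in> convex hull {k, z}" using hull_mono by blast
    then have "hy q \<le> hlin k z (hx q)" by (rule hull_below) (use fp fq k(2) in auto)
    then show False using h(1) hq by simp
  qed
  then show ?thesis using T(1) by blast
qed

end

section \<open>Equality forces every interior point to be close to a side\<close>

context star
begin

text \<open>If the number of triangulations attains the bound, all estimates in the chain leading to
  it are equalities: every triangulation is glued, and the sum over the paths has no slack.\<close>

lemma glued_eq_trifams:
  assumes eq: "card (trifams M) = catalan (card M - 2)"
  shows "glued = trifams M" and "(\<Sum>S\<in>paths. \<Prod>c\<in>corners S. catalan (card (block S c) - 2)) \<le> catalan (card X - 1)"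
proof -
  have IH: "catalan (card B - 2) \<le> card (trifams B)" if "B \<subset> M" "3 \<le> card B" for B
    using catalan_le_card_trifams[of B] finite_subset[of B M] general_position_subset[OF gpM, of B] finM that by blast
  have "catalan (card M - 2) \<le> card glued" by (rule catalan_le_glued[OF IH])
  then show "glued = trifams M" using eq by (intro card_subset_eq[OF finite_trifams[OF finM] glued_subset])
     (metis card_mono[OF finite_trifams[OF finM] glued_subset] order_antisym)
  have "(\<Sum>S\<in>paths. \<Prod>c\<in>corners S. catalan (card (block S c) - 2)) \<le> (\<Sum>S\<in>paths. \<Prod>c\<in>corners S. card (block_trifams (block S c)))"
    by (intro sum_mono prod_mono conjI catalan_le_block_trifams[OF IH]) auto
  also have "\<dots> \<le> card glued" by (rule card_glued_ge)
  also have "\<dots> \<le> card (trifams M)" by (rule card_mono[OF finite_trifams[OF finM] glued_subset])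
  also have "\<dots> = catalan (card X - 1)" using eq by (simp add: card_X numeral_2_eq_2)
  finally show "(\<Sum>S\<in>paths. \<Prod>c\<in>corners S. catalan (card (block S c) - 2)) \<le> catalan (card X - 1)" .
qed

text \<open>The slope of the line \<open>z s\<close> in the transformed coordinates. Whether
  \<open>z\<close> is above or below a chord \<open>l r\<close> over it depends only on the order of
  the slopes to \<open>l\<close> and \<open>r\<close>.\<close>

definition slope :: "point \<Rightarrow> point \<Rightarrow> real" where "slope z s = (hy z - hy s) / (hx z - hx s)"

lemma slope_eq:
  assumes "hx s \<noteq> hx z"
  shows "hy s = hy z + slope z s * (hx s - hx z)"
proof -
  have "slope z s * (hx z - hx s) = hy z - hy s" using assms by (simp add: slope_def)
  then show ?thesis by (simp add: algebra_simps)
qed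

lemma hlin_slope:
  assumes "hx s \<noteq> hx z"
  shows "hlin s z \<tau> = hy z + slope z s * (\<tau> - hx z)"
proof -
  have "hlin s z \<tau> = hlin z s \<tau>" using assms by (rule lin_commute)
  also have "\<dots> = hy z + ((hy s - hy z) / (hx s - hx z)) * (\<tau> - hx z)" by (simp add: lin_def)
  also have "(hy s - hy z) / (hx s - hx z) = slope z s" unfolding slope_def by (metis minus_diff_eq minus_divide_divide)
  finally show ?thesis .
qed

lemma slope_neq:
  assumes "a \<in> X" "b \<in> X" "z \<in> X" "a \<noteq> b" "a \<noteq> z" "b \<noteq> z"
  shows "slope z a \<noteq> slope z b"
proof
  assume e: "slope z a = slope z b"
  have "hx a \<noteq> hx z" "hx b \<noteq> hx z" using hx_neq assms by blast+
  then have "hy a = hlin b z (hx a)" using slope_eq[of a z] hlin_slope[of b z "hx a"] e by simp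
  then show False using gp[of b z a] assms by blast
qed

lemma below_iff_slope:
  assumes "hx l < hx z" "hx z < hx r"
  shows "hy z < hlin l r (hx z) \<longleftrightarrow> slope z l < slope z r"
proof -
  have "hlin l z (hx r) < hy r \<longleftrightarrow> slope z l * (hx r - hx z) < slope z r * (hx r - hx z)"
    using hlin_slope[of l z "hx r"] slope_eq[of r z] assms by simp
  also have "\<dots> \<longleftrightarrow> slope z l < slope z r" using assms by simp
  finally show ?thesis using lin_kink_iff(1)[of hx l z r hy, OF assms] by blast
qed

lemma above_iff_slope:
  assumes "hx l < hx z" "hx z < hx r"
  shows "hlin l r (hx z) < hy z \<longleftrightarrow> slope z r < slope z l"
proof -
  have "hy r < hlin l z (hx r) \<longleftrightarrow> slope z r * (hx r - hx z) < slope z l * (hx r - hx z)"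
    using hlin_slope[of l z "hx r"] slope_eq[of r z] assms by simp
  also have "\<dots> \<longleftrightarrow> slope z r < slope z l" using assms by simp
  finally show ?thesis using lin_kink_iff(3)[of hx l z r hy, OF assms] by blast
qed

text \<open>If \<open>z\<close> were an extremal point for \<open>hx\<close>, the values of
  \<open>hx\<close> at the other points of \<open>X\<close> would stay away from
  \<open>hx z\<close>, and so they would on the hull of these points and \<open>R\<close>.\<close>

lemma interior_not_end:
  assumes z: "z \<in> X" "z \<in> convex hull (M - {z})"
  shows "z \<in> X - {p1, p2}"
proof -
  have fz: "0 < ff z" by (rule ff_pos[OF z(1)])
  have "z \<noteq> p1"
  proof
    assume zp: "z = p1"
    note n = nxt_props[OF inj fin qX, of z]
    have lt: "hx z < hx p2" using pq zp by simp
    have "hx (nxt hx X z) \<le> hx z"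
    proof (rule hull_hx(1)[OF z(2) fz])
      fix s assume "s \<in> M - {z}"
      then have "s = R \<or> s \<in> X \<and> s \<noteq> z" using X_M(3) by blast
      moreover have "hx z < hx s" if "s \<in> X" "s \<noteq> z" using bounds[OF that(1)] hx_neq[OF that(1) z(1) that(2)] zp by simp
      ultimately show "s = R \<or> 0 < ff s \<and> hx (nxt hx X z) \<le> hx s" using n(3)[OF lt, of s] ff_pos by blast
    qed
    then show False using n(2)[OF lt] by simp
  qed
  moreover have "z \<noteq> p2"
  proof
    assume zp: "z = p2"
    note n = prv_props[OF inj fin pX, of z]
    have lt: "hx p1 < hx z" using pq zp by simp
    have "hx z \<le> hx (prv hx X z)"
    proof (rule hull_hx(2)[OF z(2) fz])
      fix s assume "s \<in> M - {z}"
      then have "s = R \<or> s \<in> X \<and> s \<noteq> z" using X_M(3) by blast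
      moreover have "hx s < hx z" if "s \<in> X" "s \<noteq> z" using bounds[OF that(1)] hx_neq[OF that(1) z(1) that(2)] zp by simp
      ultimately show "s = R \<or> 0 < ff s \<and> hx s \<le> hx (prv hx X z)" using n(3)[OF lt, of s] ff_pos by blast
    qed
    then show False using n(2)[OF lt] by simp
  qed
  ultimately show ?thesis using z(1) by blast
qed

text \<open>A point in the hull of the others lies below the upper hull of the others; the edge of
  that hull over \<open>z\<close> provides \<open>l\<close> and \<open>r\<close>.\<close>

lemma interior_below_pair:
  assumes z: "z \<in> X" "z \<in> convex hull (M - {z})"
  obtains l r where "l \<in> X" "r \<in> X" "hx l < hx z" "hx z < hx r" "hy z < hlin l r (hx z)"
proof -
  have fz: "0 < ff z" by (rule ff_pos[OF z(1)])
  note ze = interior_not_end[OF z]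
  let ?B = "X - {z}"
  have B: "finite ?B" "inj_on hx ?B" using fin inj_on_subset[OF inj, of ?B] by blast+
  obtain U where U: "U \<subseteq> ?B" "p1 \<in> U" "p2 \<in> U" "\<And>a b s. adjacent hx U a b \<Longrightarrow> s \<in> ?B - {a, b} \<Longrightarrow> hy s < hlin a b (hx s)"
  proof (rule upper_hull_exists[OF B, of hy p1 p2])
    show "\<And>a b c. a \<in> ?B \<Longrightarrow> b \<in> ?B \<Longrightarrow> c \<in> ?B \<Longrightarrow> a \<noteq> b \<Longrightarrow> b \<noteq> c \<Longrightarrow> a \<noteq> c \<Longrightarrow> hy c \<noteq> hlin a b (hx c)"
      using gp by blast
    show "p1 \<in> ?B" "p2 \<in> ?B" using pX qX ze by blast+
    show "\<And>s. s \<in> ?B \<Longrightarrow> hx p1 \<le> hx s \<and> hx s \<le> hx p2" using bounds by blast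
  qed (rule that)
  have finU: "finite U" by (rule finite_subset[OF U(1) B(1)])
  have injU: "inj_on hx U" by (rule inj_on_subset[OF B(2) U(1)])
  have zz: "hx p1 \<le> hx z" "hx z \<le> hx p2" using bounds[OF z(1)] by auto
  obtain a b where ab: "adjacent hx U a b" "hx a \<le> hx z" "hx z \<le> hx b"
    using adjacent_interval[OF finU injU U(2,3) pq zz] by blast
  note A = adjacentD[OF ab(1)]
  have abX: "a \<in> X" "b \<in> X" "a \<noteq> z" "b \<noteq> z" "a \<noteq> b" using A(1-3) U(1) by auto
  then have lt: "hx a < hx z" "hx z < hx b" using ab hx_neq[of a z] hx_neq[of b z] z(1) by force+
  have "hy z \<le> hlin a b (hx z)"
  proof (rule hull_below[OF z(2) _ less_imp_neq[OF A(3)] fz])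
    fix s assume "s \<in> M - {z}"
    then consider "s = R" | "s \<in> ?B" using X_M(3) by blast
    then show "s = R \<or> 0 < ff s \<and> hy s \<le> hlin a b (hx s)"
    proof cases
      case 2
      have "hy s \<le> hlin a b (hx s)" using U(4)[OF ab(1), of s] 2 A(3) by (cases "s = a"; cases "s = b") auto
      then show ?thesis using 2 ff_pos by blast
    qed blast
  qed
  moreover have "hy z \<noteq> hlin a b (hx z)" using gp[OF abX(1,2) z(1) abX(5,4,3)] .
  ultimately show ?thesis using that[OF abX(1,2) lt] by simp
qed

text \<open>The line given by \<open>hx = hx s\<close> passes through \<open>R\<close>, and for an
  extreme value of \<open>hx\<close> it leaves all other points strictly on one side.\<close>

lemma side_first:
  assumes "s = p1 \<or> s = p2"
  shows "is_side M R s"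
proof -
  have pR: "p1 \<noteq> R" "p2 \<noteq> R" using pX qX X_M(2) by blast+
  have w: "(v - \<tau> *\<^sub>R u) \<bullet> q - (v - \<tau> *\<^sub>R u) \<bullet> R = gg q - \<tau> * ff q" for q \<tau>
    by (simp add: ff_def gg_def inner_diff_left inner_diff_right algebra_simps)
  have ends0: "gg p1 - hx p1 * ff p1 = 0" "gg p2 - hx p2 * ff p2 = 0" using gg_eq[of p1] gg_eq[of p2] ff_pos pX qX by auto
  have 1: "is_side M R p1"
  proof (rule is_sideI[OF finM RM, of p1 "v - hx p1 *\<^sub>R u" "(v - hx p1 *\<^sub>R u) \<bullet> R"])
    show "p1 \<in> M" "R \<noteq> p1" using pX X_M(1) pR by auto
    show "(v - hx p1 *\<^sub>R u) \<bullet> p1 = (v - hx p1 *\<^sub>R u) \<bullet> R" using w[of "hx p1" p1] ends0 by simp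
    fix s assume "s \<in> M - {R, p1}"
    then have s: "s \<in> X" "s \<noteq> p1" using X_M(3) by blast+
    then have "hx p1 < hx s" using bounds[OF s(1)] hx_neq[OF s(1) pX s(2)] by simp
    then have "hx p1 * ff s < gg s" using ff_pos[OF s(1)] gg_eq[of s] by simp
    then show "(v - hx p1 *\<^sub>R u) \<bullet> R < (v - hx p1 *\<^sub>R u) \<bullet> s" using w[of "hx p1" s] by linarith
  qed simp
  have 2: "is_side M R p2"
  proof (rule is_sideI[OF finM RM, of p2 "- (v - hx p2 *\<^sub>R u)" "- ((v - hx p2 *\<^sub>R u) \<bullet> R)"])
    show "p2 \<in> M" "R \<noteq> p2" using qX X_M(1) pR by auto
    show "- (v - hx p2 *\<^sub>R u) \<bullet> p2 = - ((v - hx p2 *\<^sub>R u) \<bullet> R)" "- (v - hx p2 *\<^sub>R u) \<bullet> R = - ((v - hx p2 *\<^sub>R u) \<bullet> R)"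
      unfolding inner_minus_left using w[of "hx p2" p2] ends0 by simp_all
    fix s assume "s \<in> M - {R, p2}"
    then have s: "s \<in> X" "s \<noteq> p2" using X_M(3) by blast+
    then have "hx s < hx p2" using bounds[OF s(1)] hx_neq[OF s(1) qX s(2)] by simp
    then have "gg s < hx p2 * ff s" using ff_pos[OF s(1)] gg_eq[of s] by simp
    then show "- ((v - hx p2 *\<^sub>R u) \<bullet> R) < - (v - hx p2 *\<^sub>R u) \<bullet> s" unfolding inner_minus_left using w[of "hx p2" s] by linarith
  qed
  from 1 2 assms show ?thesis by blast
qed

text \<open>The path with cut set \<open>{z}\<close> cannot have \<open>z\<close> as a peak here, so
  by \<open>catalan_less_sum_blocks\<close> no point lies strictly between \<open>p1\<close> and
  \<open>z\<close>, or none strictly between \<open>z\<close> and \<open>p2\<close>. In the first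
  case every point other than \<open>R\<close>, \<open>p1\<close>, \<open>z\<close> lies to the
  right of \<open>z\<close>, and as \<open>z\<close> is below all chords, it lies in the triangle of
  that point with \<open>R\<close> and \<open>p1\<close>.\<close>

lemma close_side_below:
  assumes eq: "card (trifams M) = catalan (card M - 2)" and z: "z \<in> X - {p1, p2}"
    and below: "\<And>l r. l \<in> X \<Longrightarrow> r \<in> X \<Longrightarrow> hx l < hx z \<Longrightarrow> hx z < hx r \<Longrightarrow> hy z < hlin l r (hx z)"
  shows "\<exists>Q Q'. is_side M Q Q' \<and> close_to_side M z Q Q'"
proof -
  obtain S where S: "S \<in> paths" "cut S = {z}" using cut_single_exists[OF z] .
  have zX: "z \<in> X" using z by blast
  have zz: "hx p1 < hx z" "hx z < hx p2" using inner_between[OF z] by auto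
  have fz: "0 < ff z" by (rule ff_pos[OF zX])
  have zS: "z \<notin> S"
  proof
    assume zS: "z \<in> S"
    note n = path_neighbours[OF S(1) z]
    have "z \<in> cut S" using S(2) by simp
    then have "hlin (prv hx S z) (nxt hx S z) (hx z) < hy z" using zS by (simp add: cut_def)
    moreover have "hy z < hlin (prv hx S z) (nxt hx S z) (hx z)" using below n(1-4) pathD(1)[OF S(1)] by blast
    ultimately show False by simp
  qed
  have notboth: False if "l \<in> X" "hx p1 < hx l" "hx l < hx z" "r \<in> X" "hx z < hx r" "hx r < hx p2" for l r
    using catalan_less_sum_blocks[OF z S zS that] glued_eq_trifams(2)[OF eq] by simp
  have wedge: "z \<in> convex hull {R, a, b}" if "a \<in> X" "b \<in> X" "hx a < hx z" "hx z < hx b" for a b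
    using mem_wedge[of a b z] ff_pos[OF that(1)] ff_pos[OF that(2)] that fz below[OF that] by simp
  show ?thesis
  proof (cases "\<exists>l\<in>X. hx p1 < hx l \<and> hx l < hx z")
    case False
    have "z \<in> convex hull {P, R, p1}" if P: "P \<in> M - {R, p1}" for P
    proof (cases "P = z")
      case True
      then show ?thesis by (simp add: hull_inc)
    next
      case ne: False
      have PX: "P \<in> X" "P \<noteq> p1" using P X_M(3) by blast+
      then have "hx p1 < hx P" using bounds[OF PX(1)] hx_neq[OF PX(1) pX PX(2)] by simp
      then have "\<not> hx P < hx z" using False PX(1) by blast
      then have "hx z < hx P" using hx_neq[OF PX(1) zX ne] by simp
      from wedge[OF pX PX(1) zz(1) this] show ?thesis by (simp add: insert_commute)
    qed
    then have "close_to_side M z R p1" unfolding close_to_side_def by blast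
    then show ?thesis using side_first by blast
  next
    case True
    then obtain l where l: "l \<in> X" "hx p1 < hx l" "hx l < hx z" by blast
    have "z \<in> convex hull {P, R, p2}" if P: "P \<in> M - {R, p2}" for P
    proof (cases "P = z")
      case True
      then show ?thesis by (simp add: hull_inc)
    next
      case ne: False
      have PX: "P \<in> X" "P \<noteq> p2" using P X_M(3) by blast+
      then have "hx P < hx p2" using bounds[OF PX(1)] hx_neq[OF PX(1) qX PX(2)] by simp
      then have "\<not> hx z < hx P" using notboth[OF l PX(1)] by blast
      then have "hx P < hx z" using hx_neq[OF PX(1) zX ne] by simp
      from wedge[OF PX(1) qX this zz(2)] show ?thesis by (simp add: insert_commute)
    qed
    then have "close_to_side M z R p2" unfolding close_to_side_def by blast
    then show ?thesis using side_first by blast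
  qed
qed

text \<open>By the slopes, \<open>z\<close> is below the chord \<open>a a'\<close> but above every
  chord over it from another point to \<open>a\<close> or \<open>a'\<close>. So all other points are
  below the line \<open>a a'\<close>, which is therefore a side, and a triangle over this side has
  \<open>z\<close> between two of its edges, or below the side if its third vertex is
  \<open>R\<close>.\<close>

lemma close_side_above:
  assumes z: "z \<in> X" and a: "a \<in> X" "hx a < hx z" and a': "a' \<in> X" "hx z < hx a'" and aa': "slope z a < slope z a'"
    and left: "\<And>s. s \<in> X \<Longrightarrow> hx s < hx z \<Longrightarrow> s \<noteq> a \<Longrightarrow> slope z a' < slope z s"
    and right: "\<And>s. s \<in> X \<Longrightarrow> hx z < hx s \<Longrightarrow> s \<noteq> a' \<Longrightarrow> slope z s < slope z a"
  shows "is_side M a a' \<and> close_to_side M z a a'"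
proof -
  have fz: "0 < ff z" by (rule ff_pos[OF z])
  have lt: "hx a < hx a'" using a a' by simp
  define m where "m = (hy a' - hy a) / (hx a' - hx a)"
  have L: "hlin a a' t = hy a + m * (t - hx a)" for t by (simp add: lin_def m_def)
  have "m * (hx a' - hx a) = hy a' - hy a" using lt by (simp add: m_def)
  then have L': "hlin a a' t = hy a' + m * (t - hx a')" for t by (simp add: L algebra_simps)
  have zb: "hy z < hlin a a' (hx z)" using below_iff_slope[OF a(2) a'(2)] aa' by blast
  have ya: "hy a = hy z + slope z a * (hx a - hx z)" using slope_eq[of a z] a(2) by simp
  have ya': "hy a' = hy z + slope z a' * (hx a' - hx z)" using slope_eq[of a' z] a'(2) by simp
  have m1: "slope z a < m"
  proof -
    have "slope z a * (hx z - hx a) < m * (hx z - hx a)" using zb unfolding L ya by (simp add: algebra_simps)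
    then show ?thesis using a(2) by simp
  qed
  have m2: "m < slope z a'"
  proof -
    have "m * (hx a' - hx z) < slope z a' * (hx a' - hx z)" using zb unfolding L' ya' by (simp add: algebra_simps)
    then show ?thesis using a'(2) by simp
  qed
  have below: "hy s < hlin a a' (hx s)" if s: "s \<in> X" "s \<noteq> a" "s \<noteq> a'" for s
  proof (cases "s = z")
    case True
    then show ?thesis using zb by simp
  next
    case False
    then have ne: "hx s \<noteq> hx z" using hx_neq[OF s(1) z] by blast
    note ys = slope_eq[OF ne]
    show ?thesis
    proof (cases "hx s < hx z")
      case True
      have "slope z s * (hx s - hx z) < slope z a' * (hx s - hx z)"
        using left[OF s(1) True s(2)] True by (intro mult_strict_right_mono_neg) auto
      then have "hy s < hy a' + slope z a' * (hx s - hx a')" unfolding ys ya' by (simp add: algebra_simps)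
      also have "\<dots> < hy a' + m * (hx s - hx a')" using m2 True a'(2) by (simp add: mult_strict_right_mono_neg)
      finally show ?thesis unfolding L' .
    next
      case False
      then have gt: "hx z < hx s" using ne by simp
      have "slope z s * (hx s - hx z) < slope z a * (hx s - hx z)"
        using right[OF s(1) gt s(3)] gt by (intro mult_strict_right_mono) auto
      then have "hy s < hy a + slope z a * (hx s - hx a)" unfolding ys ya by (simp add: algebra_simps)
      also have "\<dots> < hy a + m * (hx s - hx a)" using m1 gt a(2) by (simp add: mult_strict_right_mono)
      finally show ?thesis unfolding L .
    qed
  qed
  obtain w c where w: "\<And>q. 0 < ff q \<Longrightarrow> ff q * (hy q - hlin a a' (hx q)) = w \<bullet> q - c" and wR: "w \<bullet> R - c = - 1"
    using above_affine[OF less_imp_neq[OF lt]] by blast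
  have "is_side M a a'"
  proof (rule is_sideI[OF finM, of a a' "- w" "- c"])
    show "a \<in> M" "a' \<in> M" "a \<noteq> a'" using a(1) a'(1) X_M(1) lt by auto
    show "- w \<bullet> a = - c" "- w \<bullet> a' = - c" using w[OF ff_pos[OF a(1)]] w[OF ff_pos[OF a'(1)]] lt by simp_all
    fix s assume s: "s \<in> M - {a, a'}"
    show "- c < - w \<bullet> s"
    proof (cases "s = R")
      case True
      then show ?thesis using wR by simp
    next
      case False
      then have sX: "s \<in> X" "s \<noteq> a" "s \<noteq> a'" using s X_M(3) by blast+
      have "ff s * (hy s - hlin a a' (hx s)) < 0" using below[OF sX] ff_pos[OF sX(1)] by (intro mult_pos_neg) auto
      then show ?thesis using w[OF ff_pos[OF sX(1)]] by simp
    qed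
  qed
  moreover have "z \<in> convex hull {P, a, a'}" if P: "P \<in> M - {a, a'}" for P
  proof -
    consider "P = R" | "P = z" | "P \<in> X" "hx P < hx z" | "P \<in> X" "hx z < hx P"
      using P X_M(3) hx_neq[OF _ z, of P] by (metis DiffD1 insertE linorder_neqE_linordered_idom)
    then show ?thesis
    proof cases
      case 1
      then show ?thesis using mem_wedge[of a a' z] ff_pos[OF a(1)] ff_pos[OF a'(1)] lt fz a(2) a'(2) zb by simp
    next
      case 2
      then show ?thesis by (simp add: hull_inc)
    next
      case 3
      have "P \<noteq> a" using P by blast
      then have "hlin P a' (hx z) < hy z" using above_iff_slope[OF 3(2) a'(2)] left[OF 3] by blast
      then show ?thesis
        by (intro mem_between[of "{P, a, a'}" P a' a a']) (use 3 a a' lt fz zb in auto)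
    next
      case 4
      have "P \<noteq> a'" using P by blast
      then have "hlin a P (hx z) < hy z" using above_iff_slope[OF a(2) 4(2)] right[OF 4] by blast
      then show ?thesis
        by (intro mem_between[of "{P, a, a'}" a P a a']) (use 4 a a' lt fz zb in auto)
    qed
  qed
  ultimately show ?thesis unfolding close_to_side_def by blast
qed

lemma close_side_exists:
  assumes eq: "card (trifams M) = catalan (card M - 2)" and z: "z \<in> X" "z \<in> convex hull (M - {z})"
  shows "\<exists>Q Q'. is_side M Q Q' \<and> close_to_side M z Q Q'"
proof (cases "\<exists>l r. l \<in> X \<and> r \<in> X \<and> hx l < hx z \<and> hx z < hx r \<and> hlin l r (hx z) < hy z")
  case False
  show ?thesis
  proof (rule close_side_below[OF eq interior_not_end[OF z]])
    fix l r assume h: "l \<in> X" "r \<in> X" "hx l < hx z" "hx z < hx r"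
    then have "hy z \<noteq> hlin l r (hx z)" using gp[of l r z] z(1) by force
    moreover have "\<not> hlin l r (hx z) < hy z" using False h by blast
    ultimately show "hy z < hlin l r (hx z)" by simp
  qed
next
  case True
  then obtain l0 r0 where lr0: "l0 \<in> X" "r0 \<in> X" "hx l0 < hx z" "hx z < hx r0" "hlin l0 r0 (hx z) < hy z" by blast
  note ze = interior_not_end[OF z]
  have all: "\<T> \<in> glued" if "\<T> \<in> trifams M" for \<T> using glued_eq_trifams(1)[OF eq] that by simp
  let ?L = "{s \<in> X. hx s < hx z}" and ?R = "{s \<in> X. hx z < hx s}"
  have fL: "finite ?L" "finite ?R" using fin by simp_all
  have neL: "?L \<noteq> {}" "?R \<noteq> {}" using lr0 by blast+
  \<comment> \<open>\<open>a\<close> and \<open>a'\<close> are the points that appear highest from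
    \<open>z\<close> on the left and on the right; on the left the highest direction has the
    smallest slope.\<close>
  obtain a where a0: "a \<in> ?L" "\<And>s. s \<in> ?L \<Longrightarrow> - slope z s \<le> - slope z a" using finite_argmax[OF fL(1) neL(1), of "\<lambda>s. - slope z s"] by blast
  obtain a' where a'0: "a' \<in> ?R" "\<And>s. s \<in> ?R \<Longrightarrow> slope z s \<le> slope z a'" using finite_argmax[OF fL(2) neL(2), of "slope z"] by blast
  have a: "a \<in> X" "hx a < hx z" and a': "a' \<in> X" "hx z < hx a'" using a0(1) a'0(1) by auto
  have az: "a \<noteq> z" "a' \<noteq> z" using a(2) a'(2) by auto
  have amin: "slope z a < slope z s" if "s \<in> X" "hx s < hx z" "s \<noteq> a" for s
  proof -
    have "s \<noteq> z" using that(2) by auto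
    then have "slope z a \<noteq> slope z s" using slope_neq[OF a(1) that(1) z(1)] that(3) az(1) by blast
    then show ?thesis using a0(2)[of s] that by simp
  qed
  have amax: "slope z s < slope z a'" if "s \<in> X" "hx z < hx s" "s \<noteq> a'" for s
  proof -
    have "s \<noteq> z" using that(2) by auto
    then have "slope z a' \<noteq> slope z s" using slope_neq[OF a'(1) that(1) z(1)] that(3) az(2) by blast
    then show ?thesis using a'0(2)[of s] that by simp
  qed
  obtain l r where lr: "l \<in> X" "r \<in> X" "hx l < hx z" "hx z < hx r" "hy z < hlin l r (hx z)" using interior_below_pair[OF z] .
  have "slope z l < slope z r" using below_iff_slope[OF lr(3,4)] lr(5) by blast
  moreover have "slope z a \<le> slope z l" "slope z r \<le> slope z a'" using a0(2)[of l] a'0(2)[of r] lr by auto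
  ultimately have aa': "slope z a < slope z a'" by simp
  \<comment> \<open>Otherwise \<open>z\<close> lies below the chord \<open>k a'\<close> while
    \<open>a\<close> lies above the line \<open>k z\<close>, and \<open>not_glued_exists\<close>
    gives a triangulation that is not glued.\<close>
  have left: "slope z a' < slope z k" if k: "k \<in> X" "hx k < hx z" "k \<noteq> a" for k
  proof (rule ccontr)
    assume "\<not> slope z a' < slope z k"
    moreover have "slope z k \<noteq> slope z a'"
      by (rule slope_neq[OF k(1) a'(1) z(1)]) (use k(2) a'(2) az in auto)
    ultimately have "slope z k < slope z a'" by simp
    then have zk: "hy z < hlin k a' (hx z)" using below_iff_slope[OF k(2) a'(2)] by blast
    have "hlin k z (hx a) < hy a"
    proof -
      have "slope z k * (hx a - hx z) < slope z a * (hx a - hx z)"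
        using amin[OF k] a(2) by (intro mult_strict_right_mono_neg) auto
      then show ?thesis using slope_eq[of a z] hlin_slope[of k z "hx a"] k(2) a(2) by simp
    qed
    from not_glued_exists[OF ze lr0 a this k a' zk] show False using all by blast
  qed
  have right: "slope z k < slope z a" if k: "k \<in> X" "hx z < hx k" "k \<noteq> a'" for k
  proof (rule ccontr)
    assume "\<not> slope z k < slope z a"
    moreover have "slope z k \<noteq> slope z a"
      by (rule slope_neq[OF k(1) a(1) z(1)]) (use k(2) a(2) az in auto)
    ultimately have "slope z a < slope z k" by simp
    then have zk: "hy z < hlin a k (hx z)" using below_iff_slope[OF a(2) k(2)] by blast
    have ka: "hlin k z (hx a') < hy a'"
    proof -
      have "slope z k * (hx a' - hx z) < slope z a' * (hx a' - hx z)"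
        using amax[OF k] a'(2) by (intro mult_strict_right_mono) auto
      then show ?thesis using slope_eq[of a' z] hlin_slope[of k z "hx a'"] k(2) a'(2) by simp
    qed
    interpret m: star R u "- v" M p2 p1 by (rule mirror)
    have "\<exists>\<T>\<in>trifams M. \<T> \<notin> m.glued"
    proof (rule m.not_glued_exists)
      show "z \<in> X - {p2, p1}" using ze by blast
      show "r0 \<in> X" "l0 \<in> X" "a' \<in> X" "k \<in> X" "k \<noteq> a'" "a \<in> X" by (fact lr0 a'(1) k a(1))+
      show "m.hx r0 < m.hx z" "m.hx z < m.hx l0" "m.hx a' < m.hx z" "m.hx k < m.hx z" "m.hx z < m.hx a"
        unfolding mirror_hx using lr0(3,4) a'(2) k(2) a(2) by simp_all
      show "lin m.hx hy r0 l0 (m.hx z) < hy z"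
        unfolding mirror_hx lin_reflect using lr0(3,4,5) lin_commute[of hx r0 l0 hy] by simp
      show "lin m.hx hy k z (m.hx a') < hy a'"
        unfolding mirror_hx lin_reflect by (rule ka)
      show "hy z < lin m.hx hy k a (m.hx z)"
        unfolding mirror_hx lin_reflect using zk lin_commute[of hx k a hy] k(2) a(2) by simp
    qed
    then show False using m.glued_eq_trifams(1)[OF eq] by simp
  qed
  show ?thesis using close_side_above[OF z(1) a a' aa' left right] by blast
qed

end

theorem quasi_convex_if_card_eq:
  assumes fin: "finite M" and gp: "general_position M" and card: "3 \<le> card M" and eq: "card (trifams M) = catalan (card M - 2)"
  shows "quasi_convex M"
  unfolding quasi_convex_def
proof (intro allI impI)
  fix z assume "interior_point M z"
  then have z: "z \<in> M" "\<not> z extreme_point_of convex hull M" by (auto simp: interior_point_def hull_vertices_def)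
  have "M \<noteq> {}" using z(1) by blast
  then obtain R where R: "R extreme_point_of convex hull M" using hull_vertex_exists[OF fin] by blast
  obtain u v p1 p2 where "star R u v M p1 p2" using star_exists[OF fin gp card R] .
  then interpret star R u v M p1 p2 .
  have "z \<in> X" using z R by (auto simp: X_def)
  moreover have "z \<in> convex hull (M - {z})"
  proof (rule ccontr)
    assume "z \<notin> convex hull (M - {z})"
    then have "z extreme_point_of convex hull (insert z (M - {z}))" using finM by (intro extreme_point_of_convex_hull_insert) auto
    then show False using z by (simp add: insert_absorb)
  qed
  ultimately show "\<exists>Q Q'. is_side M Q Q' \<and> close_to_side M z Q Q'" by (rule close_side_exists[OF eq])
qed

section \<open>Orientations and the upper bound for almost convex orders\<close>

definition orient :: "point \<Rightarrow> point \<Rightarrow> point \<Rightarrow> real" where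
  "orient a b c = (b $ 1 - a $ 1) * (c $ 2 - a $ 2) - (b $ 2 - a $ 2) * (c $ 1 - a $ 1)"

lemma orient_rotate: "orient b c a = orient a b c"
  by (simp add: orient_def algebra_simps)

lemma orient_swap: "orient a c b = - orient a b c"
  by (simp add: orient_def algebra_simps)

lemma orient_degenerate [simp]: "orient a b a = 0" "orient a b b = 0" "orient a a b = 0"
  by (simp_all add: orient_def)

lemma orient_affine:
  obtains w c where "\<And>q. orient a b q = w \<bullet> q - c"
proof -
  define w where "w = (vector [a $ 2 - b $ 2, b $ 1 - a $ 1] :: point)"
  have "orient a b q = w \<bullet> q - w \<bullet> a" for q
    by (simp add: orient_def w_def inner_vec_def sum_2 algebra_simps)
  then show ?thesis by (rule that)
qed

lemma orient_comb:
  assumes "s + t = 1"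
  shows "orient a b (s *\<^sub>R p + t *\<^sub>R q) = s * orient a b p + t * orient a b q"
proof -
  obtain w c where w: "\<And>q. orient a b q = w \<bullet> q - c" using orient_affine[of a b] by blast
  have "s * c + t * c = c" using assms by (simp flip: distrib_right)
  then show ?thesis by (simp add: w inner_add_right algebra_simps)
qed

lemma orient_comb3:
  assumes "r + s + t = 1"
  shows "orient a b (r *\<^sub>R o' + s *\<^sub>R p + t *\<^sub>R q) = r * orient a b o' + s * orient a b p + t * orient a b q"
proof -
  obtain w c where w: "\<And>q. orient a b q = w \<bullet> q - c" using orient_affine[of a b] by blast
  have "r * c + s * c + t * c = c" using assms by (simp flip: distrib_right)
  then show ?thesis by (simp add: w inner_add_right algebra_simps)
qed

lemma orient_hull_nonneg:
  assumes "q \<in> convex hull A" "\<And>s. s \<in> A \<Longrightarrow> 0 \<le> \<epsilon> * orient a b s"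
  shows "0 \<le> \<epsilon> * orient a b q"
proof -
  obtain w c where w: "\<And>q. orient a b q = w \<bullet> q - c" using orient_affine[of a b] by blast
  have "\<epsilon> * c \<le> (\<epsilon> *\<^sub>R w) \<bullet> s" if "s \<in> A" for s using assms(2)[OF that] by (simp add: w algebra_simps)
  then have "\<epsilon> * c \<le> (\<epsilon> *\<^sub>R w) \<bullet> q" by (rule hull_ge[OF assms(1)])
  then show ?thesis by (simp add: w algebra_simps)
qed

lemma orient_0_collinear:
  assumes "orient a b c = 0"
  shows "collinear {a, b, c}"
proof (cases "a = b")
  case False
  have e: "(b $ 1 - a $ 1) * (c $ 2 - a $ 2) = (b $ 2 - a $ 2) * (c $ 1 - a $ 1)" using assms by (simp add: orient_def)
  have "\<exists>t. c = (1 - t) *\<^sub>R a + t *\<^sub>R b"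
  proof (cases "b $ 1 = a $ 1")
    case False
    define t where "t = (c $ 1 - a $ 1) / (b $ 1 - a $ 1)"
    have t1: "t * (b $ 1 - a $ 1) = c $ 1 - a $ 1" using False by (simp add: t_def)
    have "(b $ 1 - a $ 1) * (t * (b $ 2 - a $ 2)) = (b $ 1 - a $ 1) * (c $ 2 - a $ 2)"
    proof -
      have "(b $ 1 - a $ 1) * (t * (b $ 2 - a $ 2)) = (t * (b $ 1 - a $ 1)) * (b $ 2 - a $ 2)" by (simp only: ac_simps)
      also have "\<dots> = (b $ 2 - a $ 2) * (c $ 1 - a $ 1)" unfolding t1 by (rule mult.commute)
      finally show ?thesis using e by simp
    qed
    then have t2: "t * (b $ 2 - a $ 2) = c $ 2 - a $ 2" using False by simp
    have "c = (1 - t) *\<^sub>R a + t *\<^sub>R b" using t1 t2 by (simp add: vec_eq_iff forall_2 algebra_simps)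
    then show ?thesis by blast
  next
    case True
    then have b2: "b $ 2 \<noteq> a $ 2" using \<open>a \<noteq> b\<close> by (simp add: vec_eq_iff forall_2)
    then have c1: "c $ 1 = a $ 1" using e True by simp
    define t where "t = (c $ 2 - a $ 2) / (b $ 2 - a $ 2)"
    have t2: "t * (b $ 2 - a $ 2) = c $ 2 - a $ 2" using b2 by (simp add: t_def)
    have "c = (1 - t) *\<^sub>R a + t *\<^sub>R b" using t2 True c1 by (simp add: vec_eq_iff forall_2 algebra_simps)
    then show ?thesis by blast
  qed
  then obtain t where "c = (1 - t) *\<^sub>R a + (1 - (1 - t)) *\<^sub>R b" by auto
  then have "collinear {a, c, b}" unfolding collinear_3_expand by blast
  then show ?thesis by (simp add: insert_commute)
qed simp

lemma orient_nonzero: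
  assumes "general_position M" "a \<in> M" "b \<in> M" "c \<in> M" "a \<noteq> b" "b \<noteq> c" "a \<noteq> c"
  shows "orient a b c \<noteq> 0"
  using orient_0_collinear[of a b c] assms unfolding general_position_def by blast

lemma mem_triangle:
  assumes "0 < orient a b c" "0 \<le> orient a b p" "0 \<le> orient b c p" "0 \<le> orient c a p"
  shows "p \<in> convex hull {a, b, c}"
proof -
  define \<Delta> where "\<Delta> = orient a b c"
  have p: "0 < \<Delta>" using assms by (simp add: \<Delta>_def)
  have sum: "orient b c p + orient c a p + orient a b p = \<Delta>" by (simp add: \<Delta>_def orient_def algebra_simps)
  have "\<Delta> * p $ 1 = orient b c p * a $ 1 + orient c a p * b $ 1 + orient a b p * c $ 1"
    "\<Delta> * p $ 2 = orient b c p * a $ 2 + orient c a p * b $ 2 + orient a b p * c $ 2"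
    by (simp_all add: \<Delta>_def orient_def algebra_simps)
  then have "\<Delta> *\<^sub>R p = orient b c p *\<^sub>R a + orient c a p *\<^sub>R b + orient a b p *\<^sub>R c"
    by (simp add: vec_eq_iff forall_2)
  then have "(1 / \<Delta>) *\<^sub>R (\<Delta> *\<^sub>R p) = (1 / \<Delta>) *\<^sub>R (orient b c p *\<^sub>R a + orient c a p *\<^sub>R b + orient a b p *\<^sub>R c)" by simp
  then have "p = (orient b c p / \<Delta>) *\<^sub>R a + (orient c a p / \<Delta>) *\<^sub>R b + (orient a b p / \<Delta>) *\<^sub>R c"
    using p by (simp add: scaleR_add_right)
  moreover have "orient b c p / \<Delta> + orient c a p / \<Delta> + orient a b p / \<Delta> = 1"
    using sum p by (simp flip: add_divide_distrib)
  ultimately show ?thesis unfolding convex_hull_3 using assms p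
    by (intro CollectI exI[of _ "orient b c p / \<Delta>"] exI[of _ "orient c a p / \<Delta>"] exI[of _ "orient a b p / \<Delta>"]) simp
qed

text \<open>The points are in convex position. The weights of the crossing point come from the
  affine dependence of four points in the plane, whose coefficients are the orientations of the
  complementary triples.\<close>

lemma segments_cross:
  assumes "0 < orient a b c" "0 < orient a b d" "0 < orient a c d" "0 < orient b c d"
  obtains q \<alpha> \<beta> where "0 < \<alpha>" "\<alpha> < 1" "0 < \<beta>" "\<beta> < 1" "q = (1 - \<alpha>) *\<^sub>R a + \<alpha> *\<^sub>R c" "q = (1 - \<beta>) *\<^sub>R b + \<beta> *\<^sub>R d"
proof -
  define s where "s = orient b c d + orient a b d"
  have s: "s = orient a c d + orient a b c" by (simp add: s_def orient_def algebra_simps)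
  have sp: "0 < s" using assms by (simp add: s_def)
  have "orient b c d * a $ 1 + orient a b d * c $ 1 = orient a c d * b $ 1 + orient a b c * d $ 1"
    "orient b c d * a $ 2 + orient a b d * c $ 2 = orient a c d * b $ 2 + orient a b c * d $ 2"
    by (simp_all add: orient_def algebra_simps)
  then have v: "orient b c d *\<^sub>R a + orient a b d *\<^sub>R c = orient a c d *\<^sub>R b + orient a b c *\<^sub>R d"
    by (simp add: vec_eq_iff forall_2)
  define \<alpha> \<beta> where "\<alpha> = orient a b d / s" and "\<beta> = orient a b c / s"
  have e: "1 - \<alpha> = orient b c d / s" "1 - \<beta> = orient a c d / s"
  proof -
    have "1 - \<alpha> = (s - orient a b d) / s" "1 - \<beta> = (s - orient a b c) / s" using sp by (simp_all add: \<alpha>_def \<beta>_def diff_divide_distrib)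
    moreover have "s - orient a b d = orient b c d" by (simp add: s_def)
    moreover have "s - orient a b c = orient a c d" by (simp add: s)
    ultimately show "1 - \<alpha> = orient b c d / s" "1 - \<beta> = orient a c d / s" by simp_all
  qed
  have "(1 / s) *\<^sub>R (orient b c d *\<^sub>R a + orient a b d *\<^sub>R c) = (1 / s) *\<^sub>R (orient a c d *\<^sub>R b + orient a b c *\<^sub>R d)" using v by simp
  then have q: "(1 - \<alpha>) *\<^sub>R a + \<alpha> *\<^sub>R c = (1 - \<beta>) *\<^sub>R b + \<beta> *\<^sub>R d"
    unfolding e by (simp add: \<alpha>_def \<beta>_def scaleR_add_right)
  have "0 < 1 - \<alpha>" "0 < 1 - \<beta>" unfolding e using assms sp by simp_all
  then show ?thesis using that[OF _ _ _ _ refl q] assms sp by (simp add: \<alpha>_def \<beta>_def)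
qed

lemma trifams_vertex_in_hull:
  assumes gp: "general_position B" and T: "\<T> \<in> trifams B" and V: "V \<in> \<T>" "V' \<in> \<T>" and p: "p \<in> convex hull V" "p \<in> V'"
  shows "p \<in> V"
proof -
  note D = trifamsD[OF T]
  have i: "\<not> affine_dependent V'" using triple_independent[OF gp D(1,2)] V(2) by blast
  have "p \<in> convex hull V'" using p(2) by (rule hull_inc)
  then have "p \<in> convex hull (V \<inter> V') \<inter> convex hull {p}" using D(3)[OF V] p(1) by auto
  then have "p \<in> convex hull ((V \<inter> V') \<inter> {p})" using convex_hull_Int_faces[OF i, of "V \<inter> V'" "{p}"] p(2) by blast
  then show ?thesis by (cases "p \<in> V") auto
qed

text \<open>The crossing point lies in both triangles, hence in their common face, and in the
  interior of the segment \<open>b d\<close>. So \<open>b\<close> and \<open>d\<close> are common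
  vertices, and \<open>V\<close> would have four of them.\<close>

lemma trifams_no_crossing:
  assumes gp: "general_position B" and T: "\<T> \<in> trifams B" and V: "V \<in> \<T>" "V' \<in> \<T>" and ac: "a \<in> V" "c \<in> V" and bd: "b \<in> V'" "d \<in> V'"
    and o: "0 < orient a b c" "0 < orient a b d" "0 < orient a c d" "0 < orient b c d"
  shows False
proof -
  note D = trifamsD[OF T]
  have i: "\<not> affine_dependent V'" using triple_independent[OF gp D(1,2)] V(2) by blast
  obtain q \<alpha> \<beta> where q: "0 < \<alpha>" "\<alpha> < 1" "0 < \<beta>" "\<beta> < 1" "q = (1 - \<alpha>) *\<^sub>R a + \<alpha> *\<^sub>R c" "q = (1 - \<beta>) *\<^sub>R b + \<beta> *\<^sub>R d"
    using segments_cross[OF o] .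
  have "q \<in> convex hull {a, c}" unfolding convex_hull_2 using q(1,2,5) by (intro CollectI exI[of _ "1 - \<alpha>"] exI[of _ \<alpha>]) simp
  then have "q \<in> convex hull V" using hull_mono[of "{a, c}" V convex] ac by blast
  moreover have qbd: "q \<in> convex hull {b, d}" unfolding convex_hull_2 using q(3,4,6) by (intro CollectI exI[of _ "1 - \<beta>"] exI[of _ \<beta>]) simp
  then have "q \<in> convex hull V'" using hull_mono[of "{b, d}" V' convex] bd by blast
  ultimately have "q \<in> convex hull (V \<inter> V')" using D(3)[OF V] by blast
  then have qf: "q \<in> convex hull ((V \<inter> V') \<inter> {b, d})"
    using convex_hull_Int_faces[OF i, of "V \<inter> V'" "{b, d}"] qbd bd by blast
  have ne: "b \<noteq> d" using o(2) by auto
  have "(V \<inter> V') \<inter> {b, d} = {b, d}"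
  proof (rule in_hull_subset_pos[OF _ _ qf, of _ "\<lambda>x. if x = b then 1 - \<beta> else \<beta>"])
    show "\<not> affine_dependent {b, d}" using affine_dependent_subset[of "{b, d}" V'] i bd by blast
  qed (use q ne in auto)
  then have "{a, b, c, d} \<subseteq> V" using ac by blast
  moreover have "card {a, b, c, d} = 4"
  proof -
    have "a \<noteq> b" "a \<noteq> c" "a \<noteq> d" "b \<noteq> c" "c \<noteq> d" using o by auto
    then show ?thesis using ne by simp
  qed
  moreover have "card V = 3" "finite V" using D(2)[OF V(1)] card.infinite by fastforce+
  ultimately show False using card_mono[of V "{a, b, c, d}"] by simp
qed

text \<open>Moving a point of the hull towards \<open>c\<close> leaves every triangle that is not contained in \<open>Q\<close>.\<close>

lemma trifams_restrict:
  assumes T: "\<T> \<in> trifams B" and fin: "finite B" and QB: "Q \<subseteq> B" and c: "c \<in> convex hull Q"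
    and sep: "\<And>V. V \<in> \<T> \<Longrightarrow> \<not> V \<subseteq> Q \<Longrightarrow>
      \<exists>a b \<epsilon>. (\<forall>s\<in>Q. 0 \<le> \<epsilon> * orient a b s) \<and> 0 < \<epsilon> * orient a b c \<and> (\<forall>s\<in>V. \<epsilon> * orient a b s \<le> 0)"
  shows "{V \<in> \<T>. V \<subseteq> Q} \<in> trifams Q"
proof -
  note D = trifamsD[OF T]
  have "convex hull Q \<subseteq> (\<Union>V\<in>{V \<in> \<T>. V \<subseteq> Q}. convex hull V)" (is "_ \<subseteq> ?U")
  proof
    fix q assume q: "q \<in> convex hull Q"
    have finT: "finite {V \<in> \<T>. V \<subseteq> Q}" by (rule finite_subset[of _ "Pow B"]) (use D(1) fin in auto)
    have closed: "closed ?U"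
    proof (rule closed_UN[OF finT], rule ballI)
      fix V assume "V \<in> {V \<in> \<T>. V \<subseteq> Q}"
      then have "finite V" using D(1) fin finite_subset by blast
      then show "closed (convex hull V)" by (simp add: compact_imp_closed finite_imp_compact_convex_hull)
    qed
    define f where "f t = (1 - t) *\<^sub>R q + t *\<^sub>R c" for t :: real
    have inU: "f t \<in> ?U" if t: "0 < t" "t \<le> 1" for t
    proof -
      have fQ: "f t \<in> convex hull Q" unfolding f_def using convexD[OF convex_convex_hull q c, of "1 - t" t] t by simp
      then have "f t \<in> convex hull B" using hull_mono[OF QB, of convex] by blast
      then obtain V where V: "V \<in> \<T>" "f t \<in> convex hull V" using D(4) by blast
      have "V \<subseteq> Q"
      proof (rule ccontr)
        assume "\<not> V \<subseteq> Q"
        then obtain a b \<epsilon> where s: "\<forall>s\<in>Q. 0 \<le> \<epsilon> * orient a b s" "0 < \<epsilon> * orient a b c" "\<forall>s\<in>V. \<epsilon> * orient a b s \<le> 0"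
          using sep[OF V(1)] by blast
        have "0 \<le> \<epsilon> * orient a b q" using orient_hull_nonneg[OF q] s(1) by blast
        then have "0 \<le> (1 - t) * (\<epsilon> * orient a b q)" using t by simp
        moreover have "0 < t * (\<epsilon> * orient a b c)" using t s(2) by simp
        moreover have "\<epsilon> * orient a b (f t) = (1 - t) * (\<epsilon> * orient a b q) + t * (\<epsilon> * orient a b c)"
          unfolding f_def by (subst orient_comb) (simp_all add: algebra_simps)
        ultimately have "0 < \<epsilon> * orient a b (f t)" by linarith
        moreover have "0 \<le> (- \<epsilon>) * orient a b (f t)" by (rule orient_hull_nonneg[OF V(2)]) (use s(3) in simp)
        ultimately show False by simp
      qed
      then show ?thesis using V by blast
    qed
    \<comment> \<open>A finite union of triangles is closed, so being covered passes from the points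
      \<open>f t\<close> with \<open>t > 0\<close> to \<open>q\<close> itself.\<close>
    have "(f \<longlongrightarrow> f 0) (at_right 0)"
      unfolding f_def by (intro tendsto_intros)
    moreover have "eventually (\<lambda>t. f t \<in> ?U) (at_right 0)"
      unfolding eventually_at_right_field by (intro exI[of _ 1]) (use inU in auto)
    moreover have "at_right (0::real) \<noteq> bot" by simp
    ultimately have "f 0 \<in> ?U" using Lim_in_closed_set[OF closed] by blast
    then show "q \<in> ?U" by (simp add: f_def)
  qed
  moreover have "?U \<subseteq> convex hull Q" using hull_mono[of _ Q convex] by blast
  ultimately show ?thesis using D(2,3) by (auto simp: trifams_def)
qed

section \<open>Orders with dents, and the triangle on the base\<close>

definition dent_triple :: "(point \<Rightarrow> real) \<Rightarrow> point set \<Rightarrow> point set \<Rightarrow> point \<Rightarrow> point \<Rightarrow> point \<Rightarrow> bool" where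
  "dent_triple \<rho> D B a b c \<longleftrightarrow> b \<in> D \<and> adjacent \<rho> B a b \<and> adjacent \<rho> B b c"

definition interval :: "(point \<Rightarrow> real) \<Rightarrow> point set \<Rightarrow> point \<Rightarrow> point \<Rightarrow> point set" where
  "interval \<rho> B l r = {b \<in> B. \<rho> l \<le> \<rho> b \<and> \<rho> b \<le> \<rho> r}"

text \<open>What may remain between \<open>l\<close> and \<open>r\<close> beside the splitting
  triangle. If only a dent lies between them, it is on the other side of the chord
  \<open>l r\<close>, inside the splitting triangle, so no triangle is left; like an interval of two
  points this counts once.\<close>

definition fills :: "(point \<Rightarrow> real) \<Rightarrow> point set \<Rightarrow> point set \<Rightarrow> point \<Rightarrow> point \<Rightarrow> point set set set" where
  "fills \<rho> D B l r = (if card (interval \<rho> B l r) \<le> 2 \<or> (\<exists>d. dent_triple \<rho> D B l d r) then {{}} else trifams (interval \<rho> B l r))"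

lemma dent_tripleD:
  assumes "dent_triple \<rho> D B a b c"
  shows "b \<in> D" "adjacent \<rho> B a b" "adjacent \<rho> B b c" "a \<in> B" "b \<in> B" "c \<in> B" "\<rho> a < \<rho> b" "\<rho> b < \<rho> c"
  using assms adjacentD[of \<rho> B a b] adjacentD[of \<rho> B b c] unfolding dent_triple_def by blast+

lemma third_vertex:
  assumes "card V = 3" "a \<in> V" "b \<in> V" "a \<noteq> b"
  obtains s where "V = {a, b, s}" "s \<noteq> a" "s \<noteq> b"
proof -
  have fin: "finite V" using assms(1) card.infinite by fastforce
  have "card (V - {a, b}) = 1" using assms fin by (subst card_Diff_subset) auto
  then obtain s where "V - {a, b} = {s}" by (rule card_1_singletonE)
  then show ?thesis using that[of s] assms(2,3) by blast
qed

text \<open>Here \<open>K\<close> is empty or consists of the predecessor of \<open>j\<close>; in the second case \<open>j\<close> is a dent of the side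
  formed by \<open>i\<close> and this predecessor.\<close>

locale split_at =
  fixes \<rho> :: "point \<Rightarrow> real" and D B K :: "point set" and i j P :: point and \<T> :: "point set set"
  assumes finB: "finite B" and injB: "inj_on \<rho> B" and gpB: "general_position B"
    and iB: "i \<in> B" and jB: "j \<in> B" and PB: "P \<in> B" and iP: "\<rho> i < \<rho> P" and Pj: "\<rho> P < \<rho> j"
    and ends: "\<And>b. b \<in> B \<Longrightarrow> \<rho> i \<le> \<rho> b \<and> \<rho> b \<le> \<rho> j"
    and pos: "\<And>a b c. a \<in> B \<Longrightarrow> b \<in> B \<Longrightarrow> c \<in> B \<Longrightarrow> \<rho> a < \<rho> b \<Longrightarrow> \<rho> b < \<rho> c \<Longrightarrow> \<not> dent_triple \<rho> D B a b c \<Longrightarrow> \<not> (a = i \<and> b \<in> K \<and> c = j) \<Longrightarrow> 0 < orient a b c"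
    and neg: "\<And>a b c. dent_triple \<rho> D B a b c \<Longrightarrow> orient a b c < 0"
    and noadj: "\<And>s t. adjacent \<rho> B s t \<Longrightarrow> \<not> (s \<in> D \<and> t \<in> D)"
    and K: "\<And>k. k \<in> K \<Longrightarrow> \<rho> P < \<rho> k \<and> adjacent \<rho> B k j \<and> k \<notin> D \<and> orient i k j < 0"
    and Kdent: "\<And>k s. k \<in> K \<Longrightarrow> \<not> dent_triple \<rho> D B i s k"
    and T: "\<T> \<in> trifams B" and WT: "{i, P, j} \<in> \<T>"
    and nb: "\<not> dent_triple \<rho> D B i P j"
begin

lemmas TD = trifamsD[OF T]

lemma eqI: "a \<in> B \<Longrightarrow> b \<in> B \<Longrightarrow> \<rho> a = \<rho> b \<Longrightarrow> a = b"
  using injB by (auto simp: inj_on_def)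

lemma not_adjacent: "s \<in> B \<Longrightarrow> \<rho> a < \<rho> s \<Longrightarrow> \<rho> s < \<rho> b \<Longrightarrow> \<not> adjacent \<rho> B a b"
  unfolding adjacent_def by force

lemma PK: "\<rho> s \<le> \<rho> P \<Longrightarrow> s \<notin> K"
  using K by force

lemma outer: "s \<in> B \<Longrightarrow> s \<noteq> i \<Longrightarrow> \<rho> i < \<rho> s" "s \<in> B \<Longrightarrow> s \<noteq> j \<Longrightarrow> \<rho> s < \<rho> j"
  using ends[of s] eqI[of i s] eqI[of s j] iB jB by force+

lemma W_pos: "0 < orient i P j"
  by (rule pos[OF iB PB jB iP Pj nb]) (use PK in blast)

text \<open>Closeness recovered from orientations. Since \<open>P\<close> is a vertex in use, this
  forces the third vertex of any triangle with the side \<open>S U\<close> in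
  \<open>triangle_over_dent\<close>.\<close>

lemma dent_in_hull:
  assumes d: "dent_triple \<rho> D B S P U" and s: "s \<in> B" "s \<noteq> S" "s \<noteq> P" "s \<noteq> U"
  shows "P \<in> convex hull {S, U, s}"
proof -
  note dd = dent_tripleD[OF d]
  have SD: "S \<notin> D" "U \<notin> D" using noadj[OF dd(2)] noadj[OF dd(3)] dd(1) by blast+
  have o: "0 < orient S U P" using neg[OF d] orient_swap[of S P U] by simp
  have "\<rho> s \<le> \<rho> S \<or> \<rho> P \<le> \<rho> s" "\<rho> s \<le> \<rho> P \<or> \<rho> U \<le> \<rho> s" using adjacentD(4)[OF dd(2) s(1)] adjacentD(4)[OF dd(3) s(1)] by blast+
  then have "\<rho> s \<le> \<rho> S \<or> \<rho> U \<le> \<rho> s" using eqI[OF s(1) PB] s(3) by force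
  then consider "\<rho> s < \<rho> S" | "\<rho> U < \<rho> s" using eqI[OF s(1) dd(4)] eqI[OF s(1) dd(6)] s by force
  then show ?thesis
  proof cases
    case 1
    have "0 < orient s S U" by (rule pos[OF s(1) dd(4,6) 1]) (use dd SD PK[of S] in \<open>auto simp: dent_triple_def\<close>)
    moreover have "0 < orient s P U"
      by (rule pos[OF s(1) PB dd(6)]) (use 1 dd PK[of P] not_adjacent[OF dd(4) 1 dd(7)] in \<open>auto simp: dent_triple_def\<close>)
    moreover have "0 < orient s S P" by (rule pos[OF s(1) dd(4) PB 1 dd(7)]) (use SD PK[of S] dd in \<open>auto simp: dent_triple_def\<close>)
    ultimately have "P \<in> convex hull {s, S, U}" using o orient_rotate[of s P U] by (intro mem_triangle) auto
    then show ?thesis by (simp add: insert_commute)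
  next
    case 2
    have "0 < orient S U s" by (rule pos[OF dd(4,6) s(1) _ 2]) (use dd SD d Kdent[of U P] in \<open>auto simp: dent_triple_def\<close>)
    moreover have "0 < orient P U s"
      by (rule pos[OF PB dd(6) s(1) dd(8) 2]) (use SD iP in \<open>auto simp: dent_triple_def\<close>)
    moreover have "0 < orient S P s"
      by (rule pos[OF dd(4) PB s(1) dd(7)]) (use 2 dd PK[of P] not_adjacent[OF dd(6) dd(8) 2] in \<open>auto simp: dent_triple_def\<close>)
    ultimately show ?thesis using o orient_rotate[of U s P] orient_rotate[of S P s] by (intro mem_triangle) auto
  qed
qed

lemma triangle_over_dent:
  assumes "V \<in> \<T>" "dent_triple \<rho> D B S P U" "S \<in> V" "U \<in> V"
  shows "V = {S, P, U}"
proof -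
  note dd = dent_tripleD[OF assms(2)]
  have "S \<noteq> U" using dd(7,8) by auto
  then obtain s where s: "V = {S, U, s}" "s \<noteq> S" "s \<noteq> U" using third_vertex[OF TD(2)[OF assms(1)] assms(3,4)] by blast
  have "s \<in> B" using TD(1)[OF assms(1)] s(1) by blast
  have "s = P"
  proof (rule ccontr)
    assume "s \<noteq> P"
    then have "P \<in> convex hull V" unfolding s(1) using dent_in_hull[OF assms(2) \<open>s \<in> B\<close>] s(2,3) by blast
    then have "P \<in> V" using trifams_vertex_in_hull[OF gpB T assms(1) WT] by blast
    then show False using \<open>s \<noteq> P\<close> dd(7,8) unfolding s(1) by auto
  qed
  then show ?thesis using s(1) by blast
qed

lemma base_dent_in_hull:
  assumes k: "k \<in> K" and s: "s \<in> B" "s \<noteq> i" "s \<noteq> k" "s \<noteq> j"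
  shows "j \<in> convex hull {i, s, k}"
proof -
  have kk: "\<rho> P < \<rho> k" "adjacent \<rho> B k j" "k \<notin> D" "orient i k j < 0" using K[OF k] by blast+
  have kB: "k \<in> B" "\<rho> k < \<rho> j" using adjacentD[OF kk(2)] by auto
  have si: "\<rho> i < \<rho> s" "\<rho> s < \<rho> j" using outer s by auto
  then have sk: "\<rho> s < \<rho> k" using adjacentD(4)[OF kk(2) s(1)] eqI[OF s(1) kB(1)] s(3) by force
  have sK: "s \<notin> K" using K[of s] not_adjacent[OF kB(1) sk kB(2)] by blast
  have "0 < orient i s k" by (rule pos[OF iB s(1) kB(1) si(1) sk]) (use Kdent[OF k] sK in auto)
  moreover have "0 < orient i s j"
    by (rule pos[OF iB s(1) jB si]) (use not_adjacent[OF kB(1) sk kB(2)] sK in \<open>auto simp: dent_triple_def\<close>)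
  moreover have "0 < orient s k j"
    by (rule pos[OF s(1) kB(1) jB sk kB(2)]) (use kk(3) s(2) in \<open>auto simp: dent_triple_def\<close>)
  moreover have "0 < orient k i j" using kk(4) orient_swap[of i k j] orient_rotate[of i j k] by linarith
  ultimately show ?thesis by (intro mem_triangle) auto
qed

lemma triangle_over_base_dent:
  assumes "V \<in> \<T>" "k \<in> K" "i \<in> V" "k \<in> V"
  shows "V = {i, k, j}"
proof -
  have "i \<noteq> k" using K[OF assms(2)] iP by auto
  then obtain s where s: "V = {i, k, s}" "s \<noteq> i" "s \<noteq> k" using third_vertex[OF TD(2)[OF assms(1)] assms(3,4)] by blast
  have "s \<in> B" using TD(1)[OF assms(1)] s(1) by blast
  have "s = j"
  proof (rule ccontr)
    assume "s \<noteq> j"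
    then have "j \<in> convex hull V" unfolding s(1) using base_dent_in_hull[OF assms(2) \<open>s \<in> B\<close> s(2,3)] by (simp add: insert_commute)
    then have "j \<in> V" using trifams_vertex_in_hull[OF gpB T assms(1) WT] by blast
    moreover have "j \<noteq> i" "j \<noteq> k" using iP Pj adjacentD(3)[of \<rho> B k j] K[OF assms(2)] by auto
    ultimately show False using \<open>s \<noteq> j\<close> unfolding s(1) by blast
  qed
  then show ?thesis using s(1) by simp
qed

text \<open>The dent \<open>c\<close> lies on the inner side of the chord \<open>P j\<close> and
  hence in the splitting triangle, which contains no vertices besides its own.\<close>

lemma not_dent_right:
  assumes "dent_triple \<rho> D B P c j" "V \<in> \<T>"
  shows "c \<notin> V"
proof
  assume "c \<in> V"
  note dd = dent_tripleD[OF assms(1)]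
  have PD: "P \<notin> D" using noadj[OF dd(2)] dd(1) by blast
  have ic: "\<rho> i < \<rho> c" using iP dd(7) by simp
  have "0 < orient i P c" by (rule pos[OF iB PB dd(5) iP dd(7)]) (use PD PK[of P] in \<open>auto simp: dent_triple_def\<close>)
  moreover have "0 < orient P j c" using neg[OF assms(1)] orient_swap[of P c j] by simp
  moreover have "0 < orient i c j"
    by (rule pos[OF iB dd(5) jB ic dd(8)]) (use not_adjacent[OF PB iP dd(7)] K[of c] dd(1) in \<open>auto simp: dent_triple_def\<close>)
  ultimately have "c \<in> convex hull {i, P, j}" using W_pos orient_rotate[of i c j] by (intro mem_triangle) auto
  then have "c \<in> {i, P, j}" by (rule trifams_vertex_in_hull[OF gpB T WT assms(2) _ \<open>c \<in> V\<close>])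
  then show False using dd(7,8) ic by auto
qed

lemma not_dent_left:
  assumes "dent_triple \<rho> D B i a P" "V \<in> \<T>"
  shows "a \<notin> V"
proof
  assume "a \<in> V"
  note dd = dent_tripleD[OF assms(1)]
  have PD: "P \<notin> D" using noadj[OF dd(3)] dd(1) by blast
  have aj: "\<rho> a < \<rho> j" using Pj dd(8) by simp
  have "0 < orient a P j" by (rule pos[OF dd(5) PB jB dd(8) Pj]) (use PD PK[of P] in \<open>auto simp: dent_triple_def\<close>)
  moreover have "0 < orient i P a" using neg[OF assms(1)] orient_swap[of i a P] by simp
  moreover have "0 < orient i a j"
    by (rule pos[OF iB dd(5) jB dd(7) aj]) (use not_adjacent[OF PB dd(8) Pj] PK[of a] dd(8) in \<open>auto simp: dent_triple_def\<close>)
  ultimately have "a \<in> convex hull {i, P, j}" using W_pos orient_rotate[of i a j] orient_rotate[of P j a] by (intro mem_triangle) auto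
  then have "a \<in> {i, P, j}" by (rule trifams_vertex_in_hull[OF gpB T WT assms(2) _ \<open>a \<in> V\<close>])
  then show False using dd(7,8) aj by auto
qed

text \<open>The triangles that may belong to neither interval: the splitting triangle, the triangle
  cut off at \<open>P\<close> if \<open>P\<close> is a dent, and the triangle over the side
  \<open>i k\<close> with its dent \<open>j\<close>.\<close>

definition straddling :: "point set \<Rightarrow> bool" where
  "straddling V \<longleftrightarrow> V = {i, P, j} \<or> (\<exists>S U. dent_triple \<rho> D B S P U \<and> V = {S, P, U}) \<or> (\<exists>k\<in>K. V = {i, k, j})"

text \<open>Apart from the listed exceptions, \<open>a\<close>, \<open>P\<close>, \<open>c\<close>,
  \<open>j\<close> are in convex position, and the edge \<open>a c\<close> would cross the edge
  \<open>P j\<close> of the splitting triangle.\<close>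

lemma straddling_right:
  assumes V: "V \<in> \<T>" "a \<in> V" "c \<in> V" and ac: "\<rho> a < \<rho> P" "\<rho> P < \<rho> c" "c \<noteq> j"
  shows "straddling V"
proof -
  have B: "a \<in> B" "c \<in> B" using TD(1)[OF V(1)] V(2,3) by blast+
  have cj: "\<rho> c < \<rho> j" using outer(2)[OF B(2) ac(3)] .
  have a'c: "\<rho> a < \<rho> c" using ac by simp
  consider "dent_triple \<rho> D B a P c" | "a = i" "c \<in> K" | "\<not> dent_triple \<rho> D B a P c" "\<not> (a = i \<and> c \<in> K)" by blast
  then show ?thesis
  proof cases
    case 1
    then show ?thesis using triangle_over_dent[OF V(1) 1 V(2,3)] unfolding straddling_def by blast
  next
    case 2
    then show ?thesis using triangle_over_base_dent[OF V(1) 2(2) _ V(3)] V(2) unfolding straddling_def by blast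
  next
    case 3
    have "\<not> dent_triple \<rho> D B P c j" using not_dent_right[OF _ V(1)] V(3) by blast
    then have "0 < orient P c j" by (intro pos[OF PB B(2) jB ac(2) cj]) (use iP in auto)
    moreover have "0 < orient a P c" by (rule pos[OF B(1) PB B(2) ac(1,2) 3(1)]) (use PK[of P] in auto)
    moreover have "0 < orient a P j" by (rule pos[OF B(1) PB jB ac(1) Pj]) (use not_adjacent[OF B(2) ac(2) cj] PK[of P] in \<open>auto simp: dent_triple_def\<close>)
    moreover have "0 < orient a c j" by (rule pos[OF B(1,2) jB a'c cj]) (use not_adjacent[OF PB ac(1,2)] 3(2) in \<open>auto simp: dent_triple_def\<close>)
    ultimately have False using trifams_no_crossing[OF gpB T V(1) WT V(2,3), of P j] by blast
    then show ?thesis ..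
  qed
qed

text \<open>Here \<open>i\<close>, \<open>a\<close>, \<open>P\<close>, \<open>j\<close> are in
  convex position unless \<open>P\<close> is a dent, and the edge \<open>a j\<close> would cross the
  edge \<open>i P\<close>.\<close>

lemma straddling_left:
  assumes V: "V \<in> \<T>" "a \<in> V" "j \<in> V" and a: "\<rho> a < \<rho> P" "a \<noteq> i"
  shows "straddling V"
proof -
  have aB: "a \<in> B" using TD(1)[OF V(1)] V(2) by blast
  have ia: "\<rho> i < \<rho> a" using outer(1)[OF aB a(2)] .
  have aj: "\<rho> a < \<rho> j" using a Pj by simp
  show ?thesis
  proof (cases "dent_triple \<rho> D B a P j")
    case True
    then show ?thesis using triangle_over_dent[OF V(1) True V(2,3)] unfolding straddling_def by blast
  next
    case False
    have "\<not> dent_triple \<rho> D B i a P" using not_dent_left[OF _ V(1)] V(2) by blast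
    then have "0 < orient i a P" by (intro pos[OF iB aB PB ia a(1)]) (use Pj in auto)
    moreover have "0 < orient i a j" by (rule pos[OF iB aB jB ia aj]) (use not_adjacent[OF PB a(1) Pj] PK[of a] a(1) in \<open>auto simp: dent_triple_def\<close>)
    moreover have "0 < orient a P j" by (rule pos[OF aB PB jB a(1) Pj False]) (use a(2) in auto)
    ultimately have False using trifams_no_crossing[OF gpB T WT V(1), of i P a j] V(2,3) W_pos by blast
    then show ?thesis ..
  qed
qed

lemma straddling:
  assumes V: "V \<in> \<T>" "a \<in> V" "c \<in> V" and ac: "\<rho> a < \<rho> P" "\<rho> P < \<rho> c"
  shows "straddling V"
proof (cases "a = i \<and> c = j")
  case False
  then show ?thesis using straddling_right[OF assms] straddling_left[OF V(1,2) _ ac(1)] V(3) by blast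
next
  case True
  have "i \<noteq> j" using iP Pj by auto
  then obtain s where s: "V = {i, j, s}" "s \<noteq> i" "s \<noteq> j" using third_vertex[OF TD(2)[OF V(1)]] V(2,3) True by blast
  have sB: "s \<in> B" using TD(1)[OF V(1)] s(1) by blast
  consider "s = P" | "\<rho> s < \<rho> P" | "\<rho> P < \<rho> s" using eqI[OF sB PB] by force
  then show ?thesis
  proof cases
    case 1
    then show ?thesis using s(1) unfolding straddling_def by blast
  next
    case 2
    then show ?thesis using straddling_left[OF V(1) _ _ 2 s(2)] s(1) by blast
  next
    case 3
    then show ?thesis using straddling_right[OF V(1) _ _ ac(1) 3 s(3)] s(1) V(2) by blast
  qed
qed

lemma interval_left: "interval \<rho> B i P = {b \<in> B. \<rho> b \<le> \<rho> P}" and interval_right: "interval \<rho> B P j = {b \<in> B. \<rho> P \<le> \<rho> b}"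
  using ends by (auto simp: interval_def)

lemma triangle_cases:
  assumes "V \<in> \<T>"
  shows "V \<subseteq> interval \<rho> B i P \<or> V \<subseteq> interval \<rho> B P j \<or> straddling V"
proof (cases "\<exists>a\<in>V. \<exists>c\<in>V. \<rho> a < \<rho> P \<and> \<rho> P < \<rho> c")
  case True
  then show ?thesis using straddling[OF assms] by blast
next
  case False
  then show ?thesis using TD(1)[OF assms] unfolding interval_left interval_right by force
qed

lemma thirds: "(1/3) *\<^sub>R a + (1/3) *\<^sub>R b + (1/3) *\<^sub>R c \<in> convex hull {a, b, c}"
  unfolding convex_hull_3 by (intro CollectI exI[of _ "1/3"]) simp

text \<open>An application of \<open>trifams_restrict\<close>. The triangles outside the interval
  are separated from it by the line \<open>i P\<close>, except for the triangle at a dent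
  \<open>P\<close>, which is separated by the line through \<open>P\<close> and its
  predecessor.\<close>

lemma left_fill: "{V \<in> \<T>. V \<subseteq> interval \<rho> B i P} \<in> fills \<rho> D B i P"
proof -
  let ?A = "interval \<rho> B i P"
  have finA: "finite ?A" using finB by (simp add: interval_def)
  show ?thesis
  proof (cases "card ?A \<le> 2 \<or> (\<exists>d. dent_triple \<rho> D B i d P)")
    case True
    have "\<not> V \<subseteq> ?A" if V: "V \<in> \<T>" for V
    proof
      assume sub: "V \<subseteq> ?A"
      then have "3 \<le> card ?A" using card_mono[OF finA sub] TD(2)[OF V] by simp
      then obtain d where d: "dent_triple \<rho> D B i d P" using True by auto
      note dd = dent_tripleD[OF d]
      have "?A \<subseteq> {i, d, P}"
      proof
        fix s assume s: "s \<in> ?A"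
        then have sB: "s \<in> B" "\<rho> i \<le> \<rho> s" "\<rho> s \<le> \<rho> P" by (auto simp: interval_def)
        have "\<rho> s = \<rho> i \<or> \<rho> s = \<rho> d \<or> \<rho> s = \<rho> P" using adjacentD(4)[OF dd(2) sB(1)] adjacentD(4)[OF dd(3) sB(1)] sB(2,3) by linarith
        then show "s \<in> {i, d, P}" using eqI[OF sB(1)] iB PB dd(5) by blast
      qed
      then have "V - {d} \<subseteq> {i, P}" using sub by blast
      then have "card (V - {d}) \<le> 2" using card_mono[of "{i, P}" "V - {d}"] by (simp add: card_insert_if split: if_splits)
      then have "d \<in> V" using TD(2)[OF V] by (cases "d \<in> V") auto
      then show False using not_dent_left[OF d V] by blast
    qed
    then have "{V \<in> \<T>. V \<subseteq> ?A} = {}" by blast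
    then show ?thesis using True by (simp add: fills_def)
  next
    case False
    define S where "S = prv \<rho> B P"
    have SP: "adjacent \<rho> B S P" unfolding S_def by (rule adjacent_prv[OF injB finB PB iB iP])
    note A = adjacentD[OF SP]
    have Si: "S \<noteq> i"
    proof
      assume "S = i"
      have "?A \<subseteq> {i, P}"
      proof
        fix s assume s: "s \<in> ?A"
        then have sB: "s \<in> B" "\<rho> i \<le> \<rho> s" "\<rho> s \<le> \<rho> P" by (auto simp: interval_def)
        then have "\<rho> s = \<rho> i \<or> \<rho> s = \<rho> P" using A(4)[OF sB(1)] unfolding \<open>S = i\<close> by linarith
        then show "s \<in> {i, P}" using eqI[OF sB(1)] iB PB by blast
      qed
      then have "card ?A \<le> card {i, P}" by (intro card_mono) auto
      also have "\<dots> \<le> 2" by (simp add: card_insert_if)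
      finally show False using False by simp
    qed
    have iS: "\<rho> i < \<rho> S" by (rule outer(1)[OF A(1) Si])
    \<comment> \<open>The centroid of a triangle with vertices in the interval lies strictly on the
      inner side of each separating line used below.\<close>
    define c where "c = (1/3) *\<^sub>R i + (1/3) *\<^sub>R S + (1/3) *\<^sub>R P"
    have SA: "{i, S, P} \<subseteq> ?A" using iB PB A(1,3) iS iP by (auto simp: interval_def)
    have oc: "orient a b c = (orient a b i + orient a b S + orient a b P) / 3" for a b
      unfolding c_def by (subst orient_comb3) simp_all
    have nAdj: "\<not> adjacent \<rho> B i P" by (rule not_adjacent[OF A(1) iS A(3)])
    have below: "orient i P s < 0" if "s \<in> ?A" "s \<noteq> i" "s \<noteq> P" for s
    proof -
      have s: "s \<in> B" "\<rho> s \<le> \<rho> P" using that(1) by (auto simp: interval_def)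
      have sP: "\<rho> s < \<rho> P" using s eqI[OF s(1) PB] that(3) by force
      have "0 < orient i s P" by (rule pos[OF iB s(1) PB outer(1)[OF s(1) that(2)] sP]) (use False PK[OF s(2)] in auto)
      then show ?thesis using orient_swap[of i s P] by simp
    qed
    have above: "0 < orient i P s" if "s \<in> B" "\<rho> P < \<rho> s" for s
      by (rule pos[OF iB PB that(1) iP that(2)]) (use nAdj PK[of P] in \<open>auto simp: dent_triple_def\<close>)
    have sepiP: "\<exists>a b \<epsilon>. (\<forall>s\<in>?A. 0 \<le> \<epsilon> * orient a b s) \<and> 0 < \<epsilon> * orient a b c \<and> (\<forall>s\<in>V. \<epsilon> * orient a b s \<le> 0)"
      if hV: "\<And>s. s \<in> V \<Longrightarrow> s = i \<or> s = P \<or> s \<in> B \<and> \<rho> P < \<rho> s" for V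
    proof (rule exI[of _ i], rule exI[of _ P], rule exI[of _ "- 1"], intro conjI ballI)
      show "0 \<le> - 1 * orient i P s" if "s \<in> ?A" for s using below[OF that] by (cases "s = i"; cases "s = P") auto
      show "0 < - 1 * orient i P c" unfolding oc using below[of S] SA Si A(3) by auto
      show "- 1 * orient i P s \<le> 0" if "s \<in> V" for s using hV[OF that] above[of s] by auto
    qed
    have "{V \<in> \<T>. V \<subseteq> ?A} \<in> trifams ?A"
    proof (rule trifams_restrict[OF T finB])
      show "?A \<subseteq> B" by (auto simp: interval_def)
      show "c \<in> convex hull ?A" using thirds[of i S P] hull_mono[OF SA, of convex] unfolding c_def by blast
      fix V assume V: "V \<in> \<T>" "\<not> V \<subseteq> ?A"
      then consider "V \<subseteq> interval \<rho> B P j" | "V = {i, P, j}" | k where "k \<in> K" "V = {i, k, j}" | S' U where "dent_triple \<rho> D B S' P U" "V = {S', P, U}"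
        using triangle_cases[OF V(1)] unfolding straddling_def by blast
      then show "\<exists>a b \<epsilon>. (\<forall>s\<in>?A. 0 \<le> \<epsilon> * orient a b s) \<and> 0 < \<epsilon> * orient a b c \<and> (\<forall>s\<in>V. \<epsilon> * orient a b s \<le> 0)"
      proof cases
        case 1
        show ?thesis
        proof (rule sepiP)
          fix s assume "s \<in> V"
          then have s: "s \<in> B" "\<rho> P \<le> \<rho> s" using 1 by (auto simp: interval_def)
          then show "s = i \<or> s = P \<or> s \<in> B \<and> \<rho> P < \<rho> s" using eqI[OF PB s(1)] by force
        qed
      next
        case 2
        show ?thesis by (rule sepiP) (use 2 jB Pj in auto)
      next
        case 3
        have "k \<in> B" "\<rho> P < \<rho> k" using K[OF 3(1)] adjacentD(1)[of \<rho> B k j] by auto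
        then show ?thesis by (intro sepiP) (use 3 jB Pj in auto)
      next
        case 4
        note dd = dent_tripleD[OF 4(1)]
        have "S' = S" unfolding S_def using prv_adjacent[OF injB dd(2), of P] dd(7) by simp
        have SD: "S \<notin> D" using noadj[OF SP] dd(1) by blast
        have ge: "0 < orient S P s" if "s \<in> ?A" "s \<noteq> S" "s \<noteq> P" for s
        proof -
          have s: "s \<in> B" "\<rho> s \<le> \<rho> P" using that(1) by (auto simp: interval_def)
          have "\<rho> s < \<rho> S" using A(4)[OF s(1)] s(2) eqI[OF s(1) PB] eqI[OF s(1) A(1)] that(2,3) by force
          then have "0 < orient s S P" by (intro pos[OF s(1) A(1) PB _ A(3)]) (use SD Pj in \<open>auto simp: dent_triple_def\<close>)
          then show ?thesis using orient_rotate[of S P s] by simp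
        qed
        have iS': "i \<noteq> S" "i \<noteq> P" "i \<in> ?A" using Si iP SA by auto
        show ?thesis
        proof (rule exI[of _ S], rule exI[of _ P], rule exI[of _ 1], intro conjI ballI)
          show "0 \<le> 1 * orient S P s" if "s \<in> ?A" for s using ge[OF that] by (cases "s = S"; cases "s = P") auto
          show "0 < 1 * orient S P c" unfolding oc using ge[OF iS'(3,1,2)] by simp
          show "1 * orient S P s \<le> 0" if "s \<in> V" for s
            using that neg[OF 4(1)] unfolding 4(2) \<open>S' = S\<close> by auto
        qed
      qed
    qed
    then show ?thesis using False by (simp add: fills_def)
  qed
qed

text \<open>The counterpart of \<open>left_fill\<close> with one more separating line: the triangle
  \<open>{i, k, j}\<close> with \<open>k\<close> in \<open>K\<close> is cut off by the line
  \<open>k j\<close>.\<close>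

lemma right_fill: "{V \<in> \<T>. V \<subseteq> interval \<rho> B P j} \<in> fills \<rho> D B P j"
proof -
  let ?C = "interval \<rho> B P j"
  have finC: "finite ?C" using finB by (simp add: interval_def)
  show ?thesis
  proof (cases "card ?C \<le> 2 \<or> (\<exists>d. dent_triple \<rho> D B P d j)")
    case True
    have "\<not> V \<subseteq> ?C" if V: "V \<in> \<T>" for V
    proof
      assume sub: "V \<subseteq> ?C"
      then have "3 \<le> card ?C" using card_mono[OF finC sub] TD(2)[OF V] by simp
      then obtain d where d: "dent_triple \<rho> D B P d j" using True by auto
      note dd = dent_tripleD[OF d]
      have "?C \<subseteq> {P, d, j}"
      proof
        fix s assume s: "s \<in> ?C"
        then have sB: "s \<in> B" "\<rho> P \<le> \<rho> s" "\<rho> s \<le> \<rho> j" by (auto simp: interval_def)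
        have "\<rho> s = \<rho> P \<or> \<rho> s = \<rho> d \<or> \<rho> s = \<rho> j" using adjacentD(4)[OF dd(2) sB(1)] adjacentD(4)[OF dd(3) sB(1)] sB(2,3) by linarith
        then show "s \<in> {P, d, j}" using eqI[OF sB(1)] jB PB dd(5) by blast
      qed
      then have "V - {d} \<subseteq> {P, j}" using sub by blast
      then have "card (V - {d}) \<le> 2" using card_mono[of "{P, j}" "V - {d}"] by (simp add: card_insert_if split: if_splits)
      then have "d \<in> V" using TD(2)[OF V] by (cases "d \<in> V") auto
      then show False using not_dent_right[OF d V] by blast
    qed
    then have "{V \<in> \<T>. V \<subseteq> ?C} = {}" by blast
    then show ?thesis using True by (simp add: fills_def)
  next
    case False
    define U where "U = nxt \<rho> B P"
    have PU: "adjacent \<rho> B P U" unfolding U_def by (rule adjacent_nxt[OF injB finB PB jB Pj])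
    note A = adjacentD[OF PU]
    have Uj: "U \<noteq> j"
    proof
      assume "U = j"
      have "?C \<subseteq> {P, j}"
      proof
        fix s assume s: "s \<in> ?C"
        then have sB: "s \<in> B" "\<rho> P \<le> \<rho> s" "\<rho> s \<le> \<rho> j" by (auto simp: interval_def)
        then have "\<rho> s = \<rho> P \<or> \<rho> s = \<rho> j" using A(4)[OF sB(1)] unfolding \<open>U = j\<close> by linarith
        then show "s \<in> {P, j}" using eqI[OF sB(1)] jB PB by blast
      qed
      then have "card ?C \<le> card {P, j}" by (intro card_mono) auto
      also have "\<dots> \<le> 2" by (simp add: card_insert_if)
      finally show False using False by simp
    qed
    have Uj': "\<rho> U < \<rho> j" by (rule outer(2)[OF A(2) Uj])
    define c where "c = (1/3) *\<^sub>R P + (1/3) *\<^sub>R U + (1/3) *\<^sub>R j"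
    have SC: "{P, U, j} \<subseteq> ?C" using jB PB A(2,3) Uj' Pj by (auto simp: interval_def)
    have oc: "orient a b c = (orient a b P + orient a b U + orient a b j) / 3" for a b
      unfolding c_def by (subst orient_comb3) simp_all
    have nAdj: "\<not> adjacent \<rho> B P j" by (rule not_adjacent[OF A(2,3) Uj'])
    have below: "orient P j s < 0" if "s \<in> ?C" "s \<noteq> P" "s \<noteq> j" for s
    proof -
      have s: "s \<in> B" "\<rho> P \<le> \<rho> s" using that(1) by (auto simp: interval_def)
      have sP: "\<rho> P < \<rho> s" using s eqI[OF PB s(1)] that(2) by force
      have "0 < orient P s j" by (rule pos[OF PB s(1) jB sP outer(2)[OF s(1) that(3)]]) (use False iP in auto)
      then show ?thesis using orient_swap[of P s j] by simp
    qed
    have above: "0 < orient P j s" if "s \<in> B" "\<rho> s < \<rho> P" for s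
    proof -
      have "0 < orient s P j" by (rule pos[OF that(1) PB jB that(2) Pj]) (use nAdj PK[of P] in \<open>auto simp: dent_triple_def\<close>)
      then show ?thesis using orient_rotate[of P j s] by simp
    qed
    have sepPj: "\<exists>a b \<epsilon>. (\<forall>s\<in>?C. 0 \<le> \<epsilon> * orient a b s) \<and> 0 < \<epsilon> * orient a b c \<and> (\<forall>s\<in>V. \<epsilon> * orient a b s \<le> 0)"
      if hV: "\<And>s. s \<in> V \<Longrightarrow> s = j \<or> s = P \<or> s \<in> B \<and> \<rho> s < \<rho> P" for V
    proof (rule exI[of _ P], rule exI[of _ j], rule exI[of _ "- 1"], intro conjI ballI)
      show "0 \<le> - 1 * orient P j s" if "s \<in> ?C" for s using below[OF that] by (cases "s = j"; cases "s = P") auto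
      show "0 < - 1 * orient P j c" unfolding oc using below[of U] SC Uj A(3) by auto
      show "- 1 * orient P j s \<le> 0" if "s \<in> V" for s using hV[OF that] above[of s] by auto
    qed
    have "{V \<in> \<T>. V \<subseteq> ?C} \<in> trifams ?C"
    proof (rule trifams_restrict[OF T finB])
      show "?C \<subseteq> B" by (auto simp: interval_def)
      show "c \<in> convex hull ?C" using thirds[of P U j] hull_mono[OF SC, of convex] unfolding c_def by blast
      fix V assume V: "V \<in> \<T>" "\<not> V \<subseteq> ?C"
      then consider "V \<subseteq> interval \<rho> B i P" | "V = {i, P, j}" | k where "k \<in> K" "V = {i, k, j}" | S U' where "dent_triple \<rho> D B S P U'" "V = {S, P, U'}"
        using triangle_cases[OF V(1)] unfolding straddling_def by blast
      then show "\<exists>a b \<epsilon>. (\<forall>s\<in>?C. 0 \<le> \<epsilon> * orient a b s) \<and> 0 < \<epsilon> * orient a b c \<and> (\<forall>s\<in>V. \<epsilon> * orient a b s \<le> 0)"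
      proof cases
        case 1
        show ?thesis
        proof (rule sepPj)
          fix s assume "s \<in> V"
          then have s: "s \<in> B" "\<rho> s \<le> \<rho> P" using 1 by (auto simp: interval_def)
          then show "s = j \<or> s = P \<or> s \<in> B \<and> \<rho> s < \<rho> P" using eqI[OF s(1) PB] by force
        qed
      next
        case 2
        show ?thesis by (rule sepPj) (use 2 iB iP in auto)
      next
        case 3
        have kk: "\<rho> P < \<rho> k" "adjacent \<rho> B k j" "k \<notin> D" "orient i k j < 0" using K[OF 3(1)] by blast+
        have kB: "k \<in> B" "\<rho> k < \<rho> j" using adjacentD[OF kk(2)] by auto
        have ge: "0 < orient k j s" if "s \<in> ?C" "s \<noteq> k" "s \<noteq> j" for s
        proof -
          have s: "s \<in> B" "\<rho> P \<le> \<rho> s" using that(1) by (auto simp: interval_def)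
          have "\<rho> s < \<rho> k" using adjacentD(4)[OF kk(2) s(1)] outer(2)[OF s(1) that(3)] eqI[OF s(1) kB(1)] that(2) by force
          then have "0 < orient s k j" by (intro pos[OF s(1) kB(1) jB _ kB(2)]) (use kk(3) s(2) iP in \<open>auto simp: dent_triple_def\<close>)
          then show ?thesis using orient_rotate[of k j s] by simp
        qed
        have ge': "0 \<le> orient k j s" if "s \<in> ?C" for s using ge[OF that] by (cases "s = k"; cases "s = j") auto
        have PC: "P \<in> ?C" "P \<noteq> k" "P \<noteq> j" "U \<in> ?C" using SC kk(1) Pj by auto
        show ?thesis
        proof (rule exI[of _ k], rule exI[of _ j], rule exI[of _ 1], intro conjI ballI)
          show "0 \<le> 1 * orient k j s" if "s \<in> ?C" for s using ge'[OF that] by simp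
          show "0 < 1 * orient k j c" unfolding oc using ge[OF PC(1-3)] ge'[OF PC(4)] by simp
          show "1 * orient k j s \<le> 0" if "s \<in> V" for s
            using that kk(4) orient_rotate[of k j i] unfolding 3(2) by auto
        qed
      next
        case 4
        note dd = dent_tripleD[OF 4(1)]
        have "U' = U" unfolding U_def using nxt_adjacent[OF injB dd(3), of P] dd(8) by simp
        have UD: "U \<notin> D" using noadj[OF PU] dd(1) by blast
        have ge: "0 < orient P U s" if "s \<in> ?C" "s \<noteq> U" "s \<noteq> P" for s
        proof -
          have s: "s \<in> B" "\<rho> P \<le> \<rho> s" using that(1) by (auto simp: interval_def)
          have "\<rho> U < \<rho> s" using A(4)[OF s(1)] s(2) eqI[OF s(1) PB] eqI[OF s(1) A(2)] that(2,3) by force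
          then show ?thesis by (intro pos[OF PB A(2) s(1) A(3)]) (use UD iP in \<open>auto simp: dent_triple_def\<close>)
        qed
        have jU: "j \<noteq> U" "j \<noteq> P" "j \<in> ?C" using Uj Pj SC by auto
        show ?thesis
        proof (rule exI[of _ P], rule exI[of _ U], rule exI[of _ 1], intro conjI ballI)
          show "0 \<le> 1 * orient P U s" if "s \<in> ?C" for s using ge[OF that] by (cases "s = U"; cases "s = P") auto
          show "0 < 1 * orient P U c" unfolding oc using ge[OF jU(3,1,2)] by simp
          show "1 * orient P U s \<le> 0" if "s \<in> V" for s
            using that neg[OF 4(1)] orient_rotate[of P U S] unfolding 4(2) \<open>U' = U\<close> by auto
        qed
      qed
    qed
    then show ?thesis using False by (simp add: fills_def)
  qed
qed

end

text \<open>The restrictions, the splitting triangle and the base triangle are shared, so the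
  families can differ only in the triangle \<open>{S, P, U}\<close> at a dent \<open>P\<close>. If
  only \<open>\<T>\<close> contained it, \<open>\<T>'\<close> would be a subfamily that covers the
  hull already, and \<open>covered_triangle_mem\<close> would put the triangle into it.\<close>

lemma split_determines:
  assumes s: "split_at \<rho> D B K i j P \<T>" and s': "split_at \<rho> D B K i j P \<T>'"
    and eq: "{V \<in> \<T>. V \<subseteq> interval \<rho> B i P} = {V \<in> \<T>'. V \<subseteq> interval \<rho> B i P}"
      "{V \<in> \<T>. V \<subseteq> interval \<rho> B P j} = {V \<in> \<T>'. V \<subseteq> interval \<rho> B P j}"
    and base: "\<And>k. k \<in> K \<Longrightarrow> {i, k, j} \<in> \<T> \<and> {i, k, j} \<in> \<T>'"
  shows "\<T> \<subseteq> \<T>'"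
proof -
  interpret a: split_at \<rho> D B K i j P \<T> by (rule s)
  interpret b: split_at \<rho> D B K i j P \<T>' by (rule s')
  define dents where "dents V \<longleftrightarrow> (\<exists>S U. dent_triple \<rho> D B S P U \<and> V = {S, P, U})" for V
  have unique: "V = V'" if "dents V" "dents V'" for V V'
  proof -
    obtain S U S' U' where d: "dent_triple \<rho> D B S P U" "V = {S, P, U}" "dent_triple \<rho> D B S' P U'" "V' = {S', P, U'}"
      using \<open>dents V\<close> \<open>dents V'\<close> unfolding dents_def by blast
    note x = dent_tripleD[OF d(1)] and y = dent_tripleD[OF d(3)]
    have "S = S'" using prv_adjacent[OF a.injB x(2), of P] prv_adjacent[OF a.injB y(2), of P] x(7) y(7) by simp
    moreover have "U = U'" using nxt_adjacent[OF a.injB x(3), of P] nxt_adjacent[OF a.injB y(3), of P] x(8) y(8) by simp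
    ultimately show ?thesis using d by simp
  qed
  have ab: "V \<in> \<T>'" if V: "V \<in> \<T>" "\<not> dents V" for V
  proof -
    consider "V \<subseteq> interval \<rho> B i P" | "V \<subseteq> interval \<rho> B P j" | "V = {i, P, j}" | k where "k \<in> K" "V = {i, k, j}"
      using a.triangle_cases[OF V(1)] V(2) unfolding a.straddling_def dents_def by blast
    then show ?thesis using eq V(1) b.WT base by cases blast+
  qed
  have ba: "V \<in> \<T>" if V: "V \<in> \<T>'" "\<not> dents V" for V
  proof -
    consider "V \<subseteq> interval \<rho> B i P" | "V \<subseteq> interval \<rho> B P j" | "V = {i, P, j}" | k where "k \<in> K" "V = {i, k, j}"
      using b.triangle_cases[OF V(1)] V(2) unfolding b.straddling_def dents_def by blast
    then show ?thesis using eq V(1) a.WT base by cases blast+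
  qed
  show ?thesis
  proof
    fix V assume V: "V \<in> \<T>"
    show "V \<in> \<T>'"
    proof (rule ccontr)
      assume n: "V \<notin> \<T>'"
      then have d: "dents V" using ab[OF V] by blast
      have sub: "\<T>' \<subseteq> \<T>" using ba unique[OF d] n by blast
      have "V \<in> \<T>'"
      proof (rule covered_triangle_mem[OF _ V sub])
        show "compat \<T>" using a.TD(3) unfolding compat_def by blast
        show "\<not> affine_dependent V" using triple_independent[OF a.gpB a.TD(1,2)] V by blast
        show "convex hull V \<subseteq> (\<Union>W\<in>\<T>'. convex hull W)" unfolding b.TD(4) using a.TD(1)[OF V] by (rule hull_mono)
      qed (rule a.TD(2))
      then show False using n by contradiction
    qed
  qed
qed

lemma finite_fills: "finite B \<Longrightarrow> finite (fills \<rho> D B l r)"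
  using finite_trifams[of "interval \<rho> B l r"] by (simp add: fills_def interval_def)

text \<open>A triangulation is mapped to a splitting point and its restrictions to the two
  intervals; \<open>split_determines\<close> makes this injective.\<close>

lemma card_split_le:
  assumes fin: "finite B" and I: "I \<subseteq> B"
    and split: "\<And>\<T>. \<T> \<in> \<S> \<Longrightarrow> \<exists>P\<in>I. split_at \<rho> D B K i j P \<T>"
    and base: "\<And>\<T> k. \<T> \<in> \<S> \<Longrightarrow> k \<in> K \<Longrightarrow> {i, k, j} \<in> \<T>"
  shows "card \<S> \<le> (\<Sum>P\<in>I. card (fills \<rho> D B i P) * card (fills \<rho> D B P j))"
proof -
  define pt where "pt \<T> = (SOME P. P \<in> I \<and> split_at \<rho> D B K i j P \<T>)" for \<T>
  have pt: "pt \<T> \<in> I \<and> split_at \<rho> D B K i j (pt \<T>) \<T>" if "\<T> \<in> \<S>" for \<T>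
    unfolding pt_def by (rule someI_ex) (use split[OF that] in blast)
  define \<Phi> where "\<Phi> \<T> = (pt \<T>, {V \<in> \<T>. V \<subseteq> interval \<rho> B i (pt \<T>)}, {V \<in> \<T>. V \<subseteq> interval \<rho> B (pt \<T>) j})" for \<T>
  define \<Sigma> where "\<Sigma> = Sigma I (\<lambda>P. fills \<rho> D B i P \<times> fills \<rho> D B P j)"
  have "inj_on \<Phi> \<S>"
  proof (rule inj_onI)
    fix \<T> \<T>' assume T: "\<T> \<in> \<S>" "\<T>' \<in> \<S>" "\<Phi> \<T> = \<Phi> \<T>'"
    define P where "P = pt \<T>"
    have P': "pt \<T>' = P" using T(3) by (simp add: \<Phi>_def P_def)
    have s: "split_at \<rho> D B K i j P \<T>" "split_at \<rho> D B K i j P \<T>'" using pt[OF T(1)] pt[OF T(2)] P' P_def by auto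
    have e: "{V \<in> \<T>. V \<subseteq> interval \<rho> B i P} = {V \<in> \<T>'. V \<subseteq> interval \<rho> B i P}"
      "{V \<in> \<T>. V \<subseteq> interval \<rho> B P j} = {V \<in> \<T>'. V \<subseteq> interval \<rho> B P j}"
      using T(3) unfolding \<Phi>_def P' P_def[symmetric] by simp_all
    show "\<T> = \<T>'"
    proof (rule equalityI)
      show "\<T> \<subseteq> \<T>'" by (rule split_determines[OF s e]) (use base T(1,2) in blast)
      show "\<T>' \<subseteq> \<T>" by (rule split_determines[OF s(2,1) e[symmetric]]) (use base T(1,2) in blast)
    qed
  qed
  moreover have "\<Phi> ` \<S> \<subseteq> \<Sigma>"
  proof
    fix x assume "x \<in> \<Phi> ` \<S>"
    then obtain \<T> where T: "\<T> \<in> \<S>" "x = \<Phi> \<T>" by blast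
    have p: "pt \<T> \<in> I" "split_at \<rho> D B K i j (pt \<T>) \<T>" using pt[OF T(1)] by auto
    show "x \<in> \<Sigma>" unfolding T(2) \<Phi>_def \<Sigma>_def using p(1) split_at.left_fill[OF p(2)] split_at.right_fill[OF p(2)] by blast
  qed
  moreover have finI: "finite I" by (rule finite_subset[OF I fin])
  have finS: "finite \<Sigma>" unfolding \<Sigma>_def using finI finite_fills[OF fin] by (intro finite_SigmaI) auto
  ultimately have "card \<S> \<le> card \<Sigma>" by (intro card_inj_on_le)
  also have "card \<Sigma> = (\<Sum>P\<in>I. card (fills \<rho> D B i P \<times> fills \<rho> D B P j))"
    unfolding \<Sigma>_def using finI finite_fills[OF fin] by (intro card_SigmaI) auto
  also have "\<dots> = (\<Sum>P\<in>I. card (fills \<rho> D B i P) * card (fills \<rho> D B P j))" by (simp add: card_cartesian_product)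
  finally show ?thesis .
qed

text \<open>Both factors depend only on the rank of \<open>P\<close> among the inner points, so the
  sum is the Catalan recursion. The \<open>- 2\<close> removes the two ends of an interval.\<close>

lemma sum_intervals:
  assumes fin: "finite B" and inj: "inj_on \<rho> B" and ij: "i \<in> B" "j \<in> B" "\<rho> i < \<rho> j"
    and ends: "\<And>b. b \<in> B \<Longrightarrow> \<rho> i \<le> \<rho> b \<and> \<rho> b \<le> \<rho> j" and card: "3 \<le> card B"
  shows "(\<Sum>P\<in>B - {i, j}. catalan (card (interval \<rho> B i P) - 2) * catalan (card (interval \<rho> B P j) - 2)) = catalan (card B - 2)"
proof -
  define I where "I = B - {i, j}"
  have finI: "finite I" using fin by (simp add: I_def)
  have eqB: "a = b" if "a \<in> B" "b \<in> B" "\<rho> a = \<rho> b" for a b using inj that by (auto simp: inj_on_def)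
  have cI: "card I = card B - 2"
  proof -
    have "i \<noteq> j" using ij(3) by auto
    then have "card {i, j} = 2" by simp
    then show ?thesis unfolding I_def using ij by (subst card_Diff_subset) auto
  qed
  have "card I \<noteq> 0" using cI card by linarith
  then obtain m where m: "card I = Suc m" using not0_implies_Suc by blast
  have "catalan (card (interval \<rho> B i P) - 2) * catalan (card (interval \<rho> B P j) - 2) =
     catalan (card {b \<in> I. \<rho> b < \<rho> P}) * catalan (m - card {b \<in> I. \<rho> b < \<rho> P})" if P: "P \<in> I" for P
  proof -
    let ?l = "{b \<in> I. \<rho> b < \<rho> P}" and ?r = "{b \<in> I. \<rho> P < \<rho> b}"
    have PB: "P \<in> B" "P \<noteq> i" "P \<noteq> j" using P by (auto simp: I_def)
    have lt: "\<rho> i < \<rho> P" "\<rho> P < \<rho> j" using ends[OF PB(1)] eqB[OF ij(1) PB(1)] eqB[OF PB(1) ij(2)] PB by force+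
    have "interval \<rho> B i P = insert i (insert P ?l)"
    proof (intro equalityI subsetI)
      fix s assume "s \<in> interval \<rho> B i P"
      then have s: "s \<in> B" "\<rho> s \<le> \<rho> P" by (auto simp: interval_def)
      then have "s = P \<or> \<rho> s < \<rho> P" using eqB[OF s(1) PB(1)] by force
      moreover have "s \<noteq> j" using s(2) lt(2) by auto
      ultimately show "s \<in> insert i (insert P ?l)" using s(1) by (auto simp: I_def)
    qed (use ij lt PB ends in \<open>auto simp: interval_def I_def\<close>)
    moreover have "i \<notin> insert P ?l" "P \<notin> ?l" "finite ?l" "finite ?r" using PB finI by (auto simp: I_def)
    ultimately have l: "card (interval \<rho> B i P) = card ?l + 2" by simp
    have "interval \<rho> B P j = insert j (insert P ?r)"
    proof (intro equalityI subsetI)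
      fix s assume "s \<in> interval \<rho> B P j"
      then have s: "s \<in> B" "\<rho> P \<le> \<rho> s" by (auto simp: interval_def)
      then have "s = P \<or> \<rho> P < \<rho> s" using eqB[OF PB(1) s(1)] by force
      moreover have "s \<noteq> i" using s(2) lt(1) by auto
      ultimately show "s \<in> insert j (insert P ?r)" using s(1) by (auto simp: I_def)
    qed (use ij lt PB ends in \<open>auto simp: interval_def I_def\<close>)
    moreover have "j \<notin> insert P ?r" "P \<notin> ?r" using PB by (auto simp: I_def)
    ultimately have r: "card (interval \<rho> B P j) = card ?r + 2" using \<open>finite ?r\<close> by simp
    have "I = insert P (?l \<union> ?r)"
    proof (intro equalityI subsetI)
      fix s assume s: "s \<in> I"
      then have "s = P \<or> \<rho> s < \<rho> P \<or> \<rho> P < \<rho> s" using eqB[of s P] PB(1) by (force simp: I_def)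
      then show "s \<in> insert P (?l \<union> ?r)" using s by blast
    qed (use P in auto)
    moreover have "card (insert P (?l \<union> ?r)) = Suc (card ?l + card ?r)"
      using \<open>finite ?l\<close> \<open>finite ?r\<close> by (subst card_insert_disjoint) (auto intro!: card_Un_disjoint)
    ultimately have "card ?r = m - card ?l" using m by simp
    then show ?thesis using l r by simp
  qed
  then have "(\<Sum>P\<in>I. catalan (card (interval \<rho> B i P) - 2) * catalan (card (interval \<rho> B P j) - 2)) =
     (\<Sum>P\<in>I. (\<lambda>r. catalan r * catalan (m - r)) (card {b \<in> I. \<rho> b < \<rho> P}))"
    by (intro sum.cong) auto
  also have "\<dots> = (\<Sum>r<card I. catalan r * catalan (m - r))"
    by (rule sum_by_rank[OF finI]) (rule inj_on_subset[OF inj], auto simp: I_def)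
  also have "\<dots> = catalan (card I)" unfolding m by (simp only: lessThan_Suc_atMost catalan_convolution)
  finally show ?thesis unfolding I_def[symmetric] cI .
qed

text \<open>Counterclockwise convex position in the order \<open>\<rho>\<close>, except that members
  of \<open>D\<close> with neighbours on both sides are dents. At an end of the order a member of
  \<open>D\<close> is an ordinary vertex, which lets the notion pass to intervals.\<close>

definition almost_convex :: "(point \<Rightarrow> real) \<Rightarrow> point set \<Rightarrow> point set \<Rightarrow> bool" where
  "almost_convex \<rho> D B \<longleftrightarrow> finite B \<and> inj_on \<rho> B \<and> general_position B
     \<and> (\<forall>a b c. a \<in> B \<and> b \<in> B \<and> c \<in> B \<and> \<rho> a < \<rho> b \<and> \<rho> b < \<rho> c \<and> \<not> dent_triple \<rho> D B a b c \<longrightarrow> 0 < orient a b c)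
     \<and> (\<forall>a b c. dent_triple \<rho> D B a b c \<longrightarrow> orient a b c < 0)
     \<and> (\<forall>s t. adjacent \<rho> B s t \<longrightarrow> \<not> (s \<in> D \<and> t \<in> D))"

lemma almost_convexD:
  assumes "almost_convex \<rho> D B"
  shows "finite B" "inj_on \<rho> B" "general_position B"
    "\<And>a b c. a \<in> B \<Longrightarrow> b \<in> B \<Longrightarrow> c \<in> B \<Longrightarrow> \<rho> a < \<rho> b \<Longrightarrow> \<rho> b < \<rho> c \<Longrightarrow> \<not> dent_triple \<rho> D B a b c \<Longrightarrow> 0 < orient a b c"
    "\<And>a b c. dent_triple \<rho> D B a b c \<Longrightarrow> orient a b c < 0"
    "\<And>s t. adjacent \<rho> B s t \<Longrightarrow> \<not> (s \<in> D \<and> t \<in> D)"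
  using assms unfolding almost_convex_def by blast+

lemma adjacent_interval_iff:
  "adjacent \<rho> (interval \<rho> B l r) a b \<longleftrightarrow> adjacent \<rho> B a b \<and> a \<in> interval \<rho> B l r \<and> b \<in> interval \<rho> B l r"
  by (force simp: adjacent_def interval_def)

lemma almost_convex_interval:
  assumes "finite B" "inj_on \<rho> B" "general_position B"
    and pos: "\<And>a b c. a \<in> interval \<rho> B l r \<Longrightarrow> b \<in> interval \<rho> B l r \<Longrightarrow> c \<in> interval \<rho> B l r \<Longrightarrow> \<rho> a < \<rho> b \<Longrightarrow> \<rho> b < \<rho> c \<Longrightarrow> \<not> dent_triple \<rho> D B a b c \<Longrightarrow> 0 < orient a b c"
    and neg: "\<And>a b c. dent_triple \<rho> D B a b c \<Longrightarrow> orient a b c < 0"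
    and noadj: "\<And>s t. adjacent \<rho> B s t \<Longrightarrow> \<not> (s \<in> D \<and> t \<in> D)"
  shows "almost_convex \<rho> D (interval \<rho> B l r)"
proof -
  let ?I = "interval \<rho> B l r"
  have sub: "?I \<subseteq> B" by (auto simp: interval_def)
  have dt: "dent_triple \<rho> D ?I a b c \<longleftrightarrow> dent_triple \<rho> D B a b c" if "a \<in> ?I" "b \<in> ?I" "c \<in> ?I" for a b c
    unfolding dent_triple_def adjacent_interval_iff using that by blast
  have dt': "dent_triple \<rho> D B a b c" if "dent_triple \<rho> D ?I a b c" for a b c
    using that unfolding dent_triple_def adjacent_interval_iff by blast
  show ?thesis unfolding almost_convex_def
  proof (intro conjI allI impI)
    show "finite ?I" by (rule finite_subset[OF sub assms(1)])
    show "inj_on \<rho> ?I" by (rule inj_on_subset[OF assms(2) sub])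
    show "general_position ?I" by (rule general_position_subset[OF assms(3) sub])
    show "0 < orient a b c" if "a \<in> ?I \<and> b \<in> ?I \<and> c \<in> ?I \<and> \<rho> a < \<rho> b \<and> \<rho> b < \<rho> c \<and> \<not> dent_triple \<rho> D ?I a b c" for a b c
      using pos[of a b c] that dt[of a b c] by blast
    show "orient a b c < 0" if "dent_triple \<rho> D ?I a b c" for a b c using neg[OF dt'[OF that]] .
    show "\<not> (s \<in> D \<and> t \<in> D)" if "adjacent \<rho> ?I s t" for s t using noadj that unfolding adjacent_interval_iff by blast
  qed
qed

lemma card_fills_le:
  assumes "3 \<le> card (interval \<rho> B l r) \<Longrightarrow> card (trifams (interval \<rho> B l r)) \<le> catalan (card (interval \<rho> B l r) - 2)"
  shows "card (fills \<rho> D B l r) \<le> catalan (card (interval \<rho> B l r) - 2)"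
proof (cases "card (interval \<rho> B l r) \<le> 2 \<or> (\<exists>d. dent_triple \<rho> D B l d r)")
  case True
  then have "card (fills \<rho> D B l r) = 1" by (simp add: fills_def)
  then show ?thesis using catalan_pos[of "card (interval \<rho> B l r) - 2"] by linarith
next
  case False
  then show ?thesis using assms by (simp add: fills_def)
qed

lemma card_trifams_3:
  assumes "card B = 3"
  shows "card (trifams B) \<le> 1"
proof -
  have fin: "finite B" "B \<noteq> {}" using assms card.infinite by fastforce+
  have "\<T> = {B}" if T: "\<T> \<in> trifams B" for \<T>
  proof -
    have "V = B" if "V \<in> \<T>" for V
      using trifamsD(1,2)[OF T that] assms fin(1) by (intro card_subset_eq) auto
    moreover have "\<T> \<noteq> {}"
    proof
      assume "\<T> = {}"
      then have "convex hull B = {}" using trifamsD(4)[OF T] by simp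
      then show False using fin(2) by simp
    qed
    ultimately show ?thesis by blast
  qed
  then have "trifams B \<subseteq> {{B}}" by blast
  then show ?thesis using card_mono[of "{{B}}" "trifams B"] by simp
qed

lemma order_ends:
  fixes \<rho> :: "point \<Rightarrow> real"
  assumes "finite B" "B \<noteq> {}"
  obtains i j where "i \<in> B" "j \<in> B" "\<And>b. b \<in> B \<Longrightarrow> \<rho> i \<le> \<rho> b \<and> \<rho> b \<le> \<rho> j"
proof -
  obtain j where j: "j \<in> B" "\<And>b. b \<in> B \<Longrightarrow> \<rho> b \<le> \<rho> j" using finite_argmax[OF assms, of \<rho>] by blast
  obtain i where i: "i \<in> B" "\<And>b. b \<in> B \<Longrightarrow> - \<rho> b \<le> - \<rho> i" using finite_argmax[OF assms, of "\<lambda>b. - \<rho> b"] by blast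
  show ?thesis using that[OF i(1) j(1)] i(2) j(2) by force
qed

text \<open>The first and the last point span a side of the hull, so every triangulation has a
  triangle \<open>i P j\<close>, and both intervals are almost convex again. Three points are
  treated apart, since there the middle one may be a dent between \<open>i\<close> and
  \<open>j\<close>.\<close>

theorem card_trifams_le:
  assumes "almost_convex \<rho> D B" "3 \<le> card B"
  shows "card (trifams B) \<le> catalan (card B - 2)"
  using assms
proof (induction "card B" arbitrary: B rule: less_induct)
  case less
  note A = almost_convexD[OF less.prems(1)]
  show ?case
  proof (cases "card B = 3")
    case True
    then show ?thesis using card_trifams_3[OF True] catalan_pos[of "card B - 2"] by linarith
  next
    case False
    have "B \<noteq> {}" using less.prems(2) by auto
    then obtain i j where ij: "i \<in> B" "j \<in> B" and ends: "\<And>b. b \<in> B \<Longrightarrow> \<rho> i \<le> \<rho> b \<and> \<rho> b \<le> \<rho> j"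
      using order_ends[OF A(1), of \<rho>] by blast
    have eqB: "a = b" if "a \<in> B" "b \<in> B" "\<rho> a = \<rho> b" for a b using A(2) that by (auto simp: inj_on_def)
    have lt: "\<rho> i < \<rho> j"
    proof (rule ccontr)
      assume "\<not> \<rho> i < \<rho> j"
      then have "b = i" if "b \<in> B" for b using eqB[OF that ij(1)] ends[OF that] by linarith
      then have "B \<subseteq> {i}" by blast
      then have "card B \<le> 1" using card_mono[of "{i}" B] by simp
      then show False using less.prems(2) by simp
    qed
    have inner: "\<rho> i < \<rho> s \<and> \<rho> s < \<rho> j" if "s \<in> B" "s \<noteq> i" "s \<noteq> j" for s
      using ends[OF that(1)] eqB[OF ij(1) that(1)] eqB[OF that(1) ij(2)] that by force
    have nd: "\<not> dent_triple \<rho> D B i s j" for s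
    proof
      assume "dent_triple \<rho> D B i s j"
      note dd = dent_tripleD[OF this]
      have "B \<subseteq> {i, s, j}"
      proof
        fix b assume b: "b \<in> B"
        have "\<rho> b = \<rho> i \<or> \<rho> b = \<rho> s \<or> \<rho> b = \<rho> j" using adjacentD(4)[OF dd(2) b] adjacentD(4)[OF dd(3) b] ends[OF b] by linarith
        then show "b \<in> {i, s, j}" using eqB[OF b] ij dd(5) by blast
      qed
      then have "card B \<le> card {i, s, j}" by (intro card_mono) auto
      also have "\<dots> \<le> 3" by (simp add: card_insert_if)
      finally show False using False less.prems(2) by simp
    qed
    have base: "0 < orient i s j" if "s \<in> B" "s \<noteq> i" "s \<noteq> j" for s
      using A(4)[OF ij(1) that(1) ij(2)] inner[OF that] nd by blast
    have split: "\<exists>P\<in>B - {i, j}. split_at \<rho> D B {} i j P \<T>" if T: "\<T> \<in> trifams B" for \<T>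
    proof -
      obtain w c where w: "\<And>q. orient i j q = w \<bullet> q - c" using orient_affine[of i j] by blast
      have ne: "i \<noteq> j" using lt by auto
      have "\<exists>V\<in>\<T>. {i, j} \<subseteq> V"
      proof (rule side_in_triangle[OF T ij ne, of "- w" "- c"])
        show "- w \<bullet> i = - c" "- w \<bullet> j = - c" using w[of i] w[of j] by simp_all
        show "- c < - w \<bullet> s" if "s \<in> B - {i, j}" for s
          using w[of s] orient_swap[of i s j] base[of s] that by auto
      qed
      then obtain V where V: "V \<in> \<T>" "i \<in> V" "j \<in> V" by blast
      obtain P where P: "V = {i, j, P}" "P \<noteq> i" "P \<noteq> j" using third_vertex[OF trifamsD(2)[OF T V(1)] V(2,3) ne] .
      have PB: "P \<in> B" using trifamsD(1)[OF T V(1)] P(1) by blast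
      have "split_at \<rho> D B {} i j P \<T>"
      proof
        show "{i, P, j} \<in> \<T>" using V(1) P(1) by (simp add: insert_commute)
        show "\<rho> i < \<rho> P" "\<rho> P < \<rho> j" using inner[OF PB P(2,3)] by auto
        show "\<not> dent_triple \<rho> D B i P j" by (rule nd)
        show "0 < orient a b c" if "a \<in> B" "b \<in> B" "c \<in> B" "\<rho> a < \<rho> b" "\<rho> b < \<rho> c" "\<not> dent_triple \<rho> D B a b c" for a b c
          using A(4)[OF that] .
        show "orient a b c < 0" if "dent_triple \<rho> D B a b c" for a b c using A(5)[OF that] .
        show "\<not> (s \<in> D \<and> t \<in> D)" if "adjacent \<rho> B s t" for s t using A(6)[OF that] .
        show "finite B" "inj_on \<rho> B" "general_position B" "i \<in> B" "j \<in> B" "P \<in> B" "\<T> \<in> trifams B" by (fact A ij PB T)+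
        show "\<And>b. b \<in> B \<Longrightarrow> \<rho> i \<le> \<rho> b \<and> \<rho> b \<le> \<rho> j" by (rule ends)
      qed auto
      then show ?thesis using PB P by blast
    qed
    have IH: "card (fills \<rho> D B l r) \<le> catalan (card (interval \<rho> B l r) - 2)" if "interval \<rho> B l r \<subset> B" for l r
    proof (rule card_fills_le)
      assume c: "3 \<le> card (interval \<rho> B l r)"
      have "almost_convex \<rho> D (interval \<rho> B l r)"
        by (rule almost_convex_interval[OF A(1-3) A(4)]) (use A(5,6) in \<open>auto simp: interval_def\<close>)
      then show "card (trifams (interval \<rho> B l r)) \<le> catalan (card (interval \<rho> B l r) - 2)"
        using less.hyps[OF psubset_card_mono[OF A(1) that]] c by blast
    qed
    have "card (trifams B) \<le> (\<Sum>P\<in>B - {i, j}. card (fills \<rho> D B i P) * card (fills \<rho> D B P j))"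
      by (rule card_split_le[OF A(1) _ split]) auto
    also have "\<dots> \<le> (\<Sum>P\<in>B - {i, j}. catalan (card (interval \<rho> B i P) - 2) * catalan (card (interval \<rho> B P j) - 2))"
    proof (rule sum_mono)
      fix P assume P: "P \<in> B - {i, j}"
      have "\<rho> i < \<rho> P" "\<rho> P < \<rho> j" using inner P by auto
      then have "j \<notin> interval \<rho> B i P" "i \<notin> interval \<rho> B P j" by (auto simp: interval_def)
      then have "interval \<rho> B i P \<subset> B" "interval \<rho> B P j \<subset> B" using ij by (auto simp: interval_def)
      then show "card (fills \<rho> D B i P) * card (fills \<rho> D B P j) \<le> catalan (card (interval \<rho> B i P) - 2) * catalan (card (interval \<rho> B P j) - 2)"
        by (intro mult_le_mono IH)
    qed
    also have "\<dots> = catalan (card B - 2)" by (rule sum_intervals[OF A(1,2) ij lt ends less.prems(2)])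
    finally show ?thesis .
  qed
qed

text \<open>\<open>j\<close> is a dent of the side \<open>i k\<close> and last in the order.
  Triangulations without the vertex \<open>j\<close> are triangulations of \<open>B - {j}\<close>
  and are bounded by the term for \<open>P = k\<close> of the recursion. The others contain the
  triangle \<open>{i, k, j}\<close> and a second triangle on \<open>i j\<close>, whose third vertex
  \<open>P \<noteq> k\<close> splits them with \<open>K = {k}\<close>.\<close>

theorem card_trifams_le_base_dent:
  assumes fin: "finite B" and inj: "inj_on \<rho> B" and gp: "general_position B" and ij: "i \<in> B" "j \<in> B"
    and ends: "\<And>b. b \<in> B \<Longrightarrow> \<rho> i \<le> \<rho> b \<and> \<rho> b \<le> \<rho> j" and kj: "adjacent \<rho> B k j" and ik: "\<rho> i < \<rho> k" and kD: "k \<notin> D"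
    and pos: "\<And>a b c. a \<in> B \<Longrightarrow> b \<in> B \<Longrightarrow> c \<in> B \<Longrightarrow> \<rho> a < \<rho> b \<Longrightarrow> \<rho> b < \<rho> c \<Longrightarrow> \<not> dent_triple \<rho> D B a b c \<Longrightarrow> \<not> (a = i \<and> b = k \<and> c = j) \<Longrightarrow> 0 < orient a b c"
    and neg: "\<And>a b c. dent_triple \<rho> D B a b c \<Longrightarrow> orient a b c < 0"
    and noadj: "\<And>s t. adjacent \<rho> B s t \<Longrightarrow> \<not> (s \<in> D \<and> t \<in> D)"
    and kneg: "orient i k j < 0" and kdent: "\<And>s. \<not> dent_triple \<rho> D B i s k" and card: "4 \<le> card B"
  shows "card (trifams B) \<le> catalan (card B - 2)"
proof -
  note kk = adjacentD[OF kj]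
  have eqB: "a = b" if "a \<in> B" "b \<in> B" "\<rho> a = \<rho> b" for a b using inj that by (auto simp: inj_on_def)
  have lt: "\<rho> i < \<rho> j" using ik kk(3) by simp
  have ne: "i \<noteq> j" "i \<noteq> k" "k \<noteq> j" using lt ik kk(3) by auto
  have inner: "\<rho> i < \<rho> s \<and> \<rho> s < \<rho> k" if s: "s \<in> B" "s \<noteq> i" "s \<noteq> j" "s \<noteq> k" for s
  proof -
    have "\<rho> i < \<rho> s" "\<rho> s < \<rho> j" using ends[OF s(1)] eqB[OF ij(1) s(1)] eqB[OF s(1) ij(2)] s by force+
    then show ?thesis using kk(4)[OF s(1)] eqB[OF s(1) kk(1)] s(4) by force
  qed
  have nadj: "\<not> adjacent \<rho> B s j" if "\<rho> s < \<rho> k" for s using kk(1,3) that unfolding adjacent_def by force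
  have inhull: "j \<in> convex hull {i, s, k}" and isj: "0 < orient i s j" and isk: "0 < orient i s k" if s: "s \<in> B" "s \<noteq> i" "s \<noteq> j" "s \<noteq> k" for s
  proof -
    note n = inner[OF s]
    have 1: "0 < orient i s k" by (rule pos[OF ij(1) s(1) kk(1)]) (use n kdent ne in auto)
    have 2: "0 < orient i s j" by (rule pos[OF ij(1) s(1) ij(2)]) (use n kk(3) nadj[of s] s in \<open>auto simp: dent_triple_def\<close>)
    have 3: "0 < orient s k j" by (rule pos[OF s(1) kk(1) ij(2)]) (use n kk(3) kD s in \<open>auto simp: dent_triple_def\<close>)
    have "0 < orient k i j" using kneg orient_swap[of i k j] orient_rotate[of i j k] by linarith
    then show "j \<in> convex hull {i, s, k}" using 1 2 3 by (intro mem_triangle) auto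
    show "0 < orient i s j" "0 < orient i s k" by (fact 2 1)+
  qed
  obtain b where b: "b \<in> B" "b \<noteq> i" "b \<noteq> j" "b \<noteq> k"
  proof -
    have "\<not> B \<subseteq> {i, j, k}"
    proof
      assume "B \<subseteq> {i, j, k}"
      then have "card B \<le> card {i, j, k}" by (intro card_mono) auto
      also have "\<dots> \<le> 3" by (simp add: card_insert_if)
      finally show False using card by simp
    qed
    then show ?thesis using that by blast
  qed
  \<comment> \<open>\<open>j\<close> lies in the triangle \<open>i b k\<close>, so a triangulation
    that omits \<open>j\<close> covers the hull of the remaining points.\<close>
  have hull_eq: "convex hull (B - {j}) = convex hull B"
  proof -
    have "{i, b, k} \<subseteq> B - {j}" using ij(1) kk(1) b ne by blast
    then have "j \<in> convex hull (B - {j})" using inhull[OF b] hull_mono by blast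
    then have "convex hull (insert j (B - {j})) = convex hull (B - {j})" by (rule hull_redundant)
    then show ?thesis using ij(2) by (simp add: insert_absorb)
  qed
  have sub_ac: "almost_convex \<rho> D (interval \<rho> B l r)" if "i \<notin> interval \<rho> B l r \<or> j \<notin> interval \<rho> B l r" for l r
  proof (rule almost_convex_interval[OF fin inj gp _ neg noadj])
    fix a b c assume h: "a \<in> interval \<rho> B l r" "b \<in> interval \<rho> B l r" "c \<in> interval \<rho> B l r" "\<rho> a < \<rho> b" "\<rho> b < \<rho> c" "\<not> dent_triple \<rho> D B a b c"
    then have "a \<in> B" "b \<in> B" "c \<in> B" by (auto simp: interval_def)
    then show "0 < orient a b c" by (rule pos[OF _ _ _ h(4-6)]) (use that h in blast)
  qed
  have iv: "interval \<rho> B i k = B - {j}"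
  proof (intro equalityI subsetI)
    fix s assume "s \<in> B - {j}"
    then show "s \<in> interval \<rho> B i k" using inner[of s] ik ij(1) kk(1) by (cases "s = i"; cases "s = k") (auto simp: interval_def)
  qed (use kk(3) in \<open>auto simp: interval_def\<close>)
  have c1: "card (B - {j}) = card B - 1" using fin ij(2) by simp
  define S0 S1 where "S0 = {\<T> \<in> trifams B. j \<notin> \<Union>\<T>}" and "S1 = {\<T> \<in> trifams B. j \<in> \<Union>\<T>}"
  have "S0 \<subseteq> trifams (B - {j})"
  proof
    fix \<T> assume "\<T> \<in> S0"
    then have T: "\<T> \<in> trifams B" "j \<notin> \<Union>\<T>" by (auto simp: S0_def)
    have "V \<subseteq> B - {j}" if "V \<in> \<T>" for V using trifamsD(1)[OF T(1) that] T(2) that by blast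
    then show "\<T> \<in> trifams (B - {j})"
      unfolding trifams_def mem_Collect_eq hull_eq using trifamsD(2-4)[OF T(1)] by simp
  qed
  then have "card S0 \<le> card (trifams (B - {j}))" using fin by (intro card_mono finite_trifams) auto
  also have "\<dots> \<le> catalan (card (B - {j}) - 2)"
    using sub_ac[of i k] unfolding iv by (intro card_trifams_le) (use c1 card in auto)
  finally have S0: "card S0 \<le> catalan (card B - 3)" using c1 by (simp add: numeral_3_eq_3 numeral_2_eq_2)
  have X0: "{i, k, j} \<in> \<T>" if T: "\<T> \<in> S1" for \<T>
  proof -
    have tr: "\<T> \<in> trifams B" using T by (simp add: S1_def)
    obtain w c where w: "\<And>q. orient i k q = w \<bullet> q - c" using orient_affine[of i k] by blast
    have "\<exists>V\<in>\<T>. {i, k} \<subseteq> V"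
    proof (rule side_in_triangle[OF tr ij(1) kk(1) ne(2), of "- w" "- c"])
      show "- w \<bullet> i = - c" "- w \<bullet> k = - c" using w[of i] w[of k] by simp_all
      fix s assume s: "s \<in> B - {i, k}"
      have "orient i k s < 0"
      proof (cases "s = j")
        case False
        then show ?thesis using isk[of s] s orient_swap[of i s k] by auto
      qed (use kneg in simp)
      then show "- c < - w \<bullet> s" using w[of s] by simp
    qed
    then obtain V where V: "V \<in> \<T>" "i \<in> V" "k \<in> V" by blast
    obtain s where s: "V = {i, k, s}" "s \<noteq> i" "s \<noteq> k" using third_vertex[OF trifamsD(2)[OF tr V(1)] V(2,3) ne(2)] .
    have sB: "s \<in> B" using trifamsD(1)[OF tr V(1)] s(1) by blast
    have "s = j"
    proof (rule ccontr)
      assume "s \<noteq> j"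
      then have "j \<in> convex hull V" unfolding s(1) using inhull[OF sB s(2) _ s(3)] by (simp add: insert_commute)
      moreover obtain V' where "V' \<in> \<T>" "j \<in> V'" using T by (auto simp: S1_def)
      ultimately have "j \<in> V" using trifams_vertex_in_hull[OF gp tr V(1)] by blast
      then show False using \<open>s \<noteq> j\<close> ne unfolding s(1) by blast
    qed
    then show ?thesis using V(1) s(1) by simp
  qed
  have split: "\<exists>P\<in>B - {i, j, k}. split_at \<rho> D B {k} i j P \<T>" if T: "\<T> \<in> S1" for \<T>
  proof -
    have tr: "\<T> \<in> trifams B" using T by (simp add: S1_def)
    note TD = trifamsD[OF tr]
    have X: "{i, k, j} \<in> \<T>" by (rule X0[OF T])
    have indep: "\<not> affine_dependent {i, k, j}" using triple_independent[OF gp TD(1,2)[OF X]] .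
    have "\<exists>V\<in>\<T> - {{i, k, j}}. {i, j} \<subseteq> V"
    proof (rule ccontr)
      assume no: "\<not> (\<exists>V\<in>\<T> - {{i, k, j}}. {i, j} \<subseteq> V)"
      let ?U = "\<Union>V\<in>\<T> - {{i, k, j}}. convex hull V"
      \<comment> \<open>The midpoint of \<open>i j\<close> is a limit of points on the side of
        \<open>b\<close>, which the triangle \<open>{i, k, j}\<close> does not reach. So another
        triangle contains it, and compatibility with \<open>{i, k, j}\<close> forces
        \<open>i\<close> and \<open>j\<close> to be vertices of that triangle.\<close>
      define m where "m = (1/2) *\<^sub>R i + (1/2) *\<^sub>R j"
      have mij: "m \<in> convex hull {i, j}" unfolding m_def convex_hull_2 by (intro CollectI exI[of _ "1/2"]) simp
      then have mX: "m \<in> convex hull {i, k, j}" using hull_mono[of "{i, j}" "{i, k, j}" convex] by blast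
      have mU: "m \<notin> ?U"
      proof
        assume "m \<in> ?U"
        then obtain V where V: "V \<in> \<T>" "V \<noteq> {i, k, j}" "m \<in> convex hull V" by blast
        have "m \<in> convex hull (V \<inter> {i, k, j})" using TD(3)[OF V(1) X] V(3) mX by blast
        then have "m \<in> convex hull ((V \<inter> {i, k, j}) \<inter> {i, j})"
          using convex_hull_Int_faces[OF indep, of "V \<inter> {i, k, j}" "{i, j}"] mij by blast
        then have "(V \<inter> {i, k, j}) \<inter> {i, j} = {i, j}"
        proof (rule in_hull_subset_pos[rotated 2, where u = "\<lambda>_. 1/2"])
          show "\<not> affine_dependent {i, j}" using affine_dependent_subset[of "{i, j}" "{i, k, j}"] indep by blast
        qed (use ne(1) in \<open>auto simp: m_def\<close>)
        then show False using no V(1,2) by blast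
      qed
      have finT: "finite (\<T> - {{i, k, j}})" by (rule finite_subset[of _ "Pow B"]) (use TD(1) fin in auto)
      have closed: "closed ?U"
      proof (rule closed_UN[OF finT], rule ballI)
        fix V assume "V \<in> \<T> - {{i, k, j}}"
        then have "finite V" using TD(1) fin finite_subset by blast
        then show "closed (convex hull V)" by (simp add: compact_imp_closed finite_imp_compact_convex_hull)
      qed
      define f where "f t = (1 - t) *\<^sub>R m + t *\<^sub>R b" for t :: real
      have mB: "m \<in> convex hull B" using mij hull_mono[of "{i, j}" B convex] ij by blast
      have ob: "orient i j b < 0" using isj[OF b] orient_swap[of i b j] by simp
      have om: "orient i j m = 0" unfolding m_def by (subst orient_comb) simp_all
      have inU: "f t \<in> ?U" if t: "0 < t" "t \<le> 1" for t
      proof -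
        have "f t \<in> convex hull B" unfolding f_def using convexD[OF convex_convex_hull mB hull_inc[OF b(1)], of "1 - t" t] t by simp
        then obtain V where V: "V \<in> \<T>" "f t \<in> convex hull V" using TD(4) by blast
        have "orient i j (f t) = t * orient i j b" unfolding f_def using om by (subst orient_comb) simp_all
        then have neg': "orient i j (f t) < 0" using t ob by (simp add: mult_pos_neg)
        have "V \<noteq> {i, k, j}"
        proof
          assume e: "V = {i, k, j}"
          have "0 \<le> 1 * orient i j (f t)"
            by (rule orient_hull_nonneg[OF V(2)]) (use kneg orient_swap[of i k j] in \<open>auto simp: e\<close>)
          then show False using neg' by simp
        qed
        then show ?thesis using V by blast
      qed
      have "(f \<longlongrightarrow> f 0) (at_right 0)" unfolding f_def by (intro tendsto_intros)
      moreover have "eventually (\<lambda>t. f t \<in> ?U) (at_right 0)"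
        unfolding eventually_at_right_field by (intro exI[of _ 1]) (use inU in auto)
      moreover have "at_right (0::real) \<noteq> bot" by simp
      ultimately have "f 0 \<in> ?U" using Lim_in_closed_set[OF closed] by blast
      then show False using mU by (simp add: f_def)
    qed
    then obtain V where V: "V \<in> \<T>" "V \<noteq> {i, k, j}" "i \<in> V" "j \<in> V" by blast
    obtain P where P: "V = {i, j, P}" "P \<noteq> i" "P \<noteq> j" using third_vertex[OF TD(2)[OF V(1)] V(3,4) ne(1)] .
    have PB: "P \<in> B" using TD(1)[OF V(1)] P(1) by blast
    have Pk: "P \<noteq> k" using V(2) P(1) by (auto simp: insert_commute)
    note n = inner[OF PB P(2,3) Pk]
    have "split_at \<rho> D B {k} i j P \<T>"
    proof
      show "{i, P, j} \<in> \<T>" using V(1) P(1) by (simp add: insert_commute)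
      show "\<rho> i < \<rho> P" "\<rho> P < \<rho> j" using n kk(3) by auto
      show "\<not> dent_triple \<rho> D B i P j" using nadj n by (auto simp: dent_triple_def)
      show "0 < orient a b c" if "a \<in> B" "b \<in> B" "c \<in> B" "\<rho> a < \<rho> b" "\<rho> b < \<rho> c" "\<not> dent_triple \<rho> D B a b c" "\<not> (a = i \<and> b \<in> {k} \<and> c = j)" for a b c
        using pos[OF that(1-6)] that(7) by blast
      show "orient a b c < 0" if "dent_triple \<rho> D B a b c" for a b c using neg[OF that] .
      show "\<not> (s \<in> D \<and> t \<in> D)" if "adjacent \<rho> B s t" for s t using noadj[OF that] .
      show "\<rho> P < \<rho> k' \<and> adjacent \<rho> B k' j \<and> k' \<notin> D \<and> orient i k' j < 0" if "k' \<in> {k}" for k'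
        using that n kj kD kneg by simp
      show "\<not> dent_triple \<rho> D B i s k'" if "k' \<in> {k}" for k' s using that kdent by simp
      show "finite B" "inj_on \<rho> B" "general_position B" "i \<in> B" "j \<in> B" "P \<in> B" "\<T> \<in> trifams B" by (fact fin inj gp ij PB tr)+
      show "\<And>b. b \<in> B \<Longrightarrow> \<rho> i \<le> \<rho> b \<and> \<rho> b \<le> \<rho> j" by (rule ends)
    qed
    then show ?thesis using PB P Pk by blast
  qed
  let ?w = "\<lambda>P. catalan (card (interval \<rho> B i P) - 2) * catalan (card (interval \<rho> B P j) - 2)"
  have "card S1 \<le> (\<Sum>P\<in>B - {i, j, k}. card (fills \<rho> D B i P) * card (fills \<rho> D B P j))"
    by (rule card_split_le[OF fin _ split]) (use X0 in auto)
  also have "\<dots> \<le> (\<Sum>P\<in>B - {i, j, k}. ?w P)"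
  proof (rule sum_mono)
    fix P assume P: "P \<in> B - {i, j, k}"
    have n: "\<rho> i < \<rho> P" "\<rho> P < \<rho> j" using inner[of P] P kk(3) by auto
    then have o: "j \<notin> interval \<rho> B i P" "i \<notin> interval \<rho> B P j" by (auto simp: interval_def)
    show "card (fills \<rho> D B i P) * card (fills \<rho> D B P j) \<le> ?w P"
      by (intro mult_le_mono card_fills_le card_trifams_le[OF sub_ac]) (use o in auto)
  qed
  finally have S1: "card S1 \<le> (\<Sum>P\<in>B - {i, j, k}. ?w P)" .
  have "card (trifams B) = card S0 + card S1"
  proof -
    have "trifams B = S0 \<union> S1" "S0 \<inter> S1 = {}" by (auto simp: S0_def S1_def)
    moreover have "finite S0" "finite S1" using finite_trifams[OF fin] by (auto simp: S0_def S1_def)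
    ultimately show ?thesis by (simp add: card_Un_disjoint)
  qed
  also have "\<dots> \<le> ?w k + (\<Sum>P\<in>B - {i, j, k}. ?w P)"
  proof -
    have "catalan (card B - 3) = catalan (card (interval \<rho> B i k) - 2)" unfolding iv c1 by (simp add: numeral_3_eq_3 numeral_2_eq_2)
    then have "catalan (card B - 3) \<le> ?w k" using catalan_pos[of "card (interval \<rho> B k j) - 2"] by simp
    then show ?thesis using S0 S1 by simp
  qed
  also have "\<dots> = (\<Sum>P\<in>B - {i, j}. ?w P)"
  proof -
    have "B - {i, j} = insert k (B - {i, j, k})" using kk(1) ne by blast
    moreover have "k \<notin> B - {i, j, k}" "finite (B - {i, j, k})" using fin by auto
    ultimately show ?thesis by simp
  qed
  also have "\<dots> = catalan (card B - 2)" by (rule sum_intervals[OF fin inj ij lt ends]) (use card in auto)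
  finally show ?thesis .
qed

section \<open>The boundary order of a quasi-convex set\<close>

text \<open>Faces of a polytope are exposed, which provides the functional \<open>w\<close>; general
  position keeps all other points of \<open>M\<close> off the line of the side.\<close>

lemma is_sideD:
  assumes fin: "finite M" and gp: "general_position M" and side: "is_side M Q Q'"
  shows "Q extreme_point_of convex hull M" "Q' extreme_point_of convex hull M" "Q \<in> M" "Q' \<in> M" "Q \<noteq> Q'"
    "\<exists>w c. w \<bullet> Q = c \<and> w \<bullet> Q' = c \<and> (\<forall>s\<in>M - {Q, Q'}. c < w \<bullet> s)"
proof -
  have f: "closed_segment Q Q' face_of convex hull M" and d: "aff_dim (closed_segment Q Q') = 1"
    using side unfolding is_side_def edge_of_def by auto
  show "Q \<noteq> Q'" using d by auto
  show e: "Q extreme_point_of convex hull M" "Q' extreme_point_of convex hull M"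
    using extreme_point_of_face[OF f] extreme_point_of_segment by blast+
  show Q: "Q \<in> M" "Q' \<in> M" using e extreme_point_of_convex_hull by blast+
  have "polyhedron (convex hull M)" using fin by (simp add: polytope_convex_hull polytope_imp_polyhedron)
  then have "closed_segment Q Q' exposed_face_of convex hull M" using f exposed_face_of_polyhedron by blast
  then obtain a b where ab: "convex hull M \<subseteq> {x. a \<bullet> x \<le> b}" "closed_segment Q Q' = convex hull M \<inter> {x. a \<bullet> x = b}"
    unfolding exposed_face_of_def by blast
  have "a \<bullet> Q = b" "a \<bullet> Q' = b" using ab(2) ends_in_segment by blast+
  moreover have "a \<bullet> s < b" if s: "s \<in> M - {Q, Q'}" for s
  proof -
    have sM: "s \<in> convex hull M" using s by (simp add: hull_inc)
    have "a \<bullet> s \<noteq> b"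
    proof
      assume "a \<bullet> s = b"
      then have "s \<in> closed_segment Q Q'" using ab(2) sM by blast
      then obtain t where "s = (1 - t) *\<^sub>R Q + t *\<^sub>R Q'" unfolding closed_segment_def by blast
      then have "s = (1 - t) *\<^sub>R Q + (1 - (1 - t)) *\<^sub>R Q'" by simp
      then have "collinear {Q, s, Q'}" unfolding collinear_3_expand by blast
      moreover have "s \<in> M" "Q \<noteq> s" "s \<noteq> Q'" using s by auto
      ultimately show False using gp[unfolded general_position_def, rule_format, of Q s Q'] Q \<open>Q \<noteq> Q'\<close> by simp
    qed
    then show ?thesis using ab(1) sM by force
  qed
  ultimately show "\<exists>w c. w \<bullet> Q = c \<and> w \<bullet> Q' = c \<and> (\<forall>s\<in>M - {Q, Q'}. c < w \<bullet> s)"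
    by (intro exI[of _ "- a"] exI[of _ "- b"]) simp
qed

lemma inner_on_segment:
  fixes w :: point
  assumes "q \<in> convex hull {s, t}" "w \<bullet> s = c" "w \<bullet> t = c"
  shows "w \<bullet> q = c"
proof -
  obtain a b where ab: "a + b = 1" "q = a *\<^sub>R s + b *\<^sub>R t" using assms(1) unfolding convex_hull_2 by blast
  have "w \<bullet> q = a * c + b * c" unfolding ab(2) using assms(2,3) by (simp add: inner_add_right)
  also have "\<dots> = (a + b) * c" by (simp add: distrib_right)
  finally show ?thesis using ab(1) by simp
qed

lemma not_in_hull_off_line:
  fixes w :: point
  assumes "q \<in> convex hull A" "w \<bullet> q = c" "\<And>s. s \<in> A \<Longrightarrow> c < w \<bullet> s"
  shows False
  using hull_gt[OF assms(1,3)] assms(2) by simp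

section \<open>Sides and dents in the coordinates at \<open>R\<close>\<close>

context star
begin

lemma orient_star:
  "(u $ 1 * v $ 2 - u $ 2 * v $ 1) * orient a b c = (ff a * gg b - gg a * ff b) + (ff b * gg c - gg b * ff c) + (ff c * gg a - gg c * ff a)"
  by (simp add: orient_def ff_def gg_def inner_vec_def sum_2 algebra_simps)

lemma orient_R_pos:
  assumes dpos: "0 < u $ 1 * v $ 2 - u $ 2 * v $ 1" and "0 < ff a" "0 < ff b" "hx a < hx b"
  shows "0 < orient R a b"
proof -
  have "(u $ 1 * v $ 2 - u $ 2 * v $ 1) * orient R a b = ff a * gg b - gg a * ff b" unfolding orient_star by simp
  also have "\<dots> = (ff a * ff b) * (hx b - hx a)" using gg_eq[OF assms(2)] gg_eq[OF assms(3)] by (simp add: algebra_simps)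
  finally have "0 < (u $ 1 * v $ 2 - u $ 2 * v $ 1) * orient R a b" using assms by simp
  then show ?thesis using dpos by (rule zero_less_mult_pos)
qed

text \<open>The link between orientations and the transformed picture: for a positive determinant,
  \<open>orient a b c\<close> has the sign of the height of \<open>b\<close> above the line
  \<open>a c\<close>.\<close>

lemma orient_kink:
  assumes "0 < ff a" "0 < ff b" "0 < ff c" "hx a < hx c"
  shows "(u $ 1 * v $ 2 - u $ 2 * v $ 1) * orient a b c = (ff a * ff b * ff c * (hx c - hx a)) * (hy b - hlin a c (hx b))"
proof -
  have "hlin a c (hx b) * (hx c - hx a) = hy a * (hx c - hx a) + (hy c - hy a) * (hx b - hx a)"
    using assms(4) by (simp add: lin_def distrib_right)
  then have "(hx c - hx a) * (hy b - hlin a c (hx b)) = (hx c - hx a) * hy b - hy a * (hx c - hx b) - hy c * (hx b - hx a)"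
    by (simp add: algebra_simps)
  then have "(ff a * ff b * ff c * (hx c - hx a)) * (hy b - hlin a c (hx b)) =
     ff a * ff b * ff c * ((hx c - hx a) * hy b - hy a * (hx c - hx b) - hy c * (hx b - hx a))"
    by (simp only: mult.assoc)
  also have "\<dots> = (ff b * hy b) * (ff a * ff c * (hx c - hx a)) - (ff a * hy a) * (ff b * ff c * (hx c - hx b)) - (ff c * hy c) * (ff a * ff b * (hx b - hx a))"
    by (simp add: algebra_simps)
  also have "\<dots> = - (ff a * ff c * (hx c - hx a)) + ff b * ff c * (hx c - hx b) + ff a * ff b * (hx b - hx a)"
    using assms by (simp add: hy_def)
  finally show ?thesis unfolding orient_star using gg_eq[OF assms(1)] gg_eq[OF assms(2)] gg_eq[OF assms(3)] by (simp add: algebra_simps)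
qed

lemma orient_above:
  assumes dpos: "0 < u $ 1 * v $ 2 - u $ 2 * v $ 1" and "a \<in> X" "b \<in> X" "c \<in> X" "hx a < hx c" "hlin a c (hx b) < hy b"
  shows "0 < orient a b c"
proof -
  have fp: "0 < ff a" "0 < ff b" "0 < ff c" using ff_pos assms by blast+
  have "0 < (u $ 1 * v $ 2 - u $ 2 * v $ 1) * orient a b c" unfolding orient_kink[OF fp assms(5)] using fp assms(5,6) by simp
  then show ?thesis using dpos by (rule zero_less_mult_pos)
qed

lemma orient_below:
  assumes dpos: "0 < u $ 1 * v $ 2 - u $ 2 * v $ 1" and "a \<in> X" "b \<in> X" "c \<in> X" "hx a < hx c" "hy b < hlin a c (hx b)"
  shows "orient a b c < 0"
proof -
  have fp: "0 < ff a" "0 < ff b" "0 < ff c" using ff_pos assms by blast+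
  have "(u $ 1 * v $ 2 - u $ 2 * v $ 1) * orient a b c < 0"
    unfolding orient_kink[OF fp assms(5)] using fp assms(5,6) by (intro mult_pos_neg) simp_all
  then show ?thesis using dpos by (simp add: mult_less_0_iff)
qed

lemma in_wedge:
  assumes "a \<in> X" "b \<in> X" "hx a < hx b" "s \<in> X" "s \<in> convex hull {R, a, b}" "s \<noteq> a" "s \<noteq> b"
  shows "hx a < hx s" "hx s < hx b" "hy s < hlin a b (hx s)"
proof -
  have sR: "s \<noteq> R" using assms(4) X_M(2) by blast
  have w: "hx a \<le> hx s" "hx s \<le> hx b" "hy s \<le> hlin a b (hx s)"
    using assms(5) sR unfolding mem_wedge[OF ff_pos[OF assms(1)] ff_pos[OF assms(2)] assms(3)] by blast+
  show "hx a < hx s" "hx s < hx b" using w hx_neq[OF assms(4,1,6)] hx_neq[OF assms(4,2,7)] by auto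
  have "a \<noteq> b" using assms(3) by auto
  then show "hy s < hlin a b (hx s)" using w(3) gp[of a b s] assms by force
qed

text \<open>The supporting line of the side leaves \<open>R\<close> and \<open>r\<close> strictly on
  one side. If \<open>r\<close> were above the line \<open>s t\<close>, the segment from
  \<open>R\<close> to \<open>r\<close> would meet the side, or one end of the side would lie in the
  triangle of \<open>R\<close>, \<open>r\<close> and the other end; the supporting line excludes
  both.\<close>

lemma side_below:
  assumes side: "is_side M s t" and st: "s \<in> X" "t \<in> X" "hx s < hx t" and r: "r \<in> X" "r \<noteq> s" "r \<noteq> t"
  shows "hy r < hlin s t (hx r)"
proof (rule ccontr)
  assume "\<not> hy r < hlin s t (hx r)"
  moreover have "hy r \<noteq> hlin s t (hx r)" using gp[of s t r] st r by auto
  ultimately have ab: "hlin s t (hx r) < hy r" by simp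
  obtain w c where w: "w \<bullet> s = c" "w \<bullet> t = c" "\<And>q. q \<in> M - {s, t} \<Longrightarrow> c < w \<bullet> q" using is_sideD(6)[OF finM gpM side] by blast
  have Rr: "c < w \<bullet> R" "c < w \<bullet> r" using w(3)[of R] w(3)[of r] RM X_M st r by blast+
  have fp: "0 < ff s" "0 < ff t" "0 < ff r" using ff_pos st r by blast+
  consider "hx r < hx s" | "hx s < hx r" "hx r < hx t" | "hx t < hx r"
    using hx_neq[OF r(1) st(1) r(2)] hx_neq[OF r(1) st(2) r(3)] by linarith
  then show False
  proof cases
    case 1
    have "hy s < hlin r t (hx s)" using lin_kink_iff(2)[of hx r s t hy, OF 1 st(3)] ab by blast
    then have "s \<in> convex hull {R, r, t}" unfolding mem_wedge[OF fp(3,2) less_trans[OF 1 st(3)]] using fp 1 st(3) by simp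
    then have "s \<in> convex hull {q \<in> {R, r, t}. w \<bullet> q = c}"
      by (rule convex_hull_supporting[rotated 2]) (use w Rr in \<open>auto intro: less_imp_le\<close>)
    moreover have "{q \<in> {R, r, t}. w \<bullet> q = c} = {t}" using Rr w(2) by auto
    ultimately show False using st(3) by simp
  next
    case 2
    obtain q where q: "q \<in> convex hull {s, t}" "0 < ff q" "hx q = hx r" "hy q = hlin s t (hx r)"
      using point_on_segment[OF fp(1,2) st(3), of "hx r"] 2 by (metis less_imp_le)
    have "w \<bullet> q = c" by (rule inner_on_segment[OF q(1) w(1,2)])
    moreover have "q \<in> convex hull {R, r}" by (rule mem_ray) (use q fp ab in auto)
    ultimately show False using not_in_hull_off_line[of q "{R, r}" w c] Rr by blast
  next
    case 3
    have "hy t < hlin s r (hx t)" using lin_kink_iff(1)[of hx s t r hy, OF st(3) 3] ab by blast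
    then have "t \<in> convex hull {R, s, r}" unfolding mem_wedge[OF fp(1,3) less_trans[OF st(3) 3]] using fp 3 st(3) by simp
    then have "t \<in> convex hull {q \<in> {R, s, r}. w \<bullet> q = c}"
      by (rule convex_hull_supporting[rotated 2]) (use w Rr in \<open>auto intro: less_imp_le\<close>)
    moreover have "{q \<in> {R, s, r}. w \<bullet> q = c} = {s}" using Rr w(1) by auto
    ultimately show False using st(3) by simp
  qed
qed

text \<open>Otherwise the ray from \<open>R\<close> through \<open>t\<close>, which lies on the
  supporting line, would meet the segment \<open>p1 p2\<close>, which lies strictly on one side of
  that line.\<close>

lemma side_at_R:
  assumes side: "is_side M R t"
  shows "t = p1 \<or> t = p2"
proof (rule ccontr)
  assume n: "\<not> (t = p1 \<or> t = p2)"
  note sd = is_sideD[OF finM gpM side]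
  have tX: "t \<in> X - {p1, p2}" using sd(4,5) n by (auto simp: X_def)
  have tt: "hx p1 < hx t" "hx t < hx p2" using inner_between[OF tX] by auto
  obtain w c where w: "w \<bullet> R = c" "w \<bullet> t = c" "\<And>q. q \<in> M - {R, t} \<Longrightarrow> c < w \<bullet> q" using sd(6) by blast
  have fp: "0 < ff p1" "0 < ff p2" "0 < ff t" using ff_pos pX qX tX by blast+
  have wp: "c < w \<bullet> p1" "c < w \<bullet> p2" using w(3)[of p1] w(3)[of p2] pX qX X_M n by blast+
  obtain q where q: "q \<in> convex hull {p1, p2}" "0 < ff q" "hx q = hx t"
    using point_on_segment[OF fp(1,2) pq, of "hx t"] tt by (metis less_imp_le)
  have wq: "c < w \<bullet> q" by (rule hull_gt[OF q(1)]) (use wp in blast)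
  show False
  proof (cases "hy q \<le> hy t")
    case True
    have "q \<in> convex hull {R, t}" by (rule mem_ray) (use q fp True in auto)
    then have "w \<bullet> q = c" using inner_on_segment w(1,2) by blast
    then show False using wq by simp
  next
    case False
    have "t \<in> convex hull {R, q}" by (rule mem_ray) (use q fp False in auto)
    then have "t \<in> convex hull {x \<in> {R, q}. w \<bullet> x = c}"
      by (rule convex_hull_supporting[rotated 2]) (use w wq in \<open>auto intro: less_imp_le\<close>)
    moreover have "{x \<in> {R, q}. w \<bullet> x = c} = {R}" using wq w(1) by auto
    ultimately show False using tX X_M(2) by simp
  qed
qed

lemma vertex_above_chords:
  assumes "b extreme_point_of convex hull M" "a \<in> X" "b \<in> X" "c \<in> X" "hx a < hx b" "hx b < hx c"
  shows "hlin a c (hx b) < hy b"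
proof (rule ccontr)
  assume "\<not> hlin a c (hx b) < hy b"
  then have "b \<in> convex hull {R, a, c}"
    using mem_wedge[of a c b] ff_pos assms by (simp add: not_less)
  moreover have "{R, a, c} \<subseteq> M - {b}" using assms(2-6) X_M by auto
  ultimately have "b \<in> convex hull (M - {b})" using hull_mono by blast
  moreover have "convex (convex hull M - {b})" using assms(1) extreme_point_of_stillconvex[of "convex hull M"] by (simp add: convex_convex_hull)
  then have "convex hull (M - {b}) \<subseteq> convex hull M - {b}" using hull_subset[of M convex] by (intro hull_minimal) auto
  ultimately show False by blast
qed

lemma interior_in_hull:
  assumes "b \<in> M" "\<not> b extreme_point_of convex hull M"
  shows "b \<in> convex hull (M - {b})"
proof (rule ccontr)
  assume "b \<notin> convex hull (M - {b})"
  then have "b extreme_point_of convex hull (insert b (M - {b}))" using finM by (intro extreme_point_of_convex_hull_insert) auto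
  then show False using assms by (simp add: insert_absorb)
qed

text \<open>The dents of the sides that do not end at \<open>R\<close>, with left end
  \<open>s\<close> and right end \<open>t\<close>.\<close>

definition mid :: "point \<Rightarrow> point \<Rightarrow> point \<Rightarrow> bool" where
  "mid b s t \<longleftrightarrow> b \<in> X \<and> \<not> b extreme_point_of convex hull M \<and> s \<in> X \<and> t \<in> X \<and> hx s < hx t \<and> is_side M s t \<and> close_to_side M b s t"

text \<open>Closeness to \<open>s t\<close> is turned into the slope inequalities from which
  \<open>close_side_above\<close> starts: \<open>b\<close> lies in every triangle over the side,
  hence above the lower edge of that triangle.\<close>

lemma midD:
  assumes "mid b s t"
  shows "b \<in> X" "s \<in> X" "t \<in> X" "hx s < hx b" "hx b < hx t" "slope b s < slope b t"
    "\<And>r. r \<in> X \<Longrightarrow> hx r < hx b \<Longrightarrow> r \<noteq> s \<Longrightarrow> slope b t < slope b r"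
    "\<And>r. r \<in> X \<Longrightarrow> hx b < hx r \<Longrightarrow> r \<noteq> t \<Longrightarrow> slope b r < slope b s"
    "s extreme_point_of convex hull M" "t extreme_point_of convex hull M"
    "\<And>r. r \<in> M - {s, t} \<Longrightarrow> b \<in> convex hull {r, s, t}"
proof -
  have m: "b \<in> X" "\<not> b extreme_point_of convex hull M" "s \<in> X" "t \<in> X" "hx s < hx t" "is_side M s t" "close_to_side M b s t"
    using assms unfolding mid_def by blast+
  show "b \<in> X" "s \<in> X" "t \<in> X" by (fact m)+
  show ext: "s extreme_point_of convex hull M" "t extreme_point_of convex hull M" using is_sideD[OF finM gpM m(6)] by blast+
  show cl: "b \<in> convex hull {r, s, t}" if "r \<in> M - {s, t}" for r using m(7) that unfolding close_to_side_def by blast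
  have ne: "b \<noteq> s" "b \<noteq> t" using m(2) ext by blast+
  have "b \<in> convex hull {R, s, t}" using cl[of R] RM m(3,4) X_M(2) by blast
  note w = in_wedge[OF m(3,4,5,1) this ne]
  show lt: "hx s < hx b" "hx b < hx t" by (fact w)+
  show "slope b s < slope b t" using below_iff_slope[OF lt] w(3) by blast
  show "slope b t < slope b r" if r: "r \<in> X" "hx r < hx b" "r \<noteq> s" for r
  proof -
    have rt: "hx r < hx t" "r \<noteq> t" "r \<noteq> b" using r(2) lt by auto
    have bl: "hy r < hlin s t (hx r)" by (rule side_below[OF m(6,3,4,5) r(1,3) rt(2)])
    have "hlin r t (hx s) < hy s"
    proof (cases "hx r < hx s")
      case True
      then show ?thesis using lin_kink_iff(4)[of hx r s t hy, OF True m(5)] bl by blast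
    next
      case False
      then have "hx s < hx r" using hx_neq[OF r(1) m(3) r(3)] by simp
      then show ?thesis using lin_kink_iff(2)[of hx s r t hy, OF _ rt(1)] bl by blast
    qed
    moreover have "b \<in> convex hull {r, s, t}" using cl[of r] r X_M(1) rt by blast
    ultimately have "hlin r t (hx b) \<le> hy b"
      by (intro hull_above[of b "{r, s, t}" r t]) (use ff_pos m r rt in auto)
    moreover have "hy b \<noteq> hlin r t (hx b)" using gp[of r t b] r m rt ne by blast
    ultimately show ?thesis using above_iff_slope[OF r(2) lt(2)] by simp
  qed
  show "slope b r < slope b s" if r: "r \<in> X" "hx b < hx r" "r \<noteq> t" for r
  proof -
    have rs: "hx s < hx r" "r \<noteq> s" "r \<noteq> b" using r(2) lt by auto
    have bl: "hy r < hlin s t (hx r)" by (rule side_below[OF m(6,3,4,5) r(1) rs(2) r(3)])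
    have "hlin s r (hx t) < hy t"
    proof (cases "hx r < hx t")
      case True
      then show ?thesis using lin_kink_iff(1)[of hx s r t hy, OF rs(1)] bl by blast
    next
      case False
      then have "hx t < hx r" using hx_neq[OF r(1) m(4) r(3)] by simp
      then show ?thesis using lin_kink_iff(3)[of hx s t r hy, OF m(5)] bl by blast
    qed
    moreover have "b \<in> convex hull {r, s, t}" using cl[of r] r X_M(1) rs by blast
    ultimately have "hlin s r (hx b) \<le> hy b"
      by (intro hull_above[of b "{r, s, t}" s r]) (use ff_pos m r rs in auto)
    moreover have "hy b \<noteq> hlin s r (hx b)" using gp[of s r b] r m rs ne by blast
    ultimately show ?thesis using above_iff_slope[OF lt(1) r(2)] by simp
  qed
qed

lemma mid_above:
  assumes m: "mid b s t" and a: "a \<in> X" "hx a < hx b" and c: "c \<in> X" "hx b < hx c" and ne: "\<not> (a = s \<and> c = t)"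
  shows "hlin a c (hx b) < hy b"
proof -
  note d = midD[OF m]
  have "slope b c < slope b a"
  proof (cases "a = s")
    case True
    then show ?thesis using d(8)[OF c] ne by blast
  next
    case False
    then have 1: "slope b t < slope b a" using d(7)[OF a] by blast
    show ?thesis
    proof (cases "c = t")
      case False
      then have "slope b c < slope b s" using d(8)[OF c] by blast
      then show ?thesis using 1 d(6) by simp
    qed (use 1 in simp)
  qed
  then show ?thesis using above_iff_slope[OF a(2) c(2)] by blast
qed

text \<open>Seen from \<open>r\<close>, closeness of \<open>b\<close> gives \<open>b\<close> a
  larger slope than \<open>t\<close>, whereas closeness of \<open>r\<close> gives it a smaller slope
  than \<open>s\<close>, and \<open>slope r s < slope r t\<close>.\<close>

lemma mid_same_side:
  assumes m: "mid b s t" and m': "mid r s t" and lt: "hx r < hx b"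
  shows False
proof -
  note d = midD[OF m] and d' = midD[OF m']
  have "hlin r t (hx b) < hy b" by (rule mid_above[OF m d'(1) lt d(3,5)]) (use d'(4) in auto)
  moreover have "hlin r t (hx b) = hlin t r (hx b)" using d'(5) by (intro lin_commute) auto
  moreover have "hlin t r (hx b) = hy r + slope r t * (hx b - hx r)" by (rule hlin_slope) (use d'(5) in auto)
  moreover have "hy b = hy r + slope r b * (hx b - hx r)" by (rule slope_eq) (use lt in auto)
  ultimately have "slope r t * (hx b - hx r) < slope r b * (hx b - hx r)" by simp
  then have "slope r t < slope r b" using lt by simp
  moreover have "slope r b < slope r s" by (rule d'(8)[OF d(1) lt]) (use d(5) in auto)
  ultimately show False using d'(6) by simp
qed

lemma vertex_not_between:
  assumes m: "mid b s t" and r: "r \<in> X" "r extreme_point_of convex hull M" "hx s < hx r" "hx r < hx t"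
  shows False
proof -
  note d = midD[OF m]
  have "hy r < hlin s t (hx r)" using side_below[OF _ d(2,3) _ r(1)] r(3,4) m unfolding mid_def by force
  then show False using vertex_above_chords[OF r(2) d(2) r(1) d(3) r(3,4)] by simp
qed

text \<open>No hull vertex lies over the inside of a side, so two sides away from \<open>R\<close>
  whose ranges of \<open>hx\<close> overlap in an inner point are equal; and a side has only one
  dent.\<close>

lemma mid_between:
  assumes m: "mid b s t" and m': "mid r s' t'" and r: "hx s < hx r" "hx r < hx t"
  shows "r = b"
proof -
  note d = midD[OF m] and d' = midD[OF m']
  have "\<not> (hx s < hx s' \<and> hx s' < hx t)" "\<not> (hx s < hx t' \<and> hx t' < hx t)"
    using vertex_not_between[OF m d'(2,9)] vertex_not_between[OF m d'(3,10)] by blast+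
  moreover have "\<not> (hx s' < hx s \<and> hx s < hx t')" "\<not> (hx s' < hx t \<and> hx t < hx t')"
    using vertex_not_between[OF m' d(2,9)] vertex_not_between[OF m' d(3,10)] by blast+
  ultimately have "hx s = hx s'" "hx t = hx t'" using r d'(4,5) by linarith+
  then have "s' = s" "t' = t" using hx_neq[OF d(2) d'(2)] hx_neq[OF d(3) d'(3)] by blast+
  then have "mid r s t" using m' by simp
  then have "\<not> hx r < hx b" "\<not> hx b < hx r" using mid_same_side[OF m] mid_same_side[OF _ m] by blast+
  then show ?thesis using hx_neq[OF d'(1) d(1)] by force
qed

end

section \<open>The boundary order and its orientations\<close>

context star
begin

definition Mids :: "point set" where "Mids = {b. \<exists>s t. mid b s t}"

text \<open>The dents of the side \<open>R p2\<close>. An interior point may be close to several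
  sides (a single point inside a triangle is close to all three), so \<open>Mids\<close> is excluded
  here, and \<open>Mids\<close> and \<open>Lasts\<close> in \<open>Firsts\<close>, to give it one
  place in the order.\<close>

definition Lasts :: "point set" where
  "Lasts = {b \<in> X. \<not> b extreme_point_of convex hull M \<and> close_to_side M b R p2 \<and> b \<notin> Mids}"

definition Firsts :: "point set" where
  "Firsts = {b \<in> X. \<not> b extreme_point_of convex hull M \<and> close_to_side M b R p1 \<and> b \<notin> Mids \<and> b \<notin> Lasts}"

text \<open>The boundary order of \<open>M\<close>, starting at \<open>p1\<close>: it agrees with the angular order around \<open>R\<close> except for the dents of the two sides at \<open>R\<close>.\<close>

definition rank :: "point \<Rightarrow> real" where
  "rank b = (if b \<in> Lasts then hx p2 + 1 else if b = R then hx p2 + 2 else if b \<in> Firsts then hx p2 + 3 else hx b)"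

definition Core :: "point set" where "Core = X - Lasts - Firsts"

lemma ends_extreme: "p1 extreme_point_of convex hull M" "p2 extreme_point_of convex hull M"
proof -
  have "z extreme_point_of convex hull M" if z: "z \<in> X" "z = p1 \<or> z = p2" for z
  proof (rule ccontr)
    assume "\<not> z extreme_point_of convex hull M"
    then have "z \<in> convex hull (M - {z})" using interior_in_hull[of z] z(1) X_M(1) by blast
    then show False using interior_not_end[OF z(1)] z(2) by blast
  qed
  then show "p1 extreme_point_of convex hull M" "p2 extreme_point_of convex hull M" using pX qX by blast+
qed

lemma LastsD:
  assumes y: "y \<in> Lasts" and s: "s \<in> X" "s \<noteq> y" "s \<noteq> p2"
  shows "hx s < hx y" "hy y < hlin s p2 (hx y)"
proof -
  have yX: "y \<in> X" "y \<noteq> p2" "close_to_side M y R p2" using y ends_extreme unfolding Lasts_def by blast+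
  have "s \<in> M - {R, p2}" using s X_M by blast
  then have "y \<in> convex hull {s, R, p2}" using yX(3) unfolding close_to_side_def by blast
  then have "y \<in> convex hull {R, s, p2}" by (simp add: insert_commute)
  moreover have "hx s < hx p2" using bounds[OF s(1)] hx_neq[OF s(1) qX s(3)] by simp
  ultimately show "hx s < hx y" "hy y < hlin s p2 (hx y)" using in_wedge[OF s(1) qX _ yX(1)] s(2) yX(2) by blast+
qed

lemma FirstsD:
  assumes z: "z \<in> Firsts" and s: "s \<in> X" "s \<noteq> z" "s \<noteq> p1"
  shows "hx z < hx s" "hy z < hlin p1 s (hx z)"
proof -
  have zX: "z \<in> X" "z \<noteq> p1" "close_to_side M z R p1" using z ends_extreme unfolding Firsts_def by blast+
  have "s \<in> M - {R, p1}" using s X_M by blast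
  then have "z \<in> convex hull {s, R, p1}" using zX(3) unfolding close_to_side_def by blast
  then have "z \<in> convex hull {R, p1, s}" by (simp add: insert_commute)
  moreover have "hx p1 < hx s" using bounds[OF s(1)] hx_neq[OF s(1) pX s(3)] by simp
  ultimately show "hx z < hx s" "hy z < hlin p1 s (hx z)" using in_wedge[OF pX s(1) _ zX(1)] s(2) zX(2) by blast+
qed

lemma Lasts_props:
  assumes "y \<in> Lasts"
  shows "y \<in> X" "y \<noteq> p1" "y \<noteq> p2" "hx y < hx p2" "\<And>r. r \<in> M - {R, p2} \<Longrightarrow> y \<in> convex hull {r, R, p2}"
proof -
  show y: "y \<in> X" "y \<noteq> p1" "y \<noteq> p2" using assms ends_extreme unfolding Lasts_def by blast+
  show "hx y < hx p2" using bounds[OF y(1)] hx_neq[OF y(1) qX y(3)] by simp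
  show "y \<in> convex hull {r, R, p2}" if "r \<in> M - {R, p2}" for r using assms that unfolding Lasts_def close_to_side_def by blast
qed

lemma Firsts_props:
  assumes "z \<in> Firsts"
  shows "z \<in> X" "z \<noteq> p1" "z \<noteq> p2" "hx p1 < hx z" "\<And>r. r \<in> M - {R, p1} \<Longrightarrow> z \<in> convex hull {r, R, p1}"
proof -
  show z: "z \<in> X" "z \<noteq> p1" "z \<noteq> p2" using assms ends_extreme unfolding Firsts_def by blast+
  show "hx p1 < hx z" using bounds[OF z(1)] hx_neq[OF z(1) pX z(2)] by simp
  show "z \<in> convex hull {r, R, p1}" if "r \<in> M - {R, p1}" for r using assms that unfolding Firsts_def close_to_side_def by blast
qed

lemma Lasts_unique: "y \<in> Lasts \<Longrightarrow> y' \<in> Lasts \<Longrightarrow> y = y'"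
  using LastsD(1)[of y y'] LastsD(1)[of y' y] Lasts_props[of y] Lasts_props[of y'] by force

lemma Firsts_unique: "z \<in> Firsts \<Longrightarrow> z' \<in> Firsts \<Longrightarrow> z = z'"
  using FirstsD(1)[of z z'] FirstsD(1)[of z' z] Firsts_props[of z] Firsts_props[of z'] by force

text \<open>Core points are ranked by \<open>hx\<close>, at most \<open>hx p2\<close>. The offsets
  1, 2, 3 append the dent of \<open>R p2\<close>, the vertex \<open>R\<close> and the dent of
  \<open>R p1\<close>.\<close>

lemma rank_simps:
  shows "s \<in> Core \<Longrightarrow> rank s = hx s" "s \<in> Lasts \<Longrightarrow> rank s = hx p2 + 1" "rank R = hx p2 + 2" "s \<in> Firsts \<Longrightarrow> rank s = hx p2 + 3"
  using X_M(2) by (auto simp: rank_def Core_def Lasts_def Firsts_def)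

lemma point_cases:
  assumes "s \<in> M"
  obtains "s \<in> Core" "rank s = hx s" "rank s \<le> hx p2" | "s \<in> Lasts" "rank s = hx p2 + 1" | "s = R" "rank s = hx p2 + 2" | "s \<in> Firsts" "rank s = hx p2 + 3"
proof -
  consider "s \<in> Core" | "s \<in> Lasts" | "s = R" | "s \<in> Firsts" using assms X_M(3) unfolding Core_def by blast
  then show ?thesis
  proof cases
    case 1
    then have "s \<in> X" by (simp add: Core_def)
    then show ?thesis using that(1)[OF 1] rank_simps(1)[OF 1] bounds[of s] by simp
  qed (use that rank_simps in blast)+
qed

lemma CoreD: "s \<in> Core \<Longrightarrow> s \<in> X" "s \<in> Core \<Longrightarrow> s \<notin> Lasts" "s \<in> Core \<Longrightarrow> s \<notin> Firsts" "s \<in> Core \<Longrightarrow> hx s \<le> hx p2"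
  using bounds[of s] by (auto simp: Core_def)

lemma extreme_Core: "s \<in> X \<Longrightarrow> s extreme_point_of convex hull M \<Longrightarrow> s \<in> Core"
  by (auto simp: Core_def Lasts_def Firsts_def)

lemma mid_Core: "mid b s t \<Longrightarrow> b \<in> Core \<and> s \<in> Core \<and> t \<in> Core"
  using midD[of b s t] extreme_Core by (auto simp: Core_def Lasts_def Firsts_def Mids_def)

lemma inj_on_rank: "inj_on rank M"
proof (rule inj_onI)
  fix s t assume st: "s \<in> M" "t \<in> M" "rank s = rank t"
  show "s = t"
    by (rule point_cases[OF st(1)]; rule point_cases[OF st(2)])
      (use st(3) hx_neq[of s t] CoreD(1)[of s] CoreD(1)[of t] Lasts_unique[of s t] Firsts_unique[of s t] in auto)
qed

lemma orient_to_R: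
  assumes dpos: "0 < u $ 1 * v $ 2 - u $ 2 * v $ 1" and "a \<in> X" "b \<in> X" "hx a < hx b"
  shows "0 < orient a b R"
  using orient_R_pos[OF dpos ff_pos[OF assms(2)] ff_pos[OF assms(3)] assms(4)] orient_rotate[of a b R] by simp

text \<open>The form in which closeness yields orientations: nonnegativity at the vertices of a
  triangle passes to its point \<open>q\<close>, and general position makes it strict.\<close>

lemma orient_pos_in_hull:
  assumes "q \<in> convex hull {x1, x2, x3}" "0 \<le> orient a b x1" "0 \<le> orient a b x2" "0 \<le> orient a b x3"
    and "a \<in> M" "b \<in> M" "q \<in> M" "a \<noteq> b" "b \<noteq> q" "a \<noteq> q"
  shows "0 < orient a b q"
proof -
  have "0 \<le> 1 * orient a b q" by (rule orient_hull_nonneg[OF assms(1)]) (use assms(2-4) in auto)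
  moreover have "orient a b q \<noteq> 0" by (rule orient_nonzero[OF gpM assms(5-10)])
  ultimately show ?thesis by simp
qed

lemma XM: "s \<in> X \<Longrightarrow> s \<in> M"
  using X_M(1) by blast

context
  assumes dpos: "0 < u $ 1 * v $ 2 - u $ 2 * v $ 1" and qc: "quasi_convex M"
begin

lemma dent_cases:
  assumes b: "b \<in> X" "\<not> b extreme_point_of convex hull M"
  shows "b \<in> Mids \<or> b \<in> Lasts \<or> b \<in> Firsts"
proof -
  have "interior_point M b" using b X_M(1) by (auto simp: interior_point_def hull_vertices_def)
  then obtain Q Q' where Q: "is_side M Q Q'" "close_to_side M b Q Q'" using qc unfolding quasi_convex_def by blast
  have sym: "is_side M Q' Q" "close_to_side M b Q' Q" using Q unfolding is_side_def close_to_side_def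
    by (simp_all add: closed_segment_commute insert_commute)
  note sd = is_sideD[OF finM gpM Q(1)]
  consider "Q = R" | "Q' = R" | "Q \<in> X" "Q' \<in> X" using sd(3,4) X_M(3) by blast
  then show ?thesis
  proof cases
    case 1
    then have "Q' = p1 \<or> Q' = p2" using side_at_R Q(1) by blast
    then show ?thesis using Q(2) 1 b unfolding Lasts_def Firsts_def by blast
  next
    case 2
    then have "Q = p1 \<or> Q = p2" using side_at_R sym(1) by blast
    then show ?thesis using sym(2) 2 b unfolding Lasts_def Firsts_def by blast
  next
    case 3
    then have "hx Q < hx Q' \<or> hx Q' < hx Q" using hx_neq[OF 3 sd(5)] by linarith
    then have "mid b Q Q' \<or> mid b Q' Q" using 3 b Q sym unfolding mid_def by blast
    then show ?thesis unfolding Mids_def by blast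
  qed
qed

lemma orient_Core:
  assumes "a \<in> Core" "b \<in> Core" "c \<in> Core" "hx a < hx b" "hx b < hx c"
  shows "0 < orient a b c \<or> mid b a c"
proof -
  have X: "a \<in> X" "b \<in> X" "c \<in> X" using CoreD(1) assms(1-3) by blast+
  have ac: "hx a < hx c" using assms(4,5) by simp
  have "hlin a c (hx b) < hy b \<or> mid b a c"
  proof (cases "b extreme_point_of convex hull M")
    case True
    then show ?thesis using vertex_above_chords[OF True X assms(4,5)] by blast
  next
    case False
    then obtain s t where m: "mid b s t" using dent_cases[OF X(2)] CoreD(2,3)[OF assms(2)] unfolding Mids_def by blast
    then show ?thesis using mid_above[OF m X(1) assms(4) X(3) assms(5)] by blast
  qed
  then show ?thesis using orient_above[OF dpos X ac] by blast
qed

lemma orient_p2_Last: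
  assumes "a \<in> Core" "y \<in> Lasts" "a \<noteq> p2"
  shows "0 < orient a p2 y"
proof -
  note yp = Lasts_props[OF assms(2)]
  have a: "a \<in> X" "a \<noteq> y" using CoreD assms by blast+
  note l = LastsD[OF assms(2) a assms(3)]
  have "orient a y p2 < 0" by (rule orient_below[OF dpos a(1) yp(1) qX _ l(2)]) (use l(1) yp(4) in simp)
  then show ?thesis using orient_swap[of a y p2] by simp
qed

text \<open>If \<open>a\<close>, \<open>b\<close>, \<open>p2\<close> turn left, no vertex of the
  triangle \<open>b R p2\<close> is to the right of \<open>a b\<close>, and this triangle contains
  \<open>y\<close>. Otherwise \<open>b\<close> is the dent between \<open>a\<close> and
  \<open>p2\<close> and lies in the triangle \<open>y a p2\<close>.\<close>

lemma orient_Last: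
  assumes "a \<in> Core" "b \<in> Core" "hx a < hx b" "y \<in> Lasts"
  shows "0 < orient a b y"
proof (cases "b = p2")
  case True
  then show ?thesis using orient_p2_Last[OF assms(1,4)] assms(3) by auto
next
  case False
  note yp = Lasts_props[OF assms(4)]
  have X: "a \<in> X" "b \<in> X" "a \<noteq> y" "b \<noteq> y" "a \<noteq> b" "a \<noteq> R" "b \<noteq> R" using CoreD assms X_M(2) by auto
  have p2C: "p2 \<in> Core" by (rule extreme_Core[OF qX ends_extreme(2)])
  have bp: "hx b < hx p2" using bounds[OF X(2)] hx_neq[OF X(2) qX False] by simp
  have ap: "a \<noteq> p2" using assms(3) bp by auto
  show ?thesis
  proof (cases "0 < orient a b p2")
    case True
    have "y \<in> convex hull {b, R, p2}" by (rule yp(5)) (use X X_M(1) False in blast)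
    then show ?thesis
      by (rule orient_pos_in_hull) (use True orient_to_R[OF dpos X(1,2) assms(3)] X yp(1) XM in auto)
  next
    case F: False
    then have m: "mid b a p2" using orient_Core[OF assms(1,2) p2C assms(3) bp] by blast
    have "b \<in> convex hull {y, a, p2}" by (rule midD(11)[OF m]) (use yp X XM in auto)
    then have "0 < orient y a b"
      by (rule orient_pos_in_hull) (use orient_p2_Last[OF assms(1,4) ap] orient_rotate[of a p2 y] X yp(1) XM in auto)
    then show ?thesis using orient_rotate[of a b y] by simp
  qed
qed

lemma orient_p1_First:
  assumes "b \<in> X" "b \<noteq> p1" "b \<noteq> z" "z \<in> Firsts"
  shows "0 < orient p1 b z"
proof -
  note zp = Firsts_props[OF assms(4)]
  note l = FirstsD[OF assms(4,1,3,2)]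
  have "orient p1 z b < 0" by (rule orient_below[OF dpos pX zp(1) assms(1) _ l(2)]) (use l(1) zp(4) in simp)
  then show ?thesis using orient_swap[of p1 z b] by simp
qed

text \<open>As in \<open>orient_Last\<close>, with \<open>p1\<close> in the role of
  \<open>p2\<close>; in the exceptional case \<open>a\<close> is the dent between \<open>p1\<close>
  and \<open>b\<close>.\<close>

lemma orient_First:
  assumes "a \<in> Core" "b \<in> Core" "hx a < hx b" "z \<in> Firsts"
  shows "0 < orient a b z"
proof -
  note zp = Firsts_props[OF assms(4)]
  have X: "a \<in> X" "b \<in> X" "a \<noteq> z" "b \<noteq> z" "a \<noteq> b" "a \<noteq> R" "b \<noteq> R" using CoreD assms X_M(2) by auto
  have bp: "b \<noteq> p1" using bounds[OF X(1)] assms(3) by auto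
  show ?thesis
  proof (cases "a = p1")
    case True
    then show ?thesis using orient_p1_First[OF X(2) bp X(4) assms(4)] by simp
  next
    case False
    have p1C: "p1 \<in> Core" by (rule extreme_Core[OF pX ends_extreme(1)])
    have pa: "hx p1 < hx a" using bounds[OF X(1)] hx_neq[OF X(1) pX False] by simp
    show ?thesis
    proof (cases "0 < orient p1 a b")
      case True
      have "z \<in> convex hull {a, R, p1}" by (rule zp(5)) (use X X_M(1) False in blast)
      then show ?thesis
        by (rule orient_pos_in_hull) (use True orient_rotate[of a b p1] orient_to_R[OF dpos X(1,2) assms(3)] X zp(1) XM in auto)
    next
      case F: False
      then have m: "mid a p1 b" using orient_Core[OF p1C assms(1,2) pa assms(3)] by blast
      have "a \<in> convex hull {z, p1, b}" by (rule midD(11)[OF m]) (use zp X XM in auto)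
      then have "0 < orient b z a"
        by (rule orient_pos_in_hull) (use orient_p1_First[OF X(2) bp X(4) assms(4)] orient_rotate[of b z p1] X zp(1) XM in auto)
      then show ?thesis using orient_rotate[of b z a] by simp
    qed
  qed
qed

lemma orient_Last_First:
  assumes "a \<in> Core" "y \<in> Lasts" "z \<in> Firsts"
  shows "0 < orient a y z"
proof -
  note yp = Lasts_props[OF assms(2)] and zp = Firsts_props[OF assms(3)]
  have X: "a \<in> X" "a \<noteq> y" "a \<noteq> z" "a \<noteq> R" "y \<noteq> R" "z \<noteq> R" using CoreD assms X_M(2) yp zp by auto
  have yz: "y \<noteq> z" using assms(2,3) by (auto simp: Firsts_def)
  consider "a = p2" | "a = p1" | "a \<noteq> p1" "a \<noteq> p2" by blast
  then show ?thesis
  proof cases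
    case 1
    have zp2: "hx z < hx p2" using bounds[OF zp(1)] hx_neq[OF zp(1) qX zp(3)] by simp
    have "y \<in> convex hull {z, R, p2}" by (rule yp(5)) (use zp X XM in auto)
    then have "0 < orient z p2 y"
      by (rule orient_pos_in_hull) (use orient_to_R[OF dpos zp(1) qX zp2] XM[OF zp(1)] XM[OF qX] XM[OF yp(1)] yz yp zp in auto)
    then show ?thesis using orient_rotate[of p2 y z] 1 by simp
  next
    case 2
    then show ?thesis using orient_p1_First[OF yp(1,2) yz assms(3)] by simp
  next
    case 3
    have ay: "hx a < hx y" by (rule LastsD(1)[OF assms(2) X(1,2) 3(2)])
    have p1C: "p1 \<in> Core" by (rule extreme_Core[OF pX ends_extreme(1)])
    have pa: "hx p1 < hx a" using bounds[OF X(1)] hx_neq[OF X(1) pX 3(1)] by simp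
    have "z \<in> convex hull {a, R, p1}" by (rule zp(5)) (use X XM 3 in auto)
    then show ?thesis
      by (rule orient_pos_in_hull)
        (use orient_to_R[OF dpos X(1) yp(1) ay] orient_Last[OF p1C assms(1) pa assms(2)] orient_rotate[of a y p1] X XM[OF X(1)] XM[OF yp(1)] XM[OF zp(1)] yz in auto)
  qed
qed

text \<open>A point ranked strictly between \<open>s\<close> and \<open>t\<close> is neither a hull
  vertex nor the dent of another side, so it is \<open>b\<close>.\<close>

lemma mid_adjacent:
  assumes "mid b s t"
  shows "adjacent rank M s b" "adjacent rank M b t"
proof -
  note d = midD[OF assms]
  have C: "b \<in> Core" "s \<in> Core" "t \<in> Core" using mid_Core[OF assms] by auto
  have no: "r = b" if r: "r \<in> M" "rank s < rank r" "rank r < rank t" for r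
  proof (rule point_cases[OF r(1)])
    assume rC: "r \<in> Core" "rank r = hx r"
    then have lt: "hx s < hx r" "hx r < hx t" using r rank_simps(1)[OF C(2)] rank_simps(1)[OF C(3)] by auto
    show "r = b"
    proof (cases "r extreme_point_of convex hull M")
      case True
      then show ?thesis using vertex_not_between[OF assms CoreD(1)[OF rC(1)] True lt] by blast
    next
      case False
      then obtain s' t' where "mid r s' t'" using dent_cases[OF CoreD(1)[OF rC(1)]] CoreD(2,3)[OF rC(1)] unfolding Mids_def by blast
      then show ?thesis using mid_between[OF assms _ lt] by blast
    qed
  qed (use r(3) rank_simps(1)[OF C(3)] CoreD(4)[OF C(3)] in auto)
  have rk: "rank s < rank b" "rank b < rank t" using rank_simps(1) C d(4,5) by auto
  have "rank r \<le> rank s \<or> rank b \<le> rank r" "rank r \<le> rank b \<or> rank t \<le> rank r" if "r \<in> M" for r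
    using no[OF that] rk by force+
  then show "adjacent rank M s b" "adjacent rank M b t" using rk C CoreD(1) XM unfolding adjacent_def by blast+
qed

lemma Last_adjacent:
  assumes "y \<in> Lasts"
  shows "adjacent rank M p2 y" "adjacent rank M y R"
proof -
  have p2C: "p2 \<in> Core" by (rule extreme_Core[OF qX ends_extreme(2)])
  have "rank r \<le> hx p2 \<or> hx p2 + 1 \<le> rank r" "rank r \<le> hx p2 + 1 \<or> hx p2 + 2 \<le> rank r" if "r \<in> M" for r
    by (rule point_cases[OF that]; auto)+
  then show "adjacent rank M p2 y" "adjacent rank M y R"
    using rank_simps(1)[OF p2C] rank_simps(2)[OF assms] rank_simps(3) XM[OF qX] XM[OF Lasts_props(1)[OF assms]] RM unfolding adjacent_def by auto
qed

text \<open>\<open>Firsts\<close> is left out: its point is last in the order and has no successor,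
  so it is not the middle of a dent triple.\<close>

definition Dents :: "point set" where "Dents = Mids \<union> Lasts"

lemma dent_tripleE:
  assumes "dent_triple rank Dents M a b c"
  obtains "mid b a c" | "b \<in> Lasts" "a = p2" "c = R"
proof -
  note d = dent_tripleD[OF assms]
  have nb: "s = a \<and> t = c" if "adjacent rank M s b" "adjacent rank M b t" for s t
    using prv_adjacent[OF inj_on_rank that(1), of b] prv_adjacent[OF inj_on_rank d(2), of b]
      nxt_adjacent[OF inj_on_rank that(2), of b] nxt_adjacent[OF inj_on_rank d(3), of b]
      adjacentD(3)[OF that(1)] adjacentD(3)[OF that(2)] d(7,8) by simp
  consider "b \<in> Mids" | "b \<in> Lasts" using d(1) unfolding Dents_def by blast
  then show ?thesis
  proof cases
    case 1
    then obtain s t where m: "mid b s t" unfolding Mids_def by blast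
    then show ?thesis using that(1) nb[OF mid_adjacent[OF m]] by blast
  next
    case 2
    then show ?thesis using that(2) nb[OF Last_adjacent[OF 2]] by blast
  qed
qed

lemma dent_tripleI: "mid b a c \<Longrightarrow> dent_triple rank Dents M a b c" "y \<in> Lasts \<Longrightarrow> dent_triple rank Dents M p2 y R"
  unfolding dent_triple_def Dents_def using mid_adjacent[of b a c] Last_adjacent[of y] by (auto simp: Mids_def)

lemma dent_neg:
  assumes "dent_triple rank Dents M a b c"
  shows "orient a b c < 0"
proof (rule dent_tripleE[OF assms])
  assume m: "mid b a c"
  note d = midD[OF m]
  have "hy b < hlin a c (hx b)" using below_iff_slope[OF d(4,5)] d(6) by blast
  then show ?thesis using orient_below[OF dpos d(2,1,3)] d(4,5) by simp
next
  assume y: "b \<in> Lasts" "a = p2" "c = R"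
  have "0 < orient b p2 R" by (rule orient_to_R[OF dpos Lasts_props(1)[OF y(1)] qX Lasts_props(4)[OF y(1)]])
  then show ?thesis using orient_swap[of R b p2] orient_rotate[of b p2 R] orient_rotate[of p2 b R] y by simp
qed

text \<open>The successor of a dent is an end of its side, which is no dent.\<close>

lemma dents_not_adjacent:
  assumes "adjacent rank M s t"
  shows "\<not> (s \<in> Dents \<and> t \<in> Dents)"
proof
  assume st: "s \<in> Dents \<and> t \<in> Dents"
  have nx: "t = t'" if "adjacent rank M s t'" for t'
    using nxt_adjacent[OF inj_on_rank assms, of s] nxt_adjacent[OF inj_on_rank that, of s] adjacentD(3)[OF assms] adjacentD(3)[OF that] by simp
  have tD: "t \<in> X" "\<not> t extreme_point_of convex hull M" using st unfolding Dents_def Mids_def Lasts_def mid_def by blast+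
  consider s' t' where "mid s s' t'" | "s \<in> Lasts" using st unfolding Dents_def Mids_def by blast
  then show False
  proof cases
    case 1
    then show False using nx[OF mid_adjacent(2)[OF 1]] midD(10)[OF 1] tD(2) by blast
  next
    case 2
    then show False using nx[OF Last_adjacent(2)[OF 2]] tD(1) X_M(2) by blast
  qed
qed

text \<open>The second exception is the dent of the side \<open>R p1\<close>: in the cyclic order it
  comes between \<open>R\<close> and \<open>p1\<close>, but the linear order is cut open
  there.\<close>

lemma orient_by_rank:
  assumes M: "a \<in> M" "b \<in> M" "c \<in> M" and rk: "rank a < rank b" "rank b < rank c" and nd: "\<not> dent_triple rank Dents M a b c"
    and nf: "\<not> (a = p1 \<and> b = R \<and> c \<in> Firsts)"
  shows "0 < orient a b c"
proof (rule point_cases[OF M(3)])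
  assume c: "c \<in> Core" "rank c = hx c" "rank c \<le> hx p2"
  have C: "b \<in> Core" "rank b = hx b" by (rule point_cases[OF M(2)]; use rk(2) c in simp)+
  have C': "a \<in> Core" "rank a = hx a" by (rule point_cases[OF M(1)]; use rk c in simp)+
  show ?thesis using orient_Core[OF C'(1) C(1) c(1)] rk C C' c nd dent_tripleI(1) by auto
next
  assume c: "c \<in> Lasts" "rank c = hx p2 + 1"
  have C: "b \<in> Core" "rank b = hx b" by (rule point_cases[OF M(2)]; use rk(2) c in simp)+
  have C': "a \<in> Core" "rank a = hx a" by (rule point_cases[OF M(1)]; use rk c in simp)+
  show ?thesis using orient_Last[OF C'(1) C(1) _ c(1)] rk C C' by simp
next
  assume c: "c = R" "rank c = hx p2 + 2"
  have C': "a \<in> Core" "rank a = hx a"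
    by (rule point_cases[OF M(1)]; rule point_cases[OF M(2)]; use rk c in simp)+
  show ?thesis
  proof (rule point_cases[OF M(2)])
    assume b: "b \<in> Core" "rank b = hx b"
    then show ?thesis using orient_to_R[OF dpos CoreD(1)[OF C'(1)] CoreD(1)[OF b(1)]] rk C' c by simp
  next
    assume b: "b \<in> Lasts"
    have "a \<noteq> p2" using nd dent_tripleI(2)[OF b] c by blast
    moreover have "a \<noteq> b" using rk by auto
    ultimately have "hx a < hx b" using LastsD(1)[OF b CoreD(1)[OF C'(1)]] by blast
    then show ?thesis using orient_to_R[OF dpos CoreD(1)[OF C'(1)] Lasts_props(1)[OF b]] c by simp
  qed (use rk c in simp_all)
next
  assume c: "c \<in> Firsts" "rank c = hx p2 + 3"
  note zp = Firsts_props[OF c(1)]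
  show ?thesis
  proof (rule point_cases[OF M(2)])
    assume b: "b \<in> Core" "rank b = hx b" "rank b \<le> hx p2"
    have C': "a \<in> Core" "rank a = hx a" by (rule point_cases[OF M(1)]; use rk b in simp)+
    show ?thesis using orient_First[OF C'(1) b(1) _ c(1)] rk b C' by simp
  next
    assume b: "b \<in> Lasts" "rank b = hx p2 + 1"
    have C': "a \<in> Core" "rank a = hx a" by (rule point_cases[OF M(1)]; use rk b in simp)+
    show ?thesis by (rule orient_Last_First[OF C'(1) b(1) c(1)])
  next
    assume b: "b = R" "rank b = hx p2 + 2"
    have aX: "a \<in> X" by (rule point_cases[OF M(1)]; use rk b CoreD(1) Lasts_props(1) in auto)
    have "a \<noteq> p1" "a \<noteq> c" using nf b c rk by auto
    then have "hx c < hx a" using FirstsD(1)[OF c(1) aX] by blast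
    then have "0 < orient c a R" by (rule orient_to_R[OF dpos zp(1) aX])
    then show ?thesis using orient_rotate[of a R c] b by simp
  qed (use rk c in simp_all)
qed

text \<open>Without a dent of the side \<open>R p1\<close> the order is almost convex. Otherwise
  this dent ends the order as \<open>j\<close>, with \<open>i = p1\<close> and
  \<open>k = R\<close>.\<close>

lemma card_trifams_le_star: "card (trifams M) \<le> catalan (card M - 2)"
proof (cases "Firsts = {}")
  case True
  have "almost_convex rank Dents M"
    unfolding almost_convex_def
    using finM inj_on_rank gpM dent_neg dents_not_adjacent orient_by_rank True by simp
  then show ?thesis using card3 by (rule card_trifams_le)
next
  case False
  then obtain z where z: "z \<in> Firsts" by blast
  note zp = Firsts_props[OF z]
  have p1C: "p1 \<in> Core" by (rule extreme_Core[OF pX ends_extreme(1)])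
  have RD: "R \<notin> Dents" using X_M(2) by (auto simp: Dents_def Mids_def mid_def Lasts_def)
  have rk: "rank p1 = hx p1" "rank R = hx p2 + 2" "rank z = hx p2 + 3" using rank_simps p1C z by auto
  show ?thesis
  proof (rule card_trifams_le_base_dent[where \<rho> = rank and D = Dents and i = p1 and j = z and k = R])
    show "finite M" "inj_on rank M" "general_position M" "p1 \<in> M" "z \<in> M" by (fact finM inj_on_rank gpM XM[OF pX] XM[OF zp(1)])+
    show "rank p1 \<le> rank b \<and> rank b \<le> rank z" if "b \<in> M" for b
      by (rule point_cases[OF that]) (use rk pq bounds[of b] CoreD(1)[of b] in auto)
    have "rank r \<le> hx p2 + 2 \<or> hx p2 + 3 \<le> rank r" if "r \<in> M" for r by (rule point_cases[OF that]) auto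
    then show "adjacent rank M R z" using rk RM XM[OF zp(1)] unfolding adjacent_def by auto
    show "rank p1 < rank R" using rk pq by simp
    show "R \<notin> Dents" by (rule RD)
    show "0 < orient a b c"
      if "a \<in> M" "b \<in> M" "c \<in> M" "rank a < rank b" "rank b < rank c" "\<not> dent_triple rank Dents M a b c" "\<not> (a = p1 \<and> b = R \<and> c = z)" for a b c
      using orient_by_rank[OF that(1-6)] that(7) Firsts_unique[OF z] by blast
    show "\<And>a b c. dent_triple rank Dents M a b c \<Longrightarrow> orient a b c < 0" by (rule dent_neg)
    show "\<And>s t. adjacent rank M s t \<Longrightarrow> \<not> (s \<in> Dents \<and> t \<in> Dents)" by (rule dents_not_adjacent)
    have "0 < orient p1 z R" by (rule orient_to_R[OF dpos pX zp(1,4)])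
    then show "orient p1 R z < 0" using orient_swap[of p1 z R] by simp
    show "\<not> dent_triple rank Dents M p1 s R" for s
    proof
      assume "dent_triple rank Dents M p1 s R"
      then show False
      proof (rule dent_tripleE)
        assume "mid s p1 R"
        then show False using midD(3) X_M(2) by blast
      next
        assume "p1 = p2"
        then show False using pq by simp
      qed
    qed
    have "{R, p1, z, p2} \<subseteq> M" using RM XM[OF pX] XM[OF qX] XM[OF zp(1)] by blast
    moreover have "card {R, p1, z, p2} = 4"
    proof -
      have "R \<noteq> p1" "R \<noteq> z" "R \<noteq> p2" "p1 \<noteq> z" "p1 \<noteq> p2" "z \<noteq> p2" using pX qX zp X_M(2) pq by auto
      then show ?thesis by simp
    qed
    ultimately show "4 \<le> card M" using card_mono[OF finM, of "{R, p1, z, p2}"] by simp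
  qed
qed

end

end

theorem card_trifams_le_quasi_convex:
  assumes fin: "finite M" and gp: "general_position M" and card: "3 \<le> card M" and qc: "quasi_convex M"
  shows "card (trifams M) \<le> catalan (card M - 2)"
proof -
  have "M \<noteq> {}" using card by auto
  then obtain R where R: "R extreme_point_of convex hull M" using hull_vertex_exists[OF fin] by blast
  obtain u v p1 p2 where s: "star R u v M p1 p2" using star_exists[OF fin gp card R] .
  show ?thesis
  proof (cases "0 < u $ 1 * v $ 2 - u $ 2 * v $ 1")
    case True
    then show ?thesis by (rule star.card_trifams_le_star[OF s _ qc])
  next
    case False
    have "u $ 1 * v $ 2 - u $ 2 * v $ 1 \<noteq> 0" by (rule star.det[OF s])
    \<comment> \<open>Reflecting \<open>hx\<close> flips the sign of the determinant.\<close>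
    then have "0 < u $ 1 * (- v) $ 2 - u $ 2 * (- v) $ 1" using False by simp
    then show ?thesis by (rule star.card_trifams_le_star[OF star.mirror[OF s] _ qc])
  qed
qed

theorem theorem1:
  fixes M :: "point set" and n :: nat
  assumes "n \<ge> 3" and "finite M" and "card M = n" and "general_position M"
  shows "card (partial_triangulations M) \<ge> W n
       \<and> (card (partial_triangulations M) = W n \<longleftrightarrow> quasi_convex M)"
proof -
  have c: "3 \<le> card M" using assms(1,3) by simp
  have eq: "card (partial_triangulations M) = card (trifams M)"
    using bij_betw_same_card[OF bij_betw_trifams[OF assms(4,2)]] by simp
  have W: "W n = catalan (card M - 2)" using assms(3) by (simp add: W_def)
  have ge: "catalan (card M - 2) \<le> card (trifams M)" by (rule catalan_le_card_trifams[OF assms(2,4) c])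
  show ?thesis
    unfolding eq W using ge quasi_convex_if_card_eq[OF assms(2,4) c] card_trifams_le_quasi_convex[OF assms(2,4) c] by auto
qed

end
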